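(* Let $k$ be a field and let $G$ be a finite group which is semi-faithful over $k$. Then the minimal number of factors of a decomposition (i.e. composition) series of a faithful representation of $G$ over $k$ equals $\operatorname{rk}_{\mathbb{Z}G}\operatorname{soc^{ab}}(G)$ if $\operatorname{soc^{ab}}(G)\ne\{e\}$, and equals $1$ if $\operatorname{soc^{ab}}(G)$ is trivial. Moreover the minimum is attained by a completely reducible representation.
   Context: $k$ is an arbitrary field; representations are finite dimensional over $k$. $G$ is semi-faithful (over $k$) if it admits a completely reducible faithful representation over $k$. A foot of $G$ is a minimal nontrivial normal subgroup of $G$. The abelian socle $\operatorname{soc^{ab}}(G)$ is the subgroup generated by all abelian feet of $G$; it is an abelian normal subgroup and is regarded as a $\mathbb{Z}G$-module via conjugation. For a $\mathbb{Z}G$-module $A$, $\operatorname{rk}_{\mathbb{Z}G}(A)$ denotes the minimal number $r\in\mathbb{N}_0$ of elements $a_1,\dots,a_r\in A$ generating $A$ as a $\mathbb{Z}G$-module. *)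

theory Defs
  imports
    "Jordan_Normal_Form.VS_Connect"
    "HOL-Algebra.Generated_Groups"
    "HOL-Algebra.AbelCoset"
begin

section \<open>Matrix representations over a field\<close>

definition GL :: "'k::field itself \<Rightarrow> nat \<Rightarrow> 'k mat monoid" where
  "GL K n = units_of (ring_mat K n ())"

text \<open>Every finite-dimensional representation is, after a choice of basis, of this form.
  Representation spaces are required to be nonzero: otherwise the zero space would be a faithful
  representation of the trivial group without any composition factor.\<close>

definition representation :: "('g, 'm) monoid_scheme \<Rightarrow> nat \<Rightarrow> ('g \<Rightarrow> 'k::field mat) \<Rightarrow> bool" where
  "representation G n \<rho> \<longleftrightarrow> 0 < n \<and> \<rho> \<in> hom G (GL TYPE('k) n)"

definition faithful_representation ::
  "('g, 'm) monoid_scheme \<Rightarrow> nat \<Rightarrow> ('g \<Rightarrow> 'k::field mat) \<Rightarrow> bool" where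
  "faithful_representation G n \<rho> \<longleftrightarrow> representation G n \<rho> \<and> inj_on \<rho> (carrier G)"

definition subrepresentation ::
  "('g, 'm) monoid_scheme \<Rightarrow> nat \<Rightarrow> ('g \<Rightarrow> 'k::field mat) \<Rightarrow> 'k vec set \<Rightarrow> bool" where
  "subrepresentation G n \<rho> W \<longleftrightarrow>
     subspace class_ring W (module_vec TYPE('k) n) \<and>
     (\<forall>g\<in>carrier G. \<forall>w\<in>W. \<rho> g *\<^sub>v w \<in> W)"

definition completely_reducible ::
  "('g, 'm) monoid_scheme \<Rightarrow> nat \<Rightarrow> ('g \<Rightarrow> 'k::field mat) \<Rightarrow> bool" where
  "completely_reducible G n \<rho> \<longleftrightarrow>
     (\<forall>U. subrepresentation G n \<rho> U \<longrightarrow>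
        (\<exists>W. subrepresentation G n \<rho> W \<and> U \<inter> W = {0\<^sub>v n} \<and>
             {u + w | u w. u \<in> U \<and> w \<in> W} = carrier_vec n))"

text \<open>A chain with \<open>r\<close> factors \<open>W (Suc i) / W i\<close>, where \<open>i < r\<close>; a factor is irreducible iff
  no subrepresentation lies strictly between its two members.\<close>

definition composition_series ::
  "('g, 'm) monoid_scheme \<Rightarrow> nat \<Rightarrow> ('g \<Rightarrow> 'k::field mat) \<Rightarrow> nat \<Rightarrow> (nat \<Rightarrow> 'k vec set) \<Rightarrow> bool" where
  "composition_series G n \<rho> r W \<longleftrightarrow>
     W 0 = {0\<^sub>v n} \<and> W r = carrier_vec n \<and>
     (\<forall>i\<le>r. subrepresentation G n \<rho> (W i)) \<and>
     (\<forall>i<r. W i \<subset> W (Suc i) \<and>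
        \<not> (\<exists>U. subrepresentation G n \<rho> U \<and> W i \<subset> U \<and> U \<subset> W (Suc i)))"

definition semi_faithful :: "'k::field itself \<Rightarrow> ('g, 'm) monoid_scheme \<Rightarrow> bool" where
  "semi_faithful K G \<longleftrightarrow>
     (\<exists>n (\<rho> :: 'g \<Rightarrow> 'k mat). faithful_representation G n \<rho> \<and> completely_reducible G n \<rho>)"

definition min_faithful_factors :: "'k::field itself \<Rightarrow> ('g, 'm) monoid_scheme \<Rightarrow> nat" where
  "min_faithful_factors K G =
     (LEAST r. \<exists>n (\<rho> :: 'g \<Rightarrow> 'k mat) W.
        faithful_representation G n \<rho> \<and> composition_series G n \<rho> r W)"


section \<open>Feet and the abelian socle\<close>

definition foot :: "('g, 'm) monoid_scheme \<Rightarrow> 'g set \<Rightarrow> bool" where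
  "foot G N \<longleftrightarrow> N \<lhd> G \<and> N \<noteq> {\<one>\<^bsub>G\<^esub>} \<and>
     (\<forall>M. M \<lhd> G \<longrightarrow> M \<subseteq> N \<longrightarrow> M = {\<one>\<^bsub>G\<^esub>} \<or> M = N)"

definition abelian_socle :: "('g, 'm) monoid_scheme \<Rightarrow> 'g set" where
  "abelian_socle G = generate G (\<Union>{N. foot G N \<and> comm_group (G\<lparr>carrier := N\<rparr>)})"


section \<open>Modules over the integral group ring\<close>

text \<open>The locale \<^locale>\<open>module\<close> of the library requires a commutative ring of scalars.\<close>

locale left_module = R?: ring R + M?: abelian_group M
  for R :: "('r, 'c) ring_scheme" (structure) and M :: "('r, 'b, 'd) module_scheme" (structure) +
  assumes smult_closed: "\<lbrakk>a \<in> carrier R; x \<in> carrier M\<rbrakk> \<Longrightarrow> a \<odot>\<^bsub>M\<^esub> x \<in> carrier M"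
    and smult_l_distr: "\<lbrakk>a \<in> carrier R; b \<in> carrier R; x \<in> carrier M\<rbrakk> \<Longrightarrow>
      (a \<oplus>\<^bsub>R\<^esub> b) \<odot>\<^bsub>M\<^esub> x = a \<odot>\<^bsub>M\<^esub> x \<oplus>\<^bsub>M\<^esub> b \<odot>\<^bsub>M\<^esub> x"
    and smult_r_distr: "\<lbrakk>a \<in> carrier R; x \<in> carrier M; y \<in> carrier M\<rbrakk> \<Longrightarrow>
      a \<odot>\<^bsub>M\<^esub> (x \<oplus>\<^bsub>M\<^esub> y) = a \<odot>\<^bsub>M\<^esub> x \<oplus>\<^bsub>M\<^esub> a \<odot>\<^bsub>M\<^esub> y"
    and smult_assoc: "\<lbrakk>a \<in> carrier R; b \<in> carrier R; x \<in> carrier M\<rbrakk> \<Longrightarrow>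
      (a \<otimes>\<^bsub>R\<^esub> b) \<odot>\<^bsub>M\<^esub> x = a \<odot>\<^bsub>M\<^esub> (b \<odot>\<^bsub>M\<^esub> x)"
    and smult_one: "x \<in> carrier M \<Longrightarrow> \<one>\<^bsub>R\<^esub> \<odot>\<^bsub>M\<^esub> x = x"

definition left_submodule ::
  "('r, 'c) ring_scheme \<Rightarrow> ('r, 'b, 'd) module_scheme \<Rightarrow> 'b set \<Rightarrow> bool" where
  "left_submodule R M N \<longleftrightarrow>
     additive_subgroup N M \<and> (\<forall>a\<in>carrier R. \<forall>x\<in>N. a \<odot>\<^bsub>M\<^esub> x \<in> N)"

definition submodule_generated ::
  "('r, 'c) ring_scheme \<Rightarrow> ('r, 'b, 'd) module_scheme \<Rightarrow> 'b set \<Rightarrow> 'b set" where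
  "submodule_generated R M S = \<Inter>{N. left_submodule R M N \<and> S \<subseteq> N}"

definition module_rk :: "('r, 'c) ring_scheme \<Rightarrow> ('r, 'b, 'd) module_scheme \<Rightarrow> nat" where
  "module_rk R M = (LEAST r. \<exists>as. length as = r \<and> set as \<subseteq> carrier M \<and>
     submodule_generated R M (set as) = carrier M)"

text \<open>The group ring of a finite group \<open>G\<close>: integer-valued functions on \<open>carrier G\<close>, extended by
  zero, with convolution.\<close>

definition int_group_ring :: "('g, 'm) monoid_scheme \<Rightarrow> ('g \<Rightarrow> int) ring" where
  "int_group_ring G = \<lparr>
     carrier = {f. \<forall>x. x \<notin> carrier G \<longrightarrow> f x = 0},
     mult = (\<lambda>f h x. if x \<in> carrier G
                     then \<Sum>y\<in>carrier G. f y * h (inv\<^bsub>G\<^esub> y \<otimes>\<^bsub>G\<^esub> x) else 0),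
     one = (\<lambda>x. if x = \<one>\<^bsub>G\<^esub> then 1 else 0),
     zero = (\<lambda>x. 0),
     add = (\<lambda>f h x. f x + h x)\<rparr>"

text \<open>An abelian normal subgroup \<open>A\<close>, written additively, with \<open>G\<close> acting by conjugation:
  in multiplicative notation \<open>f \<odot> a\<close> is the product over \<open>g\<close> of the powers \<open>(g a g\<^sup>-\<^sup>1)\<^sup>f\<^sup>(\<^sup>g\<^sup>)\<close>.
  The multiplicative fields of the record play no role.\<close>

definition conj_module :: "('g, 'm) monoid_scheme \<Rightarrow> 'g set \<Rightarrow> ('g \<Rightarrow> int, 'g) module" where
  "conj_module G A = \<lparr>
     carrier = A,
     mult = undefined,
     one = undefined,
     zero = \<one>\<^bsub>G\<^esub>,
     add = mult G,
     smult = (\<lambda>f a. finprod (G\<lparr>carrier := A\<rparr>)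
                (\<lambda>g. (g \<otimes>\<^bsub>G\<^esub> a \<otimes>\<^bsub>G\<^esub> inv\<^bsub>G\<^esub> g) [^]\<^bsub>G\<^esub> f g) (carrier G))\<rparr>"


section \<open>The abelian socle is a module over the integral group ring\<close>

lemma hom_finprod_comm_group:
  assumes "comm_group A" "comm_group B" "h \<in> hom A B" "f \<in> S \<rightarrow> carrier A"
  shows "h (finprod A f S) = finprod B (\<lambda>s. h (f s)) S"
proof -
  interpret A: comm_group A by fact
  interpret B: comm_group B by fact
  interpret h: group_hom A B h using assms by unfold_locales
  show ?thesis using assms(4)
  proof (induction S rule: infinite_finite_induct)
    case (insert x F)
    then have "f \<in> F \<rightarrow> carrier A" "f x \<in> carrier A" by auto
    then show ?case using insert by (simp add: Pi_iff)
  qed auto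
qed

lemma (in comm_group) finprod_swap:
  assumes "finite S" "\<And>s t. s \<in> S \<Longrightarrow> t \<in> T \<Longrightarrow> f s t \<in> carrier G"
  shows "(\<Otimes>s\<in>S. \<Otimes>t\<in>T. f s t) = (\<Otimes>t\<in>T. \<Otimes>s\<in>S. f s t)"
  using assms
proof (induction S)
  case (insert x F)
  have "(\<Otimes>t\<in>T. \<Otimes>s\<in>insert x F. f s t) = (\<Otimes>t\<in>T. f x t \<otimes> (\<Otimes>s\<in>F. f s t))"
    by (rule finprod_cong') (use insert in \<open>auto simp: Pi_iff\<close>)
  also have "\<dots> = (\<Otimes>t\<in>T. f x t) \<otimes> (\<Otimes>t\<in>T. \<Otimes>s\<in>F. f s t)"
    by (rule finprod_multf) (use insert in \<open>auto simp: Pi_iff\<close>)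
  finally show ?case using insert by (simp add: Pi_iff)
qed simp

lemma (in comm_group) int_pow_sum:
  assumes "finite S" "x \<in> carrier G"
  shows "x [^] (\<Sum>s\<in>S. e s :: int) = (\<Otimes>s\<in>S. x [^] e s)"
  using assms by (induction S) (auto simp: int_pow_mult)

lemma (in comm_group) finprod_int_pow:
  assumes "f \<in> S \<rightarrow> carrier G"
  shows "(\<Otimes>s\<in>S. f s) [^] (e :: int) = (\<Otimes>s\<in>S. f s [^] e)"
  using assms by (induction S rule: infinite_finite_induct) (auto simp: int_pow_distrib Pi_iff)

lemma ring_int_group_ring:
  assumes "group G" "finite (carrier G)"
  shows "ring (int_group_ring G)"
proof -
  interpret G: group G by fact
  have re: "(\<Sum>y\<in>carrier G. F y) = (\<Sum>w\<in>carrier G. F (z \<otimes>\<^bsub>G\<^esub> w))"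
    if z: "z \<in> carrier G" for F :: "'a \<Rightarrow> int" and z
    by (rule sum.reindex_bij_witness[of _ "\<lambda>w. z \<otimes>\<^bsub>G\<^esub> w" "\<lambda>y. inv\<^bsub>G\<^esub> z \<otimes>\<^bsub>G\<^esub> y"])
      (use z in \<open>auto simp: G.m_assoc[symmetric]\<close>)
  show ?thesis
  proof (rule ringI)
    show "abelian_group (int_group_ring G)"
    proof (rule abelian_groupI)
      fix x assume "x \<in> carrier (int_group_ring G)"
      then show "\<exists>y\<in>carrier (int_group_ring G). y \<oplus>\<^bsub>int_group_ring G\<^esub> x = \<zero>\<^bsub>int_group_ring G\<^esub>"
        by (intro bexI[of _ "\<lambda>t. - x t"]) (auto simp: int_group_ring_def)
    qed (auto simp: int_group_ring_def)
    show "monoid (int_group_ring G)"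
    proof (rule monoidI)
      fix f h k assume fhk: "f \<in> carrier (int_group_ring G)" "h \<in> carrier (int_group_ring G)"
        "k \<in> carrier (int_group_ring G)"
      have "(\<Sum>y\<in>carrier G. (\<Sum>z\<in>carrier G. f z * h (inv\<^bsub>G\<^esub> z \<otimes>\<^bsub>G\<^esub> y)) * k (inv\<^bsub>G\<^esub> y \<otimes>\<^bsub>G\<^esub> x)) =
        (\<Sum>z\<in>carrier G. f z * (\<Sum>w\<in>carrier G. h w * k (inv\<^bsub>G\<^esub> w \<otimes>\<^bsub>G\<^esub> (inv\<^bsub>G\<^esub> z \<otimes>\<^bsub>G\<^esub> x))))" (is "?l = ?r")
        if x: "x \<in> carrier G" for x
      proof -
        have "?l = (\<Sum>z\<in>carrier G. \<Sum>y\<in>carrier G. f z * h (inv\<^bsub>G\<^esub> z \<otimes>\<^bsub>G\<^esub> y) * k (inv\<^bsub>G\<^esub> y \<otimes>\<^bsub>G\<^esub> x))"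
          by (subst sum.swap) (simp add: sum_distrib_right)
        also have "\<dots> = ?r"
        proof (rule sum.cong[OF refl])
          fix z assume z: "z \<in> carrier G"
          show "(\<Sum>y\<in>carrier G. f z * h (inv\<^bsub>G\<^esub> z \<otimes>\<^bsub>G\<^esub> y) * k (inv\<^bsub>G\<^esub> y \<otimes>\<^bsub>G\<^esub> x)) =
           f z * (\<Sum>w\<in>carrier G. h w * k (inv\<^bsub>G\<^esub> w \<otimes>\<^bsub>G\<^esub> (inv\<^bsub>G\<^esub> z \<otimes>\<^bsub>G\<^esub> x)))"
            unfolding sum_distrib_left
            by (subst re[OF z], rule sum.cong)
              (use z x in \<open>auto simp: G.m_assoc[symmetric] G.inv_mult_group\<close>)
        qed
        finally show ?thesis .
      qed
      then show "(f \<otimes>\<^bsub>int_group_ring G\<^esub> h) \<otimes>\<^bsub>int_group_ring G\<^esub> k =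
        f \<otimes>\<^bsub>int_group_ring G\<^esub> (h \<otimes>\<^bsub>int_group_ring G\<^esub> k)"
        by (auto simp: int_group_ring_def fun_eq_iff)
    next
      fix f assume f: "f \<in> carrier (int_group_ring G)"
      show "\<one>\<^bsub>int_group_ring G\<^esub> \<otimes>\<^bsub>int_group_ring G\<^esub> f = f"
        using f assms(2) by (auto simp: int_group_ring_def fun_eq_iff if_distrib[of "\<lambda>a. a * _"] cong: if_cong)
      have "f y * (if inv\<^bsub>G\<^esub> y \<otimes>\<^bsub>G\<^esub> x = \<one>\<^bsub>G\<^esub> then 1 else 0) = (if y = x then f y else 0)"
        if "x \<in> carrier G" "y \<in> carrier G" for x y
        using G.inv_solve_left[of "\<one>\<^bsub>G\<^esub>" y x] that by auto
      then show "f \<otimes>\<^bsub>int_group_ring G\<^esub> \<one>\<^bsub>int_group_ring G\<^esub> = f"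
        using f assms(2) by (auto simp: int_group_ring_def fun_eq_iff)
    qed (auto simp: int_group_ring_def)
  qed (auto simp: int_group_ring_def fun_eq_iff sum.distrib ring_distribs)
qed

lemma left_module_conj_module:
  assumes "group G" "finite (carrier G)" "A \<lhd> G" "comm_group (G\<lparr>carrier := A\<rparr>)"
  shows "left_module (int_group_ring G) (conj_module G A)"
proof -
  interpret G: group G by fact
  interpret A: normal A G by fact
  let ?P = "G\<lparr>carrier := A\<rparr>"
  interpret P: comm_group ?P by fact
  define c where "c = (\<lambda>g a. g \<otimes>\<^bsub>G\<^esub> a \<otimes>\<^bsub>G\<^esub> inv\<^bsub>G\<^esub> g)"
  have AG: "a \<in> A \<Longrightarrow> a \<in> carrier G" for a using A.subset by auto
  have cA: "g \<in> carrier G \<Longrightarrow> a \<in> A \<Longrightarrow> c g a \<in> A" for g a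
    unfolding c_def by (rule A.inv_op_closed2)
  have pw: "x \<in> A \<Longrightarrow> x [^]\<^bsub>G\<^esub> (e::int) = x [^]\<^bsub>?P\<^esub> e" for x e
    using G.int_pow_consistent[OF A.subgroup_axioms] by simp
  have pc: "x \<in> A \<Longrightarrow> x [^]\<^bsub>?P\<^esub> (e::int) \<in> A" for x e
    using P.int_pow_closed by simp
  have chom: "c g \<in> hom ?P ?P" if "g \<in> carrier G" for g
  proof (rule homI)
    fix a b assume "a \<in> carrier ?P" "b \<in> carrier ?P"
    then have ab: "a \<in> carrier G" "b \<in> carrier G" using AG by auto
    have "inv\<^bsub>G\<^esub> g \<otimes>\<^bsub>G\<^esub> (g \<otimes>\<^bsub>G\<^esub> (b \<otimes>\<^bsub>G\<^esub> inv\<^bsub>G\<^esub> g)) = b \<otimes>\<^bsub>G\<^esub> inv\<^bsub>G\<^esub> g"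
      using that ab by (simp add: G.m_assoc[symmetric])
    then show "c g (a \<otimes>\<^bsub>?P\<^esub> b) = c g a \<otimes>\<^bsub>?P\<^esub> c g b"
      using that ab by (simp add: c_def G.m_assoc)
  qed (use that cA in auto)
  have cc: "c g (c h a) = c (g \<otimes>\<^bsub>G\<^esub> h) a" if "g \<in> carrier G" "h \<in> carrier G" "a \<in> A" for g h a
    using that AG by (simp add: c_def G.m_assoc G.inv_mult_group)
  define s where "s = (\<lambda>f a. finprod ?P (\<lambda>g. c g a [^]\<^bsub>?P\<^esub> (f g :: int)) (carrier G))"
  have s_eq: "f \<odot>\<^bsub>conj_module G A\<^esub> a = s f a" if "a \<in> A" for f a
  proof -
    have "(\<lambda>g. c g a [^]\<^bsub>G\<^esub> f g) g = c g a [^]\<^bsub>?P\<^esub> f g" if "g \<in> carrier G" for g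
      using pw cA that \<open>a \<in> A\<close> by simp
    then have "finprod ?P (\<lambda>g. c g a [^]\<^bsub>G\<^esub> f g) (carrier G) = s f a"
      unfolding s_def by (intro P.finprod_cong') (use cA pc that in auto)
    then show ?thesis by (simp add: conj_module_def c_def)
  qed
  have sA: "s f a \<in> A" if "a \<in> A" for f a
    unfolding s_def using P.finprod_closed[of "\<lambda>g. c g a [^]\<^bsub>?P\<^esub> f g" "carrier G"] that cA pc by auto
  have R: "ring (int_group_ring G)" by (rule ring_int_group_ring) fact+
  have M: "abelian_group (conj_module G A)"
  proof (rule abelian_groupI)
    fix x y z
    assume "x \<in> carrier (conj_module G A)" "y \<in> carrier (conj_module G A)" 
    then show "x \<oplus>\<^bsub>conj_module G A\<^esub> y = y \<oplus>\<^bsub>conj_module G A\<^esub> x"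
      using P.m_comm by (simp add: conj_module_def)
  next
    fix x assume "x \<in> carrier (conj_module G A)"
    then show "\<exists>y\<in>carrier (conj_module G A). y \<oplus>\<^bsub>conj_module G A\<^esub> x = \<zero>\<^bsub>conj_module G A\<^esub>"
      using P.l_inv_ex by (simp add: conj_module_def)
  qed (auto simp: conj_module_def AG G.m_assoc)
  show ?thesis
  proof (intro left_module.intro R M left_module_axioms.intro, goal_cases)
    case (1 f a)
    then show ?case using s_eq sA by (simp add: conj_module_def)
  next
    case (2 f h a)
    then have a: "a \<in> A" by (simp add: conj_module_def)
    have "s (\<lambda>x. f x + h x) a = s f a \<otimes>\<^bsub>?P\<^esub> s h a"
      unfolding s_def using a
      by (subst P.finprod_multf[symmetric])
        (auto intro!: P.finprod_cong' simp: pc cA P.int_pow_mult)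
    then show ?case using a by (simp add: s_eq) (simp add: conj_module_def int_group_ring_def)
  next
    case (3 f a b)
    then have ab: "a \<in> A" "b \<in> A" by (auto simp: conj_module_def)
    have "s f (a \<otimes>\<^bsub>G\<^esub> b) = s f a \<otimes>\<^bsub>?P\<^esub> s f b"
      unfolding s_def using ab
      by (subst P.finprod_multf[symmetric])
        (auto intro!: P.finprod_cong' simp: pc cA P.int_pow_distrib[simplified] hom_mult[OF chom, simplified])
    then show ?case using ab s_eq A.m_closed by (simp add: conj_module_def)
  next
    case (4 f h a)
    then have a: "a \<in> A" by (simp add: conj_module_def)
    let ?C = "carrier G"
    have "s (\<lambda>x. if x \<in> ?C then \<Sum>y\<in>?C. f y * h (inv\<^bsub>G\<^esub> y \<otimes>\<^bsub>G\<^esub> x) else 0) a =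
      finprod ?P (\<lambda>x. finprod ?P (\<lambda>y. c x a [^]\<^bsub>?P\<^esub> (f y * h (inv\<^bsub>G\<^esub> y \<otimes>\<^bsub>G\<^esub> x))) ?C) ?C"
      unfolding s_def
      by (rule P.finprod_cong') (auto simp: pc cA a P.int_pow_sum[OF assms(2)] intro!: P.finprod_closed[simplified])
    also have "\<dots> = finprod ?P (\<lambda>y. finprod ?P (\<lambda>x. c x a [^]\<^bsub>?P\<^esub> (f y * h (inv\<^bsub>G\<^esub> y \<otimes>\<^bsub>G\<^esub> x))) ?C) ?C"
      by (rule P.finprod_swap) (use assms(2) a cA pc in auto)
    also have "\<dots> = finprod ?P (\<lambda>y. c y (s h a) [^]\<^bsub>?P\<^esub> f y) ?C"
    proof (rule P.finprod_cong'[OF refl])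
      show "(\<lambda>y. c y (s h a) [^]\<^bsub>?P\<^esub> f y) \<in> ?C \<rightarrow> carrier ?P"
        using a by (auto intro!: pc cA sA)
      fix y assume y: "y \<in> ?C"
      have "c y (s h a) = finprod ?P (\<lambda>w. c y (c w a [^]\<^bsub>?P\<^esub> h w)) ?C"
        unfolding s_def
        by (rule hom_finprod_comm_group[OF assms(4) assms(4) chom[OF y]]) (use a pc cA in auto)
      also have "\<dots> = finprod ?P (\<lambda>w. c (y \<otimes>\<^bsub>G\<^esub> w) a [^]\<^bsub>?P\<^esub> h w) ?C"
      proof (rule P.finprod_cong'[OF refl])
        fix w assume w: "w \<in> ?C"
        interpret h: group_hom ?P ?P "c y" using chom[OF y] by unfold_locales
        show "c y (c w a [^]\<^bsub>?P\<^esub> h w) = c (y \<otimes>\<^bsub>G\<^esub> w) a [^]\<^bsub>?P\<^esub> h w"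
          using h.hom_int_pow cA[OF w a] cc[OF y w a] by simp
      qed (use a y cA pc in auto)
      finally have "c y (s h a) [^]\<^bsub>?P\<^esub> f y = finprod ?P (\<lambda>w. (c (y \<otimes>\<^bsub>G\<^esub> w) a [^]\<^bsub>?P\<^esub> h w) [^]\<^bsub>?P\<^esub> f y) ?C"
        using P.finprod_int_pow[of "\<lambda>w. c (y \<otimes>\<^bsub>G\<^esub> w) a [^]\<^bsub>?P\<^esub> h w" ?C "f y"] a y cA pc by (simp add: Pi_iff)
      also have "\<dots> = finprod ?P (\<lambda>w. c (y \<otimes>\<^bsub>G\<^esub> w) a [^]\<^bsub>?P\<^esub> (f y * h (inv\<^bsub>G\<^esub> y \<otimes>\<^bsub>G\<^esub> (y \<otimes>\<^bsub>G\<^esub> w)))) ?C"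
        by (rule P.finprod_cong')
          (use a y cA pc in \<open>auto simp: P.int_pow_pow mult.commute G.m_assoc[symmetric]\<close>)
      also have "\<dots> = finprod ?P (\<lambda>x. c x a [^]\<^bsub>?P\<^esub> (f y * h (inv\<^bsub>G\<^esub> y \<otimes>\<^bsub>G\<^esub> x))) ((\<lambda>w. y \<otimes>\<^bsub>G\<^esub> w) ` ?C)"
        by (rule P.finprod_reindex[symmetric]) (use a y cA pc in \<open>auto simp: inj_on_def\<close>)
      also have "(\<lambda>w. y \<otimes>\<^bsub>G\<^esub> w) ` ?C = ?C" using y by (rule G.surj_const_mult)
      finally show "finprod ?P (\<lambda>x. c x a [^]\<^bsub>?P\<^esub> (f y * h (inv\<^bsub>G\<^esub> y \<otimes>\<^bsub>G\<^esub> x))) ?C = c y (s h a) [^]\<^bsub>?P\<^esub> f y" by simp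
    qed
    also have "\<dots> = s f (s h a)" by (simp add: s_def)
    finally show ?case using a sA by (simp add: s_eq int_group_ring_def)
  next
    case (5 a)
    then have a: "a \<in> A" by (simp add: conj_module_def)
    have "s (\<lambda>x. if x = \<one>\<^bsub>G\<^esub> then 1 else 0) a =
       finprod ?P (\<lambda>g. if \<one>\<^bsub>G\<^esub> = g then c g a else \<one>\<^bsub>?P\<^esub>) (carrier G)"
      unfolding s_def by (rule P.finprod_cong') (use a cA in \<open>auto simp: P.int_pow_1\<close>)
    also have "\<dots> = c \<one>\<^bsub>G\<^esub> a" by (rule P.finprod_singleton) (use a cA assms(2) in auto)
    also have "\<dots> = a" using a AG by (simp add: c_def)
    finally show ?case using a by (simp add: s_eq int_group_ring_def)
  qed
qed

lemma
  assumes "group G"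
  shows abelian_socle_normal: "abelian_socle G \<lhd> G"
    and abelian_socle_comm_group: "comm_group (G\<lparr>carrier := abelian_socle G\<rparr>)"
proof -
  interpret G: group G by fact
  let ?S = "\<Union>{N. foot G N \<and> comm_group (G\<lparr>carrier := N\<rparr>)}"
  have sub: "?S \<subseteq> carrier G"
    using normal_imp_subgroup subgroup.subset unfolding foot_def by blast
  show n: "abelian_socle G \<lhd> G"
    unfolding abelian_socle_def
    by (rule G.normal_generateI[OF sub]) (auto simp: foot_def intro: normal.inv_op_closed2)
  have comm: "x \<otimes>\<^bsub>G\<^esub> y = y \<otimes>\<^bsub>G\<^esub> x" if "x \<in> ?S" "y \<in> ?S" for x y
  proof -
    from that obtain M N where M: "foot G M" "comm_group (G\<lparr>carrier := M\<rparr>)" "x \<in> M"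
      and N: "foot G N" "y \<in> N" by blast
    interpret M: normal M G using M by (simp add: foot_def)
    interpret N: normal N G using N by (simp add: foot_def)
    have xy: "x \<in> carrier G" "y \<in> carrier G" using that sub by blast+
    show ?thesis
    proof (cases "M = N")
      case True
      then show ?thesis using comm_groupE(4)[OF M(2)] M(3) N(2) by simp
    next
      case False
      have I: "M \<inter> N \<lhd> G"
        by (rule G.normal_invI) (auto intro: G.subgroups_Inter_pair M.subgroup_axioms N.subgroup_axioms M.inv_op_closed2 N.inv_op_closed2)
      have triv: "M \<inter> N = {\<one>\<^bsub>G\<^esub>}"
        using M(1) N(1) I False unfolding foot_def by (metis inf.absorb_iff2 inf.cobounded1 inf.cobounded2)
      let ?k = "x \<otimes>\<^bsub>G\<^esub> y \<otimes>\<^bsub>G\<^esub> inv\<^bsub>G\<^esub> x \<otimes>\<^bsub>G\<^esub> inv\<^bsub>G\<^esub> y"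
      have "?k \<in> N" using N.inv_op_closed2[OF xy(1) N(2)] N(2) by simp
      moreover have "?k = x \<otimes>\<^bsub>G\<^esub> (y \<otimes>\<^bsub>G\<^esub> inv\<^bsub>G\<^esub> x \<otimes>\<^bsub>G\<^esub> inv\<^bsub>G\<^esub> y)" using xy by (simp add: G.m_assoc)
      then have "?k \<in> M" using M.inv_op_closed2[OF xy(2) M.m_inv_closed[OF M(3)]] M(3) by simp
      ultimately have "?k = \<one>\<^bsub>G\<^esub>" using triv by blast
      then show ?thesis using xy
        by (metis G.inv_closed G.inv_equality G.inv_inv G.inv_solve_right G.m_closed G.l_one)
    qed
  qed
  have C: "subgroup {y \<in> carrier G. \<forall>x\<in>X. x \<otimes>\<^bsub>G\<^esub> y = y \<otimes>\<^bsub>G\<^esub> x} G" if X: "X \<subseteq> carrier G" for X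
  proof (rule G.subgroupI)
    fix y assume y: "y \<in> {y \<in> carrier G. \<forall>x\<in>X. x \<otimes>\<^bsub>G\<^esub> y = y \<otimes>\<^bsub>G\<^esub> x}"
    have "x \<otimes>\<^bsub>G\<^esub> inv\<^bsub>G\<^esub> y = inv\<^bsub>G\<^esub> y \<otimes>\<^bsub>G\<^esub> x" if "x \<in> X" for x
    proof -
      have c: "x \<in> carrier G" "y \<in> carrier G" "x \<otimes>\<^bsub>G\<^esub> y = y \<otimes>\<^bsub>G\<^esub> x" using X y that by auto
      have "inv\<^bsub>G\<^esub> y \<otimes>\<^bsub>G\<^esub> x = inv\<^bsub>G\<^esub> y \<otimes>\<^bsub>G\<^esub> (x \<otimes>\<^bsub>G\<^esub> y) \<otimes>\<^bsub>G\<^esub> inv\<^bsub>G\<^esub> y" using c(1,2) by (simp add: G.m_assoc)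
      also have "\<dots> = x \<otimes>\<^bsub>G\<^esub> inv\<^bsub>G\<^esub> y" unfolding c(3) using c(1,2) by (simp add: G.m_assoc[symmetric])
      finally show ?thesis by simp
    qed
    then show "inv\<^bsub>G\<^esub> y \<in> {y \<in> carrier G. \<forall>x\<in>X. x \<otimes>\<^bsub>G\<^esub> y = y \<otimes>\<^bsub>G\<^esub> x}" using y by auto
  next
    fix y z assume y: "y \<in> {y \<in> carrier G. \<forall>x\<in>X. x \<otimes>\<^bsub>G\<^esub> y = y \<otimes>\<^bsub>G\<^esub> x}"
      and z: "z \<in> {y \<in> carrier G. \<forall>x\<in>X. x \<otimes>\<^bsub>G\<^esub> y = y \<otimes>\<^bsub>G\<^esub> x}"
    have "x \<otimes>\<^bsub>G\<^esub> (y \<otimes>\<^bsub>G\<^esub> z) = y \<otimes>\<^bsub>G\<^esub> z \<otimes>\<^bsub>G\<^esub> x" if "x \<in> X" for x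
    proof -
      have c: "x \<in> carrier G" "y \<in> carrier G" "z \<in> carrier G"
        "x \<otimes>\<^bsub>G\<^esub> y = y \<otimes>\<^bsub>G\<^esub> x" "x \<otimes>\<^bsub>G\<^esub> z = z \<otimes>\<^bsub>G\<^esub> x" using X y z that by auto
      have "x \<otimes>\<^bsub>G\<^esub> (y \<otimes>\<^bsub>G\<^esub> z) = y \<otimes>\<^bsub>G\<^esub> x \<otimes>\<^bsub>G\<^esub> z" using c(1-3) c(4)[symmetric] by (simp add: G.m_assoc)
      also have "\<dots> = y \<otimes>\<^bsub>G\<^esub> (z \<otimes>\<^bsub>G\<^esub> x)" using c(1-3) c(5)[symmetric] by (simp add: G.m_assoc)
      finally show ?thesis using c(1-3) by (simp add: G.m_assoc)
    qed
    then show "y \<otimes>\<^bsub>G\<^esub> z \<in> {y \<in> carrier G. \<forall>x\<in>X. x \<otimes>\<^bsub>G\<^esub> y = y \<otimes>\<^bsub>G\<^esub> x}" using y z by auto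
  qed (use X in \<open>auto intro!: exI[of _ "\<one>\<^bsub>G\<^esub>"]\<close>)
  have comm1: "x \<otimes>\<^bsub>G\<^esub> y = y \<otimes>\<^bsub>G\<^esub> x" if "x \<in> ?S" "y \<in> generate G ?S" for x y
    using G.generate_subgroup_incl[OF _ C[OF sub]] comm sub that by blast
  have gsub: "generate G ?S \<subseteq> carrier G" using G.generate_incl[OF sub] .
  have "?S \<subseteq> {y \<in> carrier G. \<forall>x\<in>generate G ?S. x \<otimes>\<^bsub>G\<^esub> y = y \<otimes>\<^bsub>G\<^esub> x}"
  proof (intro subsetI CollectI conjI ballI)
    fix y assume y: "y \<in> ?S"
    then show "y \<in> carrier G" using sub by (rule rev_subsetD)
    fix x assume "x \<in> generate G ?S"
    then show "x \<otimes>\<^bsub>G\<^esub> y = y \<otimes>\<^bsub>G\<^esub> x" by (rule comm1[OF y, symmetric])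
  qed
  from G.generate_subgroup_incl[OF this C[OF gsub]]
  have comm2: "x \<otimes>\<^bsub>G\<^esub> y = y \<otimes>\<^bsub>G\<^esub> x" if "x \<in> generate G ?S" "y \<in> generate G ?S" for x y
    using that by blast
  show "comm_group (G\<lparr>carrier := abelian_socle G\<rparr>)"
    by (rule group.group_comm_groupI[OF G.subgroup_imp_group[OF normal_imp_subgroup[OF n]]])
      (use comm2 in \<open>auto simp: abelian_socle_def\<close>)
qed

corollary left_module_abelian_socle:
  assumes "group G" "finite (carrier G)"
  shows "left_module (int_group_ring G) (conj_module G (abelian_socle G))"
  using assms by (intro left_module_conj_module abelian_socle_normal abelian_socle_comm_group)

end

theory Submission
  imports Defs "HOL-Algebra.Algebraic_Closure_Type" "HOL-Algebra.Sylow" "HOL-Algebra.SndIsomorphismGrp"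
begin

text \<open>Let \<open>A\<close> be the abelian socle, and let \<open>K\<close> be an algebraic closure of \<open>k\<close>. Semi-faithfulness forces the
  characteristic of \<open>k\<close> not to divide the order of \<open>A\<close>. Say that \<open>r\<close> characters of \<open>A\<close> with values in \<open>K\<close> form
  a system if no nontrivial normal subgroup of \<open>G\<close> inside \<open>A\<close> lies in all their kernels. Both
  "\<open>A\<close> is generated by \<open>r\<close> elements as a module" and "\<open>A\<close> has a system of \<open>r\<close> characters" turn out to be
  equivalent to \<open>|Hom\<^sub>G(W, A)| \<le> |W|\<^sup>r\<close> for every simple submodule \<open>W\<close>: since \<open>A\<close> is semisimple, one can adjoin
  the simple summands one at a time, and a suitable new component exists as long as there are fewer
  homomorphisms than candidates. Hence the rank is the least size of a system.

  An irreducible representation \<open>V\<close> of \<open>G\<close> contains over \<open>K\<close> an eigenvector for some character \<open>\<chi>\<close> of \<open>A\<close>, and by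
  Clifford's argument a normal subgroup of \<open>G\<close> inside \<open>A\<close> acts trivially on \<open>V\<close> iff \<open>\<chi>\<close> is trivial on it. The
  composition factors of a faithful representation thus give a system, because a subgroup of \<open>A\<close> acting
  trivially on all factors acts unipotently, hence trivially.

  Conversely, choose for each character \<open>\<chi>\<close> of a system an irreducible representation that contains \<open>\<chi>\<close> and is
  nontrivial on all nonabelian feet. It exists because the product of the idempotent of \<open>\<chi>\<close> with one
  non-nilpotent element of augmentation zero in the group algebra of each nonabelian foot is again
  non-nilpotent: the subgroups involved commute and their product is direct. The direct sum of the chosen
  representations is trivial on no foot of \<open>G\<close>, so it is faithful.\<close>

no_notation fps_nth (infixl \<open>$\<close> 75)

section \<open>Matrix representations in coordinates\<close>

text \<open>The field need not contain the values of the characters, and its characteristic may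
  divide the order of G, so neither splitting over k nor Maschke's theorem is at hand.
  Representations therefore stay over k while coefficients of group algebra elements live in K.
  Non-nilpotent elements replace idempotents: a nonzero element may vanish on every irreducible
  representation, but one without vanishing power cannot, since nilpotent diagonal blocks force a
  block triangular matrix to be nilpotent. Semi-faithfulness enters through a complement of the
  vectors fixed by a normal subgroup N: it is nonzero and has no nonzero N-fixed vector. For N
  abelian of exponent p in characteristic p this is contradictory. For N a nonabelian foot, an
  irreducible N-subrepresentation of it consists of the vectors l v with l of augmentation zero, so
  some such l fixes v. The two counting bounds agree because Hom(A, W) and Hom(W, A) have equal size
  and W has as many characters as elements. With trivial socle one summand remains necessary, as
  representation spaces are nonzero; it carries the nonabelian feet.\<close>

definition mrep :: "('g, 'm) monoid_scheme \<Rightarrow> nat \<Rightarrow> ('g \<Rightarrow> 'a::field mat) \<Rightarrow> bool" where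
  "mrep G n \<sigma> \<longleftrightarrow> (\<forall>g\<in>carrier G. \<sigma> g \<in> carrier_mat n n) \<and>
     (\<forall>g\<in>carrier G. \<forall>h\<in>carrier G. \<sigma> (g \<otimes>\<^bsub>G\<^esub> h) = \<sigma> g * \<sigma> h) \<and> \<sigma> \<one>\<^bsub>G\<^esub> = 1\<^sub>m n"

lemma mrepD:
  assumes "mrep G n \<sigma>"
  shows "g \<in> carrier G \<Longrightarrow> \<sigma> g \<in> carrier_mat n n"
    and "g \<in> carrier G \<Longrightarrow> h \<in> carrier G \<Longrightarrow> \<sigma> (g \<otimes>\<^bsub>G\<^esub> h) = \<sigma> g * \<sigma> h"
    and "\<sigma> \<one>\<^bsub>G\<^esub> = 1\<^sub>m n"
  using assms by (auto simp: mrep_def)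

text \<open>The matrices of g and its inverse multiply to the identity, so invertibility is
  automatic. \<open>mrep\<close> admits dimension 0, which is where inductions over blocks and
  summands start.\<close>

lemma representation_iff_mrep:
  fixes \<sigma> :: "'g \<Rightarrow> 'a::field mat"
  assumes "group G"
  shows "representation G n \<sigma> \<longleftrightarrow> 0 < n \<and> mrep G n \<sigma>"
proof -
  interpret group G by fact
  interpret R: semiring "ring_mat TYPE('a) n ()" by (rule semiring_mat)
  have U: "x \<in> Units (ring_mat TYPE('a) n ()) \<Longrightarrow> x \<in> carrier_mat n n" for x
    using R.Units_closed by (simp add: ring_mat_simps)
  show ?thesis
  proof (intro iffI conjI)
    assume r: "representation G n \<sigma>"
    then show n: "0 < n" by (simp add: representation_def)
    have h: "\<sigma> \<in> hom G (GL TYPE('a) n)" using r by (simp add: representation_def)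
    have gr: "group (GL TYPE('a) n)" unfolding GL_def by (rule R.units_group)
    interpret h: group_hom G "GL TYPE('a) n" \<sigma>
      using h gr group_axioms by (simp add: group_hom_def group_hom_axioms_def)
    have c: "\<sigma> g \<in> carrier_mat n n" if "g \<in> carrier G" for g
      using h.hom_closed[OF that] U by (simp add: GL_def units_of_def)
    show "mrep G n \<sigma>"
      unfolding mrep_def using c h.hom_mult h.hom_one
      by (auto simp: GL_def units_of_def ring_mat_simps)
  next
    assume a: "0 < n \<and> mrep G n \<sigma>"
    then have m: "mrep G n \<sigma>" by simp
    have "\<sigma> g \<in> Units (ring_mat TYPE('a) n ())" if g: "g \<in> carrier G" for g
      using g mrepD[OF m] mrepD(2)[OF m, of g "inv\<^bsub>G\<^esub> g"] mrepD(2)[OF m, of "inv\<^bsub>G\<^esub> g" g]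
      unfolding Units_def ring_mat_simps by (auto intro!: bexI[of _ "\<sigma> (inv\<^bsub>G\<^esub> g)"])
    then show "representation G n \<sigma>"
      unfolding representation_def using a mrepD[OF m]
      by (auto simp: hom_def GL_def units_of_def ring_mat_simps)
  qed
qed

definition lin_subspace :: "nat \<Rightarrow> 'a::field vec set \<Rightarrow> bool" where
  "lin_subspace n W \<longleftrightarrow> W \<subseteq> carrier_vec n \<and> 0\<^sub>v n \<in> W \<and> (\<forall>u\<in>W. \<forall>v\<in>W. u + v \<in> W) \<and> (\<forall>c. \<forall>u\<in>W. c \<cdot>\<^sub>v u \<in> W)"

lemma lin_subspaceD:
  assumes "lin_subspace n W"
  shows "u \<in> W \<Longrightarrow> u \<in> carrier_vec n" "0\<^sub>v n \<in> W" "u \<in> W \<Longrightarrow> v \<in> W \<Longrightarrow> u + v \<in> W" "u \<in> W \<Longrightarrow> c \<cdot>\<^sub>v u \<in> W"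
  using assms by (auto simp: lin_subspace_def)

lemma lin_subspace_diff:
  assumes "lin_subspace n W" "u \<in> W" "v \<in> W"
  shows "u - v \<in> W"
proof -
  have "u - v = u + (-1) \<cdot>\<^sub>v v"
    using lin_subspaceD(1)[OF assms(1)] assms(2,3) by (intro eq_vecI) auto
  then show ?thesis using lin_subspaceD(3,4)[OF assms(1)] assms(2,3) by simp
qed

lemma subspace_iff_lin_subspace:
  fixes W :: "'a::field vec set"
  shows "VectorSpace.subspace class_ring W (module_vec TYPE('a) n) \<longleftrightarrow> lin_subspace n W"
proof -
  interpret vec_space "TYPE('a)" n .
  have inv: "-(v) \<in> W" if "\<And>c u. u \<in> W \<Longrightarrow> c \<cdot>\<^sub>v u \<in> W" "v \<in> W" for v
  proof -
    have "- v = (-1) \<cdot>\<^sub>v v" by (intro eq_vecI) auto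
    then show ?thesis using that by simp
  qed
  show ?thesis
    unfolding VectorSpace.subspace_def submodule_def lin_subspace_def module_vec_simps
    using inv by (simp add: vectorspace_axioms module_axioms) blast
qed

lemma subrepresentation_iff:
  "subrepresentation G n \<rho> W \<longleftrightarrow> lin_subspace n W \<and> (\<forall>g\<in>carrier G. \<forall>w\<in>W. \<rho> g *\<^sub>v w \<in> W)"
  by (simp add: subrepresentation_def subspace_iff_lin_subspace)

section \<open>Bases adapted to an invariant subspace\<close>

lemma mult_mat_vec_inverse:
  assumes "P \<in> carrier_mat n n" "Q \<in> carrier_mat n n" "P * Q = 1\<^sub>m n" "v \<in> carrier_vec n"
  shows "P *\<^sub>v (Q *\<^sub>v v) = (v :: 'a::field vec)"
  using assms assoc_mult_mat_vec[OF assms(1,2,4)] by simp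

text \<open>Steinitz exchange: the basis direction k is replaced by v, which is possible because v
  has a nonzero coordinate at some j at or beyond k. It enlarges an adapted basis by one
  vector.\<close>

lemma exchange_matrix:
  fixes v :: "'a::field vec"
  assumes v: "v \<in> carrier_vec n" and kj: "k \<le> j" "j < n" "v $ j \<noteq> 0"
  shows "\<exists>E F. E \<in> carrier_mat n n \<and> F \<in> carrier_mat n n \<and> E * F = 1\<^sub>m n \<and> F * E = 1\<^sub>m n \<and>
     (\<forall>u\<in>carrier_vec n. (\<forall>i<n. k < i \<longrightarrow> u $ i = 0) \<longrightarrow>
        (\<exists>c. \<exists>w\<in>carrier_vec n. (\<forall>i<n. k \<le> i \<longrightarrow> w $ i = 0) \<and> E *\<^sub>v u = w + c \<cdot>\<^sub>v v))"
proof -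
  \<comment> \<open>Column k is v and, if j differs from k, column j is the k-th unit vector; the
    other columns are those of the identity. For u supported on the coordinates up to k the image is
    therefore a combination of v and of unit vectors with index below k.\<close>
  define E where "E = mat n n (\<lambda>(i, c). if c = k then v $ i else if c = j then of_bool (i = k) else of_bool (i = c))"
  have E: "E \<in> carrier_mat n n" by (simp add: E_def)
  have Eu: "(E *\<^sub>v u) $ i = v $ i * u $ k + (if i = k then (if j = k then 0 else u $ j) else if i = j then 0 else u $ i)"
    if u: "u \<in> carrier_vec n" and i: "i < n" for u i
  proof -
    have "(E *\<^sub>v u) $ i = (\<Sum>c<n. (if c = k then v $ i else if c = j then of_bool (i = k) else of_bool (i = c)) * u $ c)"
      using u i by (simp add: E_def scalar_prod_def atLeast0LessThan)
    also have "\<dots> = (\<Sum>c<n. (if c = k then v $ i * u $ k else 0) +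
        (if c = j then (if i = k \<and> j \<noteq> k then u $ j else 0) else 0) +
        (if c = i then (if i \<noteq> k \<and> i \<noteq> j then u $ i else 0) else 0))"
      by (rule sum.cong) auto
    also have "\<dots> = v $ i * u $ k + (if i = k \<and> j \<noteq> k then u $ j else 0) + (if i \<noteq> k \<and> i \<noteq> j then u $ i else 0)"
      using kj i by (simp add: sum.distrib)
    finally show ?thesis by auto
  qed
  have inj: "u = 0\<^sub>v n" if u: "u \<in> carrier_vec n" and 0: "E *\<^sub>v u = 0\<^sub>v n" for u
  proof -
    have z: "(E *\<^sub>v u) $ i = 0" if "i < n" for i using 0 that by simp
    have uk: "u $ k = 0" using z[of j] Eu[OF u, of j] kj by (auto split: if_splits)
    have uj: "u $ j = 0" using z[of k] Eu[OF u, of k] kj uk by (auto split: if_splits)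
    have "u $ i = 0" if "i < n" for i
      using z[OF that] Eu[OF u that] uk uj by (auto split: if_splits)
    then show ?thesis using u by (intro eq_vecI) auto
  qed
  have "det E \<noteq> 0" using inj det_0_iff_vec_prod_zero[OF E] by blast
  then have "E \<in> Units (ring_mat TYPE('a) n ())" by (rule det_non_zero_imp_unit[OF E])
  then obtain F where F: "F \<in> carrier_mat n n" "E * F = 1\<^sub>m n" "F * E = 1\<^sub>m n"
    unfolding Units_def by (auto simp: ring_mat_simps)
  have "\<exists>c. \<exists>w\<in>carrier_vec n. (\<forall>i<n. k \<le> i \<longrightarrow> w $ i = 0) \<and> E *\<^sub>v u = w + c \<cdot>\<^sub>v v"
    if u: "u \<in> carrier_vec n" and u0: "\<forall>i<n. k < i \<longrightarrow> u $ i = 0" for u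
  proof (rule exI[of _ "u $ k"], rule bexI[of _ "vec n (\<lambda>i. if i < k then u $ i else 0)"], rule conjI)
      show "E *\<^sub>v u = vec n (\<lambda>i. if i < k then u $ i else 0) + u $ k \<cdot>\<^sub>v v"
      proof (rule eq_vecI)
        fix i assume "i < dim_vec (vec n (\<lambda>i. if i < k then u $ i else 0) + u $ k \<cdot>\<^sub>v v)"
        then have i: "i < n" using v by simp
        show "(E *\<^sub>v u) $ i = (vec n (\<lambda>i. if i < k then u $ i else 0) + u $ k \<cdot>\<^sub>v v) $ i"
          unfolding Eu[OF u i] using i v kj u0 by auto
      qed (use E v in auto)
  qed auto
  then show ?thesis using E F by blast
qed

text \<open>Take the largest k for which some invertible P sends the first k coordinate directions
  into W. If W held the image of a vector with a nonzero coordinate at or beyond k, an exchange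
  would give k + 1.\<close>

lemma lin_subspace_coordinates:
  fixes W :: "'a::field vec set"
  assumes W: "lin_subspace n W"
  shows "\<exists>k P Q. k \<le> n \<and> P \<in> carrier_mat n n \<and> Q \<in> carrier_mat n n \<and> P * Q = 1\<^sub>m n \<and> Q * P = 1\<^sub>m n \<and>
    (\<forall>v\<in>carrier_vec n. P *\<^sub>v v \<in> W \<longleftrightarrow> (\<forall>i<n. k \<le> i \<longrightarrow> v $ i = 0))"
proof -
  \<comment> \<open>Only one inclusion is demanded here; the reverse one is what maximality of k
    yields.\<close>
  define ok where "ok k \<longleftrightarrow> k \<le> n \<and> (\<exists>P Q. P \<in> carrier_mat n n \<and> Q \<in> carrier_mat n n \<and> P * Q = 1\<^sub>m n \<and> Q * P = 1\<^sub>m n \<and>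
    (\<forall>v\<in>carrier_vec n. (\<forall>i<n. k \<le> i \<longrightarrow> v $ i = 0) \<longrightarrow> P *\<^sub>v v \<in> W))" for k
  have "ok 0"
    unfolding ok_def
  proof (intro conjI exI[of _ "1\<^sub>m n"] ballI impI)
    fix v :: "'a vec" assume "v \<in> carrier_vec n" "\<forall>i<n. 0 \<le> i \<longrightarrow> v $ i = 0"
    then have "v = 0\<^sub>v n" by (intro eq_vecI) auto
    then show "1\<^sub>m n *\<^sub>v v \<in> W" using lin_subspaceD(2)[OF W] by simp
  qed auto
  moreover have b: "\<forall>k. ok k \<longrightarrow> k \<le> n" by (simp add: ok_def)
  ultimately obtain k where k: "ok k" and max: "\<And>k'. ok k' \<Longrightarrow> k' \<le> k"
    using Nat.ex_has_greatest_nat[of ok 0 n] by blast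
  from k obtain P Q where kn: "k \<le> n" and P: "P \<in> carrier_mat n n" and Q: "Q \<in> carrier_mat n n"
    and PQ: "P * Q = 1\<^sub>m n" "Q * P = 1\<^sub>m n"
    and PW: "\<And>v. v \<in> carrier_vec n \<Longrightarrow> (\<And>i. i < n \<Longrightarrow> k \<le> i \<Longrightarrow> v $ i = 0) \<Longrightarrow> P *\<^sub>v v \<in> W"
    unfolding ok_def by blast
  have "v $ j = 0" if v: "v \<in> carrier_vec n" and vW: "P *\<^sub>v v \<in> W" and j: "j < n" "k \<le> j" for v j
  proof (rule ccontr)
    assume "v $ j \<noteq> 0"
    from exchange_matrix[OF v j(2,1) this] obtain E F where
      E: "E \<in> carrier_mat n n" and F: "F \<in> carrier_mat n n" and EF: "E * F = 1\<^sub>m n" "F * E = 1\<^sub>m n"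
      and Eu: "\<And>u. u \<in> carrier_vec n \<Longrightarrow> (\<And>i. i < n \<Longrightarrow> k < i \<Longrightarrow> u $ i = 0) \<Longrightarrow>
        (\<exists>c. \<exists>w\<in>carrier_vec n. (\<forall>i<n. k \<le> i \<longrightarrow> w $ i = 0) \<and> E *\<^sub>v u = w + c \<cdot>\<^sub>v v)"
      by blast
    have "P * E *\<^sub>v u \<in> W" if u: "u \<in> carrier_vec n" and u0: "\<forall>i<n. Suc k \<le> i \<longrightarrow> u $ i = 0" for u
    proof -
      obtain c w where w: "w \<in> carrier_vec n" "\<forall>i<n. k \<le> i \<longrightarrow> w $ i = 0" "E *\<^sub>v u = w + c \<cdot>\<^sub>v v"
        using Eu[OF u] u0 by auto
      have "P * E *\<^sub>v u = P *\<^sub>v w + c \<cdot>\<^sub>v (P *\<^sub>v v)"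
        using P E u v w by (simp add: assoc_mult_mat_vec[of _ n n _ n] mult_add_distrib_mat_vec[of _ n n] mult_mat_vec[of _ n n])
      then show "P * E *\<^sub>v u \<in> W" using lin_subspaceD[OF W] PW[OF w(1)] w(2) vW by simp
    qed
    moreover have "P * E * (F * Q) = 1\<^sub>m n"
    proof -
      have "P * E * (F * Q) = P * (E * F) * Q" using P Q E F by (simp add: assoc_mult_mat[of _ n n _ n _ n])
      then show "P * E * (F * Q) = 1\<^sub>m n" using P PQ EF by simp
    qed
    moreover have "F * Q * (P * E) = 1\<^sub>m n"
    proof -
      have "F * Q * (P * E) = F * (Q * P) * E" using P Q E F by (simp add: assoc_mult_mat[of _ n n _ n _ n])
      then show "F * Q * (P * E) = 1\<^sub>m n" using F PQ EF by simp
    qed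
    ultimately have "ok (Suc k)"
      unfolding ok_def using P Q E F j by (simp only: Suc_le_eq) (rule conjI, simp, rule exI[of _ "P * E"], rule exI[of _ "F * Q"], simp)
    then show False using max[of "Suc k"] by simp
  qed
  then have "\<forall>v\<in>carrier_vec n. P *\<^sub>v v \<in> W \<longleftrightarrow> (\<forall>i<n. k \<le> i \<longrightarrow> v $ i = 0)" using PW by blast
  with kn P Q PQ show ?thesis by (intro exI conjI)
qed

lemma conj_mult_mat:
  fixes P :: "'a::field mat"
  assumes "P \<in> carrier_mat n n" "Q \<in> carrier_mat n n" "P * Q = 1\<^sub>m n"
    "M \<in> carrier_mat n n" "M' \<in> carrier_mat n n"
  shows "Q * M * P * (Q * M' * P) = Q * (M * M') * P"
proof -
  have "P * (Q * (M' * P)) = (P * Q) * (M' * P)"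
    using assms(1,2,5) by (simp add: assoc_mult_mat[of _ n n _ n _ n])
  also have "\<dots> = M' * P" using assms by simp
  finally show ?thesis using assms(1,2,4,5) by (simp add: assoc_mult_mat[of _ n n _ n _ n])
qed

lemma conj_cancel_mat:
  fixes P :: "'a::field mat"
  assumes "P \<in> carrier_mat n n" "Q \<in> carrier_mat n n" "P * Q = 1\<^sub>m n" "M \<in> carrier_mat n n"
  shows "P * (Q * M * P) * Q = M"
proof -
  have "P * (Q * M * P) * Q = (P * Q) * (M * (P * Q))"
    using assms(1,2,4) by (simp add: assoc_mult_mat[of _ n n _ n _ n])
  then show ?thesis using assms by simp
qed

lemma coordinate_subspace_proper:
  fixes U :: "'a::field vec set"
  assumes lU: "lin_subspace n U" and P: "P \<in> carrier_mat n n" and Q: "Q \<in> carrier_mat n n" and PQ: "P * Q = 1\<^sub>m n"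
    and PU: "\<forall>v\<in>carrier_vec n. P *\<^sub>v v \<in> U \<longleftrightarrow> (\<forall>i<n. k \<le> i \<longrightarrow> v $ i = 0)"
  shows "k = n \<Longrightarrow> U = carrier_vec n" and "k = 0 \<Longrightarrow> U = {0\<^sub>v n}"
proof -
  assume "k = n"
  then have "P *\<^sub>v (Q *\<^sub>v v) \<in> U" if "v \<in> carrier_vec n" for v using PU Q that by auto
  then have "carrier_vec n \<subseteq> U" using mult_mat_vec_inverse[OF P Q PQ] by auto
  then show "U = carrier_vec n" using lin_subspaceD(1)[OF lU] by blast
next
  assume k: "k = 0"
  have "v = 0\<^sub>v n" if v: "v \<in> U" for v
  proof -
    have vc: "v \<in> carrier_vec n" using lin_subspaceD(1)[OF lU v] .
    have "P *\<^sub>v (Q *\<^sub>v v) \<in> U" using mult_mat_vec_inverse[OF P Q PQ vc] v by simp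
    then have "Q *\<^sub>v v = 0\<^sub>v n" using PU[rule_format, of "Q *\<^sub>v v"] Q vc k by (intro eq_vecI) auto
    then have "P *\<^sub>v (Q *\<^sub>v v) = 0\<^sub>v n" using P by (auto intro!: eq_vecI)
    then show ?thesis using mult_mat_vec_inverse[OF P Q PQ vc] by simp
  qed
  then show "U = {0\<^sub>v n}" using lin_subspaceD(2)[OF lU] by blast
qed

text \<open>In a basis adapted to W, \<open>\<sigma>1\<close> is the action on W and
  \<open>\<sigma>2\<close> the action on the quotient. Diagonal blocks of block triangular matrices
  multiply separately, so both are representations again.\<close>

lemma subrepresentation_block:
  fixes \<sigma> :: "'g \<Rightarrow> 'a::field mat"
  assumes G: "group G" and m: "mrep G n \<sigma>" and W: "subrepresentation G n \<sigma> W"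
  shows "\<exists>n1 n2 P Q \<sigma>1 \<sigma>2 B. n = n1 + n2 \<and> P \<in> carrier_mat n n \<and> Q \<in> carrier_mat n n \<and> P * Q = 1\<^sub>m n \<and> Q * P = 1\<^sub>m n \<and>
    (\<forall>v\<in>carrier_vec n. P *\<^sub>v v \<in> W \<longleftrightarrow> (\<forall>i<n. n1 \<le> i \<longrightarrow> v $ i = 0)) \<and> mrep G n1 \<sigma>1 \<and> mrep G n2 \<sigma>2 \<and>
    (\<forall>g\<in>carrier G. B g \<in> carrier_mat n1 n2 \<and> Q * \<sigma> g * P = four_block_mat (\<sigma>1 g) (B g) (0\<^sub>m n2 n1) (\<sigma>2 g))"
proof -
  interpret group G by fact
  from W have lW: "lin_subspace n W" and st: "\<And>g w. g \<in> carrier G \<Longrightarrow> w \<in> W \<Longrightarrow> \<sigma> g *\<^sub>v w \<in> W"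
    by (auto simp: subrepresentation_iff)
  from lin_subspace_coordinates[OF lW] obtain k P Q where k: "k \<le> n"
    and P: "P \<in> carrier_mat n n" and Q: "Q \<in> carrier_mat n n" and PQ: "P * Q = 1\<^sub>m n" "Q * P = 1\<^sub>m n"
    and PW: "\<forall>v\<in>carrier_vec n. P *\<^sub>v v \<in> W \<longleftrightarrow> (\<forall>i<n. k \<le> i \<longrightarrow> v $ i = 0)" by blast
  define l where "l = n - k"
  have n: "n = k + l" using k by (simp add: l_def)
  define \<tau> where "\<tau> g = Q * \<sigma> g * P" for g
  have S: "\<sigma> g \<in> carrier_mat n n" if "g \<in> carrier G" for g using mrepD(1)[OF m that] .
  have T: "\<tau> g \<in> carrier_mat n n" if "g \<in> carrier G" for g
    using S[OF that] P Q by (simp add: \<tau>_def)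
  have Tm: "\<tau> (g \<otimes>\<^bsub>G\<^esub> h) = \<tau> g * \<tau> h" if "g \<in> carrier G" "h \<in> carrier G" for g h
    unfolding \<tau>_def conj_mult_mat[OF P Q PQ(1) S[OF that(1)] S[OF that(2)]] mrepD(2)[OF m that] ..
  have T1: "\<tau> \<one>\<^bsub>G\<^esub> = 1\<^sub>m n" using mrepD(3)[OF m] P Q PQ by (simp add: \<tau>_def)
  \<comment> \<open>The first k basis vectors span W, and W is stable, so their images have no
    coordinate at or beyond k.\<close>
  have zero: "\<tau> g $$ (i, c) = 0" if g: "g \<in> carrier G" and i: "i < n" "k \<le> i" and c: "c < k" for g i c
  proof -
    have cn: "c < n" using c k by simp
    have "P *\<^sub>v unit_vec n c \<in> W" using PW c cn by auto
    then have "\<sigma> g *\<^sub>v (P *\<^sub>v unit_vec n c) \<in> W" using st g by blast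
    moreover have "P *\<^sub>v (\<tau> g *\<^sub>v unit_vec n c) = \<sigma> g *\<^sub>v (P *\<^sub>v unit_vec n c)"
    proof -
      have "P *\<^sub>v (\<tau> g *\<^sub>v unit_vec n c) = (P * \<tau> g) *\<^sub>v unit_vec n c"
        using P T[OF g] by (simp add: assoc_mult_mat_vec[of _ n n _ n])
      also have "P * \<tau> g = (P * Q) * (\<sigma> g * P)"
        unfolding \<tau>_def using P Q S[OF g] by (simp add: assoc_mult_mat[of _ n n _ n _ n])
      also have "\<dots> *\<^sub>v unit_vec n c = \<sigma> g *\<^sub>v (P *\<^sub>v unit_vec n c)"
        using P Q PQ S[OF g] by (simp add: assoc_mult_mat_vec[of _ n n _ n])
      finally show ?thesis .
    qed
    ultimately have "(\<tau> g *\<^sub>v unit_vec n c) $ i = 0"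
      using PW[rule_format, of "\<tau> g *\<^sub>v unit_vec n c"] T[OF g] i by auto
    then show ?thesis using T[OF g] i cn by (simp add: scalar_prod_right_unit)
  qed
  define \<sigma>1 where "\<sigma>1 g = mat k k (\<lambda>(i, j). \<tau> g $$ (i, j))" for g
  define \<sigma>2 where "\<sigma>2 g = mat l l (\<lambda>(i, j). \<tau> g $$ (i + k, j + k))" for g
  define B where "B g = mat k l (\<lambda>(i, j). \<tau> g $$ (i, j + k))" for g
  have F: "\<tau> g = four_block_mat (\<sigma>1 g) (B g) (0\<^sub>m l k) (\<sigma>2 g)" if g: "g \<in> carrier G" for g
    by (rule eq_matI) (use T[OF g] zero[OF g] in \<open>auto simp: \<sigma>1_def \<sigma>2_def B_def n\<close>)
  have cl: "\<sigma>1 g \<in> carrier_mat k k" "\<sigma>2 g \<in> carrier_mat l l" "B g \<in> carrier_mat k l" for g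
    by (auto simp: \<sigma>1_def \<sigma>2_def B_def)
  have mult: "\<tau> (g \<otimes>\<^bsub>G\<^esub> h) = four_block_mat (\<sigma>1 g * \<sigma>1 h) (\<sigma>1 g * B h + B g * \<sigma>2 h) (0\<^sub>m l k) (\<sigma>2 g * \<sigma>2 h)"
    if g: "g \<in> carrier G" and h: "h \<in> carrier G" for g h
    unfolding Tm[OF g h] F[OF g] F[OF h]
    by (subst mult_four_block_mat[of _ k k _ l _ l _ _ k _ l]) (use cl[of g] cl[of h] in \<open>auto simp: right_add_zero_mat[of _ k k]\<close>)
  have m1: "\<sigma>1 (g \<otimes>\<^bsub>G\<^esub> h) = \<sigma>1 g * \<sigma>1 h" if g: "g \<in> carrier G" and h: "h \<in> carrier G" for g h
    by (rule eq_matI, subst \<sigma>1_def, subst mult[OF g h])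
      (use cl[of g] cl[of h] cl[of "g \<otimes>\<^bsub>G\<^esub> h"] in \<open>auto simp del: index_mult_mat(1)\<close>)
  have m2: "\<sigma>2 (g \<otimes>\<^bsub>G\<^esub> h) = \<sigma>2 g * \<sigma>2 h" if g: "g \<in> carrier G" and h: "h \<in> carrier G" for g h
    by (rule eq_matI, subst \<sigma>2_def, subst mult[OF g h])
      (use cl[of g] cl[of h] cl[of "g \<otimes>\<^bsub>G\<^esub> h"] in \<open>auto simp del: index_mult_mat(1)\<close>)
  have o: "\<sigma>1 \<one>\<^bsub>G\<^esub> = 1\<^sub>m k" "\<sigma>2 \<one>\<^bsub>G\<^esub> = 1\<^sub>m l"
    unfolding \<sigma>1_def \<sigma>2_def T1 n by (intro eq_matI; simp)+
  have r: "mrep G k \<sigma>1" "mrep G l \<sigma>2"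
    unfolding mrep_def using cl m1 m2 o by auto
  have fin: "\<forall>g\<in>carrier G. B g \<in> carrier_mat k l \<and> Q * \<sigma> g * P = four_block_mat (\<sigma>1 g) (B g) (0\<^sub>m l k) (\<sigma>2 g)"
    using cl F by (auto simp: \<tau>_def)
  show ?thesis
    by (rule exI[of _ k], rule exI[of _ l], rule exI[of _ P], rule exI[of _ Q], rule exI[of _ \<sigma>1],
       rule exI[of _ \<sigma>2], rule exI[of _ B], intro conjI n P Q PQ PW r fin)
qed

text \<open>With S the carrier and square matrices this is the image of the group algebra element f.
  The rectangular shape covers the off-diagonal block, and S a subgroup gives the sum over that
  subgroup in the averaging argument.\<close>

definition mat_comb :: "'g set \<Rightarrow> nat \<Rightarrow> nat \<Rightarrow> ('g \<Rightarrow> 'a::field mat) \<Rightarrow> ('g \<Rightarrow> 'a) \<Rightarrow> 'a mat" where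
  "mat_comb S nr nc F f = mat nr nc (\<lambda>(i, j). \<Sum>g\<in>S. f g * F g $$ (i, j))"

lemma mat_comb_carrier [simp]: "mat_comb S nr nc F f \<in> carrier_mat nr nc"
  and dim_mat_comb [simp]: "dim_row (mat_comb S nr nc F f) = nr" "dim_col (mat_comb S nr nc F f) = nc"
  by (auto simp: mat_comb_def)

lemma index_mat_comb [simp]:
  "i < nr \<Longrightarrow> j < nc \<Longrightarrow> mat_comb S nr nc F f $$ (i, j) = (\<Sum>g\<in>S. f g * F g $$ (i, j))"
  by (simp add: mat_comb_def)

lemma mat_comb_cong:
  "(\<And>g. g \<in> S \<Longrightarrow> F g = F' g) \<Longrightarrow> (\<And>g. g \<in> S \<Longrightarrow> f g = f' g) \<Longrightarrow> mat_comb S nr nc F f = mat_comb S nr nc F' f'"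
  by (auto simp: mat_comb_def intro!: eq_matI sum.cong)

lemma mult_mat_comb:
  assumes "M \<in> carrier_mat nr n" "\<And>g. g \<in> S \<Longrightarrow> F g \<in> carrier_mat n nc"
  shows "M * mat_comb S n nc F f = mat_comb S nr nc (\<lambda>g. M * F g) f"
proof (rule eq_matI)
  fix i j assume "i < dim_row (mat_comb S nr nc (\<lambda>g. M * F g) f)" "j < dim_col (mat_comb S nr nc (\<lambda>g. M * F g) f)"
  then have ij: "i < nr" "j < nc" by auto
  have "(M * mat_comb S n nc F f) $$ (i, j) = (\<Sum>c<n. M $$ (i, c) * (\<Sum>g\<in>S. f g * F g $$ (c, j)))"
    using assms(1) ij by (simp add: scalar_prod_def atLeast0LessThan)
  also have "\<dots> = (\<Sum>g\<in>S. f g * (\<Sum>c<n. M $$ (i, c) * F g $$ (c, j)))"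
    unfolding sum_distrib_left by (subst sum.swap) (simp add: ac_simps)
  also have "\<dots> = (\<Sum>g\<in>S. f g * (M * F g) $$ (i, j))"
  proof (rule sum.cong[OF refl])
    fix g assume "g \<in> S"
    from assms(2)[OF this] show "f g * (\<Sum>c<n. M $$ (i, c) * F g $$ (c, j)) = f g * (M * F g) $$ (i, j)"
      using assms(1) ij by (simp add: scalar_prod_def atLeast0LessThan)
  qed
  finally show "(M * mat_comb S n nc F f) $$ (i, j) = mat_comb S nr nc (\<lambda>g. M * F g) f $$ (i, j)"
    using ij by simp
qed (use assms in auto)

lemma mat_comb_mult:
  assumes "M \<in> carrier_mat n nc" "\<And>g. g \<in> S \<Longrightarrow> F g \<in> carrier_mat nr n"
  shows "mat_comb S nr n F f * M = mat_comb S nr nc (\<lambda>g. F g * M) f"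
proof (rule eq_matI)
  fix i j assume "i < dim_row (mat_comb S nr nc (\<lambda>g. F g * M) f)" "j < dim_col (mat_comb S nr nc (\<lambda>g. F g * M) f)"
  then have ij: "i < nr" "j < nc" by auto
  have "(mat_comb S nr n F f * M) $$ (i, j) = (\<Sum>c<n. (\<Sum>g\<in>S. f g * F g $$ (i, c)) * M $$ (c, j))"
    using assms(1) ij by (simp add: scalar_prod_def atLeast0LessThan)
  also have "\<dots> = (\<Sum>g\<in>S. f g * (\<Sum>c<n. F g $$ (i, c) * M $$ (c, j)))"
    unfolding sum_distrib_left sum_distrib_right by (subst sum.swap) (simp add: ac_simps)
  also have "\<dots> = (\<Sum>g\<in>S. f g * (F g * M) $$ (i, j))"
  proof (rule sum.cong[OF refl])
    fix g assume "g \<in> S"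
    from assms(2)[OF this] show "f g * (\<Sum>c<n. F g $$ (i, c) * M $$ (c, j)) = f g * (F g * M) $$ (i, j)"
      using assms(1) ij by (simp add: scalar_prod_def atLeast0LessThan)
  qed
  finally show "(mat_comb S nr n F f * M) $$ (i, j) = mat_comb S nr nc (\<lambda>g. F g * M) f $$ (i, j)"
    using ij by simp
qed (use assms in auto)

lemma mat_comb_four_block:
  assumes "\<And>g. g \<in> S \<Longrightarrow> A g \<in> carrier_mat n1 n1" "\<And>g. g \<in> S \<Longrightarrow> B g \<in> carrier_mat n1 n2" "\<And>g. g \<in> S \<Longrightarrow> D g \<in> carrier_mat n2 n2"
  shows "mat_comb S (n1 + n2) (n1 + n2) (\<lambda>g. four_block_mat (A g) (B g) (0\<^sub>m n2 n1) (D g)) f =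
    four_block_mat (mat_comb S n1 n1 A f) (mat_comb S n1 n2 B f) (0\<^sub>m n2 n1) (mat_comb S n2 n2 D f)" (is "?l = ?r")
proof (rule eq_matI)
  fix i j assume "i < dim_row ?r" "j < dim_col ?r"
  then have ij: "i < n1 + n2" "j < n1 + n2" by auto
  have "?l $$ (i, j) = (\<Sum>g\<in>S. f g * (if i < n1 then if j < n1 then A g $$ (i, j) else B g $$ (i, j - n1)
      else if j < n1 then 0 else D g $$ (i - n1, j - n1)))"
    unfolding index_mat_comb[OF ij]
  proof (rule sum.cong[OF refl])
    fix g assume "g \<in> S"
    from assms(1)[OF this] assms(2)[OF this] assms(3)[OF this]
    show "f g * four_block_mat (A g) (B g) (0\<^sub>m n2 n1) (D g) $$ (i, j) = f g * (if i < n1 then if j < n1 then A g $$ (i, j) else B g $$ (i, j - n1)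
      else if j < n1 then 0 else D g $$ (i - n1, j - n1))" using ij by auto
  qed
  then show "?l $$ (i, j) = ?r $$ (i, j)" using ij by auto
qed auto

lemma pow_mat_add:
  assumes "(A :: 'a::field mat) \<in> carrier_mat n n"
  shows "A ^\<^sub>m (a + b) = A ^\<^sub>m a * A ^\<^sub>m b"
proof (induction b)
  case (Suc b)
  then show ?case using assms by (simp add: assoc_mult_mat[of _ n n _ n _ n] pow_carrier_mat)
qed (use assms in \<open>simp add: pow_carrier_mat\<close>)

lemma block_pow:
  fixes A :: "'a::field mat"
  assumes A: "A \<in> carrier_mat n1 n1" and B: "B \<in> carrier_mat n1 n2" and D: "D \<in> carrier_mat n2 n2"
  shows "\<exists>B'. B' \<in> carrier_mat n1 n2 \<and>
    four_block_mat A B (0\<^sub>m n2 n1) D ^\<^sub>m N = four_block_mat (A ^\<^sub>m N) B' (0\<^sub>m n2 n1) (D ^\<^sub>m N)"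
proof (induction N)
  case 0
  show ?case by (rule exI[of _ "0\<^sub>m n1 n2"]) (use assms in \<open>auto simp: four_block_one_mat\<close>)
next
  case (Suc N)
  then obtain B' where B': "B' \<in> carrier_mat n1 n2"
    "four_block_mat A B (0\<^sub>m n2 n1) D ^\<^sub>m N = four_block_mat (A ^\<^sub>m N) B' (0\<^sub>m n2 n1) (D ^\<^sub>m N)" by blast
  have c: "A ^\<^sub>m N \<in> carrier_mat n1 n1" "D ^\<^sub>m N \<in> carrier_mat n2 n2" using A D by (auto simp: pow_carrier_mat)
  show ?case
    by (rule exI[of _ "A ^\<^sub>m N * B + B' * D"], simp only: pow_mat.simps B'(2), subst mult_four_block_mat[of _ n1 n1 _ n2 _ n2 _ _ n1 _ n2])
      (use A B D B'(1) c in \<open>auto simp: right_add_zero_mat[of _ n1 n1]\<close>)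
qed

text \<open>The power a has zero first block column and the power d has zero second block row, so
  their product vanishes.\<close>

lemma block_nilpotent:
  fixes A :: "'a::field mat"
  assumes A: "A \<in> carrier_mat n1 n1" and B: "B \<in> carrier_mat n1 n2" and D: "D \<in> carrier_mat n2 n2"
    and nil: "A ^\<^sub>m a = 0\<^sub>m n1 n1" "D ^\<^sub>m d = 0\<^sub>m n2 n2"
  shows "four_block_mat A B (0\<^sub>m n2 n1) D ^\<^sub>m (a + d) = 0\<^sub>m (n1 + n2) (n1 + n2)"
proof -
  have F: "four_block_mat A B (0\<^sub>m n2 n1) D \<in> carrier_mat (n1 + n2) (n1 + n2)" using A D by simp
  obtain B1 where B1: "B1 \<in> carrier_mat n1 n2"
    "four_block_mat A B (0\<^sub>m n2 n1) D ^\<^sub>m a = four_block_mat (0\<^sub>m n1 n1) B1 (0\<^sub>m n2 n1) (D ^\<^sub>m a)"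
    using block_pow[OF A B D, of a] nil by auto
  obtain B2 where B2: "B2 \<in> carrier_mat n1 n2"
    "four_block_mat A B (0\<^sub>m n2 n1) D ^\<^sub>m d = four_block_mat (A ^\<^sub>m d) B2 (0\<^sub>m n2 n1) (0\<^sub>m n2 n2)"
    using block_pow[OF A B D, of d] nil by auto
  have c: "A ^\<^sub>m d \<in> carrier_mat n1 n1" "D ^\<^sub>m a \<in> carrier_mat n2 n2" using A D by (auto simp: pow_carrier_mat)
  show ?thesis
    unfolding pow_mat_add[OF F] B1(2) B2(2)
    by (subst mult_four_block_mat[of _ n1 n1 _ n2 _ n2 _ _ n1 _ n2])
      (use B1(1) B2(1) c in \<open>auto simp: left_mult_zero_mat[of _ n1 n1] right_mult_zero_mat[of _ n2 n2] left_mult_zero_mat[of _ n1]\<close>)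
qed

section \<open>The action of the group algebra, with coefficients in the algebraic closure\<close>

abbreviation alg :: "('g, 'm) monoid_scheme \<Rightarrow> nat \<Rightarrow> ('g \<Rightarrow> 'a::field mat) \<Rightarrow> ('g \<Rightarrow> 'a) \<Rightarrow> 'a mat" where
  "alg G n \<equiv> mat_comb (carrier G) n n"

definition irrep :: "('g, 'm) monoid_scheme \<Rightarrow> nat \<Rightarrow> ('g \<Rightarrow> 'a::field mat) \<Rightarrow> bool" where
  "irrep G n \<rho> \<longleftrightarrow> 0 < n \<and> mrep G n \<rho> \<and> (\<forall>U. subrepresentation G n \<rho> U \<longrightarrow> U = {0\<^sub>v n} \<or> U = carrier_vec n)"

text \<open>Scalars are extended only in order to evaluate f; irreducibility keeps referring to the
  smaller field.\<close>

abbreviation ac_mat :: "('g \<Rightarrow> 'a::field mat) \<Rightarrow> 'g \<Rightarrow> 'a alg_closure mat" where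
  "ac_mat \<rho> \<equiv> \<lambda>g. map_mat to_ac (\<rho> g)"

interpretation to_ac: inj_comm_ring_hom "to_ac :: 'a::field \<Rightarrow> 'a alg_closure"
  by unfold_locales (auto simp: to_ac_eq_iff)

lemma map_mat_zero: "map_mat to_ac (0\<^sub>m nr nc) = 0\<^sub>m nr nc"
  by (rule eq_matI) auto

lemma mrep_ac_mat: "mrep G n \<rho> \<Longrightarrow> mrep G n (ac_mat \<rho>)"
  unfolding mrep_def by (auto simp: to_ac.mat_hom_one to_ac.mat_hom_mult[of _ n n _ n])

lemma alg_four_block_conj:
  assumes m: "mrep G (n1 + n2) \<rho>" "mrep G n1 \<rho>1" "mrep G n2 \<rho>2"
    and PQ: "P \<in> carrier_mat (n1 + n2) (n1 + n2)" "Q \<in> carrier_mat (n1 + n2) (n1 + n2)" "Q * P = 1\<^sub>m (n1 + n2)" "P * Q = 1\<^sub>m (n1 + n2)"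
    and B: "\<And>g. g \<in> carrier G \<Longrightarrow> B g \<in> carrier_mat n1 n2"
    and eq: "\<And>g. g \<in> carrier G \<Longrightarrow> Q * \<rho> g * P = four_block_mat (\<rho>1 g) (B g) (0\<^sub>m n2 n1) (\<rho>2 g)"
  shows "similar_mat_wit (alg G (n1 + n2) \<rho> f)
    (four_block_mat (alg G n1 \<rho>1 f) (mat_comb (carrier G) n1 n2 B f) (0\<^sub>m n2 n1) (alg G n2 \<rho>2 f)) P Q"
proof -
  let ?n = "n1 + n2" and ?A = "alg G (n1 + n2) \<rho> f"
  have "Q * ?A * P = alg G ?n (\<lambda>g. Q * \<rho> g * P) f"
    using PQ mrepD(1)[OF m(1)] by (subst mult_mat_comb[of Q ?n ?n], simp_all, subst mat_comb_mult[of P ?n ?n]) auto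
  also have "\<dots> = alg G ?n (\<lambda>g. four_block_mat (\<rho>1 g) (B g) (0\<^sub>m n2 n1) (\<rho>2 g)) f"
    by (rule mat_comb_cong) (use eq in auto)
  also have "\<dots> = four_block_mat (alg G n1 \<rho>1 f) (mat_comb (carrier G) n1 n2 B f) (0\<^sub>m n2 n1) (alg G n2 \<rho>2 f)" (is "_ = ?F")
    by (rule mat_comb_four_block) (use mrepD(1) m B in auto)
  finally have e: "Q * ?A * P = ?F" .
  have "P * ?F * Q = P * (Q * ?A * P) * Q" unfolding e ..
  also have "\<dots> = ?A" using PQ by (intro conj_cancel_mat) auto
  finally have "?A = P * ?F * Q" by simp
  then show ?thesis unfolding similar_mat_wit_def Let_def using PQ by auto
qed

text \<open>In a reducible representation f acts block triangularly, and nilpotency on both diagonal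
  blocks would make it nilpotent on the whole; so one block of smaller dimension inherits the
  hypothesis. The blocks come from a subrepresentation over \<open>'k\<close>, hence the irreducible
  representation found is defined over \<open>'k\<close>.\<close>

lemma irrep_from_nonnilpotent:
  fixes \<rho> :: "'g \<Rightarrow> 'k::field mat"
  assumes G: "group G"
  shows "mrep G n \<rho> \<Longrightarrow> (\<And>N. alg G n (ac_mat \<rho>) f ^\<^sub>m N \<noteq> 0\<^sub>m n n) \<Longrightarrow>
    \<exists>n' (\<rho>' :: 'g \<Rightarrow> 'k mat). irrep G n' \<rho>' \<and> alg G n' (ac_mat \<rho>') f \<noteq> 0\<^sub>m n' n'"
proof (induction n arbitrary: \<rho> rule: less_induct)
  case (less n)
  have n0: "0 < n"
  proof (rule ccontr)
    assume "\<not> 0 < n"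
    then have "n = 0" by simp
    \<comment> \<open>In dimension 0 the identity matrix, as the power with exponent 0, is the zero
      matrix.\<close>
    then have "alg G n (ac_mat \<rho>) f ^\<^sub>m 0 = 0\<^sub>m n n" by (intro eq_matI) auto
    then show False using less.prems(2) by blast
  qed
  show ?case
  proof (cases "irrep G n \<rho>")
    case True
    have "alg G n (ac_mat \<rho>) f \<noteq> 0\<^sub>m n n"
      using less.prems(2)[of 1] by (auto simp: left_mult_one_mat[of _ n n])
    then show ?thesis using True by blast
  next
    case False
    then obtain U where U: "subrepresentation G n \<rho> U" "U \<noteq> {0\<^sub>v n}" "U \<noteq> carrier_vec n"
      using n0 less.prems(1) by (auto simp: irrep_def)
    have lU: "lin_subspace n U" using U(1) by (simp add: subrepresentation_iff)
    from subrepresentation_block[OF G less.prems(1) U(1)] obtain n1 n2 P Q \<rho>1 \<rho>2 B where n: "n = n1 + n2"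
      and P: "P \<in> carrier_mat n n" and Q: "Q \<in> carrier_mat n n" and PQ: "P * Q = 1\<^sub>m n" "Q * P = 1\<^sub>m n"
      and PU: "\<forall>v\<in>carrier_vec n. P *\<^sub>v v \<in> U \<longleftrightarrow> (\<forall>i<n. n1 \<le> i \<longrightarrow> v $ i = 0)"
      and r: "mrep G n1 \<rho>1" "mrep G n2 \<rho>2"
      and B: "\<forall>g\<in>carrier G. B g \<in> carrier_mat n1 n2 \<and> Q * \<rho> g * P = four_block_mat (\<rho>1 g) (B g) (0\<^sub>m n2 n1) (\<rho>2 g)"
      by blast
    have "n1 \<noteq> n" "n1 \<noteq> 0"
      using coordinate_subspace_proper[OF lU P Q PQ(1) PU] U(2,3) by auto
    have "similar_mat_wit (alg G (n1 + n2) (ac_mat \<rho>) f)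
      (four_block_mat (alg G n1 (ac_mat \<rho>1) f) (mat_comb (carrier G) n1 n2 (ac_mat B) f) (0\<^sub>m n2 n1) (alg G n2 (ac_mat \<rho>2) f))
       (map_mat to_ac P) (map_mat to_ac Q)"
    proof (rule alg_four_block_conj)
      show "map_mat to_ac Q * map_mat to_ac P = 1\<^sub>m (n1 + n2)" "map_mat to_ac P * map_mat to_ac Q = 1\<^sub>m (n1 + n2)"
        using P Q PQ unfolding n by (metis to_ac.mat_hom_mult to_ac.mat_hom_one)+
      fix g assume g: "g \<in> carrier G"
      have "map_mat to_ac Q * map_mat to_ac (\<rho> g) * map_mat to_ac P = map_mat to_ac (Q * \<rho> g * P)"
        using P Q mrepD(1)[OF less.prems(1) g] by (simp add: to_ac.mat_hom_mult[of _ n n _ n])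
      also have "\<dots> = four_block_mat (map_mat to_ac (\<rho>1 g)) (map_mat to_ac (B g)) (0\<^sub>m n2 n1) (map_mat to_ac (\<rho>2 g))"
        using B g mrepD(1)[OF r(1) g] mrepD(1)[OF r(2) g]
        by (simp add: map_four_block_mat[of _ n1 n1 _ n2 _ n2] map_mat_zero)
      finally show "map_mat to_ac Q * map_mat to_ac (\<rho> g) * map_mat to_ac P = \<dots>" .
    qed (use P Q B n r less.prems(1) in \<open>auto intro: mrep_ac_mat\<close>)
    note sim = this[folded n]
    have "\<exists>n' \<rho>'. n' < n \<and> mrep G n' \<rho>' \<and> (\<forall>N. alg G n' (ac_mat (\<rho>' :: 'g \<Rightarrow> 'k mat)) f ^\<^sub>m N \<noteq> 0\<^sub>m n' n')"
    proof (rule ccontr)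
      assume no: "\<not> ?thesis"
      obtain a where a: "alg G n1 (ac_mat \<rho>1) f ^\<^sub>m a = 0\<^sub>m n1 n1" using no r(1) \<open>n1 \<noteq> n\<close> n by (metis le_add1 le_neq_implies_less)
      obtain d where d: "alg G n2 (ac_mat \<rho>2) f ^\<^sub>m d = 0\<^sub>m n2 n2" using no r(2) \<open>n1 \<noteq> 0\<close> n by (metis add_cancel_left_left le_add2 le_neq_implies_less)
      have "alg G n (ac_mat \<rho>) f ^\<^sub>m (a + d) = map_mat to_ac P * 0\<^sub>m n n * map_mat to_ac Q"
        using similar_mat_wit_pow_id[OF sim, of "a + d"] block_nilpotent[OF _ _ _ a d, of "mat_comb (carrier G) n1 n2 (ac_mat B) f"]
        by (simp add: n)
      also have "\<dots> = 0\<^sub>m n n" using P Q by simp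
      finally show False using less.prems(2) by blast
    qed
    then show ?thesis using less.IH by blast
  qed
qed

section \<open>Nilpotency in the group algebra\<close>

definition conv :: "('g, 'm) monoid_scheme \<Rightarrow> ('g \<Rightarrow> 'a::field) \<Rightarrow> ('g \<Rightarrow> 'a) \<Rightarrow> 'g \<Rightarrow> 'a" where
  "conv G f h = (\<lambda>x. if x \<in> carrier G then \<Sum>y\<in>carrier G. f y * h (inv\<^bsub>G\<^esub> y \<otimes>\<^bsub>G\<^esub> x) else 0)"

text \<open>\<open>cpow G f k\<close> is the power of \<open>f\<close> with exponent \<open>k + 1\<close>; this avoids the unit of the group algebra.\<close>

primrec cpow :: "('g, 'm) monoid_scheme \<Rightarrow> ('g \<Rightarrow> 'a::field) \<Rightarrow> nat \<Rightarrow> 'g \<Rightarrow> 'a" where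
  "cpow G f 0 = f"
| "cpow G f (Suc N) = conv G f (cpow G f N)"

definition nonnilp :: "('g, 'm) monoid_scheme \<Rightarrow> ('g \<Rightarrow> 'a::field) \<Rightarrow> bool" where
  "nonnilp G f \<longleftrightarrow> (\<forall>N. \<exists>x\<in>carrier G. cpow G f N x \<noteq> 0)"

lemma (in group) sum_translate:
  assumes "z \<in> carrier G"
  shows "(\<Sum>y\<in>carrier G. F (z \<otimes> y)) = (\<Sum>y\<in>carrier G. F y)"
  by (rule sum.reindex_bij_witness[of _ "\<lambda>w. inv z \<otimes> w" "\<lambda>y. z \<otimes> y"])
    (use assms in \<open>auto simp: m_assoc[symmetric]\<close>)

lemma mrep_mult_alg:
  fixes G (structure)
  assumes G: "group G" and m: "mrep G n \<sigma>" and x: "x \<in> carrier G"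
  shows "\<sigma> x * alg G n \<sigma> f = alg G n \<sigma> (\<lambda>z. f (inv\<^bsub>G\<^esub> x \<otimes>\<^bsub>G\<^esub> z))"
proof -
  interpret group G by fact
  have "\<sigma> x * alg G n \<sigma> f = alg G n (\<lambda>g. \<sigma> x * \<sigma> g) f"
    by (rule mult_mat_comb) (use mrepD(1)[OF m] x in auto)
  also have "\<dots> = alg G n \<sigma> (\<lambda>z. f (inv\<^bsub>G\<^esub> x \<otimes>\<^bsub>G\<^esub> z))"
  proof (rule eq_matI)
    fix i j assume "i < dim_row (alg G n \<sigma> (\<lambda>z. f (inv\<^bsub>G\<^esub> x \<otimes>\<^bsub>G\<^esub> z)))" "j < dim_col (alg G n \<sigma> (\<lambda>z. f (inv\<^bsub>G\<^esub> x \<otimes>\<^bsub>G\<^esub> z)))"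
    then have ij: "i < n" "j < n" by auto
    have "(\<Sum>g\<in>carrier G. f g * (\<sigma> x * \<sigma> g) $$ (i, j)) =
        (\<Sum>g\<in>carrier G. f (inv x \<otimes> (x \<otimes> g)) * \<sigma> (x \<otimes> g) $$ (i, j))"
      by (rule sum.cong) (use x mrepD(2)[OF m] in \<open>auto simp: m_assoc[symmetric]\<close>)
    also have "\<dots> = (\<Sum>g\<in>carrier G. f (inv x \<otimes> g) * \<sigma> g $$ (i, j))"
      by (rule sum_translate[OF x])
    finally show "alg G n (\<lambda>g. \<sigma> x * \<sigma> g) f $$ (i, j) = alg G n \<sigma> (\<lambda>z. f (inv\<^bsub>G\<^esub> x \<otimes>\<^bsub>G\<^esub> z)) $$ (i, j)"
      using ij by simp
  qed auto
  finally show ?thesis .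
qed

text \<open>Expand the left factor and absorb each \<open>\<sigma> g\<close> into the right one by
  translating the coefficients.\<close>

lemma alg_conv:
  assumes G: "group G" and m: "mrep G n \<sigma>"
  shows "alg G n \<sigma> (conv G f h) = alg G n \<sigma> f * alg G n \<sigma> h"
proof -
  have "alg G n \<sigma> f * alg G n \<sigma> h = alg G n (\<lambda>g. \<sigma> g * alg G n \<sigma> h) f"
    by (rule mat_comb_mult) (use mrepD(1)[OF m] in auto)
  also have "\<dots> = alg G n (\<lambda>g. alg G n \<sigma> (\<lambda>z. h (inv\<^bsub>G\<^esub> g \<otimes>\<^bsub>G\<^esub> z))) f"
    by (rule mat_comb_cong) (use mrep_mult_alg[OF G m] in auto)
  also have "\<dots> = alg G n \<sigma> (conv G f h)"
  proof (rule eq_matI)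
    fix i j assume "i < dim_row (alg G n \<sigma> (conv G f h))" "j < dim_col (alg G n \<sigma> (conv G f h))"
    then have ij: "i < n" "j < n" by auto
    have "(\<Sum>g\<in>carrier G. f g * (\<Sum>x\<in>carrier G. h (inv\<^bsub>G\<^esub> g \<otimes>\<^bsub>G\<^esub> x) * \<sigma> x $$ (i, j))) =
        (\<Sum>x\<in>carrier G. (\<Sum>g\<in>carrier G. f g * h (inv\<^bsub>G\<^esub> g \<otimes>\<^bsub>G\<^esub> x)) * \<sigma> x $$ (i, j))"
      unfolding sum_distrib_left sum_distrib_right by (subst sum.swap) (simp add: ac_simps)
    then show "alg G n (\<lambda>g. alg G n \<sigma> (\<lambda>z. h (inv\<^bsub>G\<^esub> g \<otimes>\<^bsub>G\<^esub> z))) f $$ (i, j) = alg G n \<sigma> (conv G f h) $$ (i, j)"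
      using ij by (simp add: conv_def)
  qed auto
  finally show ?thesis by simp
qed

lemma alg_cpow:
  assumes G: "group G" and m: "mrep G n \<sigma>"
  shows "alg G n \<sigma> (cpow G f N) = alg G n \<sigma> f ^\<^sub>m Suc N"
proof (induction N)
  case 0
  show ?case by (simp add: left_mult_one_mat[of _ n n])
next
  case (Suc N)
  have "alg G n \<sigma> (cpow G f (Suc N)) = alg G n \<sigma> f ^\<^sub>m 1 * alg G n \<sigma> f ^\<^sub>m Suc N"
    using Suc by (simp add: alg_conv[OF G m] left_mult_one_mat[of _ n n])
  also have "\<dots> = alg G n \<sigma> f ^\<^sub>m (1 + Suc N)" by (rule pow_mat_add[symmetric]) auto
  finally show ?case by simp
qed

lemma alg_zero: "(\<And>x. x \<in> carrier G \<Longrightarrow> f x = 0) \<Longrightarrow> alg G n \<sigma> f = 0\<^sub>m n n"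
  by (auto intro!: eq_matI)

lemma mult_mat_zero_vec: "A \<in> carrier_mat nr nc \<Longrightarrow> A *\<^sub>v 0\<^sub>v nc = (0\<^sub>v nr :: 'a::field vec)"
  by (auto intro!: eq_vecI)

lemma zero_mat_mult_vec: "v \<in> carrier_vec nc \<Longrightarrow> 0\<^sub>m nr nc *\<^sub>v v = (0\<^sub>v nr :: 'a::field vec)"
  by (auto intro!: eq_vecI)

lemma mat_pow_fixed_vec:
  assumes "(A :: 'a::field mat) \<in> carrier_mat n n" "v \<in> carrier_vec n" "A *\<^sub>v v = v"
  shows "A ^\<^sub>m N *\<^sub>v v = v"
proof (induction N)
  case (Suc N)
  then show ?case using assms assoc_mult_mat_vec[of "A ^\<^sub>m N" n n A n v] by (simp add: pow_carrier_mat)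
qed (use assms in simp)

text \<open>Every power of the image fixes v, so none is zero; as \<open>alg\<close> is
  multiplicative, no power of f is zero either.\<close>

lemma nonnilp_if_fixes_vec:
  assumes G: "group G" and m: "mrep G n \<sigma>" and v: "v \<in> carrier_vec n" "v \<noteq> 0\<^sub>v n" "alg G n \<sigma> f *\<^sub>v v = v"
  shows "nonnilp G f"
  unfolding nonnilp_def
proof (rule allI, rule ccontr)
  fix N assume "\<not> (\<exists>x\<in>carrier G. cpow G f N x \<noteq> 0)"
  then have "alg G n \<sigma> (cpow G f N) = 0\<^sub>m n n" by (intro alg_zero) auto
  then have "alg G n \<sigma> f ^\<^sub>m Suc N = 0\<^sub>m n n" using alg_cpow[OF G m] by metis
  moreover have "alg G n \<sigma> f ^\<^sub>m Suc N *\<^sub>v v = v" by (rule mat_pow_fixed_vec) (use v in auto)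
  ultimately show False using v zero_mat_mult_vec[OF v(1), of n] by metis
qed

text \<open>These are the permutation matrices of left translation. The entry in row x and in the
  column of the neutral element is f x, so no nonzero f acts as zero, even with coefficients in the
  closure.\<close>

lemma regular_representation:
  fixes G (structure)
  assumes G: "group G" and fin: "finite (carrier G)"
  shows "\<exists>n (\<rho> :: 'g \<Rightarrow> 'k::field mat). mrep G n \<rho> \<and>
    (\<forall>f :: 'g \<Rightarrow> 'k alg_closure. (\<exists>x\<in>carrier G. f x \<noteq> 0) \<longrightarrow> alg G n (ac_mat \<rho>) f \<noteq> 0\<^sub>m n n)"
proof -
  interpret group G by fact
  define n where "n = card (carrier G)"
  obtain e where e: "bij_betw e {0..<n} (carrier G)"
    using ex_bij_betw_nat_finite[OF fin] by (auto simp: n_def)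
  have ec: "e i \<in> carrier G" if "i < n" for i using e that by (auto simp: bij_betw_def)
  have ei: "e i = e j \<longleftrightarrow> i = j" if "i < n" "j < n" for i j
    using e that by (auto simp: bij_betw_def inj_on_def)
  have es: "\<exists>i<n. e i = x" if "x \<in> carrier G" for x
    using e that unfolding bij_betw_def by (metis atLeastLessThan_iff imageE)
  define \<rho> :: "'g \<Rightarrow> 'k mat" where "\<rho> g = mat n n (\<lambda>(i, j). if e i = g \<otimes>\<^bsub>G\<^esub> e j then 1 else 0)" for g
  have "mrep G n \<rho>"
    unfolding mrep_def
  proof (intro conjI ballI)
    fix g h assume g: "g \<in> carrier G" and h: "h \<in> carrier G"
    show "\<rho> (g \<otimes>\<^bsub>G\<^esub> h) = \<rho> g * \<rho> h"
    proof (rule eq_matI)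
      fix i j assume "i < dim_row (\<rho> g * \<rho> h)" "j < dim_col (\<rho> g * \<rho> h)"
      then have ij: "i < n" "j < n" by (auto simp: \<rho>_def)
      obtain c where c: "c < n" "e c = h \<otimes> e j" using es[of "h \<otimes> e j"] h ec ij by auto
      have "(\<rho> g * \<rho> h) $$ (i, j) = (\<Sum>d<n. (if e i = g \<otimes> e d then 1 else 0) * (if e d = h \<otimes> e j then 1 else 0))"
        using ij by (simp add: \<rho>_def scalar_prod_def atLeast0LessThan)
      also have "\<dots> = (\<Sum>d<n. if d = c then (if e i = g \<otimes> e d then 1 else 0) else 0)"
        by (rule sum.cong) (use c ei[of _ c] in auto)
      also have "\<dots> = (if e i = g \<otimes> (h \<otimes> e j) then 1 else 0)" using c by simp
      finally show "\<rho> (g \<otimes>\<^bsub>G\<^esub> h) $$ (i, j) = (\<rho> g * \<rho> h) $$ (i, j)"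
        using ij g h ec by (simp add: \<rho>_def m_assoc)
    qed (auto simp: \<rho>_def)
  next
    show "\<rho> \<one>\<^bsub>G\<^esub> = 1\<^sub>m n" by (rule eq_matI) (auto simp: \<rho>_def ec ei)
  qed (simp add: \<rho>_def)
  moreover have "alg G n (ac_mat \<rho>) f \<noteq> 0\<^sub>m n n" if "\<exists>x\<in>carrier G. f x \<noteq> 0" for f :: "'g \<Rightarrow> 'k alg_closure"
  proof -
    from that obtain x where x: "x \<in> carrier G" "f x \<noteq> 0" by blast
    obtain i where i: "i < n" "e i = x" using es[OF x(1)] by blast
    obtain j where j: "j < n" "e j = \<one>" using es[of \<one>] by blast
    have "alg G n (ac_mat \<rho>) f $$ (i, j) = (\<Sum>g\<in>carrier G. if g = x then f g else 0)"
      unfolding index_mat_comb[OF i(1) j(1)] by (rule sum.cong) (use i j in \<open>auto simp: \<rho>_def\<close>)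
    then have "alg G n (ac_mat \<rho>) f $$ (i, j) = f x" using fin x by simp
    then show ?thesis using x(2) i(1) j(1) by (metis index_zero_mat(1))
  qed
  ultimately show ?thesis by blast
qed

text \<open>The powers of f are nonzero functions, hence act as nonzero matrices on the regular
  representation, so that f is not nilpotent there.\<close>

lemma irrep_nonzero_on_nonnilp:
  fixes f :: "'g \<Rightarrow> 'k::field alg_closure"
  assumes G: "group G" and fin: "finite (carrier G)" and f: "nonnilp G f"
  shows "\<exists>n (\<rho> :: 'g \<Rightarrow> 'k mat). irrep G n \<rho> \<and> alg G n (ac_mat \<rho>) f \<noteq> 0\<^sub>m n n"
proof -
  obtain n and \<rho> :: "'g \<Rightarrow> 'k mat" where m: "mrep G n \<rho>" and
    nz: "\<And>f :: 'g \<Rightarrow> 'k alg_closure. \<exists>x\<in>carrier G. f x \<noteq> 0 \<Longrightarrow> alg G n (ac_mat \<rho>) f \<noteq> 0\<^sub>m n n"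
    using regular_representation[OF G fin] by blast
  show ?thesis
  proof (rule irrep_from_nonnilpotent[OF G m])
    fix N
    \<comment> \<open>\<open>cpow\<close> only describes powers with positive exponent; exponent N
      follows, since a vanishing power makes the next one vanish.\<close>
    have s: "alg G n (ac_mat \<rho>) f ^\<^sub>m Suc N \<noteq> 0\<^sub>m n n"
      unfolding alg_cpow[OF G mrep_ac_mat[OF m], symmetric] using f by (intro nz) (auto simp: nonnilp_def)
    show "alg G n (ac_mat \<rho>) f ^\<^sub>m N \<noteq> 0\<^sub>m n n"
    proof
      assume "alg G n (ac_mat \<rho>) f ^\<^sub>m N = 0\<^sub>m n n"
      then show False using s by (simp add: left_mult_zero_mat[of _ n n])
    qed
  qed
qed

text \<open>Needed to see that a nonzero value of a power of f is attained inside H.\<close>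

lemma cpow_supported:
  fixes G (structure)
  assumes "group G" "subgroup H G" and f: "\<And>x. x \<in> carrier G \<Longrightarrow> x \<notin> H \<Longrightarrow> f x = 0"
  shows "x \<in> carrier G \<Longrightarrow> x \<notin> H \<Longrightarrow> cpow G f N x = 0"
proof (induction N arbitrary: x)
  case (Suc N)
  interpret group G by fact
  interpret H: subgroup H G by fact
  have "f y * cpow G f N (inv y \<otimes> x) = 0" if y: "y \<in> carrier G" for y
  proof (cases "y \<in> H")
    case True
    have "inv y \<otimes> x \<notin> H"
    proof
      assume "inv y \<otimes> x \<in> H"
      then have "y \<otimes> (inv y \<otimes> x) \<in> H" using True by simp
      then show False using Suc.prems y by (simp add: m_assoc[symmetric])
    qed
    then show ?thesis using Suc y by simp
  qed (use f y in simp)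
  then show ?case by (simp add: conv_def)
qed (use f in simp)

text \<open>H and N commute elementwise and meet trivially, so the group algebra of their product is
  a tensor product and the convolution is f tensor h. Its powers at a b are the product of the
  powers of f at a and of h at b, and a product of nonzero values in a field is nonzero.\<close>

lemma nonnilp_conv:
  fixes G (structure) and f h :: "'g \<Rightarrow> 'a::field"
  assumes G: "group G" and fin: "finite (carrier G)" and H: "H \<lhd> G" and N: "N \<lhd> G" and HN: "H \<inter> N = {\<one>\<^bsub>G\<^esub>}"
    and f: "\<And>x. x \<in> carrier G \<Longrightarrow> x \<notin> H \<Longrightarrow> f x = 0" "nonnilp G f"
    and h: "\<And>x. x \<in> carrier G \<Longrightarrow> x \<notin> N \<Longrightarrow> h x = 0" "nonnilp G h"
  shows "nonnilp G (conv G f h)"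
    and "x \<in> carrier G \<Longrightarrow> x \<notin> H <#>\<^bsub>G\<^esub> N \<Longrightarrow> conv G f h x = 0"
proof -
  interpret group G by fact
  interpret H: normal H G by fact
  interpret N: normal N G by fact
  have Hc: "a \<in> H \<Longrightarrow> a \<in> carrier G" for a using H.subset by auto
  have Nc: "a \<in> N \<Longrightarrow> a \<in> carrier G" for a using N.subset by auto
  have comm: "a \<otimes> b = b \<otimes> a" if "a \<in> H" "b \<in> N" for a b
    using normal_imp_commuting[OF H N] HN that by auto
  have inj: "a = c \<and> b = d" if "a \<in> H" "b \<in> N" "c \<in> H" "d \<in> N" "a \<otimes> b = c \<otimes> d" for a b c d
  proof -
    have "inv c \<otimes> a = inv c \<otimes> (a \<otimes> b) \<otimes> inv b" using that(1-4) Hc Nc by (simp add: m_assoc)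
    also have "\<dots> = d \<otimes> inv b" unfolding that(5) using that Hc Nc by (simp add: m_assoc[symmetric])
    finally have "inv c \<otimes> a = d \<otimes> inv b" .
    moreover have "inv c \<otimes> a \<in> H" "d \<otimes> inv b \<in> N" using that by auto
    ultimately have "inv c \<otimes> a \<in> H \<inter> N" by simp
    then have "inv c \<otimes> a = \<one>" unfolding HN by simp
    then have "a = c" using that(1,3) Hc by (metis inv_closed inv_equality inv_inv)
    then show ?thesis using that Hc Nc by simp
  qed
  have cv: "conv G f h (a \<otimes> b) = f a * h b" if a: "a \<in> H" and b: "b \<in> N" for a b
  proof -
    have "(\<Sum>y\<in>carrier G. f y * h (inv y \<otimes> (a \<otimes> b))) = (\<Sum>y\<in>carrier G. if y = a then f a * h b else 0)"
    proof (rule sum.cong[OF refl])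
      fix y assume y: "y \<in> carrier G"
      show "f y * h (inv y \<otimes> (a \<otimes> b)) = (if y = a then f a * h b else 0)"
      proof (cases "y = a")
        case True
        then show ?thesis using a b Hc Nc by (simp add: m_assoc[symmetric])
      next
        case False
        have "h (inv y \<otimes> (a \<otimes> b)) = 0" if yH: "y \<in> H"
        proof (rule h(1))
          show "inv y \<otimes> (a \<otimes> b) \<notin> N"
          proof
            assume n: "inv y \<otimes> (a \<otimes> b) \<in> N"
            have "a \<otimes> b = y \<otimes> (inv y \<otimes> (a \<otimes> b))" using y a b Hc Nc by (simp add: m_assoc[symmetric])
            from inj[OF a b yH n this] show False using False by simp
          qed
        qed (use y a b Hc Nc in auto)
        then show ?thesis using False f(1)[OF y] by auto
      qed
    qed
    then show ?thesis using fin a b Hc Nc by (simp add: conv_def)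
  qed
  show sup: "conv G f h x = 0" if x: "x \<in> carrier G" "x \<notin> H <#>\<^bsub>G\<^esub> N" for x
  proof -
    have "f y * h (inv y \<otimes> x) = 0" if y: "y \<in> carrier G" for y
    proof (cases "y \<in> H")
      case True
      have "inv y \<otimes> x \<notin> N"
      proof
        assume n: "inv y \<otimes> x \<in> N"
        have "x = y \<otimes> (inv y \<otimes> x)" using y x by (simp add: m_assoc[symmetric])
        then show False using x(2) True n unfolding set_mult_def by blast
      qed
      then show ?thesis using h(1) y x by simp
    qed (use f(1) y in simp)
    then show ?thesis by (simp add: conv_def)
  qed
  have pw: "cpow G (conv G f h) k (a \<otimes> b) = cpow G f k a * cpow G h k b" if "a \<in> H" "b \<in> N" for k a b
    using that
  proof (induction k arbitrary: a b)
    case 0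
    then show ?case using cv by simp
  next
    case (Suc k)
    note ab = Suc.prems
    let ?F = "conv G f h"
    \<comment> \<open>The convolution is supported on the product of H and N, where every element is
      c d in exactly one way; the sum over G becomes a double sum that factors.\<close>
    have "(\<Sum>y\<in>carrier G. ?F y * cpow G ?F k (inv y \<otimes> (a \<otimes> b))) = (\<Sum>y\<in>(\<lambda>(c, d). c \<otimes> d) ` (H \<times> N). ?F y * cpow G ?F k (inv y \<otimes> (a \<otimes> b)))"
    proof (rule sum.mono_neutral_right[OF fin])
      show "(\<lambda>(c, d). c \<otimes> d) ` (H \<times> N) \<subseteq> carrier G" using Hc Nc by auto
      show "\<forall>y\<in>carrier G - (\<lambda>(c, d). c \<otimes> d) ` (H \<times> N). ?F y * cpow G ?F k (inv y \<otimes> (a \<otimes> b)) = 0"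
        using sup by (auto simp: set_mult_def image_iff)
    qed
    also have "\<dots> = (\<Sum>(c, d)\<in>H \<times> N. ?F (c \<otimes> d) * cpow G ?F k (inv (c \<otimes> d) \<otimes> (a \<otimes> b)))"
      by (subst sum.reindex) (use inj in \<open>auto simp: inj_on_def case_prod_unfold\<close>)
    also have "\<dots> = (\<Sum>(c, d)\<in>H \<times> N. (f c * cpow G f k (inv c \<otimes> a)) * (h d * cpow G h k (inv d \<otimes> b)))"
    proof (rule sum.cong[OF refl], clarify)
      fix c d assume cd: "c \<in> H" "d \<in> N"
      have "inv (c \<otimes> d) \<otimes> (a \<otimes> b) = inv d \<otimes> ((inv c \<otimes> a) \<otimes> b)" using cd ab Hc Nc by (simp add: inv_mult_group m_assoc)
      also have "\<dots> = inv d \<otimes> (inv c \<otimes> a) \<otimes> b" using cd ab Hc Nc by (simp add: m_assoc)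
      also have "inv d \<otimes> (inv c \<otimes> a) = (inv c \<otimes> a) \<otimes> inv d" using comm[of "inv c \<otimes> a" "inv d"] cd ab by simp
      finally have "inv (c \<otimes> d) \<otimes> (a \<otimes> b) = (inv c \<otimes> a) \<otimes> (inv d \<otimes> b)" using cd ab Hc Nc by (simp add: m_assoc)
      then show "?F (c \<otimes> d) * cpow G ?F k (inv (c \<otimes> d) \<otimes> (a \<otimes> b)) = (f c * cpow G f k (inv c \<otimes> a)) * (h d * cpow G h k (inv d \<otimes> b))"
        using cv[OF cd] Suc.IH[of "inv c \<otimes> a" "inv d \<otimes> b"] cd ab by simp
    qed
    also have "\<dots> = (\<Sum>c\<in>H. f c * cpow G f k (inv c \<otimes> a)) * (\<Sum>d\<in>N. h d * cpow G h k (inv d \<otimes> b))"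
      by (simp add: sum_product sum.cartesian_product)
    also have "(\<Sum>c\<in>H. f c * cpow G f k (inv c \<otimes> a)) = (\<Sum>c\<in>carrier G. f c * cpow G f k (inv c \<otimes> a))"
      by (rule sum.mono_neutral_left[OF fin]) (use f H.subset in auto)
    also have "(\<Sum>d\<in>N. h d * cpow G h k (inv d \<otimes> b)) = (\<Sum>d\<in>carrier G. h d * cpow G h k (inv d \<otimes> b))"
      by (rule sum.mono_neutral_left[OF fin]) (use h N.subset in auto)
    finally show ?case using ab Hc Nc by (simp add: conv_def)
  qed
  show "nonnilp G (conv G f h)"
    unfolding nonnilp_def
  proof
    fix k
    obtain a where a: "a \<in> carrier G" "cpow G f k a \<noteq> 0" using f(2) by (auto simp: nonnilp_def)
    obtain b where b: "b \<in> carrier G" "cpow G h k b \<noteq> 0" using h(2) by (auto simp: nonnilp_def)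
    have "a \<in> H" using cpow_supported[OF G H.subgroup_axioms, of f] f(1) a by blast
    moreover have "b \<in> N" using cpow_supported[OF G N.subgroup_axioms, of h] h(1) b by blast
    ultimately show "\<exists>x\<in>carrier G. cpow G (conv G f h) k x \<noteq> 0"
      using pw a b by (intro bexI[of _ "a \<otimes> b"]) auto
  qed
qed

section \<open>Non-nilpotent elements of augmentation zero\<close>

lemma mat_comb_add:
  "mat_comb S nr nc F f + mat_comb S nr nc F h = mat_comb S nr nc F (\<lambda>x. f x + h x)"
  by (rule eq_matI) (auto simp: sum.distrib ring_distribs)

lemma mat_comb_smult:
  "c \<cdot>\<^sub>m mat_comb S nr nc F f = mat_comb S nr nc F (\<lambda>x. c * f x)"
  by (rule eq_matI) (auto simp: sum_distrib_left ac_simps)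

lemma alg_single:
  assumes "finite (carrier G)" "x \<in> carrier G" "\<sigma> x \<in> carrier_mat n n"
  shows "alg G n \<sigma> (\<lambda>g. if g = x then 1 else 0) = \<sigma> x"
  by (rule eq_matI) (use assms in \<open>auto simp: if_distrib[of "\<lambda>a. a * _"] cong: if_cong\<close>)

lemma smult_mat_mult_vec:
  assumes "A \<in> carrier_mat nr n" "v \<in> carrier_vec n"
  shows "(c \<cdot>\<^sub>m A) *\<^sub>v v = c \<cdot>\<^sub>v (A *\<^sub>v (v :: 'a::field vec))"
  using assms by (intro eq_vecI) (auto simp: scalar_prod_def sum_distrib_left ac_simps)

text \<open>The vectors \<open>P *\<^sub>v (v @\<^sub>v 0\<^sub>v n2)\<close> are those of the
  invariant subspace, on which only the first diagonal block is felt.\<close>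

lemma block_mult_append_zero:
  fixes P :: "'a::field mat"
  assumes P: "P \<in> carrier_mat (n1 + n2) (n1 + n2)" and Q: "Q \<in> carrier_mat (n1 + n2) (n1 + n2)" and PQ: "P * Q = 1\<^sub>m (n1 + n2)"
    and t: "T \<in> carrier_mat (n1 + n2) (n1 + n2)" and b: "Q * T * P = four_block_mat T1 B (0\<^sub>m n2 n1) T2"
    and c: "T1 \<in> carrier_mat n1 n1" "B \<in> carrier_mat n1 n2" "T2 \<in> carrier_mat n2 n2" and v: "v \<in> carrier_vec n1"
  shows "T *\<^sub>v (P *\<^sub>v (v @\<^sub>v 0\<^sub>v n2)) = P *\<^sub>v ((T1 *\<^sub>v v) @\<^sub>v 0\<^sub>v n2)"
proof -
  let ?n = "n1 + n2" and ?w = "v @\<^sub>v 0\<^sub>v n2"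
  have w: "?w \<in> carrier_vec ?n" using v by simp
  have "four_block_mat T1 B (0\<^sub>m n2 n1) T2 *\<^sub>v ?w = (T1 *\<^sub>v v) @\<^sub>v 0\<^sub>v n2"
    by (subst four_block_mat_mult_vec[of _ n1 n1 _ n2 _ n2])
      (use c v in \<open>auto simp: mult_mat_zero_vec[of _ n1 n2] mult_mat_zero_vec[of _ n2 n2] zero_mat_mult_vec\<close>)
  then have "(Q * T * P) *\<^sub>v ?w = (T1 *\<^sub>v v) @\<^sub>v 0\<^sub>v n2" using b by simp
  then have "P *\<^sub>v ((Q * T * P) *\<^sub>v ?w) = P *\<^sub>v ((T1 *\<^sub>v v) @\<^sub>v 0\<^sub>v n2)" by simp
  moreover have "P *\<^sub>v ((Q * T * P) *\<^sub>v ?w) = P *\<^sub>v (Q *\<^sub>v (T *\<^sub>v (P *\<^sub>v ?w)))"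
    using P Q t w by (simp add: assoc_mult_mat_vec[of _ ?n ?n _ ?n])
  moreover have "\<dots> = T *\<^sub>v (P *\<^sub>v ?w)"
    by (rule mult_mat_vec_inverse[OF P Q PQ]) (use t P w in auto)
  ultimately show ?thesis by simp
qed

lemma append_zero_eq_zeroD:
  fixes P :: "'a::field mat"
  assumes P: "P \<in> carrier_mat (n1 + n2) (n1 + n2)" and Q: "Q \<in> carrier_mat (n1 + n2) (n1 + n2)" and PQ: "Q * P = 1\<^sub>m (n1 + n2)"
    and v: "v \<in> carrier_vec n1" and z: "P *\<^sub>v (v @\<^sub>v 0\<^sub>v n2) = 0\<^sub>v (n1 + n2)"
  shows "v = 0\<^sub>v n1"
proof -
  let ?w = "v @\<^sub>v 0\<^sub>v n2"
  have w: "?w \<in> carrier_vec (n1 + n2)" using v by simp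
  have "Q *\<^sub>v (P *\<^sub>v ?w) = 0\<^sub>v (n1 + n2)" unfolding z by (rule mult_mat_zero_vec[OF Q])
  then have "?w = 0\<^sub>v (n1 + n2)" using mult_mat_vec_inverse[OF Q P PQ w] by simp
  then have "?w $ i = 0" if "i < n1" for i using that by simp
  then show ?thesis using v by (intro eq_vecI) auto
qed

text \<open>The absence of fixed vectors passes to invariant subspaces, so one may descend to an
  irreducible one. There the vectors l v with l of augmentation zero form a subrepresentation; it is
  nonzero because some x moves v, hence it contains v itself. An l with l v = v is not
  nilpotent.\<close>

lemma augmentation_nonnilp:
  fixes H (structure) and \<tau> :: "'g \<Rightarrow> 'a::field mat"
  assumes H: "group H" and fin: "finite (carrier H)"
  shows "0 < n \<Longrightarrow> mrep H n \<tau> \<Longrightarrow>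
    (\<And>v. v \<in> carrier_vec n \<Longrightarrow> (\<And>x. x \<in> carrier H \<Longrightarrow> \<tau> x *\<^sub>v v = v) \<Longrightarrow> v = 0\<^sub>v n) \<Longrightarrow>
    \<exists>l :: 'g \<Rightarrow> 'a. (\<Sum>x\<in>carrier H. l x) = 0 \<and> nonnilp H l"
proof (induction n arbitrary: \<tau> rule: less_induct)
  case (less n)
  interpret group H by fact
  note m = less.prems(2)
  show ?case
  proof (cases "irrep H n \<tau>")
    case False
    then obtain U where U: "subrepresentation H n \<tau> U" "U \<noteq> {0\<^sub>v n}" "U \<noteq> carrier_vec n"
      using less.prems by (auto simp: irrep_def)
    have lU: "lin_subspace n U" using U(1) by (simp add: subrepresentation_iff)
    from subrepresentation_block[OF H m U(1)] obtain n1 n2 P Q \<tau>1 \<tau>2 B where n: "n = n1 + n2"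
      and P: "P \<in> carrier_mat n n" and Q: "Q \<in> carrier_mat n n" and PQ: "P * Q = 1\<^sub>m n" "Q * P = 1\<^sub>m n"
      and PU: "\<forall>v\<in>carrier_vec n. P *\<^sub>v v \<in> U \<longleftrightarrow> (\<forall>i<n. n1 \<le> i \<longrightarrow> v $ i = 0)"
      and r: "mrep H n1 \<tau>1" "mrep H n2 \<tau>2"
      and B: "\<forall>g\<in>carrier H. B g \<in> carrier_mat n1 n2 \<and> Q * \<tau> g * P = four_block_mat (\<tau>1 g) (B g) (0\<^sub>m n2 n1) (\<tau>2 g)"
      by blast
    have n1: "n1 \<noteq> n" "n1 \<noteq> 0"
      using coordinate_subspace_proper[OF lU P Q PQ(1) PU] U(2,3) by auto
    show ?thesis
    proof (rule less.IH[OF _ _ r(1)])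
      show "n1 < n" "0 < n1" using n n1 by auto
      fix v assume v: "v \<in> carrier_vec n1" and fx: "\<And>x. x \<in> carrier H \<Longrightarrow> \<tau>1 x *\<^sub>v v = v"
      note d = P[unfolded n] Q[unfolded n]
      have "P *\<^sub>v (v @\<^sub>v 0\<^sub>v n2) = 0\<^sub>v n"
      proof (rule less.prems(3))
        show "P *\<^sub>v (v @\<^sub>v 0\<^sub>v n2) \<in> carrier_vec n" using d v by (simp add: n)
        fix x assume x: "x \<in> carrier H"
        show "\<tau> x *\<^sub>v (P *\<^sub>v (v @\<^sub>v 0\<^sub>v n2)) = P *\<^sub>v (v @\<^sub>v 0\<^sub>v n2)"
          using block_mult_append_zero[OF d PQ(1)[unfolded n], of "\<tau> x" "\<tau>1 x" "B x" "\<tau>2 x" v]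
            B x mrepD(1)[OF r(1) x] mrepD(1)[OF r(2) x] mrepD(1)[OF m x] v fx[OF x] by (simp add: n)
      qed
      then show "v = 0\<^sub>v n1" using append_zero_eq_zeroD[OF d PQ(2)[unfolded n] v] by (simp add: n)
    qed
  next
    case True
    define v :: "'a vec" where "v = unit_vec n 0"
    have v: "v \<in> carrier_vec n" "v \<noteq> 0\<^sub>v n" using less.prems(1) by (auto simp: v_def)
    define D where "D = {alg H n \<tau> l *\<^sub>v v | l. (\<Sum>x\<in>carrier H. l x) = 0}"
    have DI: "alg H n \<tau> l *\<^sub>v v \<in> D" if "(\<Sum>x\<in>carrier H. l x) = 0" for l using that by (auto simp: D_def)
    have sub: "subrepresentation H n \<tau> D"
      unfolding subrepresentation_iff lin_subspace_def
    proof (intro conjI ballI allI)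
      show "D \<subseteq> carrier_vec n" using mult_mat_vec_carrier[OF mat_comb_carrier v(1)] by (auto simp: D_def)
      have "alg H n \<tau> (\<lambda>x. 0) *\<^sub>v v = 0\<^sub>v n" using v alg_zero[of H "\<lambda>x. 0" n \<tau>] by (auto intro!: eq_vecI)
      then show "0\<^sub>v n \<in> D" using DI[of "\<lambda>x. 0"] by simp
    next
      fix a b assume "a \<in> D" "b \<in> D"
      then obtain l k where l: "a = alg H n \<tau> l *\<^sub>v v" "(\<Sum>x\<in>carrier H. l x) = 0"
        and k: "b = alg H n \<tau> k *\<^sub>v v" "(\<Sum>x\<in>carrier H. k x) = 0" by (auto simp: D_def)
      have "a + b = alg H n \<tau> (\<lambda>x. l x + k x) *\<^sub>v v"
        unfolding l k using v by (simp add: add_mult_distrib_mat_vec[of _ n n, symmetric] mat_comb_add)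
      then show "a + b \<in> D" using DI[of "\<lambda>x. l x + k x"] l k by (simp add: sum.distrib)
    next
      fix c a assume "a \<in> D"
      then obtain l where l: "a = alg H n \<tau> l *\<^sub>v v" "(\<Sum>x\<in>carrier H. l x) = 0" by (auto simp: D_def)
      have "c \<cdot>\<^sub>v a = (c \<cdot>\<^sub>m alg H n \<tau> l) *\<^sub>v v"
        unfolding l by (rule smult_mat_mult_vec[symmetric]) (use v in auto)
      then show "c \<cdot>\<^sub>v a \<in> D" using DI[of "\<lambda>x. c * l x"] l by (simp add: mat_comb_smult sum_distrib_left[symmetric])
    next
      fix x a assume x: "x \<in> carrier H" and "a \<in> D"
      then obtain l where l: "a = alg H n \<tau> l *\<^sub>v v" "(\<Sum>x\<in>carrier H. l x) = 0" by (auto simp: D_def)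
      have "\<tau> x *\<^sub>v a = (\<tau> x * alg H n \<tau> l) *\<^sub>v v"
        unfolding l using mrepD(1)[OF m x] v by (simp add: assoc_mult_mat_vec[of _ n n _ n])
      also have "\<dots> = alg H n \<tau> (\<lambda>z. l (inv x \<otimes> z)) *\<^sub>v v" unfolding mrep_mult_alg[OF H m x] ..
      \<comment> \<open>Translating l permutes its values, so the augmentation stays zero.\<close>
      also have "\<dots> \<in> D" by (rule DI) (use sum_translate[of "inv x" l] x l in simp)
      finally show "\<tau> x *\<^sub>v a \<in> D" .
    qed
    obtain x where x: "x \<in> carrier H" "\<tau> x *\<^sub>v v \<noteq> v" using less.prems(3) v by blast
    \<comment> \<open>This is x - 1 in the group algebra; it has augmentation zero and sends v to x
      v - v.\<close>
    define l where "l g = (if g = x then 1 else 0) + (-1) * (if g = \<one> then 1 else (0::'a))" for g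
    have one: "\<one> \<in> carrier H" by simp
    have t1: "\<tau> \<one> = 1\<^sub>m n" using mrepD(3)[OF m] .
    have tx: "\<tau> x \<in> carrier_mat n n" using mrepD(1)[OF m x(1)] .
    have "alg H n \<tau> l = alg H n \<tau> (\<lambda>g. if g = x then 1 else 0) + (-1) \<cdot>\<^sub>m alg H n \<tau> (\<lambda>g. if g = \<one> then 1 else 0)"
      unfolding mat_comb_smult mat_comb_add l_def ..
    also have "\<dots> = \<tau> x + (-1) \<cdot>\<^sub>m 1\<^sub>m n"
      using alg_single[OF fin x(1), of \<tau> n] alg_single[OF fin one, of \<tau> n] tx t1 by simp
    finally have "alg H n \<tau> l *\<^sub>v v = \<tau> x *\<^sub>v v + ((-1) \<cdot>\<^sub>m 1\<^sub>m n) *\<^sub>v v"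
      using tx v by (simp add: add_mult_distrib_mat_vec[of _ n n])
    moreover have "((-1) \<cdot>\<^sub>m 1\<^sub>m n) *\<^sub>v v = (-1) \<cdot>\<^sub>v v"
      using v(1) smult_mat_mult_vec[of "1\<^sub>m n" n n v "-1"] by simp
    moreover have "\<tau> x *\<^sub>v v + (-1) \<cdot>\<^sub>v v \<noteq> 0\<^sub>v n"
    proof
      assume z: "\<tau> x *\<^sub>v v + (-1) \<cdot>\<^sub>v v = 0\<^sub>v n"
      have "(\<tau> x *\<^sub>v v) $ i = v $ i" if "i < n" for i
        using arg_cong[OF z, of "\<lambda>w. w $ i"] that v tx by simp
      then have "\<tau> x *\<^sub>v v = v" using v tx by (intro eq_vecI) auto
      then show False using x by simp
    qed
    moreover have "(\<Sum>g\<in>carrier H. l g) = 0" using fin x unfolding l_def sum.distrib sum_distrib_left[symmetric] by simp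
    ultimately have "D \<noteq> {0\<^sub>v n}" using DI[of l] by auto
    then have "D = carrier_vec n" using sub True by (auto simp: irrep_def)
    then have "v \<in> D" using v by simp
    then obtain l where l: "v = alg H n \<tau> l *\<^sub>v v" "(\<Sum>x\<in>carrier H. l x) = 0" by (auto simp: D_def)
    have "nonnilp H l" by (rule nonnilp_if_fixes_vec[OF H m v]) (use l in simp)
    then show ?thesis using l by blast
  qed
qed

section \<open>Characters of finite abelian groups\<close>

text \<open>The polynomial \<open>X^m - a\<close> splits, and its derivative
  \<open>m X^(m-1)\<close> vanishes at most at 0, which is no root; hence the m roots are
  distinct.\<close>

lemma card_nth_roots_alg_closed:
  fixes a :: "'a::alg_closed_field"
  assumes a: "a \<noteq> 0" and m: "of_nat m \<noteq> (0 :: 'a)"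
  shows "card {c. c ^ m = a} = m"
proof -
  have m0: "m \<noteq> 0" using m by (metis of_nat_0)
  define p where "p = Polynomial.monom 1 m - [:a:]"
  have deg: "Polynomial.degree p = m"
    unfolding p_def using m0 by (subst diff_conv_add_uminus, subst degree_add_eq_left) (auto simp: degree_monom_eq)
  have p0: "p \<noteq> 0" using deg m0 by auto
  have poly: "poly p c = c ^ m - a" for c by (simp add: p_def poly_monom)
  obtain R where R: "size R = m" "p = smult (Polynomial.lead_coeff p) (\<Prod>x\<in>#R. [:- x, 1:])"
    using alg_closed_imp_factorization[OF p0] deg by auto
  have roots: "{c. c ^ m = a} = set_mset R"
  proof -
    have "c ^ m = a \<longleftrightarrow> c \<in># R" for c
    proof -
      have "c ^ m = a \<longleftrightarrow> poly p c = 0" by (simp add: poly)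
      also have "\<dots> \<longleftrightarrow> poly (\<Prod>x\<in>#R. [:- x, 1:]) c = 0" using p0 by (subst R(2)) simp
      also have "\<dots> \<longleftrightarrow> c \<in># R" by (induction R) auto
      finally show ?thesis .
    qed
    then show ?thesis by blast
  qed
  have "count R x \<le> 1" for x
  proof (rule ccontr)
    assume "\<not> count R x \<le> 1"
    then have "{#x, x#} \<subseteq># R" by (intro mset_subset_eqI) auto
    then obtain R2 where R2: "R = add_mset x (add_mset x R2)" by (auto simp: mset_subset_eq_exists_conv)
    \<comment> \<open>A double root would also be a root of the derivative.\<close>
    define q where "q = smult (Polynomial.lead_coeff p) (\<Prod>x\<in>#R2. [:- x, 1:])"
    have pq: "p = [:- x, 1:] * ([:- x, 1:] * q)" using R(2) R2 by (simp add: q_def)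
    have "poly (pderiv p) x = 0" unfolding pq by (simp add: pderiv_mult del: mult_pCons_left mult_pCons_right)
    moreover have "pderiv p = Polynomial.monom (of_nat m) (m - 1)" by (simp add: p_def pderiv_diff pderiv_monom)
    ultimately have "x ^ (m - 1) = 0" using m by (simp add: poly_monom)
    then have "x = 0" by simp
    moreover have "x ^ m = a" using R2 roots by auto
    ultimately show False using a m0 by (simp add: power_0_left)
  qed
  then have le: "count R x \<le> 1" for x .
  have "count R x = count (mset_set (set_mset R)) x" for x
    using le[of x] by (cases "x \<in># R") (auto simp: not_in_iff le_antisym Suc_le_eq)
  then have "R = mset_set (set_mset R)" by (intro multiset_eqI)
  then have "size R = card (set_mset R)" by (metis size_mset_set)
  then show ?thesis using roots R by simp
qed

text \<open>Extensionality makes a character determined by its values on H, so that characters can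
  be counted. On a subgroup the values are automatically nonzero.\<close>

definition chars :: "('g, 'm) monoid_scheme \<Rightarrow> 'g set \<Rightarrow> ('g \<Rightarrow> 'a::field) set" where
  "chars G H = {\<chi> \<in> extensional H. (\<forall>x\<in>H. \<forall>y\<in>H. \<chi> (x \<otimes>\<^bsub>G\<^esub> y) = \<chi> x * \<chi> y) \<and> \<chi> \<one>\<^bsub>G\<^esub> = 1}"

lemma charsD:
  assumes "\<chi> \<in> chars G H"
  shows "x \<in> H \<Longrightarrow> y \<in> H \<Longrightarrow> \<chi> (x \<otimes>\<^bsub>G\<^esub> y) = \<chi> x * \<chi> y" "\<chi> \<one>\<^bsub>G\<^esub> = 1" "\<chi> \<in> extensional H"
  using assms by (auto simp: chars_def)

lemma chars_restrict_carrier [simp]: "chars (G\<lparr>carrier := A\<rparr>) H = chars G H"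
  by (simp add: chars_def)

lemma restrict_chars:
  assumes "\<chi> \<in> chars G H'" "H \<subseteq> H'" "subgroup H G"
  shows "restrict \<chi> H \<in> chars G H"
  using assms(1,2) subgroup.m_closed[OF assms(3)] subgroup.one_closed[OF assms(3)]
  unfolding chars_def by (simp add: subset_iff)

section \<open>Characters of subgroups of a finite group\<close>

context group
begin

lemma card_subgroup_dvd:
  assumes "subgroup H G"
  shows "card H dvd card (carrier G)"
  using lagrange[OF assms] by (metis Coset.order_def dvd_triv_right)

lemma chars_nonzero:
  assumes "subgroup H G" "\<chi> \<in> chars G H" "x \<in> H"
  shows "\<chi> x \<noteq> (0 :: 'k::field)"
proof -
  have "\<chi> (x \<otimes> inv x) = \<chi> x * \<chi> (inv x)"
    using charsD(1)[OF assms(2,3)] subgroup.m_inv_closed[OF assms(1,3)] by blast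
  then show ?thesis using subgroup.mem_carrier[OF assms(1,3)] charsD(2)[OF assms(2)] by auto
qed

lemma chars_pow:
  assumes "subgroup H G" "\<chi> \<in> chars G H" "x \<in> H"
  shows "\<chi> (x [^] (i::nat)) = \<chi> x ^ i" and "x [^] i \<in> H"
proof -
  show mem: "x [^] i \<in> H" for i :: nat
    by (induction i) (auto simp: subgroup.one_closed[OF assms(1)] subgroup.m_closed[OF assms(1)] assms(3))
  show "\<chi> (x [^] (i::nat)) = \<chi> x ^ i"
    by (induction i) (auto simp: charsD(2)[OF assms(2)] charsD(1)[OF assms(2)] mem assms(3))
qed

text \<open>All values are roots of unity for the exponent \<open>card (carrier G)\<close>, and a
  nonzero polynomial has finitely many roots.\<close>

lemma finite_chars:
  assumes "finite (carrier G)" "subgroup H G"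
  shows "finite (chars G H :: ('a \<Rightarrow> 'k::field) set)"
proof -
  have fH: "finite H" using assms subgroup.subset finite_subset by blast
  let ?R = "{c :: 'k. c ^ card (carrier G) = 1}"
  have c0: "card (carrier G) > 0" using assms(1) by (metis card_gt_0_iff empty_iff one_closed)
  have "finite ?R"
  proof -
    let ?p = "Polynomial.monom 1 (card (carrier G)) - [:1:] :: 'k poly"
    have "Polynomial.coeff ?p (card (carrier G)) = 1" using c0 by (simp add: Polynomial.coeff_pCons Polynomial.coeff_monom split: nat.splits)
    then have "?p \<noteq> 0" by (metis Polynomial.coeff_0 zero_neq_one)
    then have "finite {c. poly ?p c = 0}" by (rule poly_roots_finite)
    then show ?thesis by (simp add: poly_monom)
  qed
  moreover have "chars G H \<subseteq> (H \<rightarrow>\<^sub>E ?R)"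
  proof
    fix \<chi> :: "'a \<Rightarrow> 'k" assume c: "\<chi> \<in> chars G H"
    have "\<chi> x ^ card (carrier G) = 1" if x: "x \<in> H" for x
    proof -
      have "x [^] Coset.order G = \<one>" using pow_order_eq_1 subgroup.mem_carrier[OF assms(2) x] by blast
      then show ?thesis using chars_pow(1)[OF assms(2) c x, of "Coset.order G"] charsD(2)[OF c] by (simp add: Coset.order_def)
    qed
    then show "\<chi> \<in> H \<rightarrow>\<^sub>E ?R" using charsD(3)[OF c] by (auto simp: PiE_def)
  qed
  ultimately show ?thesis by (intro finite_subset[OF _ finite_PiE[OF fH]])
qed

end

text \<open>H' is generated by H and x, and m is the order of x modulo H. Every element of H' is h
  x^i, unique up to moving multiples of m from the exponent into h, so a character of H extends once
  an m-th root c of its value at x^m is chosen.\<close>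

lemma (in comm_group) cyclic_extension:
  assumes fin: "finite (carrier G)" and H: "subgroup H G" and x: "x \<in> carrier G" "x \<notin> H"
  shows "\<exists>H' m. subgroup H' G \<and> H \<subseteq> H' \<and> x \<in> H' \<and> 1 < m \<and> card H' = m * card H \<and> x [^] m \<in> H \<and>
     (\<forall>z\<in>H'. \<exists>h\<in>H. \<exists>i::nat. z = h \<otimes> x [^] i) \<and>
     (\<forall>\<chi> (c :: 'k::field). \<chi> \<in> chars G H \<longrightarrow> c ^ m = \<chi> (x [^] m) \<longrightarrow> (\<exists>\<chi>'\<in>chars G H'. restrict \<chi>' H = \<chi> \<and> \<chi>' x = c))"
proof -
  interpret H: subgroup H G by fact
  have Hc: "h \<in> H \<Longrightarrow> h \<in> carrier G" for h using H.subset by auto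
  define m where "m = (LEAST m::nat. 0 < m \<and> x [^] m \<in> H)"
  have "0 < Coset.order G \<and> x [^] Coset.order G \<in> H"
    using fin pow_order_eq_1[OF x(1)] order_gt_0_iff_finite by simp
  then have m: "0 < m \<and> x [^] m \<in> H" unfolding m_def by (rule LeastI)
  have least: "m \<le> j" if "0 < j" "x [^] j \<in> H" for j unfolding m_def using that by (intro Least_le) simp
  have m1: "1 < m"
  proof (rule ccontr)
    assume "\<not> 1 < m"
    then have "m = 1" using m by simp
    then show False using m x by simp
  qed
  have Hp: "h \<in> H \<Longrightarrow> h [^] (j::nat) \<in> H" for h j by (induction j) auto
  have dvd: "m dvd j" if j: "x [^] j \<in> H" for j :: nat
  proof (rule ccontr)
    assume "\<not> m dvd j"
    then have r: "0 < j mod m" by (simp add: mod_greater_zero_iff_not_dvd)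
    have "x [^] j = (x [^] m) [^] (j div m) \<otimes> x [^] (j mod m)"
      using x(1) by (simp add: nat_pow_pow nat_pow_mult mult.commute)
    then have "x [^] (j mod m) = inv ((x [^] m) [^] (j div m)) \<otimes> x [^] j"
      using x(1) by (simp add: m_assoc[symmetric])
    then have "x [^] (j mod m) \<in> H" using j m Hp by simp
    then have "m \<le> j mod m" by (rule least[OF r])
    then show False using mod_less_divisor[of m j] m by linarith
  qed
  \<comment> \<open>Natural exponents suffice, because x has finite order.\<close>
  define H' where "H' = {h \<otimes> x [^] i | h i. h \<in> H \<and> (i::nat) \<in> UNIV}"
  have H'I: "h \<otimes> x [^] i \<in> H'" if "h \<in> H" for h and i :: nat using that by (auto simp: H'_def)
  have H'E: "\<exists>h\<in>H. \<exists>i::nat. z = h \<otimes> x [^] i" if "z \<in> H'" for z using that by (auto simp: H'_def)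
  have mult: "(h \<otimes> x [^] i) \<otimes> (h' \<otimes> x [^] j) = (h \<otimes> h') \<otimes> x [^] (i + j)" if "h \<in> H" "h' \<in> H" for h h' and i j :: nat
    using that Hc x(1) by (simp add: m_ac nat_pow_mult[symmetric])
  have HH': "H \<subseteq> H'"
  proof
    fix h assume "h \<in> H"
    then show "h \<in> H'" using H'I[of h 0] Hc by simp
  qed
  have xH': "x \<in> H'" using H'I[of \<one> 1] x(1) by simp
  have sub: "subgroup H' G"
  proof (rule subgroupI)
    show "H' \<subseteq> carrier G" using Hc x(1) by (auto simp: H'_def)
    show "H' \<noteq> {}" using xH' by blast
    show "a \<otimes> b \<in> H'" if ab: "a \<in> H'" "b \<in> H'" for a b
    proof -
      obtain h i where h: "h \<in> H" "a = h \<otimes> x [^] (i::nat)" using H'E[OF ab(1)] by blast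
      obtain h' j where h': "h' \<in> H" "b = h' \<otimes> x [^] (j::nat)" using H'E[OF ab(2)] by blast
      show ?thesis unfolding h(2) h'(2) mult[OF h(1) h'(1)] by (rule H'I) (use h h' in auto)
    qed
    show "inv a \<in> H'" if a: "a \<in> H'" for a
    proof -
      obtain h i where h: "h \<in> H" "a = h \<otimes> x [^] (i::nat)" using H'E[OF a] by blast
      \<comment> \<open>Chosen with j + i a multiple of m, so that x^(j + i) lies in H and the
        inverse again has the shape of an element of H times a natural power of x.\<close>
      define j where "j = i * m - i"
      have ij: "j + i = i * m" using m by (simp add: j_def)
      define p where "p = (x [^] m) [^] i \<otimes> h"
      let ?b = "inv p \<otimes> x [^] j"
      have hp: "p \<in> H" unfolding p_def using h m Hp by simp
      have e: "p = h \<otimes> x [^] (i * m)"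
        unfolding p_def using h(1) Hc x(1) by (simp add: m_comm nat_pow_pow mult.commute)
      have "?b \<otimes> a = inv p \<otimes> p"
        unfolding h(2) mult[OF H.m_inv_closed[OF hp] h(1)] ij
        using h(1) Hc hp x(1) e by (simp add: m_assoc)
      also have "\<dots> = \<one>" using Hc[OF hp] by simp
      finally have "inv a = ?b" using h Hc x(1) hp by (intro inv_equality) auto
      then show ?thesis using H'I[OF H.m_inv_closed[OF hp]] by simp
    qed
  qed
  \<comment> \<open>Two expressions of the same element differ by a power of x that lies in H; with
    both exponents below m they coincide.\<close>
  have uni: "i \<le> j \<Longrightarrow> m dvd (j - i) \<and> h = h' \<otimes> x [^] (j - i)"
    if "h \<in> H" "h' \<in> H" "h \<otimes> x [^] i = h' \<otimes> x [^] j" for h h' and i j :: nat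
  proof -
    assume ij: "i \<le> j"
    have "h \<otimes> x [^] i = (h' \<otimes> x [^] (j - i)) \<otimes> x [^] i"
      using that ij Hc x(1) by (simp add: m_assoc nat_pow_mult)
    then have e: "h = h' \<otimes> x [^] (j - i)" using that Hc x(1) by simp
    then have "x [^] (j - i) = inv h' \<otimes> h" using that(2) Hc x(1) by (simp add: m_assoc[symmetric])
    then have "x [^] (j - i) \<in> H" using that by simp
    then show ?thesis using dvd e by blast
  qed
  have "card H' = card (H \<times> {..<m})"
  proof (rule bij_betw_same_card[symmetric], rule bij_betw_imageI)
    show "inj_on (\<lambda>(h, i). h \<otimes> x [^] i) (H \<times> {..<m})"
    proof (rule inj_onI, clarify)
      fix h i h' j assume a: "h \<in> H" "h' \<in> H" "i < m" "j < m" "h \<otimes> x [^] i = h' \<otimes> x [^] j"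
      have *: "i = j \<and> h = h'" if "i \<le> j" "j < m" "h \<in> H" "h' \<in> H" "h \<otimes> x [^] i = h' \<otimes> x [^] j" for i j h h'
      proof -
        from uni[OF that(3-5,1)] have u: "m dvd (j - i)" "h = h' \<otimes> x [^] (j - i)" by auto
        then have "j - i = 0" using that(1,2) by (metis dvd_imp_le less_imp_diff_less not_gr_zero not_less)
        then show ?thesis using u that Hc by simp
      qed
      show "h = h' \<and> i = j"
      proof (cases "i \<le> j")
        case True
        then show ?thesis using *[OF True a(4,1,2,5)] by simp
      next
        case False
        then have "j \<le> i" by simp
        then show ?thesis using *[OF _ a(3,2,1) a(5)[symmetric]] by simp
      qed
    qed
    have "h \<otimes> x [^] i \<in> (\<lambda>(h, i). h \<otimes> x [^] i) ` (H \<times> {..<m})" if h: "h \<in> H" for h and i :: nat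
    proof (rule image_eqI[of _ _ "(h \<otimes> (x [^] m) [^] (i div m), i mod m)"])
      show "h \<otimes> x [^] i = (\<lambda>(h, i). h \<otimes> x [^] i) (h \<otimes> (x [^] m) [^] (i div m), i mod m)"
        using h Hc x(1) by (simp add: m_assoc nat_pow_pow nat_pow_mult)
    qed (use h m Hp in auto)
    then show "(\<lambda>(h, i). h \<otimes> x [^] i) ` (H \<times> {..<m}) = H'"
      by (intro equalityI subsetI) (auto intro!: H'I dest!: H'E)
  qed
  then have card: "card H' = m * card H" by (simp add: card_cartesian_product)
  have ext: "\<exists>\<chi>'\<in>chars G H'. restrict \<chi>' H = \<chi> \<and> \<chi>' x = c"
    if chi: "\<chi> \<in> chars G H" and c: "c ^ m = \<chi> (x [^] m)" for \<chi> and c :: 'k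
  proof -
    have wd: "\<chi> h * c ^ i = \<chi> h' * c ^ j" if a: "h \<in> H" "h' \<in> H" "h \<otimes> x [^] i = h' \<otimes> x [^] j" for h h' and i j :: nat
    proof -
      have *: "\<chi> h * c ^ i = \<chi> h' * c ^ j" if a: "h \<in> H" "h' \<in> H" "h \<otimes> x [^] i = h' \<otimes> x [^] j" "i \<le> j" for h h' and i j :: nat
      proof -
        from uni[OF a] obtain q where q: "j - i = m * q" "h = h' \<otimes> x [^] (j - i)" by (auto elim: dvdE)
        have "x [^] (j - i) = (x [^] m) [^] q" using x(1) q by (simp add: nat_pow_pow)
        then have "\<chi> h = \<chi> h' * \<chi> ((x [^] m) [^] q)" using q(2) charsD(1)[OF chi a(2), of "(x [^] m) [^] q"] Hp m by simp
        also have "\<chi> ((x [^] m) [^] q) = (c ^ m) ^ q" using chars_pow(1)[OF H chi] m c by simp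
        also have "\<dots> = c ^ (j - i)" unfolding q(1) by (simp add: power_mult)
        finally have "\<chi> h * c ^ i = \<chi> h' * (c ^ (j - i) * c ^ i)" by simp
        then show ?thesis using a(4) by (simp add: power_add[symmetric])
      qed
      show ?thesis
      proof (cases "i \<le> j")
        case True
        then show ?thesis by (rule *[OF a])
      next
        case False
        then have "j \<le> i" by simp
        then show ?thesis by (rule *[OF a(2,1) a(3)[symmetric], symmetric])
      qed
    qed
    \<comment> \<open>Any expression of z may be used to compute the value; \<open>wd\<close> makes
      the description unambiguous.\<close>
    define \<chi>' where "\<chi>' = (\<lambda>z\<in>H'. THE v. \<exists>h\<in>H. \<exists>i::nat. z = h \<otimes> x [^] i \<and> v = \<chi> h * c ^ i)"
    have v: "\<chi>' (h \<otimes> x [^] i) = \<chi> h * c ^ i" if "h \<in> H" for h and i :: nat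
    proof -
      have "(THE v. \<exists>h'\<in>H. \<exists>j::nat. h \<otimes> x [^] i = h' \<otimes> x [^] j \<and> v = \<chi> h' * c ^ j) = \<chi> h * c ^ i"
      proof (rule the_equality)
        show "\<exists>h'\<in>H. \<exists>j::nat. h \<otimes> x [^] i = h' \<otimes> x [^] j \<and> \<chi> h * c ^ i = \<chi> h' * c ^ j"
          using that by (intro bexI[of _ h] exI[of _ i]) simp_all
        fix v assume "\<exists>h'\<in>H. \<exists>j::nat. h \<otimes> x [^] i = h' \<otimes> x [^] j \<and> v = \<chi> h' * c ^ j"
        then obtain h' j where h': "h' \<in> H" "h \<otimes> x [^] i = h' \<otimes> x [^] (j::nat)" "v = \<chi> h' * c ^ j" by blast
        show "v = \<chi> h * c ^ i" using wd[OF that h'(1,2)] h'(3) by simp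
      qed
      then show ?thesis using H'I[OF that] by (simp add: \<chi>'_def)
    qed
    have v0: "\<chi>' h = \<chi> h" if "h \<in> H" for h using v[OF that, of 0] that Hc by simp
    show ?thesis
    proof (rule bexI[of _ \<chi>'], rule conjI)
      show "restrict \<chi>' H = \<chi>" by (rule extensionalityI[of _ H]) (use v0 charsD(3)[OF chi] in auto)
      show "\<chi>' x = c" using v[of \<one> 1] x(1) charsD(2)[OF chi] by simp
      have "\<chi>' (a \<otimes> b) = \<chi>' a * \<chi>' b" if ab: "a \<in> H'" "b \<in> H'" for a b
      proof -
        obtain h i where h: "h \<in> H" "a = h \<otimes> x [^] (i::nat)" using H'E[OF ab(1)] by blast
        obtain h' j where h': "h' \<in> H" "b = h' \<otimes> x [^] (j::nat)" using H'E[OF ab(2)] by blast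
        show ?thesis unfolding h(2) h'(2) mult[OF h(1) h'(1)]
          using v[OF h(1)] v[OF h'(1)] v[of "h \<otimes> h'"] charsD(1)[OF chi h(1) h'(1)] h h' by (simp add: power_add)
      qed
      moreover have "\<chi>' \<one> = 1" using v0[of \<one>] charsD(2)[OF chi] by simp
      ultimately show "\<chi>' \<in> chars G H'" by (simp add: chars_def \<chi>'_def)
    qed
  qed
  have "\<forall>z\<in>H'. \<exists>h\<in>H. \<exists>i::nat. z = h \<otimes> x [^] i" by (intro ballI H'E)
  moreover have "\<forall>\<chi> (c :: 'k). \<chi> \<in> chars G H \<longrightarrow> c ^ m = \<chi> (x [^] m) \<longrightarrow> (\<exists>\<chi>'\<in>chars G H'. restrict \<chi>' H = \<chi> \<and> \<chi>' x = c)"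
    by (intro allI impI ext)
  ultimately show ?thesis
    using sub HH' xH' m1 card m by (intro exI[of _ H'] exI[of _ m] conjI) simp_all
qed

text \<open>Among the subgroups above H0 with property P a maximal one must be everything. This
  stands in for an induction along a chain of cyclic extensions.\<close>

lemma (in comm_group) subgroup_chain_induct:
  assumes fin: "finite (carrier G)" and H0: "subgroup H0 G" "P H0"
    and step: "\<And>H. subgroup H G \<Longrightarrow> H0 \<subseteq> H \<Longrightarrow> P H \<Longrightarrow> H \<noteq> carrier G \<Longrightarrow> \<exists>H'. subgroup H' G \<and> H \<subset> H' \<and> P H'"
  shows "P (carrier G)"
proof -
  let ?S = "{H. subgroup H G \<and> H0 \<subseteq> H \<and> P H}"
  have "finite ?S" by (rule finite_subset[of _ "Pow (carrier G)"]) (use fin subgroup.subset in auto)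
  moreover have "?S \<noteq> {}" using H0 by blast
  ultimately obtain H where H: "H \<in> ?S" and max: "\<And>H'. H' \<in> ?S \<Longrightarrow> H \<subseteq> H' \<Longrightarrow> H = H'"
    using finite_has_maximal[of ?S] by auto
  have "H = carrier G"
  proof (rule ccontr)
    assume "H \<noteq> carrier G"
    then obtain H' where "subgroup H' G" "H \<subset> H'" "P H'" using step[of H] H by auto
    then show False using max[of H'] H by auto
  qed
  then show ?thesis using H by simp
qed

text \<open>Restriction to H together with the value at x identifies the characters of H' with pairs
  of a character of H and an m-th root, so each cyclic step multiplies the count by m. There are m
  distinct roots because m divides the order of G and is thus nonzero in the field.\<close>

lemma (in comm_group) card_chars:
  assumes fin: "finite (carrier G)" and inv: "of_nat (card (carrier G)) \<noteq> (0 :: 'k::alg_closed_field)"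
  shows "card (chars G (carrier G) :: ('a \<Rightarrow> 'k) set) = card (carrier G)"
proof -
  have one: "subgroup {\<one>} G" by (rule triv_subgroup)
  have "(chars G {\<one>} :: ('a \<Rightarrow> 'k) set) = {\<lambda>x\<in>{\<one>}. 1}"
    by (auto simp: chars_def extensional_def fun_eq_iff)
  then have P1: "card (chars G {\<one>} :: ('a \<Rightarrow> 'k) set) = card {\<one>}" by simp
  show ?thesis
  proof (rule subgroup_chain_induct[where P = "\<lambda>H. card (chars G H :: ('a \<Rightarrow> 'k) set) = card H", OF fin one P1])
    fix H assume H: "subgroup H G" and P: "card (chars G H :: ('a \<Rightarrow> 'k) set) = card H" and "H \<noteq> carrier G"
    then obtain x where x: "x \<in> carrier G" "x \<notin> H" using subgroup.subset by blast
    from cyclic_extension[OF fin H x, where 'k = 'k] obtain H' m where H': "subgroup H' G" "H \<subseteq> H'" "x \<in> H'" "1 < m"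
      "card H' = m * card H" "x [^] m \<in> H" "\<And>z. z \<in> H' \<Longrightarrow> \<exists>h\<in>H. \<exists>i::nat. z = h \<otimes> x [^] i"
      and ext: "\<And>\<chi> (c :: 'k). \<chi> \<in> chars G H \<Longrightarrow> c ^ m = \<chi> (x [^] m) \<Longrightarrow> (\<exists>\<chi>'\<in>chars G H'. restrict \<chi>' H = \<chi> \<and> \<chi>' x = c)"
      by blast
    have "card H' dvd card (carrier G)" using card_subgroup_dvd[OF H'(1)] .
    then have "m dvd card (carrier G)" using H'(5) by (metis dvd_mult_left)
    then have m0: "of_nat m \<noteq> (0 :: 'k)" using inv by (auto elim!: dvdE)
    have "card (chars G H' :: ('a \<Rightarrow> 'k) set) = card (Sigma (chars G H :: ('a \<Rightarrow> 'k) set) (\<lambda>\<chi>. {c. c ^ m = \<chi> (x [^] m)}))"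
    proof (rule bij_betw_same_card, rule bij_betw_imageI)
      let ?f = "\<lambda>\<chi>' :: 'a \<Rightarrow> 'k. (restrict \<chi>' H, \<chi>' x)"
      show "inj_on ?f (chars G H')"
      proof (rule inj_onI)
        fix \<chi> \<psi> :: "'a \<Rightarrow> 'k" assume c: "\<chi> \<in> chars G H'" "\<psi> \<in> chars G H'" "?f \<chi> = ?f \<psi>"
        show "\<chi> = \<psi>"
        proof (rule extensionalityI[of _ H'])
          fix z assume "z \<in> H'"
          from H'(7)[OF this] obtain h i where z: "h \<in> H" "z = h \<otimes> x [^] (i::nat)" by blast
          have hH: "h \<in> H'" using z H'(2) by blast
          have "\<chi> h = \<psi> h" using c(3) z(1) by (metis prod.inject restrict_apply')
          then show "\<chi> z = \<psi> z"
            using z(2) charsD(1)[OF c(1) hH chars_pow(2)[OF H'(1) c(1) H'(3)]] charsD(1)[OF c(2) hH chars_pow(2)[OF H'(1) c(2) H'(3)]]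
              chars_pow(1)[OF H'(1) c(1) H'(3)] chars_pow(1)[OF H'(1) c(2) H'(3)] c(3) by simp
        qed (use c charsD(3) in auto)
      qed
      show "?f ` chars G H' = Sigma (chars G H) (\<lambda>\<chi>. {c. c ^ m = \<chi> (x [^] m)})"
      proof (intro equalityI subsetI)
        fix p assume "p \<in> ?f ` chars G H'"
        then obtain \<chi>' where p: "p = ?f \<chi>'" "\<chi>' \<in> chars G H'" by blast
        show "p \<in> Sigma (chars G H) (\<lambda>\<chi>. {c. c ^ m = \<chi> (x [^] m)})"
          using p restrict_chars[OF p(2) H'(2) H] chars_pow(1)[OF H'(1) p(2) H'(3), of m] H'(6) by simp
      next
        fix p assume "p \<in> Sigma (chars G H :: ('a \<Rightarrow> 'k) set) (\<lambda>\<chi>. {c. c ^ m = \<chi> (x [^] m)})"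
        then obtain \<chi> c where p: "p = (\<chi>, c)" "\<chi> \<in> chars G H" "c ^ m = \<chi> (x [^] m)" by blast
        show "p \<in> ?f ` chars G H'" using ext[OF p(2,3)] p(1) by (auto simp: image_iff)
      qed
    qed
    also have "\<dots> = (\<Sum>\<chi>\<in>(chars G H :: ('a \<Rightarrow> 'k) set). card {c. c ^ m = \<chi> (x [^] m)})"
    proof (rule card_SigmaI[OF finite_chars[OF fin H]], rule ballI)
      fix \<chi> :: "'a \<Rightarrow> 'k" assume "\<chi> \<in> chars G H"
      then have "card {c. c ^ m = \<chi> (x [^] m)} = m"
        by (intro card_nth_roots_alg_closed m0 chars_nonzero[OF H] H'(6))
      then show "finite {c. c ^ m = \<chi> (x [^] m)}" using H'(4) by (metis card.infinite not_less_zero)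
    qed
    also have "\<dots> = (\<Sum>\<chi>\<in>(chars G H :: ('a \<Rightarrow> 'k) set). m)"
      by (rule sum.cong[OF refl]) (intro card_nth_roots_alg_closed m0 chars_nonzero[OF H] H'(6))
    also have "\<dots> = card H'" using P H'(5) by simp
    finally show "\<exists>H'. subgroup H' G \<and> H \<subset> H' \<and> card (chars G H' :: ('a \<Rightarrow> 'k) set) = card H'"
      using H' x by blast
  qed
qed

text \<open>Algebraic closedness supplies the root that each cyclic step asks for.\<close>

lemma (in comm_group) extend_char:
  assumes fin: "finite (carrier G)" and inv: "of_nat (card (carrier G)) \<noteq> (0 :: 'k::alg_closed_field)"
    and H0: "subgroup H0 G" and chi: "\<chi> \<in> chars G H0"
  shows "\<exists>\<chi>'\<in>chars G (carrier G). restrict \<chi>' H0 = (\<chi> :: 'a \<Rightarrow> 'k)"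
proof (rule subgroup_chain_induct[where P = "\<lambda>H. \<exists>\<chi>'\<in>chars G H. restrict \<chi>' H0 = (\<chi> :: 'a \<Rightarrow> 'k)", OF fin H0])
  show "\<exists>\<chi>'\<in>chars G H0. restrict \<chi>' H0 = \<chi>"
    using chi extensional_restrict[OF charsD(3)[OF chi]] by (intro bexI[of _ \<chi>])
  fix H assume H: "subgroup H G" "H0 \<subseteq> H" and P: "\<exists>\<chi>'\<in>chars G H. restrict \<chi>' H0 = \<chi>" and "H \<noteq> carrier G"
  then obtain x where x: "x \<in> carrier G" "x \<notin> H" using subgroup.subset by blast
  from cyclic_extension[OF fin H(1) x, where 'k = 'k] obtain H' m where H': "subgroup H' G" "H \<subseteq> H'" "x \<in> H'" "1 < m"
    and ext: "\<And>\<chi> (c :: 'k). \<chi> \<in> chars G H \<Longrightarrow> c ^ m = \<chi> (x [^] m) \<Longrightarrow> (\<exists>\<chi>'\<in>chars G H'. restrict \<chi>' H = \<chi> \<and> \<chi>' x = c)"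
    by blast
  obtain \<psi> where psi: "\<psi> \<in> chars G H" "restrict \<psi> H0 = \<chi>" using P by blast
  obtain c where "c ^ m = \<psi> (x [^] m)" using nth_root_exists[of m "\<psi> (x [^] m)"] H'(4) by auto
  from ext[OF psi(1) this] obtain \<chi>' where c': "\<chi>' \<in> chars G H'" "restrict \<chi>' H = \<psi>" by blast
  have "restrict \<chi>' H0 = restrict (restrict \<chi>' H) H0" using H(2) by (simp add: Int_absorb1)
  then have "restrict \<chi>' H0 = \<chi>" using c'(2) psi(2) by simp
  then show "\<exists>H'. subgroup H' G \<and> H \<subset> H' \<and> (\<exists>\<chi>'\<in>chars G H'. restrict \<chi>' H0 = \<chi>)"
    using H' c'(1) x by blast
qed

text \<open>On the cyclic group generated by x, of order m > 1, some character sends x to an m-th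
  root of unity other than 1; it extends to the whole group.\<close>

lemma (in comm_group) char_separates:
  assumes fin: "finite (carrier G)" and inv: "of_nat (card (carrier G)) \<noteq> (0 :: 'k::alg_closed_field)"
    and x: "x \<in> carrier G" "x \<noteq> \<one>"
  shows "\<exists>\<chi>\<in>chars G (carrier G). \<chi> x \<noteq> (1 :: 'k)"
proof -
  have one: "subgroup {\<one>} G" by (rule triv_subgroup)
  have x': "x \<notin> {\<one>}" using x by simp
  from cyclic_extension[OF fin one x(1) x', where 'k = 'k] obtain H' m where H': "subgroup H' G" "x \<in> H'" "1 < m"
      "card H' = m * card {\<one>}" "x [^] m \<in> {\<one>}"
      and ext: "\<And>\<chi> (c :: 'k). \<chi> \<in> chars G {\<one>} \<Longrightarrow> c ^ m = \<chi> (x [^] m) \<Longrightarrow> (\<exists>\<chi>'\<in>chars G H'. restrict \<chi>' {\<one>} = \<chi> \<and> \<chi>' x = c)"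
    by blast
  have "m dvd card (carrier G)" using card_subgroup_dvd[OF H'(1)] H'(4) by simp
  then have m0: "of_nat m \<noteq> (0 :: 'k)" using inv by (auto elim!: dvdE)
  have "card {c :: 'k. c ^ m = 1} = m" by (rule card_nth_roots_alg_closed) (use m0 in auto)
  then obtain c :: 'k where c: "c ^ m = 1" "c \<noteq> 1"
    using H'(3) by (metis (mono_tags, lifting) card_le_Suc0_iff_eq card.infinite leD mem_Collect_eq not_less_zero One_nat_def)
  have t: "(\<lambda>x\<in>{\<one>}. 1) \<in> chars G {\<one>}" by (auto simp: chars_def)
  obtain \<chi>' where c': "\<chi>' \<in> chars G H'" "\<chi>' x = c" using ext[OF t, of c] c H'(5) by auto
  obtain \<chi> where "\<chi> \<in> chars G (carrier G)" "restrict \<chi> H' = \<chi>'" using extend_char[OF fin inv H'(1) c'(1)] by blast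
  then show ?thesis using c' c H'(2) by (metis restrict_apply')
qed

text \<open>Multiplication by a character \<open>\<psi>\<close> with \<open>\<psi> x\<close>
  different from 1 permutes the characters, so the sum S satisfies
  \<open>S = \<psi> x * S\<close>.\<close>

lemma (in comm_group) sum_chars:
  assumes fin: "finite (carrier G)" and inv: "of_nat (card (carrier G)) \<noteq> (0 :: 'k::alg_closed_field)"
    and x: "x \<in> carrier G"
  shows "(\<Sum>\<chi>\<in>chars G (carrier G). \<chi> x) = (if x = \<one> then of_nat (card (carrier G)) else (0 :: 'k))"
proof (cases "x = \<one>")
  case True
  have "(\<Sum>\<chi>\<in>chars G (carrier G). \<chi> x) = (\<Sum>\<chi>\<in>(chars G (carrier G) :: ('a \<Rightarrow> 'k) set). 1 :: 'k)"
    by (rule sum.cong[OF refl]) (simp add: True charsD(2))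
  then show ?thesis using True card_chars[OF fin inv] by simp
next
  case False
  let ?X = "chars G (carrier G) :: ('a \<Rightarrow> 'k) set"
  have sG: "subgroup (carrier G) G" by (rule subgroup_self)
  obtain \<psi> where psi: "\<psi> \<in> ?X" "\<psi> x \<noteq> 1" using char_separates[OF fin inv x False] by blast
  let ?t = "\<lambda>\<chi>. \<lambda>z\<in>carrier G. \<psi> z * \<chi> z"
  have im: "?t ` ?X \<subseteq> ?X"
    by (auto simp: chars_def charsD(1,2)[OF psi(1)])
  moreover have inj: "inj_on ?t ?X"
  proof (rule inj_onI)
    fix \<chi> \<phi> assume a: "\<chi> \<in> ?X" "\<phi> \<in> ?X" "?t \<chi> = ?t \<phi>"
    show "\<chi> = \<phi>"
    proof (rule extensionalityI[of _ "carrier G"])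
      fix z assume z: "z \<in> carrier G"
      have "\<psi> z * \<chi> z = \<psi> z * \<phi> z" using fun_cong[OF a(3), of z] z by simp
      then show "\<chi> z = \<phi> z" using chars_nonzero[OF sG psi(1) z] by simp
    qed (use a charsD(3) in auto)
  qed
  ultimately have sur: "?t ` ?X = ?X" by (intro endo_inj_surj[OF finite_chars[OF fin sG]])
  have "(\<Sum>\<chi>\<in>?X. \<chi> x) = (\<Sum>\<chi>\<in>?t ` ?X. \<chi> x)" unfolding sur ..
  also have "\<dots> = (\<Sum>\<chi>\<in>?X. ?t \<chi> x)" by (subst sum.reindex[OF inj]) simp
  also have "\<dots> = \<psi> x * (\<Sum>\<chi>\<in>?X. \<chi> x)" using x by (simp add: sum_distrib_left)
  finally have "(1 - \<psi> x) * (\<Sum>\<chi>\<in>?X. \<chi> x) = 0" by (simp add: algebra_simps)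
  then show ?thesis using psi False by simp
qed

text \<open>This is \<open>card H\<close> times the idempotent of \<open>\<chi>\<close>, so that no division occurs.\<close>

definition char_elem :: "('g, 'm) monoid_scheme \<Rightarrow> 'g set \<Rightarrow> ('g \<Rightarrow> 'k::field) \<Rightarrow> 'g \<Rightarrow> 'k" where
  "char_elem G H \<chi> = (\<lambda>x. if x \<in> H then \<chi> (inv\<^bsub>G\<^esub> x) else 0)"

text \<open>The columns of the image of \<open>char_elem\<close> are thus eigenvectors of A for
  \<open>\<chi>\<close>, so a nonzero image says that \<open>\<chi>\<close> occurs in the
  representation.\<close>

lemma mult_alg_char_elem:
  fixes G (structure)
  assumes G: "group G" and A: "subgroup A G" and chi: "\<chi> \<in> chars G A" and m: "mrep G n \<sigma>" and x: "x \<in> A"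
  shows "\<sigma> x * alg G n \<sigma> (char_elem G A \<chi>) = \<chi> x \<cdot>\<^sub>m alg G n \<sigma> (char_elem G A \<chi>)"
proof -
  interpret group G by fact
  interpret A: subgroup A G by fact
  have xc: "x \<in> carrier G" using x A.subset by auto
  have "\<sigma> x * alg G n \<sigma> (char_elem G A \<chi>) = alg G n \<sigma> (\<lambda>z. char_elem G A \<chi> (inv x \<otimes> z))"
    by (rule mrep_mult_alg[OF G m xc])
  also have "\<dots> = alg G n \<sigma> (\<lambda>z. \<chi> x * char_elem G A \<chi> z)"
  proof (rule mat_comb_cong[OF refl])
    fix z assume z: "z \<in> carrier G"
    have iff: "inv x \<otimes> z \<in> A \<longleftrightarrow> z \<in> A"
    proof
      assume "inv x \<otimes> z \<in> A"
      then have "x \<otimes> (inv x \<otimes> z) \<in> A" using x by simp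
      then show "z \<in> A" using xc z by (simp add: m_assoc[symmetric])
    qed (use x in simp)
    show "char_elem G A \<chi> (inv x \<otimes> z) = \<chi> x * char_elem G A \<chi> z"
    proof (cases "z \<in> A")
      case True
      have "inv (inv x \<otimes> z) = inv z \<otimes> x" using xc z by (simp add: inv_mult_group)
      then show ?thesis using True iff charsD(1)[OF chi, of "inv z" x] x by (simp add: char_elem_def)
    qed (use iff in \<open>simp add: char_elem_def\<close>)
  qed
  finally show ?thesis by (simp add: mat_comb_smult)
qed

text \<open>By orthogonality of characters these elements add up to card A times the neutral
  element, which acts as a nonzero scalar.\<close>

lemma exists_char_elem_nonzero:
  fixes G (structure) and \<sigma> :: "'g \<Rightarrow> 'k::alg_closed_field mat"
  assumes G: "group G" and fin: "finite (carrier G)" and A: "subgroup A G" and ab: "comm_group (G\<lparr>carrier := A\<rparr>)"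
    and inv: "of_nat (card A) \<noteq> (0 :: 'k)" and m: "mrep G n \<sigma>" and n: "0 < n"
  shows "\<exists>\<chi>\<in>chars G A. alg G n \<sigma> (char_elem G A \<chi>) \<noteq> 0\<^sub>m n n"
proof (rule ccontr)
  assume "\<not> ?thesis"
  then have z: "alg G n \<sigma> (char_elem G A \<chi>) = 0\<^sub>m n n" if "\<chi> \<in> chars G A" for \<chi> using that by blast
  interpret group G by fact
  interpret A: subgroup A G by fact
  interpret P: comm_group "G\<lparr>carrier := A\<rparr>" by fact
  have fA: "finite A" using A.subset fin finite_subset by blast
  let ?X = "chars G A :: ('g \<Rightarrow> 'k) set"
  have s: "(\<Sum>\<chi>\<in>?X. char_elem G A \<chi> x) = (if x = \<one> then of_nat (card A) else 0)" if x: "x \<in> carrier G" for x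
  proof (cases "x \<in> A")
    case True
    have "(\<Sum>\<chi>\<in>?X. \<chi> (inv x)) = (if inv x = \<one> then of_nat (card A) else 0)"
      using P.sum_chars[of "inv x", where 'k = 'k] fA inv True by simp
    then show ?thesis using True x by (simp add: char_elem_def inv_eq_1_iff)
  next
    case False
    then show ?thesis by (auto simp: char_elem_def)
  qed
  have "of_nat (card A) \<cdot>\<^sub>m \<sigma> \<one> = of_nat (card A) \<cdot>\<^sub>m alg G n \<sigma> (\<lambda>g. if g = \<one> then 1 else 0)"
    using alg_single[OF fin, of \<one> \<sigma> n] mrepD(1)[OF m] by simp
  also have "\<dots> = alg G n \<sigma> (\<lambda>x. \<Sum>\<chi>\<in>?X. char_elem G A \<chi> x)"
    unfolding mat_comb_smult by (rule mat_comb_cong) (auto simp: s)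
  also have "\<dots> = 0\<^sub>m n n"
  proof (rule eq_matI)
    fix i j assume "i < dim_row (0\<^sub>m n n :: 'k mat)" "j < dim_col (0\<^sub>m n n :: 'k mat)"
    then have ij: "i < n" "j < n" by auto
    have "(\<Sum>g\<in>carrier G. char_elem G A \<chi> g * \<sigma> g $$ (i, j)) = 0" if "\<chi> \<in> ?X" for \<chi>
      using arg_cong[OF z[OF that], of "\<lambda>M. M $$ (i, j)"] ij by simp
    then show "alg G n \<sigma> (\<lambda>x. \<Sum>\<chi>\<in>?X. char_elem G A \<chi> x) $$ (i, j) = 0\<^sub>m n n $$ (i, j)"
      using ij by (simp add: sum_distrib_right) (subst sum.swap, simp)
  qed auto
  finally have "(of_nat (card A) \<cdot>\<^sub>m \<sigma> \<one>) $$ (0, 0) = (0\<^sub>m n n :: 'k mat) $$ (0, 0)" by simp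
  then show False using inv n mrepD(3)[OF m] by simp
qed

text \<open>The square of this element is card A times itself, so all powers are nonzero multiples
  of it; its value at the neutral element is 1.\<close>

lemma nonnilp_char_elem:
  fixes G (structure) and \<chi> :: "'g \<Rightarrow> 'k::field"
  assumes G: "group G" and fin: "finite (carrier G)" and A: "subgroup A G"
    and inv: "of_nat (card A) \<noteq> (0 :: 'k)" and chi: "\<chi> \<in> chars G A"
  shows "nonnilp G (char_elem G A \<chi>)"
proof -
  interpret group G by fact
  interpret A: subgroup A G by fact
  let ?e = "char_elem G A \<chi>"
  \<comment> \<open>The factor c is carried along so that the formula applies to the multiples that
    arise as powers.\<close>
  have cv: "conv G ?e (\<lambda>x. c * ?e x) z = (of_nat (card A) * c) * ?e z" if z: "z \<in> carrier G" for z c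
  proof -
    have "?e y * (c * ?e (inv y \<otimes> z)) = (if y \<in> A then c * ?e z else 0)" if y: "y \<in> carrier G" for y
    proof (cases "y \<in> A")
      case True
      have iff: "inv y \<otimes> z \<in> A \<longleftrightarrow> z \<in> A"
      proof
        assume "inv y \<otimes> z \<in> A"
        then have "y \<otimes> (inv y \<otimes> z) \<in> A" using True by simp
        then show "z \<in> A" using y z by (simp add: m_assoc[symmetric])
      qed (use True in simp)
      show ?thesis
      proof (cases "z \<in> A")
        case zA: True
        have "inv (inv y \<otimes> z) = inv z \<otimes> y" using y z by (simp add: inv_mult_group)
        moreover have "\<chi> (inv y) * \<chi> y = 1"
          using charsD(1)[OF chi, of "inv y" y] True y charsD(2)[OF chi] by simp
        ultimately show ?thesis
          using zA True iff charsD(1)[OF chi, of "inv z" y] by (simp add: char_elem_def)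
      qed (use iff in \<open>simp add: char_elem_def\<close>)
    qed (simp add: char_elem_def)
    then have "(\<Sum>y\<in>carrier G. ?e y * (c * ?e (inv y \<otimes> z))) = (\<Sum>y\<in>carrier G. if y \<in> A then c * ?e z else 0)"
      by (intro sum.cong) auto
    also have "\<dots> = (\<Sum>y\<in>carrier G \<inter> A. c * ?e z)" by (rule sum.inter_restrict[symmetric, OF fin])
    also have "carrier G \<inter> A = A" using A.subset by auto
    finally show ?thesis using z by (simp add: conv_def)
  qed
  have cp: "cpow G ?e N x = of_nat (card A) ^ N * ?e x" if "x \<in> carrier G" for N x
    using that
  proof (induction N arbitrary: x)
    case (Suc N)
    have "cpow G ?e (Suc N) x = conv G ?e (\<lambda>x. of_nat (card A) ^ N * ?e x) x"
      using Suc by (simp add: conv_def)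
    then show ?case using cv[OF Suc.prems] by simp
  qed simp
  show ?thesis
    unfolding nonnilp_def using cp inv charsD(2)[OF chi] by (auto intro!: bexI[of _ \<one>] simp: char_elem_def)
qed

section \<open>Clifford's argument\<close>

lemma mat_eqI_mult_vec:
  assumes "A \<in> carrier_mat nr nc" "B \<in> carrier_mat nr nc"
    and "\<And>v. v \<in> carrier_vec nc \<Longrightarrow> A *\<^sub>v v = B *\<^sub>v (v :: 'a::field vec)"
  shows "A = B"
proof (rule eq_matI)
  fix i j assume "i < dim_row B" "j < dim_col B"
  then have ij: "i < nr" "j < nc" using assms by auto
  have "(A *\<^sub>v unit_vec nc j) $ i = (B *\<^sub>v unit_vec nc j) $ i" using assms(3)[of "unit_vec nc j"] by simp
  then show "A $$ (i, j) = B $$ (i, j)" using assms(1,2) ij by (simp add: scalar_prod_right_unit)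
qed (use assms in auto)

text \<open>Normality lets x pass g: x g = g y with y in M, so g v is fixed along with v.\<close>

lemma fixed_subrepresentation:
  fixes G (structure) and \<rho> :: "'g \<Rightarrow> 'k::field mat"
  assumes G: "group G" and m: "mrep G n \<rho>" and M: "M \<lhd> G"
  shows "subrepresentation G n \<rho> {v \<in> carrier_vec n. \<forall>x\<in>M. \<rho> x *\<^sub>v v = v}"
proof -
  interpret group G by fact
  interpret M: normal M G by fact
  have Mc: "x \<in> M \<Longrightarrow> x \<in> carrier G" for x using M.subset by auto
  have R: "\<rho> x \<in> carrier_mat n n" if "x \<in> carrier G" for x using mrepD(1)[OF m that] .
  define V where "V = {v \<in> carrier_vec n. \<forall>x\<in>M. \<rho> x *\<^sub>v v = v}"
  have "subrepresentation G n \<rho> V"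
    unfolding subrepresentation_iff lin_subspace_def
  proof (intro conjI ballI allI)
    show "0\<^sub>v n \<in> V" using R Mc by (auto simp: V_def mult_mat_zero_vec)
    fix u w assume "u \<in> V" "w \<in> V"
    then show "u + w \<in> V" using R Mc by (auto simp: V_def mult_add_distrib_mat_vec[of _ n n])
  next
    fix c u assume "u \<in> V"
    then show "c \<cdot>\<^sub>v u \<in> V" using R Mc by (auto simp: V_def mult_mat_vec[of _ n n])
  next
    fix g v assume g: "g \<in> carrier G" and v: "v \<in> V"
    have "\<rho> x *\<^sub>v (\<rho> g *\<^sub>v v) = \<rho> g *\<^sub>v v" if x: "x \<in> M" for x
    proof -
      let ?y = "inv g \<otimes> x \<otimes> g"
      have y: "?y \<in> M" using M.inv_op_closed1[OF g x] .
      have gy: "g \<otimes> ?y = x \<otimes> g" using g Mc[OF x] by (simp add: m_assoc[symmetric])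
      have "\<rho> x *\<^sub>v (\<rho> g *\<^sub>v v) = \<rho> (x \<otimes> g) *\<^sub>v v"
        using g x Mc v R mrepD(2)[OF m Mc[OF x] g] by (simp add: V_def assoc_mult_mat_vec[of _ n n _ n])
      also have "\<dots> = \<rho> g *\<^sub>v (\<rho> ?y *\<^sub>v v)"
        unfolding gy[symmetric] using g y Mc[OF y] v R mrepD(2)[OF m g Mc[OF y]] by (simp add: V_def assoc_mult_mat_vec[of _ n n _ n])
      also have "\<rho> ?y *\<^sub>v v = v" using y v by (simp add: V_def)
      finally show ?thesis .
    qed
    then show "\<rho> g *\<^sub>v v \<in> V" using R[OF g] v by (simp add: V_def)
  qed (auto simp: V_def)
  then show ?thesis by (simp add: V_def)
qed

text \<open>If M acts trivially, the eigenvector property of the nonzero matrix E forces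
  \<open>\<chi> x = 1\<close>. Conversely, irreducibility is available only over the small field, so
  the vectors fixed by M are taken there; some are nonzero because the sum over M multiplies E by
  card M, which is invertible.\<close>

lemma normal_trivial_iff_char:
  fixes G (structure) and \<rho> :: "'g \<Rightarrow> 'k::field mat"
  assumes G: "group G" and fin: "finite (carrier G)" and A: "subgroup A G"
    and inv: "of_nat (card A) \<noteq> (0 :: 'k)" and chi: "\<chi> \<in> chars G A"
    and irr: "irrep G n \<rho>" and nz: "alg G n (ac_mat \<rho>) (char_elem G A \<chi>) \<noteq> 0\<^sub>m n n"
    and M: "M \<lhd> G" "M \<subseteq> A"
  shows "(\<forall>x\<in>M. \<rho> x = 1\<^sub>m n) \<longleftrightarrow> (\<forall>x\<in>M. \<chi> x = 1)"
proof
  interpret group G by fact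
  interpret M: normal M G by fact
  have m: "mrep G n \<rho>" using irr by (simp add: irrep_def)
  note am = mrep_ac_mat[OF m]
  define E where "E = alg G n (ac_mat \<rho>) (char_elem G A \<chi>)"
  have E: "E \<in> carrier_mat n n" "E \<noteq> 0\<^sub>m n n" using nz by (auto simp: E_def)
  have act: "map_mat to_ac (\<rho> x) * E = \<chi> x \<cdot>\<^sub>m E" if "x \<in> A" for x
    unfolding E_def by (rule mult_alg_char_elem[OF G A chi am that])
  {
    assume t: "\<forall>x\<in>M. \<rho> x = 1\<^sub>m n"
    show "\<forall>x\<in>M. \<chi> x = 1"
    proof
      fix x assume x: "x \<in> M"
      have e: "E = \<chi> x \<cdot>\<^sub>m E" using act[of x] x M(2) t E(1) by (auto simp: to_ac.mat_hom_one)
      obtain i j where ij: "i < n" "j < n" "E $$ (i, j) \<noteq> 0"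
        using E by (metis carrier_matD(1,2) eq_matI index_zero_mat(1,2,3))
      have "E $$ (i, j) = \<chi> x * E $$ (i, j)" using arg_cong[OF e, of "\<lambda>M. M $$ (i, j)"] ij E(1) by simp
      then show "\<chi> x = 1" using ij(3) by simp
    qed
  }
  {
    assume t: "\<forall>x\<in>M. \<chi> x = 1"
    have Mc: "x \<in> M \<Longrightarrow> x \<in> carrier G" for x using M.subset by auto
    have fM: "finite M" using M.subset fin finite_subset by blast
    define V where "V = {v \<in> carrier_vec n. \<forall>x\<in>M. \<rho> x *\<^sub>v v = v}"
    have R: "\<rho> x \<in> carrier_mat n n" if "x \<in> carrier G" for x using mrepD(1)[OF m that] .
    have sub: "subrepresentation G n \<rho> V" unfolding V_def by (rule fixed_subrepresentation[OF G m M(1)])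
    have "V \<noteq> {0\<^sub>v n}"
    proof
      assume V0: "V = {0\<^sub>v n}"
      \<comment> \<open>The image of the sum over M consists of fixed vectors, so P is zero if there
        are none; over the closure, however, P times E is card M times E.\<close>
      define P where "P = mat_comb M n n \<rho> (\<lambda>_. 1)"
      have P: "P \<in> carrier_mat n n" by (simp add: P_def)
      have xP: "\<rho> x * P = P" if x: "x \<in> M" for x
      proof -
        have "\<rho> x * P = mat_comb M n n (\<lambda>y. \<rho> x * \<rho> y) (\<lambda>_. 1)"
          unfolding P_def by (rule mult_mat_comb) (use R x Mc in auto)
        also have "\<dots> = P"
        proof (rule eq_matI)
          fix i j assume "i < dim_row P" "j < dim_col P"
          then have ij: "i < n" "j < n" using P by auto
          have "(\<Sum>y\<in>M. (\<rho> x * \<rho> y) $$ (i, j)) = (\<Sum>y\<in>M. \<rho> (x \<otimes> y) $$ (i, j))"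
            by (rule sum.cong) (use mrepD(2)[OF m] x Mc in auto)
          also have "\<dots> = (\<Sum>y\<in>M. \<rho> y $$ (i, j))"
            by (rule sum.reindex_bij_witness[of _ "\<lambda>y. inv x \<otimes> y" "\<lambda>y. x \<otimes> y"])
              (use x Mc in \<open>auto simp: m_assoc[symmetric]\<close>)
          finally show "mat_comb M n n (\<lambda>y. \<rho> x * \<rho> y) (\<lambda>_. 1) $$ (i, j) = P $$ (i, j)"
            using ij by (simp add: P_def)
        qed (use P in auto)
        finally show ?thesis .
      qed
      have "P *\<^sub>v v = 0\<^sub>v n" if v: "v \<in> carrier_vec n" for v
      proof -
        have "\<rho> x *\<^sub>v (P *\<^sub>v v) = P *\<^sub>v v" if "x \<in> M" for x
          using xP[OF that] assoc_mult_mat_vec[OF R[OF Mc[OF that]] P v] by simp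
        then have "P *\<^sub>v v \<in> V" using P v by (simp add: V_def)
        then show ?thesis using V0 by simp
      qed
      then have "P = 0\<^sub>m n n"
        by (intro mat_eqI_mult_vec[OF P]) (auto simp: zero_mat_mult_vec)
      have "map_mat to_ac P = mat_comb M n n (ac_mat \<rho>) (\<lambda>_. 1)"
        by (rule eq_matI) (auto simp: P_def to_ac_sum carrier_matD[OF R[OF Mc]] intro!: sum.cong)
      then have "map_mat to_ac P * E = mat_comb M n n (\<lambda>x. map_mat to_ac (\<rho> x) * E) (\<lambda>_. 1)"
        using mat_comb_mult[OF E(1), of M "ac_mat \<rho>" n "\<lambda>_. 1"] R Mc by simp
      also have "\<dots> = mat_comb M n n (\<lambda>x. E) (\<lambda>_. 1)"
        by (rule mat_comb_cong) (use act[OF subsetD[OF M(2)]] t E(1) in auto)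
      also have "\<dots> = of_nat (card M) \<cdot>\<^sub>m E"
        by (rule eq_matI) (use E in auto)
      finally have "of_nat (card M) \<cdot>\<^sub>m E = 0\<^sub>m n n"
        unfolding \<open>P = 0\<^sub>m n n\<close> map_mat_zero using E by simp
      moreover have "of_nat (card M) \<noteq> (0 :: 'k alg_closure)"
      proof -
        have "subgroup M (G\<lparr>carrier := A\<rparr>)" using subgroup_incl[OF M.subgroup_axioms A M(2)] .
        then have "card M dvd card A" using group.card_subgroup_dvd[OF subgroup_imp_group[OF A]] by simp
        then have "of_nat (card M) \<noteq> (0 :: 'k)" using inv by (auto elim!: dvdE)
        then have "to_ac (of_nat (card M) :: 'k) \<noteq> 0" by (simp only: to_ac_eq_0_iff not_False_eq_True)
        then show ?thesis by simp
      qed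
      ultimately show False using E
        by (metis (no_types, lifting) carrier_matD(1) carrier_matD(2) eq_matI index_smult_mat(1) index_zero_mat(1) index_zero_mat(2) index_zero_mat(3) mult_eq_0_iff)
    qed
    then have "V = carrier_vec n" using irr sub by (auto simp: irrep_def)
    then have f: "\<rho> x *\<^sub>v v = v" if "x \<in> M" "v \<in> carrier_vec n" for x v using that by (auto simp: V_def)
    show "\<forall>x\<in>M. \<rho> x = 1\<^sub>m n"
    proof
      fix x assume x: "x \<in> M"
      show "\<rho> x = 1\<^sub>m n" by (rule mat_eqI_mult_vec[OF R[OF Mc[OF x]]]) (use f[OF x] in auto)
    qed
  }
qed

section \<open>Counting equivariant homomorphisms\<close>

definition ghom :: "('g, 'm) monoid_scheme \<Rightarrow> 'g set \<Rightarrow> 'g set \<Rightarrow> ('g \<Rightarrow> 'g) set" where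
  "ghom G H W = {f \<in> H \<rightarrow>\<^sub>E W. (\<forall>x\<in>H. \<forall>y\<in>H. f (x \<otimes>\<^bsub>G\<^esub> y) = f x \<otimes>\<^bsub>G\<^esub> f y) \<and>
     (\<forall>g\<in>carrier G. \<forall>x\<in>H. f (g \<otimes>\<^bsub>G\<^esub> x \<otimes>\<^bsub>G\<^esub> inv\<^bsub>G\<^esub> g) = g \<otimes>\<^bsub>G\<^esub> f x \<otimes>\<^bsub>G\<^esub> inv\<^bsub>G\<^esub> g)}"

locale abelian_normal = group G for G (structure) +
  fixes A :: "'a set"
  assumes fin: "finite (carrier G)" and A_normal: "A \<lhd> G" and A_comm: "x \<in> A \<Longrightarrow> y \<in> A \<Longrightarrow> x \<otimes> y = y \<otimes> x"
begin

text \<open>These are the submodules of A over the integral group ring: a subgroup of A is stable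
  under conjugation iff it is normal in G.\<close>

definition gsub :: "'a set \<Rightarrow> bool" where
  "gsub H \<longleftrightarrow> H \<lhd> G \<and> H \<subseteq> A"

definition gsimple :: "'a set \<Rightarrow> bool" where
  "gsimple W \<longleftrightarrow> gsub W \<and> W \<noteq> {\<one>} \<and> (\<forall>M. gsub M \<longrightarrow> M \<subseteq> W \<longrightarrow> M = {\<one>} \<or> M = W)"

lemma A_carrier: "x \<in> A \<Longrightarrow> x \<in> carrier G"
  using normal_imp_subgroup[OF A_normal] subgroup.mem_carrier by fast

lemma gsubD:
  assumes "gsub H"
  shows "H \<subseteq> A" "subgroup H G" "H \<lhd> G" "x \<in> H \<Longrightarrow> x \<in> A" "x \<in> H \<Longrightarrow> x \<in> carrier G" "\<one> \<in> H"
    "x \<in> H \<Longrightarrow> y \<in> H \<Longrightarrow> x \<otimes> y \<in> H" "x \<in> H \<Longrightarrow> inv x \<in> H" "g \<in> carrier G \<Longrightarrow> x \<in> H \<Longrightarrow> g \<otimes> x \<otimes> inv g \<in> H"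
    "finite H"
proof -
  show s: "H \<subseteq> A" "subgroup H G" "H \<lhd> G" using assms by (auto simp: gsub_def normal_imp_subgroup)
  show "x \<in> H \<Longrightarrow> x \<in> A" "x \<in> H \<Longrightarrow> x \<in> carrier G" "\<one> \<in> H"
    "x \<in> H \<Longrightarrow> y \<in> H \<Longrightarrow> x \<otimes> y \<in> H" "x \<in> H \<Longrightarrow> inv x \<in> H"
    using s subgroup.mem_carrier[OF s(2)] subgroup.one_closed[OF s(2)] subgroup.m_closed[OF s(2)] subgroup.m_inv_closed[OF s(2)] by auto
  show "g \<in> carrier G \<Longrightarrow> x \<in> H \<Longrightarrow> g \<otimes> x \<otimes> inv g \<in> H" by (rule normal.inv_op_closed2[OF s(3)])
  show "finite H" using s(2) fin subgroup.subset finite_subset by blast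
qed

lemma gsubI:
  assumes "H \<subseteq> A" "\<one> \<in> H" "\<And>x y. x \<in> H \<Longrightarrow> y \<in> H \<Longrightarrow> x \<otimes> y \<in> H" "\<And>x. x \<in> H \<Longrightarrow> inv x \<in> H"
    "\<And>g x. g \<in> carrier G \<Longrightarrow> x \<in> H \<Longrightarrow> g \<otimes> x \<otimes> inv g \<in> H"
  shows "gsub H"
  unfolding gsub_def
  by (intro conjI normal_invI subgroupI) (use assms A_carrier in auto)

lemma gsub_one: "gsub {\<one>}"
  by (rule gsubI) (use gsubD(6)[of A] A_normal in \<open>auto simp: gsub_def\<close>)

lemma gsub_A: "gsub A" using A_normal by (simp add: gsub_def)

lemma gsub_Int: "gsub H \<Longrightarrow> gsub K \<Longrightarrow> gsub (H \<inter> K)"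
  by (rule gsubI) (auto simp: gsubD)

lemma ghomD:
  assumes "f \<in> ghom G H W"
  shows "x \<in> H \<Longrightarrow> f x \<in> W" "x \<in> H \<Longrightarrow> y \<in> H \<Longrightarrow> f (x \<otimes> y) = f x \<otimes> f y"
    "g \<in> carrier G \<Longrightarrow> x \<in> H \<Longrightarrow> f (g \<otimes> x \<otimes> inv g) = g \<otimes> f x \<otimes> inv g" "f \<in> extensional H"
  using assms by (auto simp: ghom_def PiE_def)

lemma ghomI:
  assumes "\<And>x. x \<in> H \<Longrightarrow> f x \<in> W" "\<And>x y. x \<in> H \<Longrightarrow> y \<in> H \<Longrightarrow> f (x \<otimes> y) = f x \<otimes> f y"
    "\<And>g x. g \<in> carrier G \<Longrightarrow> x \<in> H \<Longrightarrow> f (g \<otimes> x \<otimes> inv g) = g \<otimes> f x \<otimes> inv g" "gsub H"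
  shows "restrict f H \<in> ghom G H W"
  using assms by (auto simp: ghom_def gsubD)

lemma ghom_one:
  assumes "gsub H" "gsub W" "f \<in> ghom G H W"
  shows "f \<one> = \<one>"
proof -
  have "f \<one> = f \<one> \<otimes> f \<one>" using ghomD(2)[OF assms(3), of \<one> \<one>] gsubD(6)[OF assms(1)] by simp
  moreover have "f \<one> \<in> carrier G" using ghomD(1)[OF assms(3)] gsubD(5)[OF assms(2)] gsubD(6)[OF assms(1)] by blast
  ultimately show ?thesis by (metis r_cancel_one')
qed

lemma ghom_inv:
  assumes "gsub H" "gsub W" "f \<in> ghom G H W" "x \<in> H"
  shows "f (inv x) = inv (f x)"
proof -
  have "f (inv x) \<otimes> f x = \<one>"
    using ghomD(2)[OF assms(3), of "inv x" x] ghom_one[OF assms(1-3)] assms gsubD[OF assms(1)] by simp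
  then show ?thesis using assms ghomD(1)[OF assms(3)] gsubD(5)[OF assms(2)] gsubD(8)[OF assms(1)] by (metis inv_equality)
qed

lemma finite_ghom: "gsub H \<Longrightarrow> gsub W \<Longrightarrow> finite (ghom G H W)"
  by (rule finite_subset[of _ "H \<rightarrow>\<^sub>E W"]) (auto simp: ghom_def gsubD intro: finite_PiE)

lemma ghom_eqI:
  assumes "f \<in> ghom G H W" "f' \<in> ghom G H W'" "\<And>x. x \<in> H \<Longrightarrow> f x = f' x"
  shows "f = f'"
  by (rule extensionalityI[of _ H]) (use assms ghomD(4) in auto)

lemma ghom_comp:
  assumes "f \<in> ghom G H W" "h \<in> ghom G W' Z" "W \<subseteq> W'" "gsub H"
  shows "(\<lambda>x\<in>H. h (f x)) \<in> ghom G H Z"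
  by (rule ghomI) (use ghomD[OF assms(1)] ghomD[OF assms(2)] assms(3,4) in \<open>auto simp: subset_iff\<close>)

lemma ghom_restrict:
  assumes "f \<in> ghom G H W" "K \<subseteq> H" "gsub K"
  shows "restrict f K \<in> ghom G K W"
  by (rule ghomI) (use ghomD[OF assms(1)] assms(2,3) in \<open>auto simp: subset_iff\<close>)

lemma ghom_mult:
  assumes "f \<in> ghom G H W" "h \<in> ghom G H W'" "gsub H" "gsub W" "gsub W'" "gsub Z" "W \<subseteq> Z" "W' \<subseteq> Z"
  shows "(\<lambda>x\<in>H. f x \<otimes> h x) \<in> ghom G H Z"
proof (rule ghomI)
  fix x y assume xy: "x \<in> H" "y \<in> H"
  have A: "f x \<in> A" "f y \<in> A" "h x \<in> A" "h y \<in> A"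
    using xy ghomD(1)[OF assms(1)] ghomD(1)[OF assms(2)] gsubD(4)[OF assms(4)] gsubD(4)[OF assms(5)] by auto
  have "h x \<otimes> (f y \<otimes> h y) = f y \<otimes> (h x \<otimes> h y)"
    using A A_comm[OF A(3,2)] A_carrier by (simp add: m_assoc[symmetric])
  then show "f (x \<otimes> y) \<otimes> h (x \<otimes> y) = f x \<otimes> h x \<otimes> (f y \<otimes> h y)"
    using xy ghomD(2)[OF assms(1)] ghomD(2)[OF assms(2)] A A_carrier by (simp add: m_assoc)
next
  fix g x assume gx: "g \<in> carrier G" "x \<in> H"
  have c: "f x \<in> carrier G" "h x \<in> carrier G"
    using gx ghomD(1)[OF assms(1)] ghomD(1)[OF assms(2)] gsubD(5)[OF assms(4)] gsubD(5)[OF assms(5)] by auto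
  have "inv g \<otimes> (g \<otimes> (h x \<otimes> inv g)) = h x \<otimes> inv g" using c gx by (simp add: m_assoc[symmetric])
  then show "f (g \<otimes> x \<otimes> inv g) \<otimes> h (g \<otimes> x \<otimes> inv g) = g \<otimes> (f x \<otimes> h x) \<otimes> inv g"
    using gx ghomD(3)[OF assms(1)] ghomD(3)[OF assms(2)] c by (simp add: m_assoc)
qed (use subsetD[OF assms(7) ghomD(1)[OF assms(1)]] subsetD[OF assms(8) ghomD(1)[OF assms(2)]] assms(3) gsubD(7)[OF assms(6)] in auto)

lemma ghom_inverse:
  assumes "f \<in> ghom G H W" "gsub H" "gsub W"
  shows "(\<lambda>x\<in>H. inv (f x)) \<in> ghom G H W"
proof (rule ghomI)
  fix x y assume xy: "x \<in> H" "y \<in> H"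
  have A: "f x \<in> A" "f y \<in> A"
    using xy ghomD(1)[OF assms(1)] gsubD(4)[OF assms(3)] by auto
  then show "inv (f (x \<otimes> y)) = inv (f x) \<otimes> inv (f y)"
    using xy ghomD(2)[OF assms(1)] A_carrier A_comm by (simp add: inv_mult_group[symmetric])
next
  fix g x assume gx: "g \<in> carrier G" "x \<in> H"
  have c: "f x \<in> carrier G" using gx ghomD(1)[OF assms(1)] gsubD(5)[OF assms(3)] by auto
  then show "inv (f (g \<otimes> x \<otimes> inv g)) = g \<otimes> inv (f x) \<otimes> inv g"
    using gx ghomD(3)[OF assms(1)] by (simp add: inv_mult_group m_assoc)
qed (use ghomD(1)[OF assms(1)] assms gsubD(8)[OF assms(3)] in auto)

lemma gsub_image:
  assumes "f \<in> ghom G H W" "gsub H" "gsub W" "gsub N" "N \<subseteq> H"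
  shows "gsub (f ` N)"
proof (rule gsubI)
  have NH: "x \<in> N \<Longrightarrow> x \<in> H" for x using assms(5) by blast
  show "f ` N \<subseteq> A" using ghomD(1)[OF assms(1)] gsubD(4)[OF assms(3)] NH by auto
  show "\<one> \<in> f ` N" using ghom_one[OF assms(2,3,1)] gsubD(6)[OF assms(4)] by (metis imageI)
  show "u \<otimes> v \<in> f ` N" if uv: "u \<in> f ` N" "v \<in> f ` N" for u v
  proof -
    obtain x y where xy: "x \<in> N" "u = f x" "y \<in> N" "v = f y" using uv by blast
    then have "u \<otimes> v = f (x \<otimes> y)" using ghomD(2)[OF assms(1)] NH by simp
    then show ?thesis using gsubD(7)[OF assms(4) xy(1,3)] by blast
  qed
  show "inv u \<in> f ` N" if u: "u \<in> f ` N" for u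
  proof -
    obtain x where x: "x \<in> N" "u = f x" using u by blast
    then have "inv u = f (inv x)" using ghom_inv[OF assms(2,3,1)] NH by simp
    then show ?thesis using gsubD(8)[OF assms(4) x(1)] by blast
  qed
  show "g \<otimes> u \<otimes> inv g \<in> f ` N" if gu: "g \<in> carrier G" "u \<in> f ` N" for g u
  proof -
    obtain x where x: "x \<in> N" "u = f x" using gu by blast
    then have "g \<otimes> u \<otimes> inv g = f (g \<otimes> x \<otimes> inv g)" using ghomD(3)[OF assms(1) gu(1)] NH by simp
    then show ?thesis using gsubD(9)[OF assms(4) gu(1) x(1)] by blast
  qed
qed

text \<open>Serves to show that two equivariant maps agreeing on generators are equal.\<close>

lemma gsub_equalizer:
  assumes "f \<in> ghom G H W" "h \<in> ghom G H W" "gsub H" "gsub W"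
  shows "gsub {x \<in> H. f x = h x}"
proof (rule gsubI)
  show "{x \<in> H. f x = h x} \<subseteq> A" using gsubD(1)[OF assms(3)] by auto
qed (use gsubD(6-9)[OF assms(3)] ghom_one[OF assms(3,4,1)] ghom_one[OF assms(3,4,2)] ghomD(2,3)[OF assms(1)] ghomD(2,3)[OF assms(2)]
    ghom_inv[OF assms(3,4,1)] ghom_inv[OF assms(3,4,2)] in auto)

lemma trivial_ghom: "gsub H \<Longrightarrow> gsub W \<Longrightarrow> (\<lambda>x\<in>H. \<one>) \<in> ghom G H W"
  by (rule ghomI) (auto simp: gsubD)

lemma gsub_kernel:
  assumes "f \<in> ghom G H W" "gsub H" "gsub W"
  shows "gsub {x \<in> H. f x = \<one>}"
proof -
  have "{x \<in> H. f x = \<one>} = {x \<in> H. f x = (\<lambda>x\<in>H. \<one>) x}" by auto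
  then show ?thesis using gsub_equalizer[OF assms(1) trivial_ghom[OF assms(2,3)] assms(2,3)] by (simp only:)
qed

lemma ghom_inj_onI:
  assumes "f \<in> ghom G H W" "gsub H" "gsub W" "gsub N" "N \<subseteq> H" "\<And>x. x \<in> N \<Longrightarrow> f x = \<one> \<Longrightarrow> x = \<one>"
  shows "inj_on f N"
proof (rule inj_onI)
  fix x y assume xy: "x \<in> N" "y \<in> N" "f x = f y"
  have N: "x \<otimes> inv y \<in> N" using xy gsubD[OF assms(4)] by auto
  have "f (x \<otimes> inv y) = f x \<otimes> inv (f y)"
    using xy assms(5) ghomD(2)[OF assms(1)] ghom_inv[OF assms(2,3,1)] gsubD(8)[OF assms(2)] by (simp add: subset_iff)
  also have "\<dots> = \<one>" using xy ghomD(1)[OF assms(1), of y] assms(5) gsubD(5)[OF assms(3)] by auto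
  finally have "x \<otimes> inv y = \<one>" using assms(6)[OF N] by simp
  then show "x = y" using xy gsubD(5)[OF assms(4)] by (metis inv_closed inv_equality inv_inv)
qed

lemma ghom_inv_into:
  assumes f: "f \<in> ghom G H W" and "gsub H" "gsub W" and N: "gsub N" "N \<subseteq> H" "inj_on f N"
  shows "(\<lambda>w\<in>f ` N. inv_into N f w) \<in> ghom G (f ` N) N"
proof -
  have e: "inv_into N f w = x" if "x \<in> N" "f x = w" for x w using inv_into_f_f[OF N(3) that(1)] that(2) by simp
  show ?thesis
  proof (rule ghomI)
    show "gsub (f ` N)" by (rule gsub_image[OF assms(1-3) N(1,2)])
    show "inv_into N f x \<in> N" if "x \<in> f ` N" for x by (rule inv_into_into[OF that])
    show "inv_into N f (u \<otimes> v) = inv_into N f u \<otimes> inv_into N f v" if uv: "u \<in> f ` N" "v \<in> f ` N" for u v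
    proof -
      obtain x y where xy: "x \<in> N" "u = f x" "y \<in> N" "v = f y" using uv by blast
      show ?thesis using xy e[of x u] e[of y v] N ghomD(2)[OF f, of x y] gsubD(7)[OF N(1)] by (intro e) auto
    qed
    show "inv_into N f (g \<otimes> u \<otimes> inv g) = g \<otimes> inv_into N f u \<otimes> inv g" if gu: "g \<in> carrier G" "u \<in> f ` N" for g u
    proof -
      obtain x where x: "x \<in> N" "u = f x" using gu by blast
      show ?thesis using x gu e[of x u] N ghomD(3)[OF f gu(1), of x] gsubD(9)[OF N(1) gu(1)] by (intro e) auto
    qed
  qed
qed

section \<open>Internal direct products of submodules\<close>

lemma gsub_set_mult:
  assumes H: "gsub H" and V: "gsub V"
  shows "gsub (H <#> V)" "H \<subseteq> H <#> V" "V \<subseteq> H <#> V"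
proof -
  have I: "x \<otimes> y \<in> H <#> V" if "x \<in> H" "y \<in> V" for x y using that by (auto simp: set_mult_def)
  have E: "\<exists>x\<in>H. \<exists>y\<in>V. z = x \<otimes> y" if "z \<in> H <#> V" for z using that by (auto simp: set_mult_def)
  have c: "x \<otimes> y = y \<otimes> x" if "x \<in> H" "y \<in> V" for x y
    using that A_comm gsubD(4)[OF H] gsubD(4)[OF V] by blast
  show "gsub (H <#> V)"
  proof (rule gsubI)
    show "H <#> V \<subseteq> A" using gsubD(4)[OF H] gsubD(4)[OF V] gsubD(7)[OF gsub_A] by (auto simp: set_mult_def)
    show "\<one> \<in> H <#> V" using I[OF gsubD(6)[OF H] gsubD(6)[OF V]] by simp
    show "a \<otimes> b \<in> H <#> V" if ab: "a \<in> H <#> V" "b \<in> H <#> V" for a b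
    proof -
      obtain x y x' y' where x: "x \<in> H" "y \<in> V" "a = x \<otimes> y" "x' \<in> H" "y' \<in> V" "b = x' \<otimes> y'" using E ab by metis
      have cc: "x \<in> carrier G" "y \<in> carrier G" "x' \<in> carrier G" "y' \<in> carrier G" using x gsubD(5)[OF H] gsubD(5)[OF V] by auto
      have "y \<otimes> (x' \<otimes> y') = x' \<otimes> (y \<otimes> y')" using c[OF x(4,2)] cc by (simp add: m_assoc[symmetric])
      then have "a \<otimes> b = (x \<otimes> x') \<otimes> (y \<otimes> y')" using x cc by (simp add: m_assoc)
      then show ?thesis using I x gsubD(7)[OF H] gsubD(7)[OF V] by simp
    qed
    show "inv a \<in> H <#> V" if a: "a \<in> H <#> V" for a
    proof -
      obtain x y where x: "x \<in> H" "y \<in> V" "a = x \<otimes> y" using E a by metis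
      have "inv a = inv x \<otimes> inv y" using x c[OF x(1,2)] gsubD(5)[OF H x(1)] gsubD(5)[OF V x(2)] by (simp add: inv_mult_group)
      then show ?thesis using I x gsubD(8)[OF H] gsubD(8)[OF V] by simp
    qed
    show "g \<otimes> a \<otimes> inv g \<in> H <#> V" if ga: "g \<in> carrier G" "a \<in> H <#> V" for g a
    proof -
      obtain x y where x: "x \<in> H" "y \<in> V" "a = x \<otimes> y" using E ga by metis
      have cc: "x \<in> carrier G" "y \<in> carrier G" using x gsubD(5)[OF H] gsubD(5)[OF V] by auto
      have "inv g \<otimes> (g \<otimes> (y \<otimes> inv g)) = y \<otimes> inv g" using cc ga by (simp add: m_assoc[symmetric])
      then have "g \<otimes> a \<otimes> inv g = (g \<otimes> x \<otimes> inv g) \<otimes> (g \<otimes> y \<otimes> inv g)" using x cc ga by (simp add: m_assoc)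
      then show ?thesis using I x gsubD(9)[OF H ga(1)] gsubD(9)[OF V ga(1)] by simp
    qed
  qed
  show "H \<subseteq> H <#> V"
  proof
    fix x assume "x \<in> H"
    then show "x \<in> H <#> V" using I[of x \<one>] gsubD(5)[OF H] gsubD(6)[OF V] by simp
  qed
  show "V \<subseteq> H <#> V"
  proof
    fix x assume "x \<in> V"
    then show "x \<in> H <#> V" using I[of \<one> x] gsubD(5)[OF V] gsubD(6)[OF H] by simp
  qed
qed

text \<open>The factorization of z into H and V is unique because they meet trivially; uniqueness
  makes both components homomorphic and equivariant.\<close>

lemma projections:
  assumes H: "gsub H" and V: "gsub V" and HV: "H \<inter> V = {\<one>}"
  obtains p q where "p \<in> ghom G (H <#> V) H" "q \<in> ghom G (H <#> V) V"
    "\<And>z. z \<in> H <#> V \<Longrightarrow> z = p z \<otimes> q z" "\<And>x. x \<in> H \<Longrightarrow> p x = x" "\<And>x. x \<in> H \<Longrightarrow> q x = \<one>"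
    "\<And>x. x \<in> V \<Longrightarrow> p x = \<one>" "\<And>x. x \<in> V \<Longrightarrow> q x = x"
proof -
  let ?S = "H <#> V"
  note S = gsub_set_mult[OF H V]
  have c: "x \<otimes> y = y \<otimes> x" if "x \<in> H" "y \<in> V" for x y
    using that A_comm gsubD(4)[OF H] gsubD(4)[OF V] by blast
  have "\<forall>z\<in>?S. \<exists>xy. fst xy \<in> H \<and> snd xy \<in> V \<and> z = fst xy \<otimes> snd xy" by (force simp: set_mult_def)
  from bchoice[OF this] obtain w where w: "\<And>z. z \<in> ?S \<Longrightarrow> fst (w z) \<in> H \<and> snd (w z) \<in> V \<and> z = fst (w z) \<otimes> snd (w z)" by blast
  have u: "fst (w z) = x \<and> snd (w z) = y" if z: "z \<in> ?S" "x \<in> H" "y \<in> V" "z = x \<otimes> y" for x y z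
  proof -
    let ?x = "fst (w z)" and ?y = "snd (w z)"
    have m: "?x \<in> H" "?y \<in> V" "?x \<otimes> ?y = x \<otimes> y" using w[OF z(1)] z(4) by auto
    have cc: "x \<in> carrier G" "y \<in> carrier G" "?x \<in> carrier G" "?y \<in> carrier G" using z m gsubD(5)[OF H] gsubD(5)[OF V] by auto
    have "inv x \<otimes> ?x = inv x \<otimes> (?x \<otimes> ?y) \<otimes> inv ?y" using cc by (simp add: m_assoc)
    also have "\<dots> = y \<otimes> inv ?y" unfolding m(3) using cc by (simp add: m_assoc[symmetric])
    finally have e: "inv x \<otimes> ?x = y \<otimes> inv ?y" .
    moreover have "inv x \<otimes> ?x \<in> H" "y \<otimes> inv ?y \<in> V" using z m gsubD[OF H] gsubD[OF V] by auto
    ultimately have "inv x \<otimes> ?x \<in> H \<inter> V" by simp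
    then have "inv x \<otimes> ?x = \<one>" unfolding HV by simp
    then have "?x = x" using cc by (metis inv_closed inv_equality inv_inv)
    then show ?thesis using m(3) cc by simp
  qed
  let ?p = "\<lambda>z\<in>?S. fst (w z)" and ?q = "\<lambda>z\<in>?S. snd (w z)"
  have hom: "fst (w (a \<otimes> b)) = fst (w a) \<otimes> fst (w b) \<and> snd (w (a \<otimes> b)) = snd (w a) \<otimes> snd (w b)" if ab: "a \<in> ?S" "b \<in> ?S" for a b
  proof (rule u)
    let ?x = "fst (w a)" and ?y = "snd (w a)" and ?x' = "fst (w b)" and ?y' = "snd (w b)"
    have cc: "?x \<in> carrier G" "?y \<in> carrier G" "?x' \<in> carrier G" "?y' \<in> carrier G"
      using w[OF ab(1)] w[OF ab(2)] gsubD(5)[OF H] gsubD(5)[OF V] by auto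
    have "?x' \<otimes> ?y = ?y \<otimes> ?x'" using c w ab by blast
    then have "?y \<otimes> (?x' \<otimes> ?y') = ?x' \<otimes> (?y \<otimes> ?y')" using cc by (simp add: m_assoc[symmetric])
    then have "(?x \<otimes> ?y) \<otimes> (?x' \<otimes> ?y') = (?x \<otimes> ?x') \<otimes> (?y \<otimes> ?y')" using cc by (simp add: m_assoc)
    then show "a \<otimes> b = (?x \<otimes> ?x') \<otimes> (?y \<otimes> ?y')" using w[OF ab(1)] w[OF ab(2)] by metis
  qed (use w ab gsubD(7)[OF H] gsubD(7)[OF V] gsubD(7)[OF S(1)] in auto)
  have cj: "fst (w (g \<otimes> a \<otimes> inv g)) = g \<otimes> fst (w a) \<otimes> inv g \<and> snd (w (g \<otimes> a \<otimes> inv g)) = g \<otimes> snd (w a) \<otimes> inv g"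
    if ga: "g \<in> carrier G" "a \<in> ?S" for g a
  proof (rule u)
    let ?x = "fst (w a)" and ?y = "snd (w a)"
    have cc: "?x \<in> carrier G" "?y \<in> carrier G" using w[OF ga(2)] gsubD(5)[OF H] gsubD(5)[OF V] by auto
    have "inv g \<otimes> (g \<otimes> (?y \<otimes> inv g)) = ?y \<otimes> inv g" using cc ga by (simp add: m_assoc[symmetric])
    then have "g \<otimes> (?x \<otimes> ?y) \<otimes> inv g = (g \<otimes> ?x \<otimes> inv g) \<otimes> (g \<otimes> ?y \<otimes> inv g)" using cc ga by (simp add: m_assoc)
    then show "g \<otimes> a \<otimes> inv g = (g \<otimes> ?x \<otimes> inv g) \<otimes> (g \<otimes> ?y \<otimes> inv g)" using w[OF ga(2)] by metis
  qed (use w ga gsubD(9)[OF H] gsubD(9)[OF V] gsubD(9)[OF S(1)] in auto)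
  show ?thesis
  proof (rule that[of ?p ?q])
    show "?p \<in> ghom G ?S H" by (rule ghomI) (use w hom cj S(1) in auto)
    show "?q \<in> ghom G ?S V" by (rule ghomI) (use w hom cj S(1) in auto)
    show "z = ?p z \<otimes> ?q z" if "z \<in> ?S" for z using w that by simp
    show "?p x = x" if "x \<in> H" for x using u[of x x \<one>] that S(2) gsubD(5)[OF H] gsubD(6)[OF V] by auto
    show "?q x = \<one>" if "x \<in> H" for x using u[of x x \<one>] that S(2) gsubD(5)[OF H] gsubD(6)[OF V] by auto
    show "?p x = \<one>" if "x \<in> V" for x using u[of x \<one> x] that S(3) gsubD(5)[OF V] gsubD(6)[OF H] by auto
    show "?q x = x" if "x \<in> V" for x using u[of x \<one> x] that S(3) gsubD(5)[OF V] gsubD(6)[OF H] by auto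
  qed
qed

text \<open>A homomorphism into a direct product is its pair of components. Together with the count
  for the other argument this carries the symmetry of Hom counts from the factors to their
  product.\<close>

lemma card_ghom_into_product:
  assumes H: "gsub H" and V: "gsub V" and HV: "H \<inter> V = {\<one>}" and W: "gsub W"
  shows "card (ghom G W (H <#> V)) = card (ghom G W H) * card (ghom G W V)"
proof -
  note S = gsub_set_mult[OF H V]
  obtain p q where p: "p \<in> ghom G (H <#> V) H" and q: "q \<in> ghom G (H <#> V) V"
    and pq: "\<And>z. z \<in> H <#> V \<Longrightarrow> z = p z \<otimes> q z" "\<And>x. x \<in> H \<Longrightarrow> p x = x" "\<And>x. x \<in> H \<Longrightarrow> q x = \<one>"
    "\<And>x. x \<in> V \<Longrightarrow> p x = \<one>" "\<And>x. x \<in> V \<Longrightarrow> q x = x" by (rule projections[OF H V HV]) (rule that; assumption)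
  have "card (ghom G W (H <#> V)) = card (ghom G W H \<times> ghom G W V)"
  proof (rule bij_betw_same_card[OF bij_betw_byWitness[where f = "\<lambda>f. (\<lambda>x\<in>W. p (f x), \<lambda>x\<in>W. q (f x))" and f' = "\<lambda>(f, h). \<lambda>x\<in>W. f x \<otimes> h x"]])
    show "\<forall>f\<in>ghom G W (H <#> V). (\<lambda>(f, h). \<lambda>x\<in>W. f x \<otimes> h x) (\<lambda>x\<in>W. p (f x), \<lambda>x\<in>W. q (f x)) = f"
    proof
      fix f assume f: "f \<in> ghom G W (H <#> V)"
      show "(\<lambda>(f, h). \<lambda>x\<in>W. f x \<otimes> h x) (\<lambda>x\<in>W. p (f x), \<lambda>x\<in>W. q (f x)) = f"
        by (rule extensionalityI[of _ W]) (use ghomD(4)[OF f] ghomD(1)[OF f] pq(1)[symmetric] in auto)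
    qed
    have hom: "p (x \<otimes> y) = x \<and> q (x \<otimes> y) = y" if "x \<in> H" "y \<in> V" for x y
      using that ghomD(2)[OF p, of x y] ghomD(2)[OF q, of x y] pq S(2,3) gsubD(5)[OF H] gsubD(5)[OF V] by (auto simp: subset_iff)
    show "\<forall>fh\<in>ghom G W H \<times> ghom G W V. (\<lambda>f. (\<lambda>x\<in>W. p (f x), \<lambda>x\<in>W. q (f x))) ((\<lambda>(f, h). \<lambda>x\<in>W. f x \<otimes> h x) fh) = fh"
    proof
      fix fh assume "fh \<in> ghom G W H \<times> ghom G W V"
      then obtain f h where fh: "fh = (f, h)" and f: "f \<in> ghom G W H" and h: "h \<in> ghom G W V" by auto
      have "(\<lambda>x\<in>W. p ((\<lambda>x\<in>W. f x \<otimes> h x) x)) = f"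
        by (rule extensionalityI[of _ W]) (use ghomD(4)[OF f] ghomD(1)[OF f] ghomD(1)[OF h] hom in auto)
      moreover have "(\<lambda>x\<in>W. q ((\<lambda>x\<in>W. f x \<otimes> h x) x)) = h"
        by (rule extensionalityI[of _ W]) (use ghomD(4)[OF h] ghomD(1)[OF f] ghomD(1)[OF h] hom in auto)
      ultimately show "(\<lambda>f. (\<lambda>x\<in>W. p (f x), \<lambda>x\<in>W. q (f x))) ((\<lambda>(f, h). \<lambda>x\<in>W. f x \<otimes> h x) fh) = fh"
        unfolding fh prod.case by simp
    qed
    show "(\<lambda>f. (\<lambda>x\<in>W. p (f x), \<lambda>x\<in>W. q (f x))) ` ghom G W (H <#> V) \<subseteq> ghom G W H \<times> ghom G W V"
      using ghom_comp[OF _ p _ W] ghom_comp[OF _ q _ W] by auto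
    show "(\<lambda>(f, h). \<lambda>x\<in>W. f x \<otimes> h x) ` (ghom G W H \<times> ghom G W V) \<subseteq> ghom G W (H <#> V)"
      using ghom_mult[OF _ _ W H V S(1) S(2,3)] by auto
  qed
  then show ?thesis by (simp add: card_cartesian_product)
qed

lemma card_ghom_from_product:
  assumes H: "gsub H" and V: "gsub V" and HV: "H \<inter> V = {\<one>}" and W: "gsub W"
  shows "card (ghom G (H <#> V) W) = card (ghom G H W) * card (ghom G V W)"
proof -
  let ?S = "H <#> V"
  note S = gsub_set_mult[OF H V]
  obtain p q where p: "p \<in> ghom G (H <#> V) H" and q: "q \<in> ghom G (H <#> V) V"
    and pq: "\<And>z. z \<in> H <#> V \<Longrightarrow> z = p z \<otimes> q z" "\<And>x. x \<in> H \<Longrightarrow> p x = x" "\<And>x. x \<in> H \<Longrightarrow> q x = \<one>"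
    "\<And>x. x \<in> V \<Longrightarrow> p x = \<one>" "\<And>x. x \<in> V \<Longrightarrow> q x = x" by (rule projections[OF H V HV]) (rule that; assumption)
  have "card (ghom G ?S W) = card (ghom G H W \<times> ghom G V W)"
  proof (rule bij_betw_same_card[OF bij_betw_byWitness[where f = "\<lambda>f. (restrict f H, restrict f V)" and f' = "\<lambda>(f, h). \<lambda>x\<in>?S. f (p x) \<otimes> h (q x)"]])
    show "\<forall>f\<in>ghom G ?S W. (\<lambda>(f, h). \<lambda>x\<in>?S. f (p x) \<otimes> h (q x)) (restrict f H, restrict f V) = f"
    proof
      fix f assume f: "f \<in> ghom G ?S W"
      show "(\<lambda>(f, h). \<lambda>x\<in>?S. f (p x) \<otimes> h (q x)) (restrict f H, restrict f V) = f"
      proof (rule extensionalityI[of _ ?S])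
        fix x assume x: "x \<in> ?S"
        have "p x \<in> H" "q x \<in> V" using ghomD(1)[OF p x] ghomD(1)[OF q x] by auto
        then show "(\<lambda>(f, h). \<lambda>x\<in>?S. f (p x) \<otimes> h (q x)) (restrict f H, restrict f V) x = f x"
          using x ghomD(2)[OF f, of "p x" "q x"] S(2,3) pq(1)[OF x] by (simp add: subset_iff)
      qed (use ghomD(4)[OF f] in auto)
    qed
    show "\<forall>fh\<in>ghom G H W \<times> ghom G V W. (restrict ((\<lambda>(f, h). \<lambda>x\<in>?S. f (p x) \<otimes> h (q x)) fh) H, restrict ((\<lambda>(f, h). \<lambda>x\<in>?S. f (p x) \<otimes> h (q x)) fh) V) = fh"
    proof
      fix fh assume "fh \<in> ghom G H W \<times> ghom G V W"
      then obtain f h where fh: "fh = (f, h)" and f: "f \<in> ghom G H W" and h: "h \<in> ghom G V W" by auto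
      have o: "f \<one> = \<one>" "h \<one> = \<one>" using ghom_one[OF H W f] ghom_one[OF V W h] by auto
      have "restrict (\<lambda>x\<in>?S. f (p x) \<otimes> h (q x)) H = f"
        by (rule extensionalityI[of _ H]) (use ghomD(4)[OF f] ghomD(1)[OF f] gsubD(5)[OF W] pq o S(2) in auto)
      moreover have "restrict (\<lambda>x\<in>?S. f (p x) \<otimes> h (q x)) V = h"
        by (rule extensionalityI[of _ V]) (use ghomD(4)[OF h] ghomD(1)[OF h] gsubD(5)[OF W] pq o S(3) in auto)
      ultimately show "(restrict ((\<lambda>(f, h). \<lambda>x\<in>?S. f (p x) \<otimes> h (q x)) fh) H, restrict ((\<lambda>(f, h). \<lambda>x\<in>?S. f (p x) \<otimes> h (q x)) fh) V) = fh"
        unfolding fh prod.case by simp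
    qed
    show "(\<lambda>f. (restrict f H, restrict f V)) ` ghom G ?S W \<subseteq> ghom G H W \<times> ghom G V W"
      using ghom_restrict[OF _ S(2) H] ghom_restrict[OF _ S(3) V] by auto
    show "(\<lambda>(f, h). \<lambda>x\<in>?S. f (p x) \<otimes> h (q x)) ` (ghom G H W \<times> ghom G V W) \<subseteq> ghom G ?S W"
    proof (rule image_subsetI)
      fix fh assume "fh \<in> ghom G H W \<times> ghom G V W"
      then obtain f h where fh: "fh = (f, h)" and f: "f \<in> ghom G H W" and h: "h \<in> ghom G V W" by auto
      have "(\<lambda>x\<in>?S. (\<lambda>x\<in>?S. f (p x)) x \<otimes> (\<lambda>x\<in>?S. h (q x)) x) \<in> ghom G ?S W"
        by (rule ghom_mult[OF ghom_comp[OF p f _ S(1)] ghom_comp[OF q h _ S(1)] S(1) W W W]) auto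
      moreover have "(\<lambda>x\<in>?S. (\<lambda>x\<in>?S. f (p x)) x \<otimes> (\<lambda>x\<in>?S. h (q x)) x) = (\<lambda>x\<in>?S. f (p x) \<otimes> h (q x))" by (rule ext) simp
      ultimately show "(\<lambda>(f, h). \<lambda>x\<in>?S. f (p x) \<otimes> h (q x)) fh \<in> ghom G ?S W" unfolding fh prod.case by simp
    qed
  qed
  then show ?thesis by (simp add: card_cartesian_product)
qed

section \<open>Simple submodules\<close>

lemma gsimpleD:
  assumes "gsimple W"
  shows "gsub W" "W \<noteq> {\<one>}" "gsub M \<Longrightarrow> M \<subseteq> W \<Longrightarrow> M = {\<one>} \<or> M = W"
  using assms by (auto simp: gsimple_def)

text \<open>Schur's lemma: kernel and image are submodules, and simplicity leaves only the extreme
  choices for them.\<close>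

lemma ghom_simple_bij:
  assumes V: "gsimple V" and W: "gsimple W" and f: "f \<in> ghom G V W" and nt: "f \<noteq> (\<lambda>x\<in>V. \<one>)"
  shows "inj_on f V" "f ` V = W"
proof -
  note v = gsimpleD[OF V] and w = gsimpleD[OF W]
  have "{x \<in> V. f x = \<one>} \<noteq> V"
  proof
    assume "{x \<in> V. f x = \<one>} = V"
    then have "f = (\<lambda>x\<in>V. \<one>)" by (intro ghom_eqI[OF f trivial_ghom[OF v(1) w(1)]]) auto
    then show False using nt by simp
  qed
  then have k: "{x \<in> V. f x = \<one>} = {\<one>}" using v(3)[OF gsub_kernel[OF f v(1) w(1)]] by blast
  show inj: "inj_on f V" by (rule ghom_inj_onI[OF f v(1) w(1) v(1)]) (use k in auto)
  have "f ` V \<noteq> {\<one>}"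
  proof
    assume "f ` V = {\<one>}"
    then have "{x \<in> V. f x = \<one>} = V" by auto
    then show False using k v(2) by simp
  qed
  then show "f ` V = W" using w(3)[OF gsub_image[OF f v(1) w(1) v(1)]] ghomD(1)[OF f] by blast
qed

text \<open>Nontrivial homomorphisms between simple modules are invertible and inversion is
  injective; the trivial one is matched with the trivial one. An inequality suffices, as V and W may
  be exchanged.\<close>

lemma card_ghom_simple_le:
  assumes V: "gsimple V" and W: "gsimple W"
  shows "card (ghom G V W) \<le> card (ghom G W V)"
proof (rule card_inj_on_le)
  note v = gsimpleD[OF V] and w = gsimpleD[OF W]
  let ?t = "\<lambda>x\<in>V. \<one>"
  let ?\<phi> = "\<lambda>f. if f = ?t then (\<lambda>x\<in>W. \<one>) else (\<lambda>x\<in>W. inv_into V f x)"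
  show "finite (ghom G W V)" by (rule finite_ghom[OF w(1) v(1)])
  show "?\<phi> ` ghom G V W \<subseteq> ghom G W V"
  proof clarify
    fix f assume f: "f \<in> ghom G V W"
    show "?\<phi> f \<in> ghom G W V"
    proof (cases "f = ?t")
      case False
      then show ?thesis using ghom_inv_into[OF f v(1) w(1) v(1)] ghom_simple_bij[OF V W f False] by simp
    qed (use trivial_ghom[OF w(1) v(1)] in simp)
  qed
  have nt: "(\<lambda>x\<in>W. inv_into V f x) \<noteq> (\<lambda>x\<in>W. \<one>)" if f: "f \<in> ghom G V W" "f \<noteq> ?t" for f
  proof
    assume e: "(\<lambda>x\<in>W. inv_into V f x) = (\<lambda>x\<in>W. \<one>)"
    have "w = \<one>" if ww: "w \<in> W" for w
    proof -
      have "inv_into V f w = \<one>" using fun_cong[OF e, of w] ww by simp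
      moreover have "f (inv_into V f w) = w" using ww ghom_simple_bij(2)[OF V W f] by (simp add: f_inv_into_f)
      ultimately show ?thesis using ghom_one[OF v(1) w(1) f(1)] by simp
    qed
    then show False using w(2) gsubD(6)[OF w(1)] by blast
  qed
  show "inj_on ?\<phi> (ghom G V W)"
  proof (rule inj_onI)
    fix f h assume f: "f \<in> ghom G V W" and h: "h \<in> ghom G V W" and e: "?\<phi> f = ?\<phi> h"
    show "f = h"
    proof (cases "f = ?t \<or> h = ?t")
      case True
      then show ?thesis using e nt[OF f] nt[OF h] by (metis (full_types))
    next
      case False
      then have e': "(\<lambda>x\<in>W. inv_into V f x) = (\<lambda>x\<in>W. inv_into V h x)" using e by simp
      show ?thesis
      proof (rule ghom_eqI[OF f h])
        fix x assume x: "x \<in> V"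
        have fx: "f x \<in> W" using ghomD(1)[OF f x] .
        have "x = inv_into V f (f x)" using ghom_simple_bij(1)[OF V W f] False x by simp
        also have "\<dots> = inv_into V h (f x)" using fun_cong[OF e', of "f x"] fx by simp
        finally have "h x = h (inv_into V h (f x))" by simp
        also have "\<dots> = f x" using ghom_simple_bij(2)[OF V W h] False fx by (simp add: f_inv_into_f)
        finally show "f x = h x" by simp
      qed
    qed
  qed
qed

lemma card_ghom_simple: "gsimple V \<Longrightarrow> gsimple W \<Longrightarrow> card (ghom G V W) = card (ghom G W V)"
  by (intro antisym card_ghom_simple_le)

lemma simple_Int:
  assumes "gsub H" "gsimple W" "\<not> W \<subseteq> H"
  shows "H \<inter> W = {\<one>}"
  using gsimpleD(3)[OF assms(2), of "H \<inter> W"] gsub_Int[OF assms(1) gsimpleD(1)[OF assms(2)]] assms(3) by blast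

end

section \<open>Generators and systems of characters\<close>

context abelian_normal
begin

lemma gsub_comm_group:
  assumes "gsub H"
  shows "comm_group (G\<lparr>carrier := H\<rparr>)"
  by (rule group.group_comm_groupI[OF subgroup_imp_group[OF gsubD(2)[OF assms]]])
    (use A_comm gsubD(4)[OF assms] in auto)

lemma gsub_card_nonzero:
  assumes "gsub H" "of_nat (card A) \<noteq> (0 :: 'k::field)"
  shows "of_nat (card H) \<noteq> (0 :: 'k)"
proof -
  have "subgroup H (G\<lparr>carrier := A\<rparr>)" using subgroup_incl[OF gsubD(2) gsubD(2) gsubD(1)] assms(1) gsub_A by blast
  then have "card H dvd card A" using group.card_subgroup_dvd[OF subgroup_imp_group[OF gsubD(2)[OF gsub_A]]] by simp
  then show ?thesis using assms(2) by (auto elim!: dvdE)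
qed

lemma card_chars_gsub:
  assumes "gsub H" "of_nat (card A) \<noteq> (0 :: 'k::alg_closed_field)"
  shows "card (chars G H :: ('a \<Rightarrow> 'k) set) = card H"
proof -
  interpret H: comm_group "G\<lparr>carrier := H\<rparr>" by (rule gsub_comm_group[OF assms(1)])
  show ?thesis using H.card_chars[where 'k = 'k] gsubD(10)[OF assms(1)] gsub_card_nonzero[OF assms] by simp
qed

lemma chars_comp:
  assumes "f \<in> ghom G H W" "\<chi> \<in> chars G W'" "W \<subseteq> W'" "gsub H" "gsub W"
  shows "(\<lambda>x\<in>H. \<chi> (f x)) \<in> chars G H"
  using ghomD(1,2)[OF assms(1)] charsD(1,2)[OF assms(2)] assms(3) gsubD(6,7)[OF assms(4)] ghom_one[OF assms(4,5,1)]
  by (simp add: chars_def subset_iff)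

definition gens :: "nat \<Rightarrow> 'a set \<Rightarrow> bool" where
  "gens r H \<longleftrightarrow> (\<exists>a. (\<forall>i<r. a i \<in> H) \<and> (\<forall>N. gsub N \<longrightarrow> (\<forall>i<r. a i \<in> N) \<longrightarrow> H \<subseteq> N))"

text \<open>The dual of \<open>gens\<close>: there no proper submodule contains all generators, here
  no nontrivial one is killed by all characters.\<close>

definition char_system :: "nat \<Rightarrow> 'a set \<Rightarrow> (nat \<Rightarrow> 'a \<Rightarrow> 'k::field) \<Rightarrow> bool" where
  "char_system r H \<chi> \<longleftrightarrow> (\<forall>i<r. \<chi> i \<in> chars G H) \<and>
     (\<forall>M. gsub M \<longrightarrow> M \<subseteq> H \<longrightarrow> (\<forall>i<r. \<forall>x\<in>M. \<chi> i x = 1) \<longrightarrow> M = {\<one>})"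

text \<open>Evaluation at the generators is injective on homomorphisms: the set where two of them
  agree is a submodule containing the generators.\<close>

lemma gens_imp_card_ghom_le:
  assumes g: "gens r A" and W: "gsub W"
  shows "card (ghom G A W) \<le> card W ^ r"
proof -
  obtain a where a: "\<And>i. i < r \<Longrightarrow> a i \<in> A" "\<And>N. gsub N \<Longrightarrow> (\<forall>i<r. a i \<in> N) \<Longrightarrow> A \<subseteq> N"
    using g by (auto simp: gens_def)
  have "card (ghom G A W) \<le> card ({..<r} \<rightarrow>\<^sub>E W)"
  proof (rule card_inj_on_le)
    let ?\<phi> = "\<lambda>f. \<lambda>i\<in>{..<r}. f (a i)"
    show "inj_on ?\<phi> (ghom G A W)"
    proof (rule inj_onI)
      fix f h assume f: "f \<in> ghom G A W" and h: "h \<in> ghom G A W" and e: "?\<phi> f = ?\<phi> h"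
      have "a i \<in> {x \<in> A. f x = h x}" if "i < r" for i
        using fun_cong[OF e, of i] a(1)[OF that] that by simp
      then have "A \<subseteq> {x \<in> A. f x = h x}" using a(2)[OF gsub_equalizer[OF f h gsub_A W]] by blast
      then show "f = h" by (intro ghom_eqI[OF f h]) auto
    qed
    show "?\<phi> ` ghom G A W \<subseteq> {..<r} \<rightarrow>\<^sub>E W"
      using a(1) by (intro image_subsetI) (simp add: restrict_PiE_iff ghomD(1))
    show "finite ({..<r} \<rightarrow>\<^sub>E W)" by (rule finite_PiE) (use gsubD(10)[OF W] in auto)
  qed
  also have "\<dots> = card W ^ r" by (simp add: card_PiE)
  finally show ?thesis .
qed

text \<open>Dually, f is determined by the r pulled back characters \<open>\<chi> i (f x)\<close>,
  and W has exactly card W characters.\<close>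

lemma char_system_imp_card_ghom_le:
  fixes \<chi> :: "nat \<Rightarrow> 'a \<Rightarrow> 'k::alg_closed_field"
  assumes c: "char_system r A \<chi>" and W: "gsub W" and inv: "of_nat (card A) \<noteq> (0 :: 'k)"
  shows "card (ghom G W A) \<le> card W ^ r"
proof -
  have c1: "\<And>i. i < r \<Longrightarrow> \<chi> i \<in> chars G A"
    and c2: "\<And>M. gsub M \<Longrightarrow> \<forall>i<r. \<forall>x\<in>M. \<chi> i x = 1 \<Longrightarrow> M = {\<one>}"
    using c gsubD(1) unfolding char_system_def by blast+
  let ?X = "chars G W :: ('a \<Rightarrow> 'k) set"
  have fX: "finite ?X" by (rule finite_chars[OF fin gsubD(2)[OF W]])
  have "card (ghom G W A) \<le> card ({..<r} \<rightarrow>\<^sub>E ?X)"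
  proof (rule card_inj_on_le)
    let ?\<phi> = "\<lambda>f. \<lambda>i\<in>{..<r}. \<lambda>x\<in>W. \<chi> i (f x)"
    show "inj_on ?\<phi> (ghom G W A)"
    proof (rule inj_onI)
      fix f h assume f: "f \<in> ghom G W A" and h: "h \<in> ghom G W A" and e: "?\<phi> f = ?\<phi> h"
      \<comment> \<open>The quotient of f by h: its image is a submodule killed by all characters of
        the system, hence trivial.\<close>
      have d: "(\<lambda>x\<in>W. f x \<otimes> (\<lambda>x\<in>W. inv (h x)) x) \<in> ghom G W A" (is "?d \<in> _")
        by (rule ghom_mult[OF f ghom_inverse[OF h W gsub_A] W gsub_A gsub_A gsub_A]) auto
      have "?d ` W = {\<one>}"
      proof (rule c2)
        show "gsub (?d ` W)" by (rule gsub_image[OF d W gsub_A W]) simp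
        show "\<forall>i<r. \<forall>x\<in>?d ` W. \<chi> i x = 1"
        proof (intro allI impI ballI)
          fix i z assume i: "i < r" and "z \<in> ?d ` W"
          then obtain x where x: "x \<in> W" "z = f x \<otimes> inv (h x)" by auto
          have "\<chi> i (f x) = \<chi> i (h x)" using fun_cong[OF fun_cong[OF e, of i], of x] i x by simp
          then have "\<chi> i z = \<chi> i (h x) * \<chi> i (inv (h x))"
            using x charsD(1)[OF c1[OF i]] ghomD(1)[OF f] ghomD(1)[OF h] gsubD(8)[OF gsub_A] by simp
          also have "\<dots> = \<chi> i (h x \<otimes> inv (h x))"
            using x charsD(1)[OF c1[OF i]] ghomD(1)[OF h] gsubD(8)[OF gsub_A] by simp
          also have "\<dots> = 1" using x ghomD(1)[OF h] A_carrier charsD(2)[OF c1[OF i]] by simp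
          finally show "\<chi> i z = 1" .
        qed
      qed
      then have one: "f x \<otimes> inv (h x) = \<one>" if "x \<in> W" for x using that by auto
      have "f x = h x" if x: "x \<in> W" for x
        using one[OF x] ghomD(1)[OF f x] ghomD(1)[OF h x] A_carrier by (metis inv_closed inv_equality inv_inv)
      then show "f = h" by (rule ghom_eqI[OF f h])
    qed
    show "?\<phi> ` ghom G W A \<subseteq> {..<r} \<rightarrow>\<^sub>E ?X" using chars_comp[OF _ c1 _ W gsub_A] by auto
    show "finite ({..<r} \<rightarrow>\<^sub>E ?X)" by (rule finite_PiE) (use fX in auto)
  qed
  also have "\<dots> = card W ^ r" using card_chars_gsub[OF W inv] by (simp add: card_PiE)
  finally show ?thesis .
qed

text \<open>The generators a i of H are corrected by elements b i of W. This can fail only if some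
  homomorphism from H to W takes every a i to b i, and the count leaves a tuple b that comes from no
  homomorphism.\<close>

lemma extend_gens:
  assumes H: "gsub H" and W: "gsimple W" and HW: "H \<inter> W = {\<one>}" and g: "gens r H"
    and card: "card (ghom G H W) < card W ^ r"
  shows "gens r (H <#> W)"
proof -
  note w = gsimpleD[OF W]
  note S = gsub_set_mult[OF H w(1)]
  obtain a where a: "\<And>i. i < r \<Longrightarrow> a i \<in> H" "\<And>N. gsub N \<Longrightarrow> (\<forall>i<r. a i \<in> N) \<Longrightarrow> H \<subseteq> N"
    using g by (auto simp: gens_def)
  obtain p q where p: "p \<in> ghom G (H <#> W) H" and q: "q \<in> ghom G (H <#> W) W"
    and pq: "\<And>z. z \<in> H <#> W \<Longrightarrow> z = p z \<otimes> q z" "\<And>x. x \<in> H \<Longrightarrow> p x = x" "\<And>x. x \<in> H \<Longrightarrow> q x = \<one>"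
    "\<And>x. x \<in> W \<Longrightarrow> p x = \<one>" "\<And>x. x \<in> W \<Longrightarrow> q x = x" by (rule projections[OF H w(1) HW]) (rule that; assumption)
  let ?g = "\<lambda>\<theta>. \<lambda>i\<in>{..<r}. \<theta> (a i)"
  have "\<not> ({..<r} \<rightarrow>\<^sub>E W) \<subseteq> ?g ` ghom G H W"
  proof
    assume "({..<r} \<rightarrow>\<^sub>E W) \<subseteq> ?g ` ghom G H W"
    then have "card ({..<r} \<rightarrow>\<^sub>E W) \<le> card (ghom G H W)" by (rule surj_card_le[OF finite_ghom[OF H w(1)]])
    then show False using card by (simp add: card_PiE)
  qed
  then obtain b where b: "b \<in> {..<r} \<rightarrow>\<^sub>E W" "b \<notin> ?g ` ghom G H W" by blast
  have bW: "b i \<in> W" if "i < r" for i using b(1) that by auto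
  show ?thesis
    unfolding gens_def
  proof (intro exI[of _ "\<lambda>i. a i \<otimes> b i"] conjI allI impI)
    fix i assume "i < r"
    then show "a i \<otimes> b i \<in> H <#> W" using a(1)[of i] bW[of i] unfolding set_mult_def by blast
  next
    fix N' assume N': "gsub N'" and c': "\<forall>i<r. a i \<otimes> b i \<in> N'"
    define N where "N = N' \<inter> (H <#> W)"
    have N: "gsub N" unfolding N_def by (rule gsub_Int[OF N' S(1)])
    have NS: "N \<subseteq> H <#> W" by (simp add: N_def)
    have cN: "a i \<otimes> b i \<in> N" if "i < r" for i
      using c' that a(1)[OF that] bW[OF that] unfolding N_def set_mult_def by blast
    have c: "a i \<in> carrier G" "b i \<in> carrier G" if "i < r" for i
      using a(1)[OF that] bW[OF that] gsubD(5)[OF H] gsubD(5)[OF w(1)] by auto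
    have pv: "p (a i \<otimes> b i) = a i" "q (a i \<otimes> b i) = b i" if i: "i < r" for i
      using ghomD(2)[OF p, of "a i" "b i"] ghomD(2)[OF q, of "a i" "b i"] a(1)[OF i] bW[OF i] S(2,3) pq c[OF i] by (auto simp: subset_iff)
    \<comment> \<open>Otherwise N meets W trivially and projects isomorphically onto H, since the
      image contains all a i. Then N is the graph of a homomorphism from H to W sending a i to b i,
      against the choice of b.\<close>
    have "W \<subseteq> N"
    proof (rule ccontr)
      assume "\<not> W \<subseteq> N"
      then have NW: "N \<inter> W = {\<one>}" by (rule simple_Int[OF N W])
      have inj: "inj_on p N"
      proof (rule ghom_inj_onI[OF p S(1) H N NS])
        fix x assume x: "x \<in> N" "p x = \<one>"
        have xS: "x \<in> H <#> W" using x NS by blast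
        have "x = q x" using pq(1)[OF xS] x(2) ghomD(1)[OF q xS] gsubD(5)[OF w(1)] by simp
        then have "x \<in> N \<inter> W" using x ghomD(1)[OF q xS] by simp
        then show "x = \<one>" using NW by simp
      qed
      have pN: "gsub (p ` N)" by (rule gsub_image[OF p S(1) H N NS])
      have "a i \<in> p ` N" if "i < r" for i using pv(1)[OF that] cN[OF that] by (metis imageI)
      then have "H \<subseteq> p ` N" using a(2)[OF pN] by blast
      moreover have "p ` N \<subseteq> H" using ghomD(1)[OF p] NS by blast
      ultimately have pH: "p ` N = H" by blast
      have inv: "(\<lambda>x\<in>H. inv_into N p x) \<in> ghom G H N"
        using ghom_inv_into[OF p S(1) H N NS inj] unfolding pH .
      have th: "(\<lambda>x\<in>H. q ((\<lambda>x\<in>H. inv_into N p x) x)) \<in> ghom G H W" (is "?th \<in> _")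
        by (rule ghom_comp[OF inv q NS H])
      have "b i = ?th (a i)" if i: "i < r" for i
      proof -
        have "inv_into N p (a i) = a i \<otimes> b i" using inv_into_f_f[OF inj cN[OF i]] pv(1)[OF i] by simp
        then show ?thesis using a(1)[OF i] pv(2)[OF i] by simp
      qed
      then have "b = ?g ?th" by (intro extensionalityI[of _ "{..<r}"]) (use b(1) in \<open>auto simp: PiE_def\<close>)
      then show False using b(2) th by blast
    qed
    have "a i \<in> N" if i: "i < r" for i
    proof -
      have "inv (b i) \<in> N" using bW[OF i] \<open>W \<subseteq> N\<close> gsubD(8)[OF w(1)] by blast
      then have "(a i \<otimes> b i) \<otimes> inv (b i) \<in> N" using cN[OF i] gsubD(7)[OF N] by blast
      then show ?thesis using c[OF i] by (simp add: m_assoc)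
    qed
    then have "H \<subseteq> N" using a(2)[OF N] by blast
    then show "H <#> W \<subseteq> N'" using \<open>W \<subseteq> N\<close> gsubD(7)[OF N'] unfolding N_def set_mult_def by blast
  qed
qed

text \<open>Dual to the extension of generators: the characters are continued by characters
  \<open>\<psi> i\<close> of W, and a tuple \<open>\<psi>\<close> is bad only if it comes from a
  homomorphism from W to H.\<close>

lemma extend_char_system:
  fixes \<chi> :: "nat \<Rightarrow> 'a \<Rightarrow> 'k::alg_closed_field"
  assumes H: "gsub H" and W: "gsimple W" and HW: "H \<inter> W = {\<one>}" and cs: "char_system r H \<chi>"
    and card: "card (ghom G W H) < card W ^ r" and inv: "of_nat (card A) \<noteq> (0 :: 'k)"
  shows "\<exists>\<chi>' :: nat \<Rightarrow> 'a \<Rightarrow> 'k. char_system r (H <#> W) \<chi>'"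
proof -
  note w = gsimpleD[OF W]
  note S = gsub_set_mult[OF H w(1)]
  have c1: "\<And>i. i < r \<Longrightarrow> \<chi> i \<in> chars G H"
    and c2: "\<And>M. gsub M \<Longrightarrow> M \<subseteq> H \<Longrightarrow> \<forall>i<r. \<forall>x\<in>M. \<chi> i x = 1 \<Longrightarrow> M = {\<one>}"
    using cs unfolding char_system_def by blast+
  obtain p q where p: "p \<in> ghom G (H <#> W) H" and q: "q \<in> ghom G (H <#> W) W"
    and pq: "\<And>z. z \<in> H <#> W \<Longrightarrow> z = p z \<otimes> q z" "\<And>x. x \<in> H \<Longrightarrow> p x = x" "\<And>x. x \<in> H \<Longrightarrow> q x = \<one>"
    "\<And>x. x \<in> W \<Longrightarrow> p x = \<one>" "\<And>x. x \<in> W \<Longrightarrow> q x = x" by (rule projections[OF H w(1) HW]) (rule that; assumption)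
  let ?X = "chars G W :: ('a \<Rightarrow> 'k) set"
  \<comment> \<open>The inverse appears because on the graph of \<open>\<theta>\<close> the product
    \<open>\<chi> i (\<theta> x) * \<psi> i x\<close> would have to be 1.\<close>
  let ?g = "\<lambda>\<theta>. \<lambda>i\<in>{..<r}. \<lambda>x\<in>W. inverse (\<chi> i (\<theta> x))"
  have "\<not> ({..<r} \<rightarrow>\<^sub>E ?X) \<subseteq> ?g ` ghom G W H"
  proof
    assume "({..<r} \<rightarrow>\<^sub>E ?X) \<subseteq> ?g ` ghom G W H"
    then have "card ({..<r} \<rightarrow>\<^sub>E ?X) \<le> card (ghom G W H)" by (rule surj_card_le[OF finite_ghom[OF w(1) H]])
    then show False using card card_chars_gsub[OF w(1) inv] by (simp add: card_PiE)
  qed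
  then obtain \<psi> where psi: "\<psi> \<in> {..<r} \<rightarrow>\<^sub>E ?X" "\<psi> \<notin> ?g ` ghom G W H" by blast
  have pX: "\<psi> i \<in> chars G W" if "i < r" for i using psi(1) that by auto
  define \<chi>' where "\<chi>' i = (\<lambda>z\<in>H <#> W. \<chi> i (p z) * \<psi> i (q z))" for i
  have "char_system r (H <#> W) \<chi>'"
    unfolding char_system_def
  proof (intro conjI allI impI)
    fix i assume i: "i < r"
    show "\<chi>' i \<in> chars G (H <#> W)"
      unfolding chars_def \<chi>'_def
      using S(1) gsubD(6,7)[OF S(1)] ghomD(1,2)[OF p] ghomD(1,2)[OF q] charsD(1,2)[OF c1[OF i]] charsD(1,2)[OF pX[OF i]]
        ghom_one[OF S(1) H p] ghom_one[OF S(1) w(1) q] by simp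
  next
    fix M assume M: "gsub M" "M \<subseteq> H <#> W" and k: "\<forall>i<r. \<forall>x\<in>M. \<chi>' i x = 1"
    show "M = {\<one>}"
    proof (rule ccontr)
      assume M1: "M \<noteq> {\<one>}"
      \<comment> \<open>On H the continued characters are the old ones, so the old system already
        controls this intersection.\<close>
      have MH: "M \<inter> H = {\<one>}"
      proof (rule c2)
        show "gsub (M \<inter> H)" by (rule gsub_Int[OF M(1) H])
        show "\<forall>i<r. \<forall>x\<in>M \<inter> H. \<chi> i x = 1"
        proof (intro allI impI ballI)
          fix i x assume i: "i < r" and x: "x \<in> M \<inter> H"
          have "\<chi>' i x = \<chi> i x" using x S(2) pq charsD(2)[OF pX[OF i]] by (auto simp: \<chi>'_def)
          then show "\<chi> i x = 1" using k i x by auto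
        qed
      qed auto
      have inj: "inj_on q M"
      proof (rule ghom_inj_onI[OF q S(1) w(1) M])
        fix x assume x: "x \<in> M" "q x = \<one>"
        have xS: "x \<in> H <#> W" using x M by blast
        have "x = p x" using pq(1)[OF xS] x(2) ghomD(1)[OF p xS] gsubD(5)[OF H] by simp
        then have "x \<in> M \<inter> H" using x ghomD(1)[OF p xS] by simp
        then show "x = \<one>" using MH by simp
      qed
      have qM: "gsub (q ` M)" by (rule gsub_image[OF q S(1) w(1) M])
      have "q ` M \<noteq> {\<one>}"
      proof
        assume e: "q ` M = {\<one>}"
        have "x = \<one>" if "x \<in> M" for x
        proof -
          have "q x = q \<one>" using e that ghom_one[OF S(1) w(1) q] by auto
          then show ?thesis using inj that gsubD(6)[OF M(1)] by (simp add: inj_on_eq_iff)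
        qed
        then show False using M1 gsubD(6)[OF M(1)] by blast
      qed
      moreover have "q ` M \<subseteq> W" using ghomD(1)[OF q] M(2) by blast
      ultimately have qW: "q ` M = W" using w(3)[OF qM] by blast
      \<comment> \<open>M meets H trivially and projects onto W, so it is the graph of a
        homomorphism from W to H.\<close>
      have inv': "(\<lambda>x\<in>W. inv_into M q x) \<in> ghom G W M"
        using ghom_inv_into[OF q S(1) w(1) M inj] unfolding qW .
      have th: "(\<lambda>x\<in>W. p ((\<lambda>x\<in>W. inv_into M q x) x)) \<in> ghom G W H" (is "?th \<in> _")
        by (rule ghom_comp[OF inv' p M(2) w(1)])
      have "\<psi> i x = inverse (\<chi> i (?th x))" if i: "i < r" and x: "x \<in> W" for i x
      proof -
        let ?z = "inv_into M q x"
        have z: "?z \<in> M" "q ?z = x" using x qW by (auto intro: inv_into_into f_inv_into_f)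
        have "\<chi> i (p ?z) * \<psi> i x = 1"
        proof -
          have "\<chi>' i ?z = 1" using k i z(1) by blast
          moreover have "?z \<in> H <#> W" using z(1) M(2) by blast
          ultimately show ?thesis using z(2) by (simp add: \<chi>'_def)
        qed
        then show ?thesis using x by (simp add: inverse_unique)
      qed
      then have "\<psi> = ?g ?th"
      proof (intro extensionalityI[of _ "{..<r}"])
        fix i assume "i \<in> {..<r}"
        then have i: "i < r" by simp
        have "\<psi> i = (\<lambda>x\<in>W. inverse (\<chi> i (?th x)))"
          by (rule extensionalityI[of _ W]) (use \<open>\<And>x i. i < r \<Longrightarrow> x \<in> W \<Longrightarrow> _\<close> i charsD(3)[OF pX[OF i]] in auto)
        then show "\<psi> i = ?g ?th i" using i by simp
      qed (use psi(1) in \<open>auto simp: PiE_def\<close>)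
      then show False using psi(2) th by blast
    qed
  qed
  then show ?thesis by blast
qed

end

section \<open>Modules generated by their simple submodules\<close>

locale semisimple_normal = abelian_normal +
  assumes gen_simple: "gsub H \<Longrightarrow> (\<And>W. gsimple W \<Longrightarrow> W \<subseteq> H) \<Longrightarrow> A \<subseteq> H"
begin

text \<open>Take H maximal with P. A simple submodule outside H would meet it trivially and could be
  adjoined, so H contains all of them and is A.\<close>

lemma simple_sum_induct [consumes 0, case_names one step]:
  assumes "P {\<one>}"
    and step: "\<And>H W. gsub H \<Longrightarrow> P H \<Longrightarrow> gsimple W \<Longrightarrow> H \<inter> W = {\<one>} \<Longrightarrow> P (H <#> W)"
  shows "P A"
proof -
  let ?S = "{H. gsub H \<and> P H}"
  have "finite ?S" by (rule finite_subset[of _ "Pow A"]) (use gsubD(10)[OF gsub_A] gsubD(1) in auto)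
  moreover have "?S \<noteq> {}" using assms(1) gsub_one by blast
  ultimately obtain H where H: "H \<in> ?S" and max: "\<And>H'. H' \<in> ?S \<Longrightarrow> H \<subseteq> H' \<Longrightarrow> H = H'"
    using finite_has_maximal[of ?S] by auto
  have "W \<subseteq> H" if W: "gsimple W" for W
  proof (rule ccontr)
    assume nW: "\<not> W \<subseteq> H"
    have gH: "gsub H" "P H" using H by auto
    have "H <#> W \<in> ?S" using step[OF gH W simple_Int[OF gH(1) W nW]] gsub_set_mult(1)[OF gH(1) gsimpleD(1)[OF W]] by simp
    then have "H = H <#> W" using max gsub_set_mult(2)[OF gH(1) gsimpleD(1)[OF W]] by blast
    then show False using gsub_set_mult(3)[OF gH(1) gsimpleD(1)[OF W]] nW by blast
  qed
  then have "A \<subseteq> H" using gen_simple H by blast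
  then have "H = A" using H gsubD(1) by blast
  then show ?thesis using H by blast
qed

text \<open>The inclusion of W into A does not take values in H. This turns the weak bound for A
  into the strict inequality that each extension step consumes.\<close>

lemma ghom_card_strict:
  assumes H: "gsub H" and W: "gsimple W" and HW: "H \<inter> W = {\<one>}"
  shows "card (ghom G W H) < card (ghom G W A)"
proof (rule psubset_card_mono[OF finite_ghom[OF gsimpleD(1)[OF W] gsub_A]])
  note w = gsimpleD[OF W]
  have "ghom G W H \<subseteq> ghom G W A" using gsubD(1)[OF H] unfolding ghom_def by (auto simp: PiE_def Pi_def)
  moreover have id: "(\<lambda>x\<in>W. x) \<in> ghom G W A" by (rule ghomI) (use w(1) gsubD(4) in auto)
  moreover have "(\<lambda>x\<in>W. x) \<notin> ghom G W H"
  proof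
    assume i: "(\<lambda>x\<in>W. x) \<in> ghom G W H"
    have "W \<subseteq> H" using ghomD(1)[OF i] by auto
    then show False using HW w(2) by blast
  qed
  ultimately show "ghom G W H \<subset> ghom G W A" by blast
qed

lemma ghom_to_gsub_one: "gsub W \<Longrightarrow> ghom G W {\<one>} = {\<lambda>x\<in>W. \<one>}"
  using trivial_ghom[OF _ gsub_one] ghomD(1) ghom_eqI by (auto, metis ghomD(1) ghom_eqI singletonD restrict_apply')

lemma ghom_from_gsub_one:
  assumes "gsub W"
  shows "ghom G {\<one>} W = {\<lambda>x\<in>{\<one>}. \<one>}"
proof -
  have "f = (\<lambda>x\<in>{\<one>}. \<one>)" if f: "f \<in> ghom G {\<one>} W" for f
    by (rule ghom_eqI[OF f trivial_ghom[OF gsub_one assms]]) (use ghom_one[OF gsub_one assms f] in auto)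
  then show ?thesis using trivial_ghom[OF gsub_one assms] by blast
qed

text \<open>The bound in the hypothesis concerns A throughout, while the induction runs over H. The
  symmetry of Hom counts is proved in the same induction, because extending generators needs a count
  of maps out of H and the bound speaks of maps into A.\<close>

lemma semisimple_ghom_cards:
  shows "(\<forall>W. gsimple W \<longrightarrow> card (ghom G A W) = card (ghom G W A)) \<and>
    ((\<forall>W. gsimple W \<longrightarrow> card (ghom G W A) \<le> card W ^ r) \<longrightarrow> gens r A \<and>
      (of_nat (card A) \<noteq> (0 :: 'k::alg_closed_field) \<longrightarrow> (\<exists>\<chi> :: nat \<Rightarrow> 'a \<Rightarrow> 'k. char_system r A \<chi>)))"
proof (induction rule: simple_sum_induct[where P = "\<lambda>H. (\<forall>W. gsimple W \<longrightarrow> card (ghom G H W) = card (ghom G W H)) \<and>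
    ((\<forall>W. gsimple W \<longrightarrow> card (ghom G W A) \<le> card W ^ r) \<longrightarrow> gens r H \<and>
      (of_nat (card A) \<noteq> (0 :: 'k::alg_closed_field) \<longrightarrow> (\<exists>\<chi> :: nat \<Rightarrow> 'a \<Rightarrow> 'k. char_system r H \<chi>)))"])
  case one
  have "gens r {\<one>}" unfolding gens_def by (rule exI[of _ "\<lambda>_. \<one>"]) (auto simp: gsubD)
  moreover have "char_system r {\<one>} (\<lambda>_. \<lambda>x\<in>{\<one>}. 1 :: 'k)"
    unfolding char_system_def chars_def using gsubD(6) by auto
  ultimately show ?case using ghom_to_gsub_one ghom_from_gsub_one gsimpleD(1) by auto
next
  case (step H W)
  note w = gsimpleD[OF step(3)]
  show ?case
  proof (intro conjI allI impI)
    fix V assume V: "gsimple V"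
    then show "card (ghom G (H <#> W) V) = card (ghom G V (H <#> W))"
      using card_ghom_from_product[OF step(1) w(1) step(4) gsimpleD(1)[OF V]] card_ghom_into_product[OF step(1) w(1) step(4) gsimpleD(1)[OF V]]
        card_ghom_simple[OF step(3) V] step(2) by simp
  next
    assume c: "\<forall>W. gsimple W \<longrightarrow> card (ghom G W A) \<le> card W ^ r"
    have lt: "card (ghom G W H) < card W ^ r"
      using ghom_card_strict[OF step(1,3,4)] c step(3) by (meson less_le_trans)
    show "gens r (H <#> W)"
      by (rule extend_gens[OF step(1,3,4)]) (use lt step(2,3) c in auto)
    assume inv: "of_nat (card A) \<noteq> (0 :: 'k)"
    then obtain \<chi> :: "nat \<Rightarrow> 'a \<Rightarrow> 'k" where "char_system r H \<chi>" using step(2) c by blast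
    then show "\<exists>\<chi> :: nat \<Rightarrow> 'a \<Rightarrow> 'k. char_system r (H <#> W) \<chi>"
      by (rule extend_char_system[OF step(1,3,4) _ lt inv])
  qed
qed

text \<open>A system of characters bounds the maps into A directly; generators bound the maps out of
  A, and symmetry converts this.\<close>

lemma gens_iff_char_system:
  assumes "of_nat (card A) \<noteq> (0 :: 'k::alg_closed_field)"
  shows "gens r A \<longleftrightarrow> (\<exists>\<chi> :: nat \<Rightarrow> 'a \<Rightarrow> 'k. char_system r A \<chi>)"
proof
  assume g: "gens r A"
  have "card (ghom G W A) \<le> card W ^ r" if "gsimple W" for W
    using gens_imp_card_ghom_le[OF g gsimpleD(1)[OF that]] semisimple_ghom_cards that by (metis (no_types, lifting))
  then show "\<exists>\<chi> :: nat \<Rightarrow> 'a \<Rightarrow> 'k. char_system r A \<chi>" using semisimple_ghom_cards assms by blast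
next
  assume "\<exists>\<chi> :: nat \<Rightarrow> 'a \<Rightarrow> 'k. char_system r A \<chi>"
  then obtain \<chi> :: "nat \<Rightarrow> 'a \<Rightarrow> 'k" where "char_system r A \<chi>" ..
  from char_system_imp_card_ghom_le[OF this gsimpleD(1) assms]
  show "gens r A" using semisimple_ghom_cards by blast
qed

end

section \<open>The abelian socle as a module\<close>

context abelian_normal
begin

lemma smult_single:
  assumes g: "g \<in> carrier G" and a: "a \<in> A"
  shows "(\<lambda>x. if x = g then 1 else 0) \<odot>\<^bsub>conj_module G A\<^esub> a = g \<otimes> a \<otimes> inv g"
proof -
  let ?P = "G\<lparr>carrier := A\<rparr>"
  interpret P: comm_group ?P by (rule gsub_comm_group[OF gsub_A])
  have c: "x \<otimes> a \<otimes> inv x \<in> A" if "x \<in> carrier G" for x using gsubD(9)[OF gsub_A that a] .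
  have "finprod ?P (\<lambda>x. (x \<otimes> a \<otimes> inv x) [^] (if x = g then 1 else 0 :: int)) (carrier G) =
      finprod ?P (\<lambda>x. if g = x then x \<otimes> a \<otimes> inv x else \<one>\<^bsub>?P\<^esub>) (carrier G)"
    by (rule P.finprod_cong') (use c A_carrier gsubD(6)[OF gsub_A] in \<open>auto simp: int_pow_1\<close>)
  also have "\<dots> = g \<otimes> a \<otimes> inv g" by (rule P.finprod_singleton) (use g c fin in auto)
  finally show ?thesis by (simp add: conj_module_def)
qed

lemma smult_closed_gsub:
  assumes N: "gsub N" and a: "a \<in> N"
  shows "f \<odot>\<^bsub>conj_module G A\<^esub> a \<in> N"
proof -
  let ?P = "G\<lparr>carrier := A\<rparr>"
  interpret P: comm_group ?P by (rule gsub_comm_group[OF gsub_A])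
  have pw: "x [^] (k :: int) \<in> N" if "x \<in> N" for x k
    by (rule subgroup_int_pow_closed[OF gsubD(2)[OF N] that])
  have cl: "(g \<otimes> a \<otimes> inv g) [^] (f g :: int) \<in> N" if "g \<in> carrier G" for g f
    by (rule pw) (rule gsubD(9)[OF N that a])
  have "finprod ?P (\<lambda>g. (g \<otimes> a \<otimes> inv g) [^] (f g :: int)) S \<in> N" if "S \<subseteq> carrier G" for S
    using finite_subset[OF that fin] that
  proof (induction S rule: finite_induct)
    case (insert x F)
    have "finprod ?P (\<lambda>g. (g \<otimes> a \<otimes> inv g) [^] (f g :: int)) (insert x F) =
        (x \<otimes> a \<otimes> inv x) [^] (f x :: int) \<otimes>\<^bsub>?P\<^esub> finprod ?P (\<lambda>g. (g \<otimes> a \<otimes> inv g) [^] (f g :: int)) F"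
      by (rule P.finprod_insert) (use insert cl gsubD(1)[OF N] in auto)
    then show ?case using insert cl gsubD(7)[OF N] by simp
  qed (use gsubD(6)[OF N] in simp)
  then show ?thesis by (simp add: conj_module_def)
qed

text \<open>The group ring element concentrated at g acts as conjugation by g, and conversely every
  scalar multiple is a product of powers of conjugates; so stability under scalars amounts to
  normality.\<close>

lemma left_submodule_iff: "left_submodule (int_group_ring G) (conj_module G A) N \<longleftrightarrow> gsub N"
proof -
  let ?M = "conj_module G A"
  have inv: "inv\<^bsub>add_monoid ?M\<^esub> x = inv x" if "x \<in> A" for x
  proof -
    have "inv\<^bsub>add_monoid ?M\<^esub> x = inv\<^bsub>G\<lparr>carrier := A\<rparr>\<^esub> x" by (simp add: m_inv_def conj_module_def)
    then show ?thesis using m_inv_consistent[OF gsubD(2)[OF gsub_A] that] by simp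
  qed
  show ?thesis
  proof
    assume l: "left_submodule (int_group_ring G) ?M N"
    then have s: "subgroup N (add_monoid ?M)" by (simp add: left_submodule_def additive_subgroup_def)
    have NA: "N \<subseteq> A" using subgroup.subset[OF s] by (simp add: conj_module_def)
    show "gsub N"
    proof (rule gsubI[OF NA])
      show "\<one> \<in> N" using subgroup.one_closed[OF s] by (simp add: conj_module_def)
      show "x \<otimes> y \<in> N" if "x \<in> N" "y \<in> N" for x y using subgroup.m_closed[OF s that] by (simp add: conj_module_def)
      show "inv x \<in> N" if "x \<in> N" for x using subgroup.m_inv_closed[OF s that] inv NA that by auto
      show "g \<otimes> x \<otimes> inv g \<in> N" if g: "g \<in> carrier G" and x: "x \<in> N" for g x
      proof -
        have "(\<lambda>x. if x = g then 1 else 0) \<in> carrier (int_group_ring G)" using g by (auto simp: int_group_ring_def)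
        then have "(\<lambda>x. if x = g then 1 else 0) \<odot>\<^bsub>?M\<^esub> x \<in> N" using l x by (simp add: left_submodule_def)
        then show ?thesis using smult_single[OF g, of x] x NA by auto
      qed
    qed
  next
    assume N: "gsub N"
    have "subgroup N (add_monoid ?M)"
      by (rule subgroup.intro) (use gsubD[OF N] inv in \<open>auto simp: conj_module_def\<close>)
    then show "left_submodule (int_group_ring G) ?M N"
      using smult_closed_gsub[OF N] by (simp add: left_submodule_def additive_subgroup_def)
  qed
qed

lemma module_rk_eq: "module_rk (int_group_ring G) (conj_module G A) = (LEAST r. gens r A)"
proof -
  have "(\<exists>as. length as = r \<and> set as \<subseteq> carrier (conj_module G A) \<and>
      submodule_generated (int_group_ring G) (conj_module G A) (set as) = carrier (conj_module G A)) \<longleftrightarrow> gens r A" (is "?L \<longleftrightarrow> ?R") for r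
  proof -
    have c: "carrier (conj_module G A) = A" by (simp add: conj_module_def)
    have s: "submodule_generated (int_group_ring G) (conj_module G A) S = A \<longleftrightarrow> (\<forall>N. gsub N \<longrightarrow> S \<subseteq> N \<longrightarrow> A \<subseteq> N)"
      if "S \<subseteq> A" for S
      unfolding submodule_generated_def left_submodule_iff using gsub_A that by blast
    show ?thesis
    proof
      assume ?L
      then obtain as where as: "length as = r" "set as \<subseteq> A" "\<And>N. gsub N \<Longrightarrow> set as \<subseteq> N \<Longrightarrow> A \<subseteq> N"
        unfolding c using s by blast
      show ?R
        unfolding gens_def
        by (rule exI[of _ "nth as"]) (use as in \<open>auto simp: in_set_conv_nth subset_iff\<close>)
    next
      assume ?R
      then obtain a where a: "\<And>i. i < r \<Longrightarrow> a i \<in> A" "\<And>N. gsub N \<Longrightarrow> (\<forall>i<r. a i \<in> N) \<Longrightarrow> A \<subseteq> N"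
        by (auto simp: gens_def)
      have "set (map a [0..<r]) \<subseteq> A" using a(1) by auto
      moreover have "A \<subseteq> N" if "gsub N" "set (map a [0..<r]) \<subseteq> N" for N by (rule a(2)) (use that in auto)
      ultimately show ?L unfolding c using s by (intro exI[of _ "map a [0..<r]"]) simp
    qed
  qed
  then show ?thesis by (simp add: module_rk_def)
qed

lemma gsimple_iff_foot: "gsimple W \<longleftrightarrow> foot G W \<and> W \<subseteq> A"
  by (auto simp: gsimple_def gsub_def foot_def)

text \<open>Guarantees that the least number defining the rank is attained.\<close>

lemma gens_exists: "\<exists>r. gens r A"
proof -
  obtain as where "set as = A" using finite_list[OF gsubD(10)[OF gsub_A]] by blast
  then have "gens (length as) A"
    unfolding gens_def by (intro exI[of _ "nth as"]) (auto simp: in_set_conv_nth subset_iff)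
  then show ?thesis ..
qed

lemma gens_zero: "gens 0 A \<Longrightarrow> A = {\<one>}"
  using gsub_one gsubD(6)[OF gsub_A] by (auto simp: gens_def)

end

lemma foot_abelian_subset_socle:
  fixes G (structure)
  assumes G: "group G" and N: "foot G N" "comm_group (G\<lparr>carrier := N\<rparr>)"
  shows "N \<subseteq> abelian_socle G"
proof -
  interpret group G by fact
  show ?thesis unfolding abelian_socle_def using N by (auto intro: generate.incl)
qed

text \<open>The simple submodules are the feet inside the socle; these include all abelian feet,
  which generate it.\<close>

lemma semisimple_abelian_socle:
  fixes G (structure)
  assumes G: "group G" and fin: "finite (carrier G)"
  shows "semisimple_normal G (abelian_socle G)"
proof -
  interpret group G by fact
  interpret c: comm_group "G\<lparr>carrier := abelian_socle G\<rparr>" by (rule abelian_socle_comm_group[OF G])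
  interpret abelian_normal G "abelian_socle G"
    by (intro abelian_normal.intro abelian_normal_axioms.intro group_axioms fin abelian_socle_normal[OF G])
      (use c.m_comm in auto)
  show ?thesis
  proof (intro semisimple_normal.intro semisimple_normal_axioms.intro abelian_normal_axioms)
    fix H assume H: "gsub H" and W: "\<And>W. gsimple W \<Longrightarrow> W \<subseteq> H"
    have "\<Union>{N. foot G N \<and> comm_group (G\<lparr>carrier := N\<rparr>)} \<subseteq> H"
    proof (rule Union_least)
      fix N assume "N \<in> {N. foot G N \<and> comm_group (G\<lparr>carrier := N\<rparr>)}"
      then show "N \<subseteq> H" using foot_abelian_subset_socle[OF G] by (intro W) (auto simp: gsimple_iff_foot)
    qed
    then show "abelian_socle G \<subseteq> H"
      using generate_subgroup_incl[OF _ gsubD(2)[OF H]] by (simp add: abelian_socle_def)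
  qed
qed

section \<open>Consequences of semi-faithfulness\<close>

text \<open>U is a complement of the space fixed by N, which is invariant by normality. It is
  nonzero because x acts nontrivially, and it meets the fixed space trivially.\<close>

lemma completely_reducible_fixed_free:
  fixes G (structure) and \<rho> :: "'g \<Rightarrow> 'k::field mat"
  assumes G: "group G" and m: "mrep G n \<rho>" and cr: "completely_reducible G n \<rho>" and N: "N \<lhd> G"
    and x: "x \<in> N" "\<rho> x \<noteq> 1\<^sub>m n"
  shows "\<exists>U. subrepresentation G n \<rho> U \<and> U \<noteq> {0\<^sub>v n} \<and> (\<forall>v\<in>U. (\<forall>x\<in>N. \<rho> x *\<^sub>v v = v) \<longrightarrow> v = 0\<^sub>v n)"
proof -
  define V where "V = {v \<in> carrier_vec n. \<forall>x\<in>N. \<rho> x *\<^sub>v v = v}"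
  have V: "subrepresentation G n \<rho> V" unfolding V_def by (rule fixed_subrepresentation[OF G m N])
  obtain U where U: "subrepresentation G n \<rho> U" "V \<inter> U = {0\<^sub>v n}" "{v + u | v u. v \<in> V \<and> u \<in> U} = carrier_vec n"
    using cr[unfolded completely_reducible_def, rule_format, OF V] by (elim exE conjE)
  have lU: "lin_subspace n U" using U(1) by (simp add: subrepresentation_iff)
  have "U \<noteq> {0\<^sub>v n}"
  proof
    assume "U = {0\<^sub>v n}"
    have fx: "\<rho> x *\<^sub>v v = v" if v: "v \<in> carrier_vec n" for v
    proof -
      obtain w u where w: "v = w + u" "w \<in> V" "u \<in> U" using U(3) v by blast
      then have "v = w" using \<open>U = {0\<^sub>v n}\<close> by (simp add: V_def)
      then show ?thesis using w(2) x(1) by (simp add: V_def)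
    qed
    have "\<rho> x \<in> carrier_mat n n" using mrepD(1)[OF m] normal_imp_subgroup[OF N] subgroup.mem_carrier x(1) by metis
    then have "\<rho> x = 1\<^sub>m n" by (intro mat_eqI_mult_vec[of _ n n]) (use fx in auto)
    then show False using x(2) by simp
  qed
  moreover have "v = 0\<^sub>v n" if "v \<in> U" "\<forall>x\<in>N. \<rho> x *\<^sub>v v = v" for v
    using that U(2) lin_subspaceD(1)[OF lU] by (auto simp: V_def)
  ultimately show ?thesis using U(1) by blast
qed

text \<open>Iterated differences replace the identity \<open>(x - 1)\<^sup>p = x\<^sup>p - 1\<close> in characteristic \<open>p\<close>.\<close>

primrec fdiff :: "(nat \<Rightarrow> 'k::field) \<Rightarrow> nat \<Rightarrow> nat \<Rightarrow> 'k" where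
  "fdiff u 0 m = u m"
| "fdiff u (Suc j) m = fdiff u j (Suc m) - fdiff u j m"

text \<open>Induction by Pascal's rule, with one of the two resulting sums shifted by an
  index.\<close>

lemma fdiff_eq: "fdiff u j m = (\<Sum>l\<le>j. (-1) ^ (j - l) * of_nat (j choose l) * u (m + l))"
proof (induction j arbitrary: m)
  case (Suc j)
  let ?t = "\<lambda>j l m. (-1) ^ (j - l) * of_nat (j choose l) * u (m + l)"
  have "(\<Sum>l\<le>Suc j. ?t (Suc j) l m) = (-1) ^ Suc j * u m + (\<Sum>l\<le>j. (-1) ^ (j - l) * of_nat (Suc j choose Suc l) * u (m + Suc l))"
    by (subst sum.atMost_Suc_shift) simp
  also have "(\<Sum>l\<le>j. (-1) ^ (j - l) * of_nat (Suc j choose Suc l) * u (m + Suc l)) =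
      (\<Sum>l\<le>j. ?t j l (Suc m)) + (\<Sum>l\<le>j. (-1) ^ (j - l) * of_nat (j choose Suc l) * u (m + Suc l))"
    unfolding sum.distrib[symmetric] by (rule sum.cong[OF refl]) (simp add: algebra_simps)
  also have "(-1) ^ Suc j * u m + ((\<Sum>l\<le>j. ?t j l (Suc m)) + (\<Sum>l\<le>j. (-1) ^ (j - l) * of_nat (j choose Suc l) * u (m + Suc l))) =
      (\<Sum>l\<le>j. ?t j l (Suc m)) + (\<Sum>l\<le>Suc j. (-1) ^ (Suc j - l) * of_nat (j choose l) * u (m + l))"
    by (subst sum.atMost_Suc_shift) simp
  also have "(\<Sum>l\<le>Suc j. (-1) ^ (Suc j - l) * of_nat (j choose l) * u (m + l)) = (\<Sum>l\<le>j. (-1) ^ (Suc j - l) * of_nat (j choose l) * u (m + l))"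
    by (simp add: binomial_eq_0)
  also have "\<dots> = - (\<Sum>l\<le>j. ?t j l m)"
    unfolding sum_negf[symmetric] by (rule sum.cong) (auto simp: Suc_diff_le)
  finally show ?case using Suc by simp
qed simp

text \<open>Modulo p only the two end terms of the binomial formula survive. Their coefficients
  \<open>(-1) ^ p\<close> and 1 add up to 0, for p = 2 because 2 = 0.\<close>

lemma fdiff_char:
  fixes u :: "nat \<Rightarrow> 'k::field"
  assumes p: "Factorial_Ring.prime p" "of_nat p = (0 :: 'k)" and u: "u p = u 0"
  shows "fdiff u p 0 = 0"
proof -
  have p0: "0 < p" using p(1) by (rule prime_gt_0_nat)
  have z: "of_nat (p choose l) = (0 :: 'k)" if "0 < l" "l < p" for l
  proof -
    have "p dvd (p choose l)" using dvd_choose_prime[of l p] that p(1) by simp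
    then show ?thesis using p(2) by (auto elim!: dvdE)
  qed
  have "fdiff u p 0 = (\<Sum>l\<in>{0, p}. (-1) ^ (p - l) * of_nat (p choose l) * u (0 + l))"
    unfolding fdiff_eq by (rule sum.mono_neutral_right) (use z in auto)
  also have "\<dots> = ((-1) ^ p + 1) * u 0" using p0 u by (simp add: algebra_simps)
  also have "(-1) ^ p + 1 = (0 :: 'k)"
  proof (cases "p = 2")
    case True
    then show ?thesis using p(2) by simp
  next
    case False
    then have "odd p" using p(1) prime_odd_nat[of p] prime_ge_2_nat[of p] by simp
    then show ?thesis by simp
  qed
  finally show ?thesis by simp
qed

text \<open>Elements are adjoined one at a time. Starting from a vector v fixed by S, apply x - 1
  repeatedly: the p-th iterate vanishes, and the last nonzero iterate is fixed by x and, as x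
  commutes with S, still by S.\<close>

lemma commuting_fixed_vec:
  fixes G (structure) and \<rho> :: "'g \<Rightarrow> 'k::field mat"
  assumes G: "group G" and m: "mrep G n \<rho>" and U: "lin_subspace n U" "U \<noteq> {0\<^sub>v n}" and M: "M \<subseteq> carrier G"
    and st: "\<And>x v. x \<in> M \<Longrightarrow> v \<in> U \<Longrightarrow> \<rho> x *\<^sub>v v \<in> U"
    and comm: "\<And>x y. x \<in> M \<Longrightarrow> y \<in> M \<Longrightarrow> x \<otimes> y = y \<otimes> x"
    and p: "Factorial_Ring.prime p" "of_nat p = (0 :: 'k)" and pow: "\<And>x. x \<in> M \<Longrightarrow> x [^] p = \<one>"
    and S: "finite S" "S \<subseteq> M"
  shows "\<exists>v\<in>U. v \<noteq> 0\<^sub>v n \<and> (\<forall>x\<in>S. \<rho> x *\<^sub>v v = v)"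
  using S
proof (induction S rule: finite_induct)
  case empty
  show ?case using U lin_subspaceD(2)[OF U(1)] by blast
next
  case (insert x S)
  interpret group G by fact
  obtain v where v: "v \<in> U" "v \<noteq> 0\<^sub>v n" "\<And>y. y \<in> S \<Longrightarrow> \<rho> y *\<^sub>v v = v" using insert by auto
  have xM: "x \<in> M" and xc: "x \<in> carrier G" using insert M by auto
  have SM: "y \<in> M" if "y \<in> S" for y using insert that by auto
  have R: "\<rho> y \<in> carrier_mat n n" if "y \<in> carrier G" for y using mrepD(1)[OF m that] .
  have Uc: "w \<in> U \<Longrightarrow> w \<in> carrier_vec n" for w using lin_subspaceD(1)[OF U(1)] .
  define w where "w = rec_nat v (\<lambda>_ w. \<rho> x *\<^sub>v w - w)"
  have w0: "w 0 = v" and wS: "w (Suc j) = \<rho> x *\<^sub>v w j - w j" for j by (simp_all add: w_def)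
  have wU: "w j \<in> U" for j
    by (induction j) (use w0 wS v(1) lin_subspace_diff[OF U(1)] st[OF xM] in auto)
  have fx: "\<rho> y *\<^sub>v w j = w j" if y: "y \<in> S" for y j
  proof (induction j)
    case (Suc j)
    have yc: "y \<in> carrier G" using SM[OF y] M by auto
    have "\<rho> y *\<^sub>v (\<rho> x *\<^sub>v w j) = \<rho> (y \<otimes> x) *\<^sub>v w j"
      using mrepD(2)[OF m yc xc] R[OF yc] R[OF xc] Uc[OF wU] by (simp add: assoc_mult_mat_vec[of _ n n _ n])
    also have "\<dots> = \<rho> x *\<^sub>v (\<rho> y *\<^sub>v w j)"
      unfolding comm[OF SM[OF y] xM] using mrepD(2)[OF m xc yc] R[OF yc] R[OF xc] Uc[OF wU] by (simp add: assoc_mult_mat_vec[of _ n n _ n])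
    finally have "\<rho> y *\<^sub>v (\<rho> x *\<^sub>v w j) = \<rho> x *\<^sub>v w j" using Suc by simp
    then show ?case
      unfolding wS using mult_minus_distrib_mat_vec[OF R[OF yc], of "\<rho> x *\<^sub>v w j" "w j"] Suc R[OF xc] Uc[OF wU] by simp
  qed (use v(3)[OF y] w0 in simp)
  \<comment> \<open>The coordinates of w j are j-th differences of those of
    \<open>\<rho> (x [^] k) *\<^sub>v v\<close>. That sequence takes the same value at k = 0 and k =
    p, so the scalar lemma applies.\<close>
  have fd: "(\<rho> (x [^] k) *\<^sub>v w j) $ i = fdiff (\<lambda>k. (\<rho> (x [^] k) *\<^sub>v v) $ i) j k" if i: "i < n" for i j k
  proof (induction j arbitrary: k)
    case (Suc j)
    have kc: "x [^] k \<in> carrier G" using xc by simp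
    have "\<rho> (x [^] k) *\<^sub>v (\<rho> x *\<^sub>v w j) = \<rho> (x [^] Suc k) *\<^sub>v w j"
      using mrepD(2)[OF m kc xc] R[OF kc] R[OF xc] Uc[OF wU] by (simp add: assoc_mult_mat_vec[of _ n n _ n])
    then have "\<rho> (x [^] k) *\<^sub>v w (Suc j) = \<rho> (x [^] Suc k) *\<^sub>v w j - \<rho> (x [^] k) *\<^sub>v w j"
      unfolding wS using mult_minus_distrib_mat_vec[OF R[OF kc], of "\<rho> x *\<^sub>v w j" "w j"] R[OF xc] Uc[OF wU] by simp
    then show ?case using Suc.IH[of k] Suc.IH[of "Suc k"] i R[OF kc] by simp
  qed (simp add: w0)
  have "w p = 0\<^sub>v n"
  proof (rule eq_vecI)
    fix i assume "i < dim_vec (0\<^sub>v n :: 'k vec)"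
    then have i: "i < n" by simp
    have "(\<rho> (x [^] (0::nat)) *\<^sub>v w p) $ i = 0"
      unfolding fd[OF i] by (rule fdiff_char[OF p]) (simp add: pow[OF xM])
    then show "w p $ i = 0\<^sub>v n $ i" using mrepD(3)[OF m] Uc[OF wU] i by simp
  qed (use Uc[OF wU] in auto)
  \<comment> \<open>The vector wanted has index one below j; since the start v is nonzero, j is
    positive.\<close>
  define j where "j = (LEAST j. w j = 0\<^sub>v n)"
  have j: "w j = 0\<^sub>v n" unfolding j_def by (rule LeastI[of _ p]) fact
  have "j \<noteq> 0" using j w0 v(2) by metis
  then obtain i where i: "j = Suc i" by (cases j) auto
  have wi: "w i \<noteq> 0\<^sub>v n" using not_less_Least[of i "\<lambda>j. w j = 0\<^sub>v n"] i j_def by simp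
  have z: "\<rho> x *\<^sub>v w i - w i = 0\<^sub>v n" using j wS[of i] i by simp
  have "(\<rho> x *\<^sub>v w i) $ l = w i $ l" if "l < n" for l
    using arg_cong[OF z, of "\<lambda>v. v $ l"] that Uc[OF wU[of i]] by simp
  then have "\<rho> x *\<^sub>v w i = w i" using R[OF xc] Uc[OF wU[of i]] by (intro eq_vecI) auto
  then show ?case using wi wU fx by (intro bexI[of _ "w i"]) auto
qed

section \<open>Elements supported on a normal subgroup, and the order of A\<close>

lemma nonnilp_extend:
  fixes G (structure)
  assumes G: "group G" and fin: "finite (carrier G)" and N: "subgroup N G" and l: "nonnilp (G\<lparr>carrier := N\<rparr>) l"
  shows "nonnilp G (\<lambda>x. if x \<in> N then l x else 0)"
proof -
  interpret group G by fact
  interpret N: subgroup N G by fact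
  let ?l = "\<lambda>x. if x \<in> N then l x else 0"
  have "cpow G ?l k x = cpow (G\<lparr>carrier := N\<rparr>) l k x" if "x \<in> N" for k x
    using that
  proof (induction k arbitrary: x)
    case (Suc k)
    have "(\<Sum>y\<in>carrier G. ?l y * cpow G ?l k (inv y \<otimes> x)) = (\<Sum>y\<in>N. ?l y * cpow G ?l k (inv y \<otimes> x))"
      by (rule sum.mono_neutral_right) (use fin N.subset in auto)
    also have "\<dots> = (\<Sum>y\<in>N. l y * cpow (G\<lparr>carrier := N\<rparr>) l k (inv\<^bsub>G\<lparr>carrier := N\<rparr>\<^esub> y \<otimes> x))"
      by (rule sum.cong) (use Suc m_inv_consistent[OF N] in auto)
    finally show ?case using Suc.prems by (simp add: conv_def)
  qed simp
  then have e: "cpow G ?l k x = cpow (G\<lparr>carrier := N\<rparr>) l k x" if "x \<in> N" for k x using that .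
  show ?thesis
    unfolding nonnilp_def
  proof
    fix k
    obtain x where "x \<in> N" "cpow (G\<lparr>carrier := N\<rparr>) l k x \<noteq> 0" using l by (auto simp: nonnilp_def)
    then show "\<exists>x\<in>carrier G. cpow G ?l k x \<noteq> 0" using e[of x k] N.mem_carrier by (intro bexI[of _ x]) simp_all
  qed
qed

text \<open>A complement of the vectors fixed by N is a nonzero representation of N without fixed
  vectors. The element it yields in the group algebra of N is extended by zero, which preserves its
  sum and its powers on N.\<close>

lemma semi_faithful_augmentation:
  fixes G (structure)
  assumes G: "group G" and fin: "finite (carrier G)" and sf: "semi_faithful TYPE('k::field) G" and N: "N \<lhd> G" "N \<noteq> {\<one>}"
  shows "\<exists>l :: 'a \<Rightarrow> 'k. (\<forall>x. x \<notin> N \<longrightarrow> l x = 0) \<and> (\<Sum>x\<in>carrier G. l x) = 0 \<and> nonnilp G l"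
proof -
  interpret group G by fact
  interpret N: normal N G by fact
  obtain n and \<rho> :: "'a \<Rightarrow> 'k mat" where f: "faithful_representation G n \<rho>" and cr: "completely_reducible G n \<rho>"
    using sf by (auto simp: semi_faithful_def)
  have m: "mrep G n \<rho>" and inj: "inj_on \<rho> (carrier G)"
    using f by (auto simp: faithful_representation_def representation_iff_mrep[OF G])
  obtain x where x: "x \<in> N" "x \<noteq> \<one>" using N(2) N.one_closed by blast
  have "\<rho> x \<noteq> 1\<^sub>m n" using inj_onD[OF inj, of x \<one>] x mrepD(3)[OF m] by auto
  from completely_reducible_fixed_free[OF G m cr N(1) x(1) this]
  obtain U where U: "subrepresentation G n \<rho> U" "U \<noteq> {0\<^sub>v n}" and ff: "\<And>v. v \<in> U \<Longrightarrow> \<forall>x\<in>N. \<rho> x *\<^sub>v v = v \<Longrightarrow> v = 0\<^sub>v n"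
    by blast
  have lU: "lin_subspace n U" using U(1) by (simp add: subrepresentation_iff)
  from subrepresentation_block[OF G m U(1)] obtain n1 n2 P Q \<rho>1 \<rho>2 B where n: "n = n1 + n2"
    and P: "P \<in> carrier_mat n n" and Q: "Q \<in> carrier_mat n n" and PQ: "P * Q = 1\<^sub>m n" "Q * P = 1\<^sub>m n"
    and PU: "\<forall>v\<in>carrier_vec n. P *\<^sub>v v \<in> U \<longleftrightarrow> (\<forall>i<n. n1 \<le> i \<longrightarrow> v $ i = 0)"
    and r: "mrep G n1 \<rho>1" "mrep G n2 \<rho>2"
    and B: "\<forall>g\<in>carrier G. B g \<in> carrier_mat n1 n2 \<and> Q * \<rho> g * P = four_block_mat (\<rho>1 g) (B g) (0\<^sub>m n2 n1) (\<rho>2 g)"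
    by blast
  have n1: "0 < n1" using coordinate_subspace_proper(2)[OF lU P Q PQ(1) PU] U(2) by blast
  have mN: "mrep (G\<lparr>carrier := N\<rparr>) n1 \<rho>1" using r(1) N.subset by (auto simp: mrep_def)
  note d = P[unfolded n] Q[unfolded n]
  have "\<exists>l :: 'a \<Rightarrow> 'k. (\<Sum>x\<in>carrier (G\<lparr>carrier := N\<rparr>). l x) = 0 \<and> nonnilp (G\<lparr>carrier := N\<rparr>) l"
  proof (rule augmentation_nonnilp[OF _ _ n1 mN])
    show "group (G\<lparr>carrier := N\<rparr>)" by (rule subgroup_imp_group[OF N.subgroup_axioms])
    show "finite (carrier (G\<lparr>carrier := N\<rparr>))" using N.subset fin finite_subset by auto
    fix v assume v: "v \<in> carrier_vec n1" and fx: "\<And>x. x \<in> carrier (G\<lparr>carrier := N\<rparr>) \<Longrightarrow> \<rho>1 x *\<^sub>v v = v"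
    have "P *\<^sub>v (v @\<^sub>v 0\<^sub>v n2) = 0\<^sub>v n"
    proof (rule ff)
      show "P *\<^sub>v (v @\<^sub>v 0\<^sub>v n2) \<in> U" using PU v n by auto
      show "\<forall>x\<in>N. \<rho> x *\<^sub>v (P *\<^sub>v (v @\<^sub>v 0\<^sub>v n2)) = P *\<^sub>v (v @\<^sub>v 0\<^sub>v n2)"
      proof
        fix x assume xN: "x \<in> N"
        then have x: "x \<in> carrier G" using N.subset by auto
        show "\<rho> x *\<^sub>v (P *\<^sub>v (v @\<^sub>v 0\<^sub>v n2)) = P *\<^sub>v (v @\<^sub>v 0\<^sub>v n2)"
          using block_mult_append_zero[OF d PQ(1)[unfolded n], of "\<rho> x" "\<rho>1 x" "B x" "\<rho>2 x" v]
            B x mrepD(1)[OF r(1) x] mrepD(1)[OF r(2) x] mrepD(1)[OF m x] v fx[of x] xN by (simp add: n)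
      qed
    qed
    then show "v = 0\<^sub>v n1" using append_zero_eq_zeroD[OF d PQ(2)[unfolded n] v] by (simp add: n)
  qed
  then obtain l :: "'a \<Rightarrow> 'k" where l: "(\<Sum>x\<in>N. l x) = 0" "nonnilp (G\<lparr>carrier := N\<rparr>) l" by auto
  have "(\<Sum>x\<in>carrier G. if x \<in> N then l x else 0) = (\<Sum>x\<in>N. if x \<in> N then l x else 0)"
    by (rule sum.mono_neutral_right) (use fin N.subset in auto)
  then have "(\<Sum>x\<in>carrier G. if x \<in> N then l x else 0) = 0" using l(1) by simp
  then show ?thesis
    using nonnilp_extend[OF G fin N.subgroup_axioms l(2)] by (intro exI[of _ "\<lambda>x. if x \<in> N then l x else 0"]) auto
qed

lemma cpow_to_ac: "cpow G (\<lambda>x. to_ac (l x)) k x = to_ac (cpow G l k x)"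
  by (induction k arbitrary: x) (auto simp: conv_def to_ac_sum)

lemma nonnilp_to_ac: "nonnilp G l \<Longrightarrow> nonnilp G (\<lambda>x. to_ac (l x))"
  by (simp add: nonnilp_def cpow_to_ac)

text \<open>If the characteristic p divided card A, the elements of A with trivial p-th power would
  form a nontrivial normal subgroup. Complete reducibility provides a nonzero invariant subspace
  without vectors fixed by it, whereas commuting operators of order dividing p have a common fixed
  vector there.\<close>

lemma (in abelian_normal) semi_faithful_card_nonzero:
  assumes sf: "semi_faithful TYPE('k::field) G"
  shows "of_nat (card A) \<noteq> (0 :: 'k)"
proof
  assume z: "of_nat (card A) = (0 :: 'k)"
  define p where "p = CHAR('k)"
  have cA: "0 < card A" using gsubD(6,10)[OF gsub_A] by (metis card_gt_0_iff empty_iff)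
  have "p dvd card A" using z by (simp add: p_def of_nat_eq_0_iff_char_dvd)
  moreover have "p \<noteq> 0" using calculation cA by auto
  ultimately have p: "Factorial_Ring.prime p" "p dvd card A" using prime_CHAR_semidom[where 'a = 'k] by (auto simp: p_def)
  have p0: "of_nat p = (0 :: 'k)" by (simp add: p_def of_nat_CHAR)
  let ?P = "G\<lparr>carrier := A\<rparr>"
  have gP: "group ?P" by (rule subgroup_imp_group[OF gsubD(2)[OF gsub_A]])
  obtain q where q: "card A = p ^ 1 * q" using p(2) by (auto elim: dvdE)
  \<comment> \<open>With exponent 1 Sylow's theorem gives Cauchy's: it provides some y of order
    p.\<close>
  have "\<exists>H. subgroup H ?P \<and> card H = p ^ 1"
    by (rule sylow_thm[OF p(1) gP, of 1 q]) (use q gsubD(10)[OF gsub_A] in \<open>auto simp: Coset.order_def\<close>)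
  then obtain H where H: "subgroup H ?P" "card H = p" by auto
  interpret H: group "?P\<lparr>carrier := H\<rparr>" by (rule group.subgroup_imp_group[OF gP H(1)])
  have HA: "H \<subseteq> A" using subgroup.subset[OF H(1)] by simp
  have "\<one> \<in> H" using subgroup.one_closed[OF H(1)] by simp
  have "H \<noteq> {\<one>}" using H(2) p(1) prime_gt_1_nat[of p] by auto
  then obtain y where y: "y \<in> H" "y \<noteq> \<one>" using \<open>\<one> \<in> H\<close> by blast
  have "y [^]\<^bsub>?P\<lparr>carrier := H\<rparr>\<^esub> p = \<one>" using H.pow_order_eq_1[of y] y(1) H(2) by (simp add: Coset.order_def)
  then have yp: "y [^] p = \<one>" by (simp add: nat_pow_def)
  \<comment> \<open>Closed under products because A is abelian, and under conjugation because
    conjugation respects powers.\<close>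
  define M where "M = {a \<in> A. a [^] p = \<one>}"
  have M: "gsub M"
  proof (rule gsubI)
    show "a \<otimes> b \<in> M" if "a \<in> M" "b \<in> M" for a b
      using that pow_mult_distrib[of a b p] A_comm A_carrier gsubD(7)[OF gsub_A] by (auto simp: M_def)
    show "inv a \<in> M" if "a \<in> M" for a
      using that nat_pow_inv[of a p] A_carrier gsubD(8)[OF gsub_A] by (auto simp: M_def)
    show "g \<otimes> a \<otimes> inv g \<in> M" if ga: "g \<in> carrier G" "a \<in> M" for g a
    proof -
      have ac: "a \<in> carrier G" "a [^] p = \<one>" using ga A_carrier by (auto simp: M_def)
      have "(g \<otimes> a \<otimes> inv g) [^] k = g \<otimes> a [^] k \<otimes> inv g" for k :: nat
      proof (induction k)
        case (Suc k)
        have "inv g \<otimes> (g \<otimes> (a \<otimes> inv g)) = a \<otimes> inv g" using ga ac by (simp add: m_assoc[symmetric])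
        then show ?case using Suc ga ac by (simp add: m_assoc)
      qed (use ga in simp)
      then show ?thesis using ga ac gsubD(9)[OF gsub_A] by (simp add: M_def)
    qed
  qed (use gsubD(6)[OF gsub_A] in \<open>auto simp: M_def\<close>)
  have yM: "y \<in> M" using y(1) HA yp by (auto simp: M_def)
  obtain n and \<rho> :: "'a \<Rightarrow> 'k mat" where f: "faithful_representation G n \<rho>" and cr: "completely_reducible G n \<rho>"
    using sf by (auto simp: semi_faithful_def)
  have m: "mrep G n \<rho>" and inj: "inj_on \<rho> (carrier G)"
    using f by (auto simp: faithful_representation_def representation_iff_mrep[OF is_group])
  have "\<rho> y \<noteq> 1\<^sub>m n" using inj_onD[OF inj, of y \<one>] y(2) gsubD(5)[OF M yM] mrepD(3)[OF m] by auto
  from completely_reducible_fixed_free[OF is_group m cr gsubD(3)[OF M] yM this]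
  obtain U where U: "subrepresentation G n \<rho> U" "U \<noteq> {0\<^sub>v n}" and ff: "\<And>v. v \<in> U \<Longrightarrow> \<forall>x\<in>M. \<rho> x *\<^sub>v v = v \<Longrightarrow> v = 0\<^sub>v n"
    by blast
  have "\<exists>v\<in>U. v \<noteq> 0\<^sub>v n \<and> (\<forall>x\<in>M. \<rho> x *\<^sub>v v = v)"
  proof (rule commuting_fixed_vec[OF is_group m _ U(2) _ _ _ p(1) p0 _ gsubD(10)[OF M]])
    show "lin_subspace n U" using U(1) by (simp add: subrepresentation_iff)
    show "M \<subseteq> carrier G" using gsubD(5)[OF M] by auto
    show "\<rho> x *\<^sub>v v \<in> U" if "x \<in> M" "v \<in> U" for x v using U(1) that gsubD(5)[OF M] by (auto simp: subrepresentation_iff)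
    show "x \<otimes> y = y \<otimes> x" if "x \<in> M" "y \<in> M" for x y using A_comm that by (auto simp: M_def)
  qed (auto simp: M_def)
  then show False using ff by blast
qed

section \<open>Characters of a composition series\<close>

text \<open>Maps are kept as functions on vectors, so that padding with zeros and taking the last
  coordinates need no matrices.\<close>

definition equivariant :: "('g, 'm) monoid_scheme \<Rightarrow> nat \<Rightarrow> ('g \<Rightarrow> 'k::field mat) \<Rightarrow> nat \<Rightarrow> ('g \<Rightarrow> 'k mat) \<Rightarrow> ('k vec \<Rightarrow> 'k vec) \<Rightarrow> bool" where
  "equivariant G n \<rho> n' \<rho>' \<phi> \<longleftrightarrow> (\<forall>v\<in>carrier_vec n. \<phi> v \<in> carrier_vec n') \<and>
     (\<forall>v\<in>carrier_vec n. \<forall>w\<in>carrier_vec n. \<phi> (v + w) = \<phi> v + \<phi> w) \<and>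
     (\<forall>c. \<forall>v\<in>carrier_vec n. \<phi> (c \<cdot>\<^sub>v v) = c \<cdot>\<^sub>v \<phi> v) \<and>
     (\<forall>g\<in>carrier G. \<forall>v\<in>carrier_vec n. \<phi> (\<rho> g *\<^sub>v v) = \<rho>' g *\<^sub>v \<phi> v)"

lemma equivariantD:
  fixes \<rho> :: "'g \<Rightarrow> 'k::field mat"
  assumes "equivariant G n \<rho> n' \<rho>' \<phi>"
  shows "v \<in> carrier_vec n \<Longrightarrow> \<phi> v \<in> carrier_vec n'"
    "v \<in> carrier_vec n \<Longrightarrow> w \<in> carrier_vec n \<Longrightarrow> \<phi> (v + w) = \<phi> v + \<phi> w"
    "v \<in> carrier_vec n \<Longrightarrow> \<phi> (c \<cdot>\<^sub>v v) = c \<cdot>\<^sub>v \<phi> v"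
    "g \<in> carrier G \<Longrightarrow> v \<in> carrier_vec n \<Longrightarrow> \<phi> (\<rho> g *\<^sub>v v) = \<rho>' g *\<^sub>v \<phi> v"
    "\<phi> (0\<^sub>v n) = 0\<^sub>v n'"
proof -
  show a: "v \<in> carrier_vec n \<Longrightarrow> \<phi> v \<in> carrier_vec n'"
    "v \<in> carrier_vec n \<Longrightarrow> w \<in> carrier_vec n \<Longrightarrow> \<phi> (v + w) = \<phi> v + \<phi> w"
    "v \<in> carrier_vec n \<Longrightarrow> \<phi> (c \<cdot>\<^sub>v v) = c \<cdot>\<^sub>v \<phi> v"
    "g \<in> carrier G \<Longrightarrow> v \<in> carrier_vec n \<Longrightarrow> \<phi> (\<rho> g *\<^sub>v v) = \<rho>' g *\<^sub>v \<phi> v" for v w c g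
    using assms by (auto simp: equivariant_def)
  have "\<phi> (0 \<cdot>\<^sub>v 0\<^sub>v n) = 0 \<cdot>\<^sub>v \<phi> (0\<^sub>v n)" by (rule a(3)) simp
  moreover have "0 \<cdot>\<^sub>v 0\<^sub>v n = (0\<^sub>v n :: 'k vec)" by (intro eq_vecI) auto
  moreover have "0 \<cdot>\<^sub>v \<phi> (0\<^sub>v n) = 0\<^sub>v n'" using a(1)[of "0\<^sub>v n"] by (intro eq_vecI) auto
  ultimately show "\<phi> (0\<^sub>v n) = 0\<^sub>v n'" by simp
qed

lemma subrepresentation_vimage:
  assumes e: "equivariant G n \<rho> n' \<rho>' \<phi>" and m: "mrep G n \<rho>" and U: "subrepresentation G n' \<rho>' U"
  shows "subrepresentation G n \<rho> {v \<in> carrier_vec n. \<phi> v \<in> U}"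
proof -
  have lU: "lin_subspace n' U" and st: "\<And>g w. g \<in> carrier G \<Longrightarrow> w \<in> U \<Longrightarrow> \<rho>' g *\<^sub>v w \<in> U"
    using U by (auto simp: subrepresentation_iff)
  have "\<rho> g *\<^sub>v v \<in> carrier_vec n" if "g \<in> carrier G" "v \<in> carrier_vec n" for g v
    using mrepD(1)[OF m that(1)] that(2) by simp
  then show ?thesis
    unfolding subrepresentation_iff lin_subspace_def
    using equivariantD[OF e] lin_subspaceD[OF lU] st by auto
qed

lemma subrepresentation_image:
  assumes e: "equivariant G n \<rho> n' \<rho>' \<phi>" and U: "subrepresentation G n \<rho> U"
  shows "subrepresentation G n' \<rho>' (\<phi> ` U)"
proof -
  have lU: "lin_subspace n U" and st: "\<And>g w. g \<in> carrier G \<Longrightarrow> w \<in> U \<Longrightarrow> \<rho> g *\<^sub>v w \<in> U"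
    using U by (auto simp: subrepresentation_iff)
  note c = lin_subspaceD(1)[OF lU]
  show ?thesis
    unfolding subrepresentation_iff lin_subspace_def
  proof (intro conjI ballI allI)
    show "\<phi> ` U \<subseteq> carrier_vec n'" using equivariantD(1)[OF e] c by auto
    show "0\<^sub>v n' \<in> \<phi> ` U" using equivariantD(5)[OF e] lin_subspaceD(2)[OF lU] by (metis imageI)
  next
    fix u v assume "u \<in> \<phi> ` U" "v \<in> \<phi> ` U"
    then obtain a b where ab: "a \<in> U" "b \<in> U" "u = \<phi> a" "v = \<phi> b" by blast
    then have "u + v = \<phi> (a + b)" using equivariantD(2)[OF e] c by simp
    then show "u + v \<in> \<phi> ` U" using lin_subspaceD(3)[OF lU ab(1,2)] by blast
  next
    fix k u assume "u \<in> \<phi> ` U"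
    then obtain a where a: "a \<in> U" "u = \<phi> a" by blast
    then have "k \<cdot>\<^sub>v u = \<phi> (k \<cdot>\<^sub>v a)" using equivariantD(3)[OF e] c by simp
    then show "k \<cdot>\<^sub>v u \<in> \<phi> ` U" using lin_subspaceD(4)[OF lU a(1)] by blast
  next
    fix g u assume g: "g \<in> carrier G" and "u \<in> \<phi> ` U"
    then obtain a where a: "a \<in> U" "u = \<phi> a" by blast
    then have "\<rho>' g *\<^sub>v u = \<phi> (\<rho> g *\<^sub>v a)" using equivariantD(4)[OF e g] c by simp
    then show "\<rho>' g *\<^sub>v u \<in> \<phi> ` U" using st[OF g a(1)] by blast
  qed
qed

lemma append_vec_add_zero: "u \<in> carrier_vec n1 \<Longrightarrow> v \<in> carrier_vec n1 \<Longrightarrow> (u + v) @\<^sub>v 0\<^sub>v n2 = (u @\<^sub>v 0\<^sub>v n2) + (v @\<^sub>v 0\<^sub>v n2 :: 'a::field vec)"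
  by (intro eq_vecI) auto

lemma append_vec_smult_zero: "u \<in> carrier_vec n1 \<Longrightarrow> (c \<cdot>\<^sub>v u) @\<^sub>v 0\<^sub>v n2 = c \<cdot>\<^sub>v (u @\<^sub>v 0\<^sub>v n2 :: 'a::field vec)"
  by (intro eq_vecI) auto

lemma
  fixes \<rho> :: "'g \<Rightarrow> 'k::field mat"
  assumes P: "P \<in> carrier_mat (n1 + n2) (n1 + n2)" and Q: "Q \<in> carrier_mat (n1 + n2) (n1 + n2)"
    and PQ: "P * Q = 1\<^sub>m (n1 + n2)" "Q * P = 1\<^sub>m (n1 + n2)"
    and m: "mrep G (n1 + n2) \<rho>" "mrep G n1 \<rho>1" "mrep G n2 \<rho>2"
    and B: "\<And>g. g \<in> carrier G \<Longrightarrow> B g \<in> carrier_mat n1 n2"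
    and b: "\<And>g. g \<in> carrier G \<Longrightarrow> Q * \<rho> g * P = four_block_mat (\<rho>1 g) (B g) (0\<^sub>m n2 n1) (\<rho>2 g)"
  shows block_inclusion: "equivariant G n1 \<rho>1 (n1 + n2) \<rho> (\<lambda>u. P *\<^sub>v (u @\<^sub>v 0\<^sub>v n2))"
    and block_projection: "equivariant G (n1 + n2) \<rho> n2 \<rho>2 (\<lambda>w. vec_last (Q *\<^sub>v w) n2)"
proof -
  let ?n = "n1 + n2"
  show "equivariant G n1 \<rho>1 ?n \<rho> (\<lambda>u. P *\<^sub>v (u @\<^sub>v 0\<^sub>v n2))"
    unfolding equivariant_def
  proof (intro conjI ballI allI)
    fix u v :: "'k vec" and c assume u: "u \<in> carrier_vec n1"
    show "P *\<^sub>v (u @\<^sub>v 0\<^sub>v n2) \<in> carrier_vec ?n" using P u by simp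
    show "P *\<^sub>v ((c \<cdot>\<^sub>v u) @\<^sub>v 0\<^sub>v n2) = c \<cdot>\<^sub>v (P *\<^sub>v (u @\<^sub>v 0\<^sub>v n2))"
      using P u by (simp add: append_vec_smult_zero mult_mat_vec[of _ ?n ?n])
    show "P *\<^sub>v ((u + v) @\<^sub>v 0\<^sub>v n2) = P *\<^sub>v (u @\<^sub>v 0\<^sub>v n2) + P *\<^sub>v (v @\<^sub>v 0\<^sub>v n2)" if "v \<in> carrier_vec n1"
      using P u that by (simp add: append_vec_add_zero mult_add_distrib_mat_vec[of _ ?n ?n])
  next
    fix g and u :: "'k vec" assume g: "g \<in> carrier G" and u: "u \<in> carrier_vec n1"
    show "P *\<^sub>v ((\<rho>1 g *\<^sub>v u) @\<^sub>v 0\<^sub>v n2) = \<rho> g *\<^sub>v (P *\<^sub>v (u @\<^sub>v 0\<^sub>v n2))"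
      by (rule block_mult_append_zero[OF P Q PQ(1) mrepD(1)[OF m(1) g] b[OF g] mrepD(1)[OF m(2) g] B[OF g] mrepD(1)[OF m(3) g] u, symmetric])
  qed
  show "equivariant G ?n \<rho> n2 \<rho>2 (\<lambda>w. vec_last (Q *\<^sub>v w) n2)"
    unfolding equivariant_def
  proof (intro conjI ballI allI)
    fix u v :: "'k vec" and c assume u: "u \<in> carrier_vec ?n"
    show "vec_last (Q *\<^sub>v u) n2 \<in> carrier_vec n2" by simp
    show "vec_last (Q *\<^sub>v (c \<cdot>\<^sub>v u)) n2 = c \<cdot>\<^sub>v vec_last (Q *\<^sub>v u) n2"
      using Q u by (intro eq_vecI) (auto simp: vec_last_def mult_mat_vec[of _ ?n ?n])
    show "vec_last (Q *\<^sub>v (u + v)) n2 = vec_last (Q *\<^sub>v u) n2 + vec_last (Q *\<^sub>v v) n2" if "v \<in> carrier_vec ?n"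
      using Q u that by (intro eq_vecI) (auto simp: vec_last_def mult_add_distrib_mat_vec[of _ ?n ?n])
  next
    fix g and w :: "'k vec" assume g: "g \<in> carrier G" and w: "w \<in> carrier_vec ?n"
    have R: "\<rho> g \<in> carrier_mat ?n ?n" using mrepD(1)[OF m(1) g] .
    define a where "a = vec_first (Q *\<^sub>v w) n1"
    define d where "d = vec_last (Q *\<^sub>v w) n2"
    have ad: "Q *\<^sub>v w = a @\<^sub>v d" "a \<in> carrier_vec n1" "d \<in> carrier_vec n2"
      unfolding a_def d_def using Q w by auto
    have "Q *\<^sub>v (\<rho> g *\<^sub>v w) = Q *\<^sub>v (\<rho> g *\<^sub>v (P *\<^sub>v (Q *\<^sub>v w)))"
      using mult_mat_vec_inverse[OF P Q PQ(1) w] by simp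
    also have "\<dots> = (Q * \<rho> g * P) *\<^sub>v (Q *\<^sub>v w)"
      using P Q R w by (simp add: assoc_mult_mat_vec[of _ ?n ?n _ ?n])
    also have "\<dots> = (\<rho>1 g *\<^sub>v a + B g *\<^sub>v d) @\<^sub>v (0\<^sub>m n2 n1 *\<^sub>v a + \<rho>2 g *\<^sub>v d)"
      unfolding b[OF g] ad(1)
      by (rule four_block_mat_mult_vec) (use ad mrepD(1)[OF m(2) g] mrepD(1)[OF m(3) g] B[OF g] in auto)
    also have "0\<^sub>m n2 n1 *\<^sub>v a + \<rho>2 g *\<^sub>v d = \<rho>2 g *\<^sub>v d"
      using zero_mat_mult_vec[OF ad(2), of n2] mrepD(1)[OF m(3) g] ad(3) by simp
    finally have "Q *\<^sub>v (\<rho> g *\<^sub>v w) = (\<rho>1 g *\<^sub>v a + B g *\<^sub>v d) @\<^sub>v (\<rho>2 g *\<^sub>v d)" .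
    then show "vec_last (Q *\<^sub>v (\<rho> g *\<^sub>v w)) n2 = \<rho>2 g *\<^sub>v vec_last (Q *\<^sub>v w) n2"
      unfolding d_def[symmetric] using ad mrepD(1)[OF m(2) g] mrepD(1)[OF m(3) g] B[OF g]
      by (intro eq_vecI) (auto simp: vec_last_def)
  qed
qed

section \<open>Splitting off the top factor of a composition series\<close>

lemma composition_seriesD:
  assumes "composition_series G n \<rho> r W"
  shows "W 0 = {0\<^sub>v n}" "W r = carrier_vec n" "i \<le> r \<Longrightarrow> subrepresentation G n \<rho> (W i)"
    "i < r \<Longrightarrow> W i \<subset> W (Suc i)"
    "i < r \<Longrightarrow> subrepresentation G n \<rho> U \<Longrightarrow> W i \<subset> U \<Longrightarrow> U \<subset> W (Suc i) \<Longrightarrow> False"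
  using assms unfolding composition_series_def by blast+

lemma composition_series_mono:
  assumes "composition_series G n \<rho> r W"
  shows "i \<le> j \<Longrightarrow> j \<le> r \<Longrightarrow> W i \<subseteq> W j"
proof (induction j rule: dec_induct)
  case (step j)
  then show ?case using composition_seriesD(4)[OF assms, of j] by auto
qed simp

lemma carrier_vec_singleton:
  assumes "{0\<^sub>v n} = (carrier_vec n :: 'a::field vec set)"
  shows "n = 0"
proof (rule ccontr)
  assume "n \<noteq> 0"
  have "unit_vec n 0 \<in> {0\<^sub>v n :: 'a vec}" unfolding assms by simp
  then have "unit_vec n 0 $ 0 = (0 :: 'a)" using \<open>n \<noteq> 0\<close> by simp
  then show False using \<open>n \<noteq> 0\<close> by simp
qed

text \<open>In a basis adapted to \<open>W r\<close> the first block carries the series truncated at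
  r, and the second block is the top factor. The latter is irreducible since preimages of its
  subrepresentations lie between \<open>W r\<close> and the whole space.\<close>

lemma composition_series_split:
  fixes \<rho> :: "'g \<Rightarrow> 'k::field mat"
  assumes G: "group G" and m: "mrep G n \<rho>" and cs: "composition_series G n \<rho> (Suc r) W"
  shows "\<exists>n1 n2 P Q \<rho>1 \<rho>2 B W'. n = n1 + n2 \<and> P \<in> carrier_mat n n \<and> Q \<in> carrier_mat n n \<and> P * Q = 1\<^sub>m n \<and> Q * P = 1\<^sub>m n \<and>
    mrep G n1 \<rho>1 \<and> irrep G n2 \<rho>2 \<and> composition_series G n1 \<rho>1 r W' \<and>
    (\<forall>g\<in>carrier G. B g \<in> carrier_mat n1 n2 \<and> Q * \<rho> g * P = four_block_mat (\<rho>1 g) (B g) (0\<^sub>m n2 n1) (\<rho>2 g))"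
proof -
  have U: "subrepresentation G n \<rho> (W r)" using composition_seriesD(3)[OF cs, of r] by simp
  have lU: "lin_subspace n (W r)" using U by (simp add: subrepresentation_iff)
  from subrepresentation_block[OF G m U] obtain n1 n2 P Q \<rho>1 \<rho>2 B where n: "n = n1 + n2"
    and P: "P \<in> carrier_mat n n" and Q: "Q \<in> carrier_mat n n" and PQ: "P * Q = 1\<^sub>m n" "Q * P = 1\<^sub>m n"
    and PU: "\<forall>v\<in>carrier_vec n. P *\<^sub>v v \<in> W r \<longleftrightarrow> (\<forall>i<n. n1 \<le> i \<longrightarrow> v $ i = 0)"
    and mr: "mrep G n1 \<rho>1" "mrep G n2 \<rho>2"
    and B: "\<forall>g\<in>carrier G. B g \<in> carrier_mat n1 n2 \<and> Q * \<rho> g * P = four_block_mat (\<rho>1 g) (B g) (0\<^sub>m n2 n1) (\<rho>2 g)"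
    by blast
  note d = P[unfolded n] Q[unfolded n] PQ[unfolded n] m[unfolded n] mr
  define \<phi> where "\<phi> u = P *\<^sub>v (u @\<^sub>v 0\<^sub>v n2)" for u
  define \<pi> where "\<pi> w = vec_last (Q *\<^sub>v w) n2" for w
  have eqi: "equivariant G n1 \<rho>1 n \<rho> \<phi>"
    using block_inclusion[OF d, of B] B unfolding n \<phi>_def by blast
  have eqp: "equivariant G n \<rho> n2 \<rho>2 \<pi>"
    using block_projection[OF d, of B] B unfolding n \<pi>_def by blast
  have phiW: "\<phi> u \<in> W r" if "u \<in> carrier_vec n1" for u
    unfolding \<phi>_def using PU that n by auto
  have phi_onto: "\<exists>u\<in>carrier_vec n1. w = \<phi> u" if w: "w \<in> W r" for w
  proof
    have wc: "w \<in> carrier_vec n" using lin_subspaceD(1)[OF lU w] .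
    have PQw: "P *\<^sub>v (Q *\<^sub>v w) = w" by (rule mult_mat_vec_inverse[OF P Q PQ(1) wc])
    have z: "\<forall>i<n. n1 \<le> i \<longrightarrow> (Q *\<^sub>v w) $ i = 0" using PU[rule_format, of "Q *\<^sub>v w"] PQw w Q wc by simp
    have "vec_first (Q *\<^sub>v w) n1 @\<^sub>v 0\<^sub>v n2 = Q *\<^sub>v w"
      using z Q wc by (intro eq_vecI) (auto simp: n vec_first_def)
    then show "w = \<phi> (vec_first (Q *\<^sub>v w) n1)" using PQw by (simp add: \<phi>_def)
  qed simp
  have phi0: "u = 0\<^sub>v n1" if "u \<in> carrier_vec n1" "\<phi> u = 0\<^sub>v n" for u
    using append_zero_eq_zeroD[OF d(1,2,4) that(1)] that(2) by (simp add: \<phi>_def n)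
  have phi_inj: "u = v" if uv: "u \<in> carrier_vec n1" "v \<in> carrier_vec n1" "\<phi> u = \<phi> v" for u v
  proof -
    have "\<phi> (u + (-1) \<cdot>\<^sub>v v) = \<phi> v + (-1) \<cdot>\<^sub>v \<phi> v" using equivariantD(2,3)[OF eqi] uv by simp
    also have "\<dots> = 0\<^sub>v n" using equivariantD(1)[OF eqi uv(2)] by (intro eq_vecI) auto
    finally have z: "u + (-1) \<cdot>\<^sub>v v = 0\<^sub>v n1" using uv by (intro phi0) auto
    have "u $ i = v $ i" if "i < n1" for i using arg_cong[OF z, of "\<lambda>w. w $ i"] that uv by simp
    then show ?thesis using uv by (intro eq_vecI) auto
  qed
  \<comment> \<open>\<open>\<phi>\<close> identifies the first block with \<open>W r\<close>; the
    members of the series are pulled back along it.\<close>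
  define W' where "W' i = {u \<in> carrier_vec n1. \<phi> u \<in> W i}" for i
  have WW: "\<phi> ` W' i = W i" if i: "i \<le> r" for i
  proof
    show "W i \<subseteq> \<phi> ` W' i"
    proof
      fix w assume w: "w \<in> W i"
      then have "w \<in> W r" using composition_series_mono[OF cs i] by auto
      then obtain u where "u \<in> carrier_vec n1" "w = \<phi> u" using phi_onto by blast
      then show "w \<in> \<phi> ` W' i" using w by (auto simp: W'_def)
    qed
  qed (auto simp: W'_def)
  have cs1: "composition_series G n1 \<rho>1 r W'"
    unfolding composition_series_def
  proof (intro conjI allI impI)
    show "W' 0 = {0\<^sub>v n1}" using phi0 equivariantD(5)[OF eqi] composition_seriesD(1)[OF cs] by (auto simp: W'_def)
    show "W' r = carrier_vec n1" using phiW by (auto simp: W'_def)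
    fix i
    show "subrepresentation G n1 \<rho>1 (W' i)" if "i \<le> r"
      unfolding W'_def by (rule subrepresentation_vimage[OF eqi mr(1)]) (use composition_seriesD(3)[OF cs] that in simp)
    assume i: "i < r"
    have "W' i \<subseteq> W' (Suc i)" using composition_seriesD(4)[OF cs, of i] i by (auto simp: W'_def)
    moreover have "W' i \<noteq> W' (Suc i)"
      using WW[of i] WW[of "Suc i"] composition_seriesD(4)[OF cs, of i] i by auto
    ultimately show "W' i \<subset> W' (Suc i)" by blast
    show "\<not> (\<exists>U. subrepresentation G n1 \<rho>1 U \<and> W' i \<subset> U \<and> U \<subset> W' (Suc i))"
    proof
      assume "\<exists>U. subrepresentation G n1 \<rho>1 U \<and> W' i \<subset> U \<and> U \<subset> W' (Suc i)"
      then obtain V where V: "subrepresentation G n1 \<rho>1 V" "W' i \<subset> V" "V \<subset> W' (Suc i)" by blast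
      have Vc: "v \<in> carrier_vec n1" if "v \<in> V" for v using V(3) that by (auto simp: W'_def)
      have strict: "\<phi> ` S \<subset> \<phi> ` T" if ST: "S \<subset> T" "T \<subseteq> carrier_vec n1" for S T
      proof -
        obtain t where t: "t \<in> T" "t \<notin> S" using ST(1) by blast
        have "\<phi> t \<notin> \<phi> ` S" using phi_inj[of t] t ST by blast
        then show ?thesis using t ST(1) by blast
      qed
      have "\<phi> ` W' i \<subset> \<phi> ` V" by (rule strict) (use V Vc in auto)
      moreover have "\<phi> ` V \<subset> \<phi> ` W' (Suc i)" by (rule strict) (use V in \<open>auto simp: W'_def\<close>)
      ultimately have "W i \<subset> \<phi> ` V" "\<phi> ` V \<subset> W (Suc i)" using WW[of i] WW[of "Suc i"] i by auto
      then show False using composition_seriesD(5)[OF cs _ subrepresentation_image[OF eqi V(1)], of i] i by simp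
    qed
  qed
  have irr: "irrep G n2 \<rho>2"
    unfolding irrep_def
  proof (intro conjI allI impI)
    have "n1 \<noteq> n"
      using coordinate_subspace_proper(1)[OF lU P Q PQ(1) PU] composition_seriesD(4)[OF cs, of r] composition_seriesD(2)[OF cs] by auto
    then show "0 < n2" using n by simp
    show "mrep G n2 \<rho>2" by fact
    fix V assume V: "subrepresentation G n2 \<rho>2 V"
    have lV: "lin_subspace n2 V" using V by (simp add: subrepresentation_iff)
    \<comment> \<open>T contains the kernel \<open>W r\<close> of the projection, so it can only be
      \<open>W r\<close> or the whole space.\<close>
    define T where "T = {w \<in> carrier_vec n. \<pi> w \<in> V}"
    have T: "subrepresentation G n \<rho> T" unfolding T_def by (rule subrepresentation_vimage[OF eqp m V])
    have onto: "\<exists>w\<in>carrier_vec n. \<pi> w = b" if b: "b \<in> carrier_vec n2" for b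
    proof
      have c: "0\<^sub>v n1 @\<^sub>v b \<in> carrier_vec n" using b by (simp add: n)
      show "P *\<^sub>v (0\<^sub>v n1 @\<^sub>v b) \<in> carrier_vec n" using P c by simp
      show "\<pi> (P *\<^sub>v (0\<^sub>v n1 @\<^sub>v b)) = b"
        unfolding \<pi>_def mult_mat_vec_inverse[OF Q P PQ(2) c] using b by (intro eq_vecI) (auto simp: vec_last_def)
    qed
    have ker: "\<pi> w = 0\<^sub>v n2 \<longleftrightarrow> w \<in> W r" if w: "w \<in> carrier_vec n" for w
    proof -
      have "w \<in> W r \<longleftrightarrow> (\<forall>i<n. n1 \<le> i \<longrightarrow> (Q *\<^sub>v w) $ i = 0)"
        using PU[rule_format, of "Q *\<^sub>v w"] mult_mat_vec_inverse[OF P Q PQ(1) w] Q w by simp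
      also have "\<dots> \<longleftrightarrow> (\<forall>i<n2. (Q *\<^sub>v w) $ (n1 + i) = 0)"
      proof (intro iffI allI impI)
        fix i assume a: "\<forall>i<n2. (Q *\<^sub>v w) $ (n1 + i) = 0" and i: "i < n" "n1 \<le> i"
        have "i - n1 < n2" using i n by simp
        with a have "(Q *\<^sub>v w) $ (n1 + (i - n1)) = 0" by blast
        then show "(Q *\<^sub>v w) $ i = 0" using i by simp
      qed (simp add: n)
      also have "\<dots> \<longleftrightarrow> \<pi> w = 0\<^sub>v n2"
        using Q w by (auto simp: \<pi>_def vec_last_def n vec_eq_iff)
      finally show ?thesis by simp
    qed
    have WT: "W r \<subseteq> T"
    proof
      fix w assume w: "w \<in> W r"
      have wc: "w \<in> carrier_vec n" using lin_subspaceD(1)[OF lU w] .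
      then have "\<pi> w = 0\<^sub>v n2" using ker w by blast
      then show "w \<in> T" using wc lin_subspaceD(2)[OF lV] by (simp add: T_def)
    qed
    have Tc: "T \<subseteq> W (Suc r)" using composition_seriesD(2)[OF cs] by (auto simp: T_def)
    have "T = W r \<or> T = W (Suc r)" using composition_seriesD(5)[OF cs _ T, of r] WT Tc by blast
    then show "V = {0\<^sub>v n2} \<or> V = carrier_vec n2"
    proof
      assume TW: "T = W r"
      have "b = 0\<^sub>v n2" if b: "b \<in> V" for b
      proof -
        obtain w where w: "w \<in> carrier_vec n" "\<pi> w = b" using onto lin_subspaceD(1)[OF lV b] by blast
        then have "w \<in> W r" using b TW by (auto simp: T_def)
        then have "\<pi> w = 0\<^sub>v n2" using ker[OF w(1)] by blast
        then show ?thesis using w(2) by simp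
      qed
      then show ?thesis using lin_subspaceD(2)[OF lV] by blast
    next
      assume TW: "T = W (Suc r)"
      have "b \<in> V" if b: "b \<in> carrier_vec n2" for b
      proof -
        obtain w where w: "w \<in> carrier_vec n" "\<pi> w = b" using onto b by blast
        then have "w \<in> T" using TW composition_seriesD(2)[OF cs] by simp
        then show ?thesis using w by (simp add: T_def)
      qed
      then show ?thesis using lin_subspaceD(1)[OF lV] by blast
    qed
  qed
  show ?thesis
    by (rule exI[of _ n1], rule exI[of _ n2], rule exI[of _ P], rule exI[of _ Q], rule exI[of _ \<rho>1],
       rule exI[of _ \<rho>2], rule exI[of _ B], rule exI[of _ W'], intro conjI n P Q PQ mr(1) irr cs1 B)
qed

text \<open>For unipotent block matrices multiplication becomes addition of the off-diagonal blocks.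
  Thus c times \<open>B x\<close> is the block of x^c, which is zero, and c is invertible.\<close>

lemma unipotent_block_trivial:
  fixes G (structure) and \<rho> :: "'g \<Rightarrow> 'k::field mat"
  assumes G: "group G" and m: "mrep G (n1 + n2) \<rho>"
    and P: "P \<in> carrier_mat (n1 + n2) (n1 + n2)" and Q: "Q \<in> carrier_mat (n1 + n2) (n1 + n2)"
    and PQ: "P * Q = 1\<^sub>m (n1 + n2)" "Q * P = 1\<^sub>m (n1 + n2)"
    and M: "subgroup M G"
    and B: "\<And>y. y \<in> M \<Longrightarrow> B y \<in> carrier_mat n1 n2 \<and> Q * \<rho> y * P = four_block_mat (1\<^sub>m n1) (B y) (0\<^sub>m n2 n1) (1\<^sub>m n2)"
    and x: "x \<in> M" "x [^] c = \<one>" "of_nat c \<noteq> (0 :: 'k)"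
  shows "\<rho> x = 1\<^sub>m (n1 + n2)"
proof -
  interpret group G by fact
  interpret M: subgroup M G by fact
  let ?n = "n1 + n2"
  have f: "Q * \<rho> y * P = four_block_mat (1\<^sub>m n1) (B y) (0\<^sub>m n2 n1) (1\<^sub>m n2)" "B y \<in> carrier_mat n1 n2" if "y \<in> M" for y
    using B[OF that] by auto
  have R: "\<rho> y \<in> carrier_mat ?n ?n" if "y \<in> M" for y using mrepD(1)[OF m M.mem_carrier[OF that]] .
  have ext: "B y = C" if "y \<in> M" "C \<in> carrier_mat n1 n2" "Q * \<rho> y * P = four_block_mat (1\<^sub>m n1) C (0\<^sub>m n2 n1) (1\<^sub>m n2)" for y C
  proof (rule eq_matI)
    fix i j assume "i < dim_row C" "j < dim_col C"
    then have ij: "i < n1" "j < n2" using that by auto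
    have "four_block_mat (1\<^sub>m n1) (B y) (0\<^sub>m n2 n1) (1\<^sub>m n2) = four_block_mat (1\<^sub>m n1) C (0\<^sub>m n2 n1) (1\<^sub>m n2)"
      using f(1)[OF that(1)] that(3) by metis
    from arg_cong[OF this, of "\<lambda>M. M $$ (i, n1 + j)"] show "B y $$ (i, j) = C $$ (i, j)" using ij f(2)[OF that(1)] that(2) by simp
  qed (use f(2)[OF that(1)] that(2) in auto)
  have Bm: "B (y \<otimes> z) = B z + B y" if y: "y \<in> M" and z: "z \<in> M" for y z
  proof (rule ext)
    show "y \<otimes> z \<in> M" using y z by simp
    show "B z + B y \<in> carrier_mat n1 n2" using f(2) y z by simp
    have "Q * \<rho> (y \<otimes> z) * P = Q * \<rho> y * P * (Q * \<rho> z * P)"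
      unfolding conj_mult_mat[OF P Q PQ(1) R[OF y] R[OF z]] mrepD(2)[OF m M.mem_carrier[OF y] M.mem_carrier[OF z]] ..
    also have "\<dots> = four_block_mat (1\<^sub>m n1) (B y) (0\<^sub>m n2 n1) (1\<^sub>m n2) * four_block_mat (1\<^sub>m n1) (B z) (0\<^sub>m n2 n1) (1\<^sub>m n2)"
      by (simp only: f(1)[OF y] f(1)[OF z])
    also have "\<dots> = four_block_mat (1\<^sub>m n1) (B z + B y) (0\<^sub>m n2 n1) (1\<^sub>m n2)"
      by (subst mult_four_block_mat[of _ n1 n1 _ n2 _ n2 _ _ n1 _ n2]) (use f(2)[OF y] f(2)[OF z] in \<open>auto simp: right_add_zero_mat[of _ n1 n1]\<close>)
    finally show "Q * \<rho> (y \<otimes> z) * P = four_block_mat (1\<^sub>m n1) (B z + B y) (0\<^sub>m n2 n1) (1\<^sub>m n2)" .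
  qed
  have B1: "B \<one> = 0\<^sub>m n1 n2"
  proof (rule ext[OF M.one_closed])
    show "Q * \<rho> \<one> * P = four_block_mat (1\<^sub>m n1) (0\<^sub>m n1 n2) (0\<^sub>m n2 n1) (1\<^sub>m n2)"
      by (simp add: mrepD(3)[OF m] right_mult_one_mat[OF Q] PQ(2) four_block_one_mat)
  qed simp
  have Bp: "x [^] k \<in> M \<and> B (x [^] k) = of_nat k \<cdot>\<^sub>m B x" for k :: nat
  proof (induction k)
    case 0
    have "0\<^sub>m n1 n2 = of_nat 0 \<cdot>\<^sub>m B x" using f(2)[OF x(1)] by (intro eq_matI) auto
    then show ?case using B1 by simp
  next
    case (Suc k)
    have "B (x [^] Suc k) = B x + of_nat k \<cdot>\<^sub>m B x" using Bm[of "x [^] k" x] Suc x(1) by simp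
    also have "\<dots> = of_nat (Suc k) \<cdot>\<^sub>m B x" using f(2)[OF x(1)] by (intro eq_matI) (auto simp: algebra_simps)
    finally show ?case using Suc x(1) by simp
  qed
  have z: "of_nat c \<cdot>\<^sub>m B x = 0\<^sub>m n1 n2" using Bp[of c] B1 x(2) by metis
  have Bx: "B x = 0\<^sub>m n1 n2"
  proof (rule eq_matI)
    fix i j assume "i < dim_row (0\<^sub>m n1 n2 :: 'k mat)" "j < dim_col (0\<^sub>m n1 n2 :: 'k mat)"
    then have ij: "i < n1" "j < n2" by auto
    have "of_nat c * B x $$ (i, j) = 0" using arg_cong[OF z, of "\<lambda>M. M $$ (i, j)"] ij f(2)[OF x(1)] by simp
    then show "B x $$ (i, j) = 0\<^sub>m n1 n2 $$ (i, j)" using x(3) ij by simp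
  qed (use f(2)[OF x(1)] in auto)
  have e: "Q * \<rho> x * P = 1\<^sub>m ?n" unfolding f(1)[OF x(1)] Bx by (rule four_block_one_mat)
  have "\<rho> x = P * (Q * \<rho> x * P) * Q" by (rule conj_cancel_mat[OF P Q PQ(1) R[OF x(1)], symmetric])
  also have "\<dots> = 1\<^sub>m ?n" by (simp only: e right_mult_one_mat[OF P] PQ(1))
  finally show ?thesis .
qed

context abelian_normal
begin

text \<open>The top factor contributes one character that occurs in it over the closure. If all
  characters are trivial on M, then M acts trivially on the lower block by induction and on the top
  factor by Clifford's argument; the order of A excludes a nontrivial unipotent action.\<close>

lemma composition_series_chars:
  assumes inv: "of_nat (card A) \<noteq> (0 :: 'k::field)"
  shows "mrep G n (\<rho> :: 'a \<Rightarrow> 'k mat) \<Longrightarrow> composition_series G n \<rho> r W \<Longrightarrow>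
    \<exists>\<chi> :: nat \<Rightarrow> 'a \<Rightarrow> 'k alg_closure. (\<forall>i<r. \<chi> i \<in> chars G A) \<and>
      (\<forall>M. gsub M \<longrightarrow> (\<forall>i<r. \<forall>x\<in>M. \<chi> i x = 1) \<longrightarrow> (\<forall>x\<in>M. \<rho> x = 1\<^sub>m n))"
proof (induction r arbitrary: n \<rho> W)
  case 0
  \<comment> \<open>Without factors the dimension is 0, where every matrix is the identity.\<close>
  have "n = 0" using composition_seriesD(1,2)[OF 0(2)] by (intro carrier_vec_singleton) (rule trans[OF sym])
  then have "\<rho> x = 1\<^sub>m n" if "x \<in> carrier G" for x using mrepD(1)[OF 0(1) that] by (intro eq_matI) auto
  then have "\<forall>x\<in>M. \<rho> x = 1\<^sub>m n" if "gsub M" for M using gsubD(5)[OF that] by blast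
  then show ?case by simp
next
  case (Suc r)
  from composition_series_split[OF is_group Suc.prems] obtain n1 n2 P Q \<rho>1 \<rho>2 B W' where n: "n = n1 + n2"
    and P: "P \<in> carrier_mat n n" and Q: "Q \<in> carrier_mat n n" and PQ: "P * Q = 1\<^sub>m n" "Q * P = 1\<^sub>m n"
    and m1: "mrep G n1 \<rho>1" and irr: "irrep G n2 \<rho>2" and cs: "composition_series G n1 \<rho>1 r W'"
    and B: "\<forall>g\<in>carrier G. B g \<in> carrier_mat n1 n2 \<and> Q * \<rho> g * P = four_block_mat (\<rho>1 g) (B g) (0\<^sub>m n2 n1) (\<rho>2 g)"
    by blast
  note m = Suc.prems(1)
  from Suc.IH[OF m1 cs] obtain \<chi> :: "nat \<Rightarrow> 'a \<Rightarrow> 'k alg_closure" where chi: "\<forall>i<r. \<chi> i \<in> chars G A"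
    and triv: "\<forall>M. gsub M \<longrightarrow> (\<forall>i<r. \<forall>x\<in>M. \<chi> i x = 1) \<longrightarrow> (\<forall>x\<in>M. \<rho>1 x = 1\<^sub>m n1)" by (elim exE conjE)
  have m2: "mrep G n2 \<rho>2" and n2: "0 < n2" using irr by (auto simp: irrep_def)
  have A: "subgroup A G" by (rule gsubD(2)[OF gsub_A])
  have "to_ac (of_nat (card A) :: 'k) \<noteq> 0" using inv by (simp only: to_ac_eq_0_iff not_False_eq_True)
  then have inv': "of_nat (card A) \<noteq> (0 :: 'k alg_closure)" by simp
  from exists_char_elem_nonzero[OF is_group fin A gsub_comm_group[OF gsub_A] inv' mrep_ac_mat[OF m2] n2]
  obtain \<psi> where psi: "\<psi> \<in> chars G A" "alg G n2 (ac_mat \<rho>2) (char_elem G A \<psi>) \<noteq> 0\<^sub>m n2 n2" by blast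
  define \<chi>' where "\<chi>' = \<chi>(r := \<psi>)"
  have "\<rho> x = 1\<^sub>m n" if M: "gsub M" and c: "\<forall>i<Suc r. \<forall>x\<in>M. \<chi>' i x = 1" and x: "x \<in> M" for M x
  proof -
    have c1: "\<forall>i<r. \<forall>x\<in>M. \<chi> i x = 1"
    proof (intro allI impI ballI)
      fix i y assume i: "i < r" and y: "y \<in> M"
      have "\<chi>' i y = 1" using c[rule_format, of i y] i y by simp
      then show "\<chi> i y = 1" using i by (simp add: \<chi>'_def)
    qed
    have c2: "\<forall>x\<in>M. \<psi> x = 1" using c[rule_format, of r] by (simp add: \<chi>'_def)
    have r1: "\<rho>1 y = 1\<^sub>m n1" if "y \<in> M" for y by (rule triv[rule_format, OF M c1[rule_format] that])
    have r2: "\<rho>2 y = 1\<^sub>m n2" if "y \<in> M" for y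
      by (rule bspec[OF iffD2[OF normal_trivial_iff_char[OF is_group fin A inv psi(1) irr psi(2) gsubD(3)[OF M] gsubD(1)[OF M]] c2] that])
    have Mc: "y \<in> carrier G" if "y \<in> M" for y using gsubD(5)[OF M that] .
    have f: "B y \<in> carrier_mat n1 n2 \<and> Q * \<rho> y * P = four_block_mat (1\<^sub>m n1) (B y) (0\<^sub>m n2 n1) (1\<^sub>m n2)" if "y \<in> M" for y
      using bspec[OF B Mc[OF that]] r1[OF that] r2[OF that] by simp
    interpret PA: group "G\<lparr>carrier := A\<rparr>" by (rule subgroup_imp_group[OF A])
    have "x [^]\<^bsub>G\<lparr>carrier := A\<rparr>\<^esub> card A = \<one>" using PA.pow_order_eq_1[of x] gsubD(4)[OF M x] by (simp add: Coset.order_def)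
    then have "x [^] card A = \<one>" by (simp add: nat_pow_def)
    show ?thesis
      unfolding n
      by (rule unipotent_block_trivial[OF is_group m[unfolded n] P[unfolded n] Q[unfolded n] PQ[unfolded n] gsubD(2)[OF M] f x _ inv])
        (assumption, fact)
  qed
  moreover have "\<chi>' i \<in> chars G A" if "i < Suc r" for i using that chi[rule_format, of i] psi(1) by (cases "i = r") (simp_all add: \<chi>'_def)
  ultimately show ?case by (intro exI[of _ \<chi>'] conjI allI impI ballI)
qed

end

section \<open>Direct sums of irreducible representations\<close>

lemma append_vec_first_last: "w \<in> carrier_vec (n + d) \<Longrightarrow> w = vec_first w n @\<^sub>v vec_last w d"
  by simp

lemma vec_first_append: "a \<in> carrier_vec n \<Longrightarrow> vec_first (a @\<^sub>v b) n = a"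
  by (intro eq_vecI) (auto simp: vec_first_def)

lemma vec_last_append: "a \<in> carrier_vec n \<Longrightarrow> b \<in> carrier_vec d \<Longrightarrow> vec_last (a @\<^sub>v b) d = b"
  by (intro eq_vecI) (auto simp: vec_last_def)

lemma
  fixes \<sigma> :: "'g \<Rightarrow> 'k::field mat"
  assumes m: "mrep G n \<sigma>" "mrep G d \<rho>"
  defines "\<tau> \<equiv> \<lambda>x. four_block_mat (\<sigma> x) (0\<^sub>m n d) (0\<^sub>m d n) (\<rho> x)"
  shows direct_sum_mrep: "mrep G (n + d) \<tau>"
    and direct_sum_inclusion: "equivariant G n \<sigma> (n + d) \<tau> (\<lambda>u. u @\<^sub>v 0\<^sub>v d)"
    and direct_sum_first: "equivariant G (n + d) \<tau> n \<sigma> (\<lambda>w. vec_first w n)"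
    and direct_sum_last: "equivariant G (n + d) \<tau> d \<rho> (\<lambda>w. vec_last w d)"
proof -
  have S: "\<sigma> g \<in> carrier_mat n n" and R: "\<rho> g \<in> carrier_mat d d" if "g \<in> carrier G" for g
    using mrepD(1)[OF m(1) that] mrepD(1)[OF m(2) that] by auto
  show "mrep G (n + d) \<tau>"
    unfolding mrep_def
  proof (intro conjI ballI)
    fix g h assume g: "g \<in> carrier G" and h: "h \<in> carrier G"
    show "\<tau> (g \<otimes>\<^bsub>G\<^esub> h) = \<tau> g * \<tau> h"
      unfolding \<tau>_def using S[OF g] S[OF h] R[OF g] R[OF h]
      by (subst mult_four_block_mat[of _ n n _ d _ d _ _ n _ d]) (auto simp: mrepD(2)[OF m(1) g h] mrepD(2)[OF m(2) g h] right_add_zero_mat[of _ n n])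
  next
    show "\<tau> \<one>\<^bsub>G\<^esub> = 1\<^sub>m (n + d)" by (simp add: \<tau>_def mrepD(3)[OF m(1)] mrepD(3)[OF m(2)] four_block_one_mat)
  qed (use S R in \<open>auto simp: \<tau>_def\<close>)
  have act: "\<tau> g *\<^sub>v (a @\<^sub>v b) = (\<sigma> g *\<^sub>v a) @\<^sub>v (\<rho> g *\<^sub>v b)"
    if "g \<in> carrier G" "a \<in> carrier_vec n" "b \<in> carrier_vec d" for g a b
    unfolding \<tau>_def by (rule mult_mat_vec_split) (use that S R in auto)
  show "equivariant G n \<sigma> (n + d) \<tau> (\<lambda>u. u @\<^sub>v 0\<^sub>v d)"
    unfolding equivariant_def using act[where b = "0\<^sub>v d"] mult_mat_zero_vec[OF R]
    by (simp add: append_vec_add_zero append_vec_smult_zero)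
  have act': "\<tau> g *\<^sub>v w = (\<sigma> g *\<^sub>v vec_first w n) @\<^sub>v (\<rho> g *\<^sub>v vec_last w d)"
    if "g \<in> carrier G" "w \<in> carrier_vec (n + d)" for g w
    using act[OF that(1), of "vec_first w n" "vec_last w d"] append_vec_first_last[OF that(2)] by simp
  show "equivariant G (n + d) \<tau> n \<sigma> (\<lambda>w. vec_first w n)"
    unfolding equivariant_def
  proof (intro conjI ballI allI)
    fix g and w :: "'k vec" assume g: "g \<in> carrier G" and w: "w \<in> carrier_vec (n + d)"
    show "vec_first (\<tau> g *\<^sub>v w) n = \<sigma> g *\<^sub>v vec_first w n"
      unfolding act'[OF g w] by (rule vec_first_append) (use S[OF g] in simp)
  qed (auto simp: vec_first_def intro!: eq_vecI)
  show "equivariant G (n + d) \<tau> d \<rho> (\<lambda>w. vec_last w d)"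
    unfolding equivariant_def
  proof (intro conjI ballI allI)
    fix g and w :: "'k vec" assume g: "g \<in> carrier G" and w: "w \<in> carrier_vec (n + d)"
    show "vec_last (\<tau> g *\<^sub>v w) d = \<rho> g *\<^sub>v vec_last w d"
      unfolding act'[OF g w] by (rule vec_last_append[of _ n]) (use S[OF g] R[OF g] in auto)
  qed (auto simp: vec_last_def intro!: eq_vecI)
qed

text \<open>Everything rests on \<open>lastU\<close>: the image of a subrepresentation in the
  irreducible last summand is zero or everything. What remains is decided inside the first
  summand.\<close>

lemma direct_sum_irrep:
  fixes \<sigma> :: "'g \<Rightarrow> 'k::field mat"
  assumes m: "mrep G n \<sigma>" and irr: "irrep G d \<rho>"
    and cr: "completely_reducible G n \<sigma>" and cs: "composition_series G n \<sigma> r W"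
  defines "\<tau> \<equiv> \<lambda>x. four_block_mat (\<sigma> x) (0\<^sub>m n d) (0\<^sub>m d n) (\<rho> x)"
  shows "completely_reducible G (n + d) \<tau>" and "\<exists>W'. composition_series G (n + d) \<tau> (Suc r) W'"
proof -
  have mr: "mrep G d \<rho>" and d0: "0 < d" using irr by (auto simp: irrep_def)
  note mt = direct_sum_mrep[OF m mr, folded \<tau>_def]
  note inc = direct_sum_inclusion[OF m mr, folded \<tau>_def]
  note fst = direct_sum_first[OF m mr, folded \<tau>_def]
  note lst = direct_sum_last[OF m mr, folded \<tau>_def]
  have lastU: "(\<forall>w\<in>U. vec_last w d = 0\<^sub>v d) \<or> (\<forall>b\<in>carrier_vec d. \<exists>w\<in>U. vec_last w d = b)"
    if U: "subrepresentation G (n + d) \<tau> U" for U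
  proof -
    have "(\<lambda>w. vec_last w d) ` U = {0\<^sub>v d} \<or> (\<lambda>w. vec_last w d) ` U = carrier_vec d"
      using subrepresentation_image[OF lst U] irr by (auto simp: irrep_def)
    then show ?thesis
    proof
      assume e: "(\<lambda>w. vec_last w d) ` U = {0\<^sub>v d}"
      have "vec_last w d = 0\<^sub>v d" if "w \<in> U" for w using imageI[OF that, of "\<lambda>w. vec_last w d"] unfolding e by simp
      then show ?thesis by blast
    next
      assume e: "(\<lambda>w. vec_last w d) ` U = carrier_vec d"
      have "\<exists>w\<in>U. vec_last w d = b" if "b \<in> carrier_vec d" for b using that unfolding e[symmetric] by blast
      then show ?thesis by blast
    qed
  qed
  have pre: "subrepresentation G n \<sigma> {u \<in> carrier_vec n. u @\<^sub>v 0\<^sub>v d \<in> U}" if "subrepresentation G (n + d) \<tau> U" for U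
    by (rule subrepresentation_vimage[OF inc m that])
  have split0: "w = vec_first w n @\<^sub>v 0\<^sub>v d" if "w \<in> carrier_vec (n + d)" "vec_last w d = 0\<^sub>v d" for w :: "'k vec"
    using append_vec_first_last[OF that(1)] that(2) by simp
  have inj: "u = v" if "u \<in> carrier_vec n" "v \<in> carrier_vec n" "u @\<^sub>v 0\<^sub>v d = v @\<^sub>v 0\<^sub>v d" for u v :: "'k vec"
    using arg_cong[OF that(3), of "\<lambda>w. vec_first w n"] that(1,2) by (simp add: vec_first_append)
  have zero: "0\<^sub>v n @\<^sub>v 0\<^sub>v d = (0\<^sub>v (n + d) :: 'k vec)" by (intro eq_vecI) auto
  show "completely_reducible G (n + d) \<tau>"
    unfolding completely_reducible_def
  proof (intro allI impI)
    fix U assume U: "subrepresentation G (n + d) \<tau> U"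
    have lU: "lin_subspace (n + d) U" using U by (simp add: subrepresentation_iff)
    \<comment> \<open>The part of U inside the first summand; U2 will be a complement of it
      there.\<close>
    define U1 where "U1 = {u \<in> carrier_vec n. u @\<^sub>v 0\<^sub>v d \<in> U}"
    have U1: "subrepresentation G n \<sigma> U1" unfolding U1_def by (rule pre[OF U])
    from cr[unfolded completely_reducible_def, rule_format, OF U1] obtain U2 where
      U2: "subrepresentation G n \<sigma> U2" "U1 \<inter> U2 = {0\<^sub>v n}" "{u + w |u w. u \<in> U1 \<and> w \<in> U2} = carrier_vec n"
      by (elim exE conjE)
    have lU2: "lin_subspace n U2" using U2(1) by (simp add: subrepresentation_iff)
    have U2c: "u \<in> carrier_vec n" if "u \<in> U2" for u using lin_subspaceD(1)[OF lU2 that] .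
    have dec: "\<exists>u u'. u \<in> U1 \<and> u' \<in> U2 \<and> a = u + u'" if "a \<in> carrier_vec n" for a using U2(3) that by blast
    show "\<exists>C. subrepresentation G (n + d) \<tau> C \<and> U \<inter> C = {0\<^sub>v (n + d)} \<and> {u + w |u w. u \<in> U \<and> w \<in> C} = carrier_vec (n + d)"
      using lastU[OF U]
    proof
      assume l0: "\<forall>w\<in>U. vec_last w d = 0\<^sub>v d"
      \<comment> \<open>U lies in the first summand, so the complement is U2 together with the whole
        last summand.\<close>
      define C where "C = {w \<in> carrier_vec (n + d). vec_first w n \<in> U2}"
      have C: "subrepresentation G (n + d) \<tau> C" unfolding C_def by (rule subrepresentation_vimage[OF fst mt U2(1)])
      have lC: "lin_subspace (n + d) C" using C by (simp add: subrepresentation_iff)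
      have "w = 0\<^sub>v (n + d)" if w: "w \<in> U" "w \<in> C" for w
      proof -
        have e: "w = vec_first w n @\<^sub>v 0\<^sub>v d" using split0 lin_subspaceD(1)[OF lU w(1)] l0 w(1) by blast
        have "vec_first w n @\<^sub>v 0\<^sub>v d \<in> U" using e w(1) by simp
        then have "vec_first w n \<in> U1 \<inter> U2" using w by (auto simp: U1_def C_def)
        then have "vec_first w n = 0\<^sub>v n" using U2(2) by blast
        then show ?thesis using e zero by simp
      qed
      then have int: "U \<inter> C = {0\<^sub>v (n + d)}" using lin_subspaceD(2)[OF lU] lin_subspaceD(2)[OF lC] by blast
      have "\<exists>u c. w = u + c \<and> u \<in> U \<and> c \<in> C" if w: "w \<in> carrier_vec (n + d)" for w
      proof -
        obtain u u' where u: "u \<in> U1" "u' \<in> U2" "vec_first w n = u + u'" using dec[of "vec_first w n"] by auto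
        have uc: "u \<in> carrier_vec n" "u' \<in> carrier_vec n" using u U2c by (auto simp: U1_def)
        have "w = (u + u') @\<^sub>v (0\<^sub>v d + vec_last w d)" using append_vec_first_last[OF w] u(3) by simp
        also have "\<dots> = (u @\<^sub>v 0\<^sub>v d) + (u' @\<^sub>v vec_last w d)" by (intro eq_vecI) (use uc in auto)
        finally have "w = (u @\<^sub>v 0\<^sub>v d) + (u' @\<^sub>v vec_last w d)" .
        moreover have "u' @\<^sub>v vec_last w d \<in> C" using u uc by (simp add: C_def vec_first_append)
        moreover have "u @\<^sub>v 0\<^sub>v d \<in> U" using u by (simp add: U1_def)
        ultimately show ?thesis by blast
      qed
      then have "carrier_vec (n + d) \<subseteq> {u + w |u w. u \<in> U \<and> w \<in> C}" by blast
      moreover have "{u + w |u w. u \<in> U \<and> w \<in> C} \<subseteq> carrier_vec (n + d)"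
        using lin_subspaceD(1)[OF lU] lin_subspaceD(1)[OF lC] by auto
      ultimately show ?thesis using C int by blast
    next
      assume la: "\<forall>b\<in>carrier_vec d. \<exists>w\<in>U. vec_last w d = b"
      \<comment> \<open>U already reaches all of the last summand, so U2 alone is a
        complement.\<close>
      define C where "C = (\<lambda>u. u @\<^sub>v 0\<^sub>v d) ` U2"
      have C: "subrepresentation G (n + d) \<tau> C" unfolding C_def by (rule subrepresentation_image[OF inc U2(1)])
      have lC: "lin_subspace (n + d) C" using C by (simp add: subrepresentation_iff)
      have "w = 0\<^sub>v (n + d)" if w: "w \<in> U" "w \<in> C" for w
      proof -
        obtain u where u: "u \<in> U2" "w = u @\<^sub>v 0\<^sub>v d" using w(2) by (auto simp: C_def)
        then have "u \<in> U1 \<inter> U2" using w(1) U2c by (auto simp: U1_def)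
        then have "u = 0\<^sub>v n" using U2(2) by blast
        then show ?thesis using u zero by simp
      qed
      then have int: "U \<inter> C = {0\<^sub>v (n + d)}" using lin_subspaceD(2)[OF lU] lin_subspaceD(2)[OF lC] by blast
      have "\<exists>u c. w = u + c \<and> u \<in> U \<and> c \<in> C" if w: "w \<in> carrier_vec (n + d)" for w
      proof -
        obtain w0 where w0: "w0 \<in> U" "vec_last w0 d = vec_last w d" using bspec[OF la vec_last_carrier[of w d]] by blast
        have w0c: "w0 \<in> carrier_vec (n + d)" using lin_subspaceD(1)[OF lU w0(1)] .
        obtain u u' where u: "u \<in> U1" "u' \<in> U2" "vec_first w n - vec_first w0 n = u + u'"
          using dec[of "vec_first w n - vec_first w0 n"] by auto
        have uc: "u \<in> carrier_vec n" "u' \<in> carrier_vec n" using u U2c by (auto simp: U1_def)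
        have wi: "w $ i = w0 $ i + u $ i + u' $ i" if "i < n" for i
          using arg_cong[OF u(3), of "\<lambda>v. v $ i"] uc that by (simp add: vec_first_def algebra_simps)
        have wl: "w $ i = w0 $ i" if "i < n + d" "\<not> i < n" for i
          using arg_cong[OF w0(2), of "\<lambda>v. v $ (i - n)"] w w0c that by (simp add: vec_last_def not_less)
        have "w = (w0 + (u @\<^sub>v 0\<^sub>v d)) + (u' @\<^sub>v 0\<^sub>v d)"
          by (rule eq_vecI) (use wi wl w w0c uc in \<open>auto simp: not_less\<close>)
        moreover have "w0 + (u @\<^sub>v 0\<^sub>v d) \<in> U" using lin_subspaceD(3)[OF lU w0(1)] u by (simp add: U1_def)
        moreover have "u' @\<^sub>v 0\<^sub>v d \<in> C" using u by (simp add: C_def)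
        ultimately show ?thesis by blast
      qed
      then have "carrier_vec (n + d) \<subseteq> {u + w |u w. u \<in> U \<and> w \<in> C}" by blast
      moreover have "{u + w |u w. u \<in> U \<and> w \<in> C} \<subseteq> carrier_vec (n + d)"
        using lin_subspaceD(1)[OF lU] lin_subspaceD(1)[OF lC] by auto
      ultimately show ?thesis using C int by blast
    qed
  qed
  let ?\<iota> = "\<lambda>u :: 'k vec. u @\<^sub>v 0\<^sub>v d"
  \<comment> \<open>The series of the first summand with the whole space put on top, whence
    \<open>Suc r\<close> factors.\<close>
  define W' where "W' i = (if i \<le> r then ?\<iota> ` W i else carrier_vec (n + d))" for i
  have Wc: "u \<in> carrier_vec n" if "i \<le> r" "u \<in> W i" for i u
    using composition_seriesD(3)[OF cs that(1)] that(2) by (auto simp: subrepresentation_iff lin_subspace_def)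
  have full: "subrepresentation G (n + d) \<tau> (carrier_vec (n + d))"
    unfolding subrepresentation_iff lin_subspace_def using mult_mat_vec_carrier[OF mrepD(1)[OF mt]] by auto
  have cs': "composition_series G (n + d) \<tau> (Suc r) W'"
    unfolding composition_series_def
  proof (intro conjI allI impI)
    show "W' 0 = {0\<^sub>v (n + d)}" using composition_seriesD(1)[OF cs] zero by (simp add: W'_def)
    show "W' (Suc r) = carrier_vec (n + d)" by (simp add: W'_def)
    fix i
    show "subrepresentation G (n + d) \<tau> (W' i)"
      using subrepresentation_image[OF inc composition_seriesD(3)[OF cs, of i]] full by (simp add: W'_def)
    assume i: "i < Suc r"
    show "W' i \<subset> W' (Suc i)"
    proof (cases "i < r")
      case True
      obtain t where t: "t \<in> W (Suc i)" "t \<notin> W i" using composition_seriesD(4)[OF cs True] by blast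
      have "?\<iota> t \<notin> ?\<iota> ` W i"
      proof
        assume "?\<iota> t \<in> ?\<iota> ` W i"
        then obtain u where u: "u \<in> W i" "?\<iota> t = ?\<iota> u" by blast
        have "t = u" by (rule inj[OF _ _ u(2)]) (use Wc[of "Suc i" t] Wc[of i u] t u True in auto)
        then show False using t u by simp
      qed
      then have "?\<iota> ` W i \<noteq> ?\<iota> ` W (Suc i)" using t by blast
      moreover have "?\<iota> ` W i \<subseteq> ?\<iota> ` W (Suc i)" using composition_seriesD(4)[OF cs True] by blast
      ultimately have "?\<iota> ` W i \<subset> ?\<iota> ` W (Suc i)" by (intro psubsetI)
      then show ?thesis using True by (simp add: W'_def)
    next
      case False
      then have ir: "i = r" using i by simp
      have "unit_vec (n + d) n \<notin> ?\<iota> ` W r"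
      proof
        assume "unit_vec (n + d) n \<in> ?\<iota> ` W r"
        then obtain u where u: "u \<in> W r" "unit_vec (n + d) n = ?\<iota> u" by blast
        have "unit_vec (n + d) n $ n = (?\<iota> u) $ n" using u(2) by simp
        then show False using Wc[of r u] u(1) d0 by simp
      qed
      moreover have "?\<iota> ` W r \<subseteq> carrier_vec (n + d)" using append_carrier_vec[OF Wc[of r] zero_carrier_vec] by auto
      ultimately have "?\<iota> ` W r \<subset> carrier_vec (n + d)" by (intro psubsetI) auto
      then show ?thesis by (simp add: ir W'_def)
    qed
    show "\<not> (\<exists>U. subrepresentation G (n + d) \<tau> U \<and> W' i \<subset> U \<and> U \<subset> W' (Suc i))"
    proof
      assume "\<exists>U. subrepresentation G (n + d) \<tau> U \<and> W' i \<subset> U \<and> U \<subset> W' (Suc i)"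
      then obtain U where U: "subrepresentation G (n + d) \<tau> U" "W' i \<subset> U" "U \<subset> W' (Suc i)" by blast
      have lU: "lin_subspace (n + d) U" using U by (simp add: subrepresentation_iff)
      show False
      proof (cases "i < r")
        case True
        \<comment> \<open>Below the top step U lies in the first summand, so it comes from a V
          strictly between \<open>W i\<close> and \<open>W (Suc i)\<close>.\<close>
        define V where "V = {u \<in> carrier_vec n. ?\<iota> u \<in> U}"
        have V: "subrepresentation G n \<sigma> V" unfolding V_def by (rule pre[OF U(1)])
        have w1: "?\<iota> ` W i \<subset> U" "U \<subset> ?\<iota> ` W (Suc i)" using U(2,3) True by (simp_all add: W'_def)
        have UV: "U = ?\<iota> ` V"
        proof
          show "U \<subseteq> ?\<iota> ` V"
          proof
            fix w assume w: "w \<in> U"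
            then obtain u where "u \<in> W (Suc i)" "w = ?\<iota> u" using w1(2) by blast
            then show "w \<in> ?\<iota> ` V" using w Wc[of "Suc i" u] True by (simp add: V_def)
          qed
        qed (auto simp: V_def)
        have "W i \<subseteq> V"
        proof
          fix u assume u: "u \<in> W i"
          then have "?\<iota> u \<in> U" using w1(1) by blast
          then show "u \<in> V" using Wc[of i u] u True by (simp add: V_def)
        qed
        moreover have "V \<subseteq> W (Suc i)"
        proof
          fix v assume v: "v \<in> V"
          then have "?\<iota> v \<in> U" by (simp add: V_def)
          then obtain u where u: "u \<in> W (Suc i)" "?\<iota> v = ?\<iota> u" using w1(2) by blast
          have "v = u" by (rule inj[OF _ _ u(2)]) (use v u(1) Wc[of "Suc i" u] True in \<open>auto simp: V_def\<close>)
          then show "v \<in> W (Suc i)" using u by simp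
        qed
        moreover have "V \<noteq> W i"
        proof
          assume "V = W i"
          then show False using w1(1) unfolding UV by simp
        qed
        moreover have "V \<noteq> W (Suc i)"
        proof
          assume "V = W (Suc i)"
          then show False using w1(2) unfolding UV by simp
        qed
        ultimately have "W i \<subset> V" "V \<subset> W (Suc i)" by (intro psubsetI; simp)+
        then show False using composition_seriesD(5)[OF cs True V] by simp
      next
        case False
        then have ir: "i = r" using i by simp
        have w1: "?\<iota> ` carrier_vec n \<subset> U" "U \<subset> carrier_vec (n + d)"
          using U(2,3) ir composition_seriesD(2)[OF cs] by (simp_all add: W'_def)
        from lastU[OF U(1)] show False
        proof
          assume l0: "\<forall>w\<in>U. vec_last w d = 0\<^sub>v d"
          have "w \<in> ?\<iota> ` carrier_vec n" if w: "w \<in> U" for w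
            by (rule image_eqI[where x = "vec_first w n"]) (rule split0[OF lin_subspaceD(1)[OF lU w] bspec[OF l0 w]], rule vec_first_carrier)
          then show False using w1(1) by blast
        next
          assume la: "\<forall>b\<in>carrier_vec d. \<exists>w\<in>U. vec_last w d = b"
          have "w \<in> U" if w: "w \<in> carrier_vec (n + d)" for w
          proof -
            obtain w0 where w0: "w0 \<in> U" "vec_last w0 d = vec_last w d" using bspec[OF la vec_last_carrier[of w d]] by blast
            have w0c: "w0 \<in> carrier_vec (n + d)" using lin_subspaceD(1)[OF lU w0(1)] .
            have wl: "w $ i = w0 $ i" if "i < n + d" "\<not> i < n" for i
              using arg_cong[OF w0(2), of "\<lambda>v. v $ (i - n)"] w w0c that by (simp add: vec_last_def not_less)
            have e: "w0 + ?\<iota> (vec_first w n - vec_first w0 n) = w"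
              by (rule eq_vecI) (use wl w w0c in \<open>auto simp: vec_first_def\<close>)
            have "?\<iota> (vec_first w n - vec_first w0 n) \<in> U"
              using w1(1) minus_carrier_vec[OF vec_first_carrier vec_first_carrier] by blast
            from lin_subspaceD(3)[OF lU w0(1) this] show ?thesis unfolding e .
          qed
          then show False using w1(2) by blast
        qed
      qed
    qed
  qed
  show "\<exists>W'. composition_series G (n + d) \<tau> (Suc r) W'" by (rule exI[of _ W'], rule cs')
qed

lemma four_block_diag_oneD:
  fixes M :: "'k::field mat"
  assumes M: "M \<in> carrier_mat n n" and N: "N \<in> carrier_mat d d"
    and e: "four_block_mat M (0\<^sub>m n d) (0\<^sub>m d n) N = 1\<^sub>m (n + d)"
  shows "M = 1\<^sub>m n" and "N = 1\<^sub>m d"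
proof -
  have "M $$ (i, j) = 1\<^sub>m n $$ (i, j)" if ij: "i < n" "j < n" for i j
  proof -
    have "M $$ (i, j) = four_block_mat M (0\<^sub>m n d) (0\<^sub>m d n) N $$ (i, j)" using M N ij by simp
    also have "\<dots> = 1\<^sub>m (n + d) $$ (i, j)" by (simp only: e)
    also have "\<dots> = 1\<^sub>m n $$ (i, j)" using ij by simp
    finally show ?thesis .
  qed
  then show "M = 1\<^sub>m n" using M by (intro eq_matI) (simp_all del: index_one_mat(1))
  have "N $$ (i, j) = 1\<^sub>m d $$ (i, j)" if ij: "i < d" "j < d" for i j
  proof -
    have "N $$ (i, j) = four_block_mat M (0\<^sub>m n d) (0\<^sub>m d n) N $$ (n + i, n + j)" using M N ij by simp
    also have "\<dots> = 1\<^sub>m (n + d) $$ (n + i, n + j)" by (simp only: e)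
    also have "\<dots> = 1\<^sub>m d $$ (i, j)" using ij by simp
    finally show ?thesis .
  qed
  then show "N = 1\<^sub>m d" using N by (intro eq_matI) (simp_all del: index_one_mat(1))
qed

text \<open>Complete reducibility and the series are built in the same induction over the summands,
  which makes the length exactly r. The start is the zero-dimensional representation, hence the
  clause that n is positive once r is.\<close>

lemma direct_sum_irreps:
  fixes \<rho> :: "nat \<Rightarrow> 'g \<Rightarrow> 'k::field mat"
  assumes "\<forall>i<r. irrep G (d i) (\<rho> i)"
  shows "\<exists>n (\<sigma> :: 'g \<Rightarrow> 'k mat) W. mrep G n \<sigma> \<and> completely_reducible G n \<sigma> \<and> composition_series G n \<sigma> r W \<and>
    (0 < r \<longrightarrow> 0 < n) \<and> (\<forall>x\<in>carrier G. \<sigma> x = 1\<^sub>m n \<longrightarrow> (\<forall>i<r. \<rho> i x = 1\<^sub>m (d i)))"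
  using assms
proof (induction r)
  case 0
  have z: "v = 0\<^sub>v 0" if "v \<in> carrier_vec 0" for v :: "'k vec"
    using that by (intro eq_vecI) simp_all
  have c: "carrier_vec 0 = {0\<^sub>v 0 :: 'k vec}"
    by (rule antisym; rule subsetI) (simp_all only: z singletonI singleton_iff zero_carrier_vec)
  let ?\<sigma> = "\<lambda>_ :: 'g. 1\<^sub>m 0 :: 'k mat"
  have z1: "0\<^sub>v 0 + 0\<^sub>v 0 = (0\<^sub>v 0 :: 'k vec)" by (rule z) simp
  have z2: "a \<cdot>\<^sub>v 0\<^sub>v 0 = (0\<^sub>v 0 :: 'k vec)" for a by (rule z) simp
  have z3: "1\<^sub>m 0 *\<^sub>v 0\<^sub>v 0 = (0\<^sub>v 0 :: 'k vec)" by (rule z) simp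
  have s1: "subrepresentation G 0 ?\<sigma> {0\<^sub>v 0}"
    unfolding subrepresentation_iff lin_subspace_def c
    by (simp only: z1 z2 z3 ball_simps singleton_iff simp_thms subset_refl) blast
  have s2: "U = {0\<^sub>v 0}" if "subrepresentation G 0 ?\<sigma> U" for U
  proof -
    have "U \<subseteq> {0\<^sub>v 0}" "0\<^sub>v 0 \<in> U" using that unfolding subrepresentation_iff lin_subspace_def c by (simp_all only: simp_thms)
    then show ?thesis by blast
  qed
  have m: "mrep G 0 ?\<sigma>" by (simp add: mrep_def)
  have cr: "completely_reducible G 0 ?\<sigma>"
    unfolding completely_reducible_def
  proof (intro allI impI exI conjI)
    fix U assume U: "subrepresentation G 0 ?\<sigma> U"
    show "subrepresentation G 0 ?\<sigma> {0\<^sub>v 0}" by (rule s1)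
    show "U \<inter> {0\<^sub>v 0} = {0\<^sub>v 0}" unfolding s2[OF U] by (rule Int_absorb)
    have "{u + w | u w. u \<in> {0\<^sub>v 0} \<and> w \<in> {0\<^sub>v 0}} = {0\<^sub>v 0 + 0\<^sub>v 0 :: 'k vec}" by blast
    then show "{u + w | u w. u \<in> U \<and> w \<in> {0\<^sub>v 0}} = carrier_vec 0" unfolding s2[OF U] c z1 .
  qed
  have cs: "composition_series G 0 ?\<sigma> 0 (\<lambda>_. {0\<^sub>v 0})"
    unfolding composition_series_def using s1 c by simp
  show ?case
    by (rule exI[of _ 0], rule exI[of _ ?\<sigma>], rule exI[of _ "\<lambda>_. {0\<^sub>v 0}"], intro conjI m cr cs) simp_all
next
  case (Suc r)
  have prem: "irrep G (d i) (\<rho> i)" if "i < Suc r" for i by (rule Suc.prems[rule_format, OF that])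
  have "\<forall>i<r. irrep G (d i) (\<rho> i)" using prem less_SucI by blast
  from Suc.IH[OF this] obtain n and \<sigma> :: "'g \<Rightarrow> 'k mat" and W where ih: "mrep G n \<sigma> \<and> completely_reducible G n \<sigma> \<and> composition_series G n \<sigma> r W \<and>
    (0 < r \<longrightarrow> 0 < n) \<and> (\<forall>x\<in>carrier G. \<sigma> x = 1\<^sub>m n \<longrightarrow> (\<forall>i<r. \<rho> i x = 1\<^sub>m (d i)))"
    by (elim exE)
  note m = ih[THEN conjunct1] and cr = ih[THEN conjunct2, THEN conjunct1] and cs = ih[THEN conjunct2, THEN conjunct2, THEN conjunct1]
    and t = ih[THEN conjunct2, THEN conjunct2, THEN conjunct2, THEN conjunct2]
  have irr: "irrep G (d r) (\<rho> r)" by (rule prem) simp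
  then have mr: "mrep G (d r) (\<rho> r)" and d0: "0 < d r" by (auto simp: irrep_def)
  let ?\<tau> = "\<lambda>x. four_block_mat (\<sigma> x) (0\<^sub>m n (d r)) (0\<^sub>m (d r) n) (\<rho> r x)"
  obtain W' where W': "composition_series G (n + d r) ?\<tau> (Suc r) W'" using direct_sum_irrep(2)[OF m irr cr cs] by blast
  have "\<forall>x\<in>carrier G. ?\<tau> x = 1\<^sub>m (n + d r) \<longrightarrow> (\<forall>i<Suc r. \<rho> i x = 1\<^sub>m (d i))"
  proof (intro ballI impI allI)
    fix x i assume x: "x \<in> carrier G" and e: "?\<tau> x = 1\<^sub>m (n + d r)" and i: "i < Suc r"
    note one = four_block_diag_oneD[OF mrepD(1)[OF m x] mrepD(1)[OF mr x] e]
    show "\<rho> i x = 1\<^sub>m (d i)"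
    proof (cases "i = r")
      case False
      then have "i < r" using i by simp
      then show ?thesis using t x one(1) by blast
    qed (use one(2) in simp)
  qed
  then show ?case
    using direct_sum_mrep[OF m mr] direct_sum_irrep(1)[OF m irr cr cs] W' d0
    by (intro exI[of _ "n + d r"] exI[of _ ?\<tau>] exI[of _ W'] conjI) simp_all
qed

section \<open>Irreducible representations above a character\<close>

lemma (in group) finite_normal_subgroups:
  assumes "finite (carrier G)"
  shows "finite {H. H \<lhd> G}"
proof (rule finite_subset)
  show "{H. H \<lhd> G} \<subseteq> Pow (carrier G)"
  proof
    fix H assume "H \<in> {H. H \<lhd> G}"
    then have "H \<lhd> G" by (rule CollectD)
    then show "H \<in> Pow (carrier G)" by (intro PowI subgroup.subset normal_imp_subgroup)
  qed
qed (use assms in simp)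

lemma (in group) foot_Int:
  assumes "foot G N" "M \<lhd> G" "\<not> N \<subseteq> M"
  shows "M \<inter> N = {\<one>}"
proof -
  have "M \<inter> N \<lhd> G" using normal_subgroup_intersect assms(1,2) by (auto simp: foot_def)
  then have "M \<inter> N = {\<one>} \<or> M \<inter> N = N" using assms(1) unfolding foot_def by blast
  then show ?thesis using assms(3) by blast
qed

lemma (in group) commuting_comm_group:
  assumes N: "subgroup N G" and c: "\<And>x y. x \<in> N \<Longrightarrow> y \<in> N \<Longrightarrow> x \<otimes> y = y \<otimes> x"
  shows "comm_group (G\<lparr>carrier := N\<rparr>)"
  by (rule group.group_comm_groupI[OF subgroup_imp_group[OF N]]) (use c in auto)

context abelian_normal
begin

text \<open>A normal subgroup H with an element f supported on it is enlarged until H contains every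
  nonabelian foot. Each enlargement multiplies f by an element of augmentation zero from a new foot,
  so that nonvanishing of the final f on an irreducible representation encodes all requirements at
  once.\<close>

lemma irrep_over_char:
  fixes \<chi> :: "'a \<Rightarrow> 'k::field alg_closure"
  assumes sf: "semi_faithful TYPE('k) G" and chi: "\<chi> \<in> chars G A"
  shows "\<exists>d (\<rho> :: 'a \<Rightarrow> 'k mat). irrep G d \<rho> \<and> (\<forall>M. gsub M \<longrightarrow> (\<forall>x\<in>M. \<rho> x = 1\<^sub>m d) \<longrightarrow> (\<forall>x\<in>M. \<chi> x = 1)) \<and>
    (\<forall>N. foot G N \<longrightarrow> \<not> comm_group (G\<lparr>carrier := N\<rparr>) \<longrightarrow> (\<exists>x\<in>N. \<rho> x \<noteq> 1\<^sub>m d))"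
proof -
  have inv: "of_nat (card A) \<noteq> (0 :: 'k)" by (rule semi_faithful_card_nonzero[OF sf])
  then have "to_ac (of_nat (card A) :: 'k) \<noteq> 0" by (simp only: to_ac_eq_0_iff not_False_eq_True)
  then have inv': "of_nat (card A) \<noteq> (0 :: 'k alg_closure)" by simp
  have sA: "subgroup A G" by (rule gsubD(2)[OF gsub_A])
  \<comment> \<open>Quantified over all representations over the closure, since the irreducible one
    is chosen only at the end.\<close>
  define good :: "'a set \<Rightarrow> ('a \<Rightarrow> 'k alg_closure) \<Rightarrow> bool" where
    "good H f \<longleftrightarrow> (\<forall>x\<in>carrier G. x \<notin> H \<longrightarrow> f x = 0) \<and> nonnilp G f \<and>
      (\<forall>n \<sigma>. mrep G n \<sigma> \<longrightarrow> alg G n \<sigma> f \<noteq> 0\<^sub>m n n \<longrightarrow> alg G n \<sigma> (char_elem G A \<chi>) \<noteq> 0\<^sub>m n n \<and>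
        (\<forall>N. foot G N \<longrightarrow> \<not> comm_group (G\<lparr>carrier := N\<rparr>) \<longrightarrow> N \<subseteq> H \<longrightarrow> (\<exists>x\<in>N. \<sigma> x \<noteq> 1\<^sub>m n)))" for H f
  let ?S = "{H. H \<lhd> G \<and> A \<subseteq> H \<and> (\<exists>f. good H f)}"
  \<comment> \<open>A contains only abelian feet, so the clause on nonabelian feet is empty for the
    start H = A.\<close>
  have "comm_group (G\<lparr>carrier := N\<rparr>)" if "foot G N" "N \<subseteq> A" for N
    using that(1) subsetD[OF that(2)] A_comm by (intro commuting_comm_group) (simp_all add: foot_def normal_imp_subgroup)
  then have "good A (char_elem G A \<chi>)"
    using nonnilp_char_elem[OF is_group fin sA inv' chi] by (auto simp: good_def char_elem_def)
  then have "A \<in> ?S" using A_normal by blast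
  then have ne: "?S \<noteq> {}" by (rule ex_in_conv[THEN iffD1, OF exI])
  have "finite ?S"
    by (rule finite_subset[OF _ finite_normal_subgroups[OF fin]]) blast
  from finite_has_maximal[OF this ne] obtain H where H: "H \<in> ?S" and max: "\<forall>H'\<in>?S. H \<subseteq> H' \<longrightarrow> H = H'"
    by (elim bexE)
  from H obtain f where Hn: "H \<lhd> G" and AH: "A \<subseteq> H" and f: "good H f" by blast
  have f1: "\<And>x. x \<in> carrier G \<Longrightarrow> x \<notin> H \<Longrightarrow> f x = 0" and f2: "nonnilp G f"
    and f3: "\<And>n \<sigma>. mrep G n \<sigma> \<Longrightarrow> alg G n \<sigma> f \<noteq> 0\<^sub>m n n \<Longrightarrow> alg G n \<sigma> (char_elem G A \<chi>) \<noteq> 0\<^sub>m n n"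
    and f4: "\<And>n \<sigma> N. mrep G n \<sigma> \<Longrightarrow> alg G n \<sigma> f \<noteq> 0\<^sub>m n n \<Longrightarrow> foot G N \<Longrightarrow> \<not> comm_group (G\<lparr>carrier := N\<rparr>) \<Longrightarrow> N \<subseteq> H \<Longrightarrow> \<exists>x\<in>N. \<sigma> x \<noteq> 1\<^sub>m n"
    using f unfolding good_def by blast+
  have sH: "subgroup H G" by (rule normal_imp_subgroup[OF Hn])
  have all: "N \<subseteq> H" if N: "foot G N" "\<not> comm_group (G\<lparr>carrier := N\<rparr>)" for N
  proof (rule ccontr)
    assume nH: "\<not> N \<subseteq> H"
    have Nn: "N \<lhd> G" "N \<noteq> {\<one>}" using N by (auto simp: foot_def)
    have sN: "subgroup N G" by (rule normal_imp_subgroup[OF Nn(1)])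
    have HN: "H \<inter> N = {\<one>}" by (rule foot_Int[OF N(1) Hn nH])
    obtain l :: "'a \<Rightarrow> 'k" where l: "\<forall>x. x \<notin> N \<longrightarrow> l x = 0" "(\<Sum>x\<in>carrier G. l x) = 0" "nonnilp G l"
      using semi_faithful_augmentation[OF is_group fin sf Nn] by blast
    define h where "h = (\<lambda>x. to_ac (l x))"
    have h1: "\<And>x. x \<in> carrier G \<Longrightarrow> x \<notin> N \<Longrightarrow> h x = 0" and h2: "nonnilp G h"
      using l nonnilp_to_ac by (auto simp: h_def)
    have h3: "(\<Sum>x\<in>carrier G. h x) = 0" using l(2) by (simp add: h_def to_ac_sum[symmetric])
    have "good (H <#> N) (conv G f h)"
      unfolding good_def
    proof (intro conjI ballI impI allI)
      show "nonnilp G (conv G f h)" by (rule nonnilp_conv(1)[OF is_group fin Hn Nn(1) HN f1 f2 h1 h2])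
      show "conv G f h x = 0" if "x \<in> carrier G" "x \<notin> H <#> N" for x
        by (rule nonnilp_conv(2)[OF is_group fin Hn Nn(1) HN f1 f2 h1 h2 that])
    next
      fix n and \<sigma> :: "'a \<Rightarrow> 'k alg_closure mat"
      assume m: "mrep G n \<sigma>" and nz: "alg G n \<sigma> (conv G f h) \<noteq> 0\<^sub>m n n"
      have e: "alg G n \<sigma> (conv G f h) = alg G n \<sigma> f * alg G n \<sigma> h" by (rule alg_conv[OF is_group m])
      have nf: "alg G n \<sigma> f \<noteq> 0\<^sub>m n n"
      proof
        assume "alg G n \<sigma> f = 0\<^sub>m n n"
        then show False using nz e by (simp add: left_mult_zero_mat[of _ n n])
      qed
      have nh: "alg G n \<sigma> h \<noteq> 0\<^sub>m n n"
      proof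
        assume "alg G n \<sigma> h = 0\<^sub>m n n"
        then show False using nz e by (simp add: right_mult_zero_mat[of _ n n])
      qed
      show "alg G n \<sigma> (char_elem G A \<chi>) \<noteq> 0\<^sub>m n n" by (rule f3[OF m nf])
      fix N' assume N': "foot G N'" "\<not> comm_group (G\<lparr>carrier := N'\<rparr>)" "N' \<subseteq> H <#> N"
      have N'n: "N' \<lhd> G" using N' by (auto simp: foot_def)
      show "\<exists>x\<in>N'. \<sigma> x \<noteq> 1\<^sub>m n"
      proof (cases "N' \<subseteq> H")
        case True
        then show ?thesis using f4[OF m nf N'(1,2)] by blast
      next
        case nH': False
        show ?thesis
        proof (cases "N' \<subseteq> N")
          case True
          then have "N' = N" using N(1) N'(1) N'n unfolding foot_def by blast
          show ?thesis
          proof (rule ccontr)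
            assume "\<not> ?thesis"
            then have t: "\<sigma> x = 1\<^sub>m n" if "x \<in> N" for x using that \<open>N' = N\<close> by blast
            \<comment> \<open>If N acts trivially, h acts as the scalar given by the sum of its
              values, which is zero.\<close>
            have "alg G n \<sigma> h = 0\<^sub>m n n"
            proof (rule eq_matI)
              fix i j assume "i < dim_row (0\<^sub>m n n :: 'k alg_closure mat)" "j < dim_col (0\<^sub>m n n :: 'k alg_closure mat)"
              then have ij: "i < n" "j < n" by auto
              have "(\<Sum>g\<in>carrier G. h g * \<sigma> g $$ (i, j)) = (\<Sum>g\<in>carrier G. h g * 1\<^sub>m n $$ (i, j))"
              proof (rule sum.cong[OF refl])
                fix g assume g: "g \<in> carrier G"
                show "h g * \<sigma> g $$ (i, j) = h g * 1\<^sub>m n $$ (i, j)"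
                  by (cases "g \<in> N") (simp_all add: t h1[OF g])
              qed
              also have "\<dots> = 0" unfolding sum_distrib_right[symmetric] h3 by simp
              finally show "alg G n \<sigma> h $$ (i, j) = 0\<^sub>m n n $$ (i, j)" using ij by simp
            qed auto
            then show False using nh by blast
          qed
        next
          case False
          \<comment> \<open>A foot in the product of H and N that meets both trivially commutes with
            both, hence with the product and in particular with itself.\<close>
          have i1: "H \<inter> N' = {\<one>}" by (rule foot_Int[OF N'(1) Hn nH'])
          have i2: "N \<inter> N' = {\<one>}" by (rule foot_Int[OF N'(1) Nn(1) False])
          have "comm_group (G\<lparr>carrier := N'\<rparr>)"
          proof (rule commuting_comm_group[OF normal_imp_subgroup[OF N'n]])
            fix x y assume x: "x \<in> N'" and y: "y \<in> N'"
            obtain a b where ab: "a \<in> H" "b \<in> N" "y = a \<otimes> b" using y N'(3) by (auto simp: set_mult_def)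
            have c: "a \<in> carrier G" "b \<in> carrier G" "x \<in> carrier G"
              using ab x subgroup.mem_carrier[OF sH] subgroup.mem_carrier[OF sN] subgroup.mem_carrier[OF normal_imp_subgroup[OF N'n]] by auto
            have ax: "a \<otimes> x = x \<otimes> a" by (rule normal_imp_commuting[OF Hn N'n _ ab(1) x]) (use i1 in simp)
            have bx: "b \<otimes> x = x \<otimes> b" by (rule normal_imp_commuting[OF Nn(1) N'n _ ab(2) x]) (use i2 in simp)
            have "x \<otimes> y = (x \<otimes> a) \<otimes> b" using ab(3) c by (simp add: m_assoc)
            also have "\<dots> = a \<otimes> (x \<otimes> b)" using ax[symmetric] c by (simp add: m_assoc)
            also have "\<dots> = y \<otimes> x" using bx[symmetric] ab(3) c by (simp add: m_assoc)
            finally show "x \<otimes> y = y \<otimes> x" .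
          qed
          then show ?thesis using N'(2) by blast
        qed
      qed
    qed
    moreover have HHN: "H \<subseteq> H <#> N"
    proof
      fix x assume "x \<in> H"
      then have "x \<otimes> \<one> \<in> H <#> N" using subgroup.one_closed[OF sN] unfolding set_mult_def by blast
      then show "x \<in> H <#> N" using \<open>x \<in> H\<close> subgroup.mem_carrier[OF sH] by simp
    qed
    ultimately have "H <#> N \<in> ?S" using normal_subgroup_set_mult_closed[OF Hn Nn(1)] AH by blast
    from max[rule_format, OF this HHN] have "H = H <#> N" .
    moreover have "N \<subseteq> H <#> N"
    proof
      fix x assume "x \<in> N"
      then have "\<one> \<otimes> x \<in> H <#> N" using subgroup.one_closed[OF sH] unfolding set_mult_def by blast
      then show "x \<in> H <#> N" using \<open>x \<in> N\<close> subgroup.mem_carrier[OF sN] by simp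
    qed
    ultimately show False using nH by simp
  qed
  obtain d and \<rho> :: "'a \<Rightarrow> 'k mat" where irr: "irrep G d \<rho>" and nz: "alg G d (ac_mat \<rho>) f \<noteq> 0\<^sub>m d d"
    using irrep_nonzero_on_nonnilp[OF is_group fin f2] by blast
  have m: "mrep G d (ac_mat \<rho>)" using irr by (auto simp: irrep_def intro: mrep_ac_mat)
  have "\<forall>x\<in>M. \<chi> x = 1" if M: "gsub M" and t: "\<forall>x\<in>M. \<rho> x = 1\<^sub>m d" for M
    by (rule iffD1[OF normal_trivial_iff_char[OF is_group fin sA inv chi irr f3[OF m nz] gsubD(3)[OF M] gsubD(1)[OF M]] t])
  moreover have "\<exists>x\<in>N. \<rho> x \<noteq> 1\<^sub>m d" if N: "foot G N" "\<not> comm_group (G\<lparr>carrier := N\<rparr>)" for N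
  proof -
    obtain x where x: "x \<in> N" "map_mat to_ac (\<rho> x) \<noteq> 1\<^sub>m d" using f4[OF m nz N all[OF N]] by blast
    then have "\<rho> x \<noteq> 1\<^sub>m d" using to_ac.mat_hom_one by metis
    then show ?thesis using x(1) by blast
  qed
  ultimately show ?thesis using irr by blast
qed

end

section \<open>Assembling the faithful representation\<close>

lemma (in group) exists_foot:
  assumes fin: "finite (carrier G)" and K: "K \<lhd> G" "K \<noteq> {\<one>}"
  shows "\<exists>N. foot G N \<and> N \<subseteq> K"
proof -
  let ?S = "{N. N \<lhd> G \<and> N \<noteq> {\<one>} \<and> N \<subseteq> K}"
  have fS: "finite ?S"
    by (rule finite_subset[OF _ finite_normal_subgroups[OF fin]]) blast
  have "K \<in> ?S" using K by simp
  then have "?S \<noteq> {}" by (rule ex_in_conv[THEN iffD1, OF exI])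
  from finite_has_minimal[OF fS this] obtain N where N: "N \<in> ?S" and min: "\<forall>N'\<in>?S. N' \<subseteq> N \<longrightarrow> N = N'"
    by (elim bexE)
  have "foot G N"
    unfolding foot_def
  proof (intro conjI allI impI)
    fix M assume M: "M \<lhd> G" "M \<subseteq> N"
    show "M = {\<one>} \<or> M = N"
    proof (cases "M = {\<one>}")
      case False
      have "M \<subseteq> K" using M(2) N by (intro order_trans[of M N K]) simp_all
      then have "M \<in> ?S" using False M(1) by simp
      from min[rule_format, OF this M(2)] show ?thesis by simp
    qed simp
  qed (use N in auto)
  then show ?thesis using N by blast
qed

text \<open>The kernel of the direct sum, if nontrivial, contains a foot. An abelian foot lies in A
  and would be killed by the whole system; a nonabelian one acts nontrivially on each
  summand.\<close>

lemma (in abelian_normal) faithful_from_char_system: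
  fixes \<chi> :: "nat \<Rightarrow> 'a \<Rightarrow> 'k::field alg_closure"
  assumes sf: "semi_faithful TYPE('k) G" and r: "0 < r" and cs: "char_system r A \<chi>"
    and feet: "\<And>N. foot G N \<Longrightarrow> comm_group (G\<lparr>carrier := N\<rparr>) \<Longrightarrow> N \<subseteq> A"
  shows "\<exists>n (\<rho> :: 'a \<Rightarrow> 'k mat) W. faithful_representation G n \<rho> \<and> completely_reducible G n \<rho> \<and> composition_series G n \<rho> r W"
proof -
  have c1: "\<And>i. i < r \<Longrightarrow> \<chi> i \<in> chars G A"
    and c2: "\<And>M. gsub M \<Longrightarrow> \<forall>i<r. \<forall>x\<in>M. \<chi> i x = 1 \<Longrightarrow> M = {\<one>}"
    using cs gsubD(1) unfolding char_system_def by blast+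
  \<comment> \<open>Dimension and representation are packed into a pair, so that both are chosen at
    once for every character.\<close>
  define P where "P i p \<longleftrightarrow> irrep G (fst p) (snd p) \<and> (\<forall>M. gsub M \<longrightarrow> (\<forall>x\<in>M. snd p x = 1\<^sub>m (fst p)) \<longrightarrow> (\<forall>x\<in>M. \<chi> i x = 1)) \<and>
    (\<forall>N. foot G N \<longrightarrow> \<not> comm_group (G\<lparr>carrier := N\<rparr>) \<longrightarrow> (\<exists>x\<in>N. snd p x \<noteq> 1\<^sub>m (fst p)))" for i and p :: "nat \<times> ('a \<Rightarrow> 'k mat)"
  have "\<exists>p. P i p" if i: "i < r" for i
  proof -
    from irrep_over_char[OF sf c1[OF i]] obtain d and \<rho> :: "'a \<Rightarrow> 'k mat" where
      "irrep G d \<rho> \<and> (\<forall>M. gsub M \<longrightarrow> (\<forall>x\<in>M. \<rho> x = 1\<^sub>m d) \<longrightarrow> (\<forall>x\<in>M. \<chi> i x = 1)) \<and>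
        (\<forall>N. foot G N \<longrightarrow> \<not> comm_group (G\<lparr>carrier := N\<rparr>) \<longrightarrow> (\<exists>x\<in>N. \<rho> x \<noteq> 1\<^sub>m d))" by (elim exE)
    then show ?thesis unfolding P_def by (intro exI[of _ "(d, \<rho>)"]) (unfold fst_conv snd_conv)
  qed
  then have "\<exists>p. \<forall>i<r. P i (p i)" by (intro choice allI) blast
  then obtain p where p: "\<And>i. i < r \<Longrightarrow> P i (p i)" by blast
  have p1: "irrep G (fst (p i)) (snd (p i))" if "i < r" for i using p[OF that] unfolding P_def by (rule conjunct1)
  have p2: "\<forall>x\<in>M. \<chi> i x = 1" if "i < r" "gsub M" "\<forall>x\<in>M. snd (p i) x = 1\<^sub>m (fst (p i))" for i M
    by (rule p[OF that(1), unfolded P_def, THEN conjunct2, THEN conjunct1, THEN spec, THEN mp, THEN mp, OF that(2,3)])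
  have p3: "\<exists>x\<in>N. snd (p i) x \<noteq> 1\<^sub>m (fst (p i))" if "i < r" "foot G N" "\<not> comm_group (G\<lparr>carrier := N\<rparr>)" for i N
    by (rule p[OF that(1), unfolded P_def, THEN conjunct2, THEN conjunct2, THEN spec, THEN mp, THEN mp, OF that(2,3)])
  have "\<forall>i<r. irrep G ((fst \<circ> p) i) ((snd \<circ> p) i)" using p1 by simp
  from direct_sum_irreps[OF this] obtain n and \<sigma> :: "'a \<Rightarrow> 'k mat" and W where
    m: "mrep G n \<sigma>" and cr: "completely_reducible G n \<sigma>" and W: "composition_series G n \<sigma> r W" and n: "0 < r \<longrightarrow> 0 < n"
    and t: "\<forall>x\<in>carrier G. \<sigma> x = 1\<^sub>m n \<longrightarrow> (\<forall>i<r. (snd \<circ> p) i x = 1\<^sub>m ((fst \<circ> p) i))"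
    by (elim exE conjE)
  define K where "K = {x \<in> carrier G. \<sigma> x = 1\<^sub>m n}"
  have R: "\<sigma> x \<in> carrier_mat n n" if "x \<in> carrier G" for x using mrepD(1)[OF m that] .
  have inv: "\<sigma> (inv x) * \<sigma> x = 1\<^sub>m n" if "x \<in> carrier G" for x
    using mrepD(2)[OF m, of "inv x" x] mrepD(3)[OF m] that by simp
  have inv': "\<sigma> x * \<sigma> (inv x) = 1\<^sub>m n" if "x \<in> carrier G" for x
    using mrepD(2)[OF m, of x "inv x"] mrepD(3)[OF m] that by simp
  have K: "K \<lhd> G"
  proof (rule normal_invI)
    show "subgroup K G"
    proof (rule subgroupI)
      show "K \<noteq> {}" using mrepD(3)[OF m] by (auto simp: K_def)
      show "a \<otimes> b \<in> K" if "a \<in> K" "b \<in> K" for a b using that mrepD(2)[OF m, of a b] by (simp add: K_def)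
      show "inv a \<in> K" if "a \<in> K" for a using that inv[of a] R[of "inv a"] by (simp add: K_def)
    qed (auto simp: K_def)
    fix g x assume g: "g \<in> carrier G" and x: "x \<in> K"
    have "\<sigma> (g \<otimes> x \<otimes> inv g) = \<sigma> g * \<sigma> x * \<sigma> (inv g)"
      using g x mrepD(2)[OF m, of "g \<otimes> x" "inv g"] mrepD(2)[OF m, of g x] by (simp add: K_def)
    also have "\<dots> = 1\<^sub>m n" using x R[OF g] inv'[OF g] by (simp add: K_def)
    finally show "g \<otimes> x \<otimes> inv g \<in> K" using g x by (simp add: K_def)
  qed
  have "K = {\<one>}"
  proof (rule ccontr)
    assume "K \<noteq> {\<one>}"
    then obtain N where N: "foot G N" "N \<subseteq> K" using exists_foot[OF fin K] by blast
    have tN: "snd (p i) x = 1\<^sub>m (fst (p i))" if "i < r" "x \<in> N" for i x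
      using bspec[OF t, of x] that N(2) by (auto simp: K_def)
    show False
    proof (cases "comm_group (G\<lparr>carrier := N\<rparr>)")
      case True
      have gN: "gsub N" using N(1) feet[OF N(1) True] by (auto simp: gsub_def foot_def)
      have "N = {\<one>}" by (rule c2[OF gN]) (use p2[OF _ gN] tN in blast)
      then show False using N(1) by (simp add: foot_def)
    next
      case False
      \<comment> \<open>A summand must exist here, which is where positivity of r enters.\<close>
      then show False using p3[OF r N(1)] tN[OF r] by blast
    qed
  qed
  have "inj_on \<sigma> (carrier G)"
  proof (rule inj_onI)
    fix x y assume xy: "x \<in> carrier G" "y \<in> carrier G" "\<sigma> x = \<sigma> y"
    have "\<sigma> (inv y \<otimes> x) = 1\<^sub>m n" using mrepD(2)[OF m, of "inv y" x] xy inv[of y] by simp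
    then have "inv y \<otimes> x \<in> K" using xy by (simp add: K_def)
    then have "inv y \<otimes> x = \<one>" using \<open>K = {\<one>}\<close> by simp
    then show "x = y" using xy by (metis inv_closed inv_equality inv_inv)
  qed
  then have "faithful_representation G n \<sigma>"
    using m n r by (simp add: faithful_representation_def representation_iff_mrep[OF is_group])
  then show ?thesis using cr W by blast
qed

section \<open>The minimal number of composition factors\<close>

theorem proposition18:
  fixes G :: "('g, 'm) monoid_scheme"
  assumes "group G" and "finite (carrier G)"
    and "semi_faithful TYPE('k::field) G"
  shows "min_faithful_factors TYPE('k) G =
           (if abelian_socle G \<noteq> {\<one>\<^bsub>G\<^esub>}
            then module_rk (int_group_ring G) (conj_module G (abelian_socle G)) else 1) \<and>
         (\<exists>n (\<rho> :: 'g \<Rightarrow> 'k mat) W.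
            faithful_representation G n \<rho> \<and> completely_reducible G n \<rho> \<and>
            composition_series G n \<rho> (min_faithful_factors TYPE('k) G) W)"
proof -
  interpret semisimple_normal G "abelian_socle G" by (rule semisimple_abelian_socle[OF assms(1,2)])
  let ?A = "abelian_socle G"
  define r where "r = (if ?A \<noteq> {\<one>\<^bsub>G\<^esub>} then module_rk (int_group_ring G) (conj_module G ?A) else 1)"
  have inv: "of_nat (card ?A) \<noteq> (0 :: 'k)" by (rule semi_faithful_card_nonzero[OF assms(3)])
  then have "to_ac (of_nat (card ?A) :: 'k) \<noteq> 0" by (simp only: to_ac_eq_0_iff not_False_eq_True)
  then have inv': "of_nat (card ?A) \<noteq> (0 :: 'k alg_closure)" by simp
  have lower: "r \<le> s" if f: "faithful_representation G n \<rho>" and W: "composition_series G n \<rho> s W"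
    for s n W and \<rho> :: "'g \<Rightarrow> 'k mat"
  proof -
    have m: "mrep G n \<rho>" and n: "0 < n" and inj: "inj_on \<rho> (carrier G)"
      using f by (auto simp: faithful_representation_def representation_iff_mrep[OF assms(1)])
    show ?thesis
    proof (cases "?A = {\<one>\<^bsub>G\<^esub>}")
      case True
      \<comment> \<open>A series without factors would live on the zero space.\<close>
      have "s \<noteq> 0"
      proof
        assume "s = 0"
        have "W 0 = carrier_vec n" using composition_seriesD(2)[OF W] unfolding \<open>s = 0\<close> .
        then have "n = 0" by (rule carrier_vec_singleton[OF trans[OF sym[OF composition_seriesD(1)[OF W]]]])
        then show False using n by simp
      qed
      then show ?thesis using True by (simp add: r_def)
    next
      case False
      obtain \<chi> :: "nat \<Rightarrow> 'g \<Rightarrow> 'k alg_closure" where chi: "\<forall>i<s. \<chi> i \<in> chars G ?A"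
        and t: "\<forall>M. gsub M \<longrightarrow> (\<forall>i<s. \<forall>x\<in>M. \<chi> i x = 1) \<longrightarrow> (\<forall>x\<in>M. \<rho> x = 1\<^sub>m n)"
        using composition_series_chars[OF inv m W] by (elim exE conjE)
      have "char_system s ?A \<chi>"
        unfolding char_system_def
      proof (intro conjI allI impI)
        fix M assume M: "gsub M" and k: "\<forall>i<s. \<forall>x\<in>M. \<chi> i x = 1"
        have "x = \<one>\<^bsub>G\<^esub>" if x: "x \<in> M" for x
        proof (rule inj_onD[OF inj])
          show "\<rho> x = \<rho> \<one>\<^bsub>G\<^esub>" using t[rule_format, OF M k[rule_format] x] mrepD(3)[OF m] by simp
        qed (use gsubD(5)[OF M x] in auto)
        then show "M = {\<one>\<^bsub>G\<^esub>}" using gsubD(6)[OF M] by blast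
      qed (use chi in blast)
      then have "gens s ?A" using gens_iff_char_system[OF inv'] by blast
      then show ?thesis using False by (simp add: r_def module_rk_eq Least_le)
    qed
  qed
  have "0 < r \<and> (\<exists>\<chi> :: nat \<Rightarrow> 'g \<Rightarrow> 'k alg_closure. char_system r ?A \<chi>)"
  proof (cases "?A = {\<one>\<^bsub>G\<^esub>}")
    case True
    \<comment> \<open>The trivial module has rank 0 while r is 1 here; one redundant generator gives
      a system of one character, whose representation still has to detect the nonabelian
      feet.\<close>
    have "gens 1 ?A"
      unfolding gens_def
    proof (intro exI[of _ "\<lambda>_. \<one>\<^bsub>G\<^esub>"] conjI allI impI gsubD(6)[OF gsub_A])
      fix N assume N: "gsub N"
      show "?A \<subseteq> N" unfolding True using gsubD(6)[OF N] by simp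
    qed
    then show ?thesis using True gens_iff_char_system[OF inv'] by (simp add: r_def)
  next
    case False
    \<comment> \<open>The minimum is attained; it is positive because the empty tuple generates only
      the trivial module.\<close>
    have "gens r ?A" using LeastI_ex[OF gens_exists] False by (simp add: r_def module_rk_eq)
    then show ?thesis using gens_zero False gens_iff_char_system[OF inv'] by (metis gr0I)
  qed
  then obtain \<chi> :: "nat \<Rightarrow> 'g \<Rightarrow> 'k alg_closure" where r: "0 < r" and chi: "char_system r ?A \<chi>" by blast
  have ex: "\<exists>n (\<rho> :: 'g \<Rightarrow> 'k mat) W. faithful_representation G n \<rho> \<and> completely_reducible G n \<rho> \<and> composition_series G n \<rho> r W"
    by (rule faithful_from_char_system[OF assms(3) r chi foot_abelian_subset_socle[OF assms(1)]])
  have "min_faithful_factors TYPE('k) G = r"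
    unfolding min_faithful_factors_def
  proof (rule Least_equality)
    show "\<exists>n (\<rho> :: 'g \<Rightarrow> 'k mat) W. faithful_representation G n \<rho> \<and> composition_series G n \<rho> r W" using ex by blast
  qed (use lower in blast)
  then show ?thesis using ex by (simp add: r_def)
qed

end
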